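(* Assume the Riemann Hypothesis. For real $T>5$, let $$I_{\mu}(T)=\int_{1}^{T}E_{\mu}^{2}(t)\,dt.$$ Then there exists a positive constant $A$ such that, for every real number $T>5$, $$I_{\mu}(T)\ll T^{3/2}\exp\left(A\,\frac{\log T}{\log\log T}\right),$$ where the implied constant is absolute.
   Context: $\mu$ is the Möbius function, $\zeta$ is the Riemann zeta-function, $\zeta'$ is its first derivative, and $\gamma$ is the Euler--Mascheroni constant. Define $$S_{\mu}(x)=\sum_{mn\le x}\mu(\gcd(m,n)),$$ the sum running over all ordered pairs $(m,n)$ of positive integers with $mn\le x$. The error term $E_{\mu}(x)$ is defined by $$E_{\mu}(x)=S_{\mu}(x)-\frac{x}{\zeta^{2}(2)}\left(\log x+2\gamma-1-4\frac{\zeta'(2)}{\zeta(2)}\right).$$ *)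

theory Defs
  imports
    "HOL-Complex_Analysis.Complex_Analysis"
    "HOL-Computational_Algebra.Squarefree"
begin

text \<open>
  The Riemann zeta function is the analytic continuation of the Dirichlet series
  \<open>\<Sum> n\<^sup>-\<^sup>s\<close> to the plane punctured at \<open>1\<close>. The junk value \<open>0\<close> at the pole
  makes the function unique; existence and uniqueness are proved below in
  \<open>is_zeta_ex1\<close>.
\<close>

definition is_zeta :: "(complex \<Rightarrow> complex) \<Rightarrow> bool" where
  "is_zeta f \<longleftrightarrow>
     f holomorphic_on (- {1}) \<and>
     (\<forall>s. Re s > 1 \<longrightarrow> f s = (\<Sum>n. 1 / of_nat (Suc n) powr s)) \<and>
     f 1 = 0"

definition zeta :: "complex \<Rightarrow> complex" where
  "zeta = (THE f. is_zeta f)"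

definition riemann_hypothesis :: bool where
  "riemann_hypothesis \<longleftrightarrow>
     (\<forall>s. zeta s = 0 \<and> 0 < Re s \<and> Re s < 1 \<longrightarrow> Re s = 1 / 2)"

definition moebius_mu :: "nat \<Rightarrow> int" where
  "moebius_mu n = (if squarefree n then (- 1) ^ card (prime_factors n) else 0)"

definition S_mu :: "real \<Rightarrow> real" where
  "S_mu x = (\<Sum>(m, n) \<in> {(m, n). m > 0 \<and> n > 0 \<and> real (m * n) \<le> x}.
               of_int (moebius_mu (gcd m n)))"

text \<open>
  \<open>zeta 2\<close> and \<open>deriv zeta 2\<close> are real, so taking real parts
  merely converts their type.
\<close>

definition E_mu :: "real \<Rightarrow> real" where
  "E_mu x = S_mu x - x / Re (zeta 2) ^ 2 *
     (ln x + 2 * euler_mascheroni - 1 - 4 * (Re (deriv zeta 2) / Re (zeta 2)))"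

definition I_mu :: "real \<Rightarrow> real" where
  "I_mu T = integral {1..T} (\<lambda>t. E_mu t ^ 2)"


subsection \<open>Existence and uniqueness of the continuation\<close>

text \<open>
  Summing the binomial expansion of \<open>(n + 1)\<^sup>1\<^sup>-\<^sup>s - n\<^sup>1\<^sup>-\<^sup>s\<close> over \<open>n\<close> expresses
  \<open>(s - 1) * \<zeta>(s)\<close> by its values at \<open>s + 1, s + 2, \<dots>\<close> and a series converging
  further to the left. This continues \<open>(s - 1) * \<zeta>(s)\<close> one strip at a time.
\<close>

lemma norm_gbinomial_le:
  fixes a :: complex
  assumes "norm a \<le> B"
  shows "norm (a gchoose j) \<le> (-1) ^ j * ((- B) gchoose j)"
proof -
  have "norm (pochhammer (- a) j) \<le> pochhammer B j"
    unfolding pochhammer_prod prod_norm[symmetric]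
  proof (rule prod_mono, intro conjI norm_ge_zero)
    fix i show "norm (- a + of_nat i) \<le> B + of_nat i"
      using norm_triangle_ineq[of "- a" "of_nat i"] assms by simp
  qed
  then show ?thesis
    by (simp add: gbinomial_pochhammer norm_mult norm_power norm_divide divide_right_mono
          flip: power_mult_distrib)
qed

lemma binomial_tail_bound:
  fixes a :: complex
  assumes "norm a \<le> B" "N \<ge> 2"
  shows "norm (of_real (1 + 1 / real N) powr a - (\<Sum>j<K. (a gchoose j) * of_real (1 / real N) ^ j))
           \<le> 2 ^ K * (1/2) powr (- B) * (1 / real N) ^ K"
proof -
  define z where "z = 1 / real N"
  have z: "0 \<le> z" "z \<le> 1/2" using assms(2) by (auto simp: z_def field_simps)
  define D where "D j = (-1) ^ j * ((- B) gchoose j)" for j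
  have D: "norm (a gchoose j) \<le> D j" for j
    unfolding D_def by (rule norm_gbinomial_le) fact
  have D0: "0 \<le> D j" for j using D[of j] norm_ge_zero order_trans by blast
  have Ds: "(\<lambda>j. D j * (1/2) ^ j) sums (1/2) powr (- B)"
  proof -
    have "(\<lambda>j. ((- B) gchoose j) * (-1/2) ^ j) sums (1 + (-1/2)) powr (- B)"
      by (rule gen_binomial_real) auto
    moreover have "((- B) gchoose j) * (-1/2) ^ j = D j * (1/2) ^ j" for j
      using power_mult_distrib[of "-1" "1/2 :: real" j] by (simp add: D_def)
    ultimately show ?thesis by simp
  qed
  define c where "c j = (a gchoose j) * of_real z ^ j" for j
  have "c sums (1 + of_real z) powr a"
    unfolding c_def by (rule gen_binomial_complex) (use z in auto)
  then have cs: "(\<lambda>j. c (j + K)) sums ((1 + of_real z) powr a - (\<Sum>j<K. c j))"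
    by (simp add: sums_iff_shift)
  have le: "norm (c (j + K)) \<le> D (j + K) * (1/2) ^ (j + K) * (2 ^ K * z ^ K)" for j
  proof -
    have "norm (c (j + K)) = norm (a gchoose (j + K)) * z ^ j * z ^ K"
      using z by (simp add: c_def norm_mult norm_power power_add)
    also have "\<dots> \<le> D (j + K) * (1/2) ^ j * z ^ K"
      using z D D0 by (intro mult_mono power_mono mult_nonneg_nonneg) auto
    also have "\<dots> = D (j + K) * (1/2) ^ (j + K) * (2 ^ K * z ^ K)"
      by (simp add: power_add field_simps)
    finally show ?thesis .
  qed
  have sD: "summable (\<lambda>j. D (j + K) * (1/2) ^ (j + K))"
    using sums_summable[OF Ds] by (rule summable_ignore_initial_segment)
  have "norm ((1 + of_real z) powr a - (\<Sum>j<K. c j))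
          \<le> (\<Sum>j. D (j + K) * (1/2) ^ (j + K) * (2 ^ K * z ^ K))"
    unfolding sums_unique[OF cs] by (intro norm_suminf_le le summable_mult2 sD)
  also have "\<dots> = (\<Sum>j. D (j + K) * (1/2) ^ (j + K)) * (2 ^ K * z ^ K)"
    by (rule suminf_mult2[symmetric, OF sD])
  also have "\<dots> \<le> (1/2) powr (- B) * (2 ^ K * z ^ K)"
  proof (rule mult_right_mono)
    have "(1/2) powr (- B) =
            (\<Sum>j. D (j + K) * (1/2) ^ (j + K)) + (\<Sum>j<K. D j * (1/2) ^ j)"
      using suminf_split_initial_segment[OF sums_summable[OF Ds], of K] sums_unique[OF Ds]
      by simp
    moreover have "0 \<le> (\<Sum>j<K. D j * (1/2) ^ j)" by (intro sum_nonneg mult_nonneg_nonneg D0) auto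
    ultimately show "(\<Sum>j. D (j + K) * (1/2) ^ (j + K)) \<le> (1/2) powr (- B)" by linarith
  qed (use z in auto)
  finally show ?thesis by (simp add: c_def z_def mult_ac)
qed

definition zeta_rem :: "nat \<Rightarrow> nat \<Rightarrow> complex \<Rightarrow> complex" where
  "zeta_rem K n s = of_nat (Suc (Suc n)) powr (1 - s) -
     (\<Sum>j<K. ((1 - s) gchoose j) * of_nat (Suc n) powr (1 - s - of_nat j))"

lemma zeta_rem_bound:
  assumes "norm (1 - s) \<le> B" "n \<ge> 1"
  shows "norm (zeta_rem K n s)
           \<le> 2 ^ K * (1/2) powr (- B) * real (Suc n) powr (1 - Re s - real K)"
proof -
  define N where "N = Suc n"
  have N: "N \<ge> 2" using assms by (simp add: N_def)
  have "of_nat (Suc N) = of_real (real N) * (of_real (1 + 1 / real N) :: complex)"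
    using N by (simp add: field_simps)
  then have "of_nat (Suc N) powr (1 - s) =
      of_real (real N) powr (1 - s) * of_real (1 + 1 / real N) powr (1 - s)"
    by (simp only:) (rule powr_times_real, auto)
  moreover have "of_nat N powr (1 - s - of_nat j) =
      of_real (real N) powr (1 - s) * of_real (1 / real N) ^ j" for j
    using N by (simp add: powr_diff powr_nat' power_divide)
  ultimately have "zeta_rem K n s = of_real (real N) powr (1 - s) *
      (of_real (1 + 1 / real N) powr (1 - s) -
        (\<Sum>j<K. ((1 - s) gchoose j) * of_real (1 / real N) ^ j))"
    by (simp add: zeta_rem_def N_def[symmetric] right_diff_distrib sum_distrib_left mult_ac)
  also have "norm \<dots> \<le> real N powr (1 - Re s) *
      (2 ^ K * (1/2) powr (- B) * (1 / real N) ^ K)"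
    unfolding norm_mult using binomial_tail_bound[OF assms(1) N, of K]
    by (subst norm_powr_real_powr) (auto intro!: mult_left_mono)
  also have "\<dots> = 2 ^ K * (1/2) powr (- B) * real N powr (1 - Re s - real K)"
    using N by (simp add: powr_diff powr_realpow power_divide)
  finally show ?thesis by (simp add: N_def)
qed

lemma open_halfplane: "open {s. c < Re s}"
  using open_halfspace_Re_gt[of c] by simp

lemma holomorphic_gbinomial [holomorphic_intros]:
  "f holomorphic_on A \<Longrightarrow> (\<lambda>s. f s gchoose j) holomorphic_on A"
  unfolding gbinomial_prod_rev by (intro holomorphic_intros) auto

lemma summable_Suc_powr:
  assumes "x < -1"
  shows "summable (\<lambda>n. real (Suc n) powr x)"
  using summable_real_powr_iff[of x] assms summable_Suc_iff[of "\<lambda>n. real n powr x"] by simp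

lemma holomorphic_zeta_rem_suminf:
  "(\<lambda>s. \<Sum>n. zeta_rem K n s) holomorphic_on {s. 2 - real K < Re s}"
proof (rule holomorphic_uniform_sequence[where f = "\<lambda>n s. \<Sum>i<n. zeta_rem K i s"])
  show "open {s. 2 - real K < Re s}" by (rule open_halfplane)
  show "(\<lambda>s. \<Sum>i<n. zeta_rem K i s) holomorphic_on {s. 2 - real K < Re s}" for n
    unfolding zeta_rem_def by (intro holomorphic_intros)
  fix x :: complex assume x: "x \<in> {s. 2 - real K < Re s}"
  define d where "d = (Re x - (2 - real K)) / 2"
  have d: "d > 0" using x by (simp add: d_def)
  have Re_ge: "2 - real K + d \<le> Re y" if "y \<in> cball x d" for y
  proof -
    have "\<bar>Re (x - y)\<bar> \<le> norm (x - y)" by (rule abs_Re_le_cmod)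
    with that have "\<bar>Re x - Re y\<bar> \<le> d" by (simp add: dist_norm)
    then show ?thesis by (simp add: d_def) argo
  qed
  define B where "B = norm (1 - x) + d"
  have B: "norm (1 - y) \<le> B" if "y \<in> cball x d" for y
    using norm_triangle_ineq[of "1 - x" "x - y"] that by (simp add: B_def dist_norm)
  define M where "M n = 2 ^ K * (1/2) powr (- B) * real (Suc n) powr (- 1 - d)" for n
  have "uniform_limit (cball x d) (\<lambda>n s. \<Sum>i<n. zeta_rem K i s) (\<lambda>s. \<Sum>n. zeta_rem K n s)
          sequentially"
  proof (rule Weierstrass_m_test_ev)
    show "summable M"
      unfolding M_def using d by (intro summable_mult summable_Suc_powr) auto
    show "\<forall>\<^sub>F n in sequentially. \<forall>y\<in>cball x d. norm (zeta_rem K n y) \<le> M n"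
      using eventually_ge_at_top[of "1::nat"]
    proof eventually_elim
      case (elim n)
      show ?case
      proof
        fix y assume y: "y \<in> cball x d"
        have "norm (zeta_rem K n y)
                \<le> 2 ^ K * (1/2) powr (- B) * real (Suc n) powr (1 - Re y - real K)"
          by (rule zeta_rem_bound[OF B[OF y] elim])
        also have "\<dots> \<le> M n"
          unfolding M_def using Re_ge[OF y] by (intro mult_left_mono powr_mono) auto
        finally show "norm (zeta_rem K n y) \<le> M n" .
      qed
    qed
  qed
  moreover have "cball x d \<subseteq> {s. 2 - real K < Re s}"
    using Re_ge d by fastforce
  ultimately show "\<exists>d>0. cball x d \<subseteq> {s. 2 - real K < Re s} \<and>
      uniform_limit (cball x d) (\<lambda>n s. \<Sum>i<n. zeta_rem K i s) (\<lambda>s. \<Sum>n. zeta_rem K n s)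
        sequentially"
    using d by blast
qed

definition zeta_series :: "complex \<Rightarrow> complex" where
  "zeta_series s = (\<Sum>n. 1 / of_nat (Suc n) powr s)"

lemma zeta_series_sums:
  assumes "Re s > 1"
  shows "(\<lambda>n. of_nat (Suc n) powr (- s)) sums zeta_series s"
proof -
  have "summable (\<lambda>n. of_nat (Suc n) powr (- s) :: complex)"
  proof (rule summable_norm_cancel)
    show "summable (\<lambda>n. norm (of_nat (Suc n) powr (- s) :: complex))"
      using summable_Suc_powr[of "- Re s"] assms by (subst norm_powr_real_powr) auto
  qed
  then show ?thesis
    by (simp add: zeta_series_def powr_minus_divide summable_sums)
qed

lemma zeta_rem_suminf:
  assumes s: "Re s > 1" and K: "K \<ge> 2"
  shows "(\<Sum>n. zeta_rem K n s) =
           (s - 1) * zeta_series s - 1 -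
           (\<Sum>j=2..<K. ((1 - s) gchoose j) * zeta_series (s + of_nat j - 1))"
proof -
  have "(\<lambda>n. of_nat (Suc n) powr (1 - s)) \<longlonglongrightarrow> (0 :: complex)"
  proof (rule tendsto_norm_zero_cancel)
    have "(\<lambda>n. real (Suc n) powr (1 - Re s)) \<longlonglongrightarrow> 0"
      using s by (intro tendsto_neg_powr filterlim_compose[OF filterlim_real_sequentially]
                    filterlim_Suc) auto
    then show "(\<lambda>n. norm (of_nat (Suc n) powr (1 - s) :: complex)) \<longlonglongrightarrow> 0"
      by (subst norm_powr_real_powr) auto
  qed
  from telescope_sums[OF this]
  have tele: "(\<lambda>n. of_nat (Suc (Suc n)) powr (1 - s) - of_nat (Suc n) powr (1 - s)) sums (- 1)"
    by simp
  have j: "(\<lambda>n. ((1 - s) gchoose j) * of_nat (Suc n) powr (1 - s - of_nat j))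
             sums (((1 - s) gchoose j) * zeta_series (s + of_nat j - 1))" if "j \<ge> 1" for j
    using zeta_series_sums[of "s + of_nat j - 1"] s that
    by (intro sums_mult) (simp add: algebra_simps)
  have split: "{..<K} = insert 0 (insert 1 {2..<K})" using K by auto
  have "(\<lambda>n. (of_nat (Suc (Suc n)) powr (1 - s) - of_nat (Suc n) powr (1 - s)) -
            ((1 - s) gchoose 1) * of_nat (Suc n) powr (1 - s - of_nat 1) -
            (\<Sum>j=2..<K. ((1 - s) gchoose j) * of_nat (Suc n) powr (1 - s - of_nat j)))
          sums (- 1 - ((1 - s) gchoose 1) * zeta_series (s + of_nat 1 - 1) -
            (\<Sum>j=2..<K. ((1 - s) gchoose j) * zeta_series (s + of_nat j - 1)))"
    by (intro sums_diff sums_sum tele j) auto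
  moreover have "(of_nat (Suc (Suc n)) powr (1 - s) - of_nat (Suc n) powr (1 - s)) -
            ((1 - s) gchoose 1) * of_nat (Suc n) powr (1 - s - of_nat 1) -
            (\<Sum>j=2..<K. ((1 - s) gchoose j) * of_nat (Suc n) powr (1 - s - of_nat j))
        = zeta_rem K n s" for n
    unfolding zeta_rem_def split by simp
  ultimately show ?thesis
    by (simp add: sums_iff algebra_simps)
qed

lemma zeta_continuation_halfplane:
  assumes "K \<ge> 2"
  shows "\<exists>g. g holomorphic_on {s. 2 - real K < Re s} \<and>
             (\<forall>s. Re s > 1 \<longrightarrow> g s = (s - 1) * zeta_series s)"
  using assms
proof (induction K rule: dec_induct)
  case base
  have "(\<lambda>s. 1 + (\<Sum>n. zeta_rem 2 n s)) holomorphic_on {s. 2 - real 2 < Re s}"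
    by (intro holomorphic_intros holomorphic_zeta_rem_suminf)
  then show ?case by (intro exI conjI allI impI, assumption) (simp add: zeta_rem_suminf)
next
  case (step K)
  then obtain g where g: "g holomorphic_on {s. 2 - real K < Re s}"
    "\<And>s. Re s > 1 \<Longrightarrow> g s = (s - 1) * zeta_series s" by blast
  define h where "h s = 1 + (\<Sum>n. zeta_rem (Suc K) n s) -
    (\<Sum>j=2..<Suc K. ((1 - s) gchoose (j - 1)) / of_nat j * g (s + of_nat j - 1))" for s
  have "(\<lambda>s. g (s + of_nat j - 1)) holomorphic_on {s. 2 - real (Suc K) < Re s}"
    if "j \<in> {2..<Suc K}" for j
    using that
    by (intro holomorphic_on_compose_gen[OF _ g(1), unfolded o_def] holomorphic_intros) auto
  then have "h holomorphic_on {s. 2 - real (Suc K) < Re s}"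
    unfolding h_def by (intro holomorphic_intros holomorphic_zeta_rem_suminf) auto
  moreover have "h s = (s - 1) * zeta_series s" if s: "Re s > 1" for s
  proof -
    have "((1 - s) gchoose (j - 1)) / of_nat j * g (s + of_nat j - 1) =
          - (((1 - s) gchoose j) * zeta_series (s + of_nat j - 1))" if j: "j \<in> {2..<Suc K}" for j
    proof -
      obtain i where i: "j = Suc i" using j by (cases j) auto
      define q where "q = 1 - s - of_nat i"
      have "((1 - s) gchoose j) = ((1 - s) gchoose i) * q / of_nat j"
        unfolding i q_def using gbinomial_absorption[of i "1 - s"] gbinomial_absorb_comp[of "1 - s" i]
        by (simp add: eq_divide_eq mult.commute del: of_nat_Suc)
      moreover have "g (s + of_nat j - 1) = (s + of_nat j - 2) * zeta_series (s + of_nat j - 1)"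
        using s j by (subst g(2)) (auto simp: algebra_simps)
      moreover have "s + of_nat j - 2 = - q" by (simp add: i q_def)
      moreover have "j - 1 = i" by (simp add: i)
      ultimately show ?thesis by simp
    qed
    then have "(\<Sum>j=2..<Suc K. ((1 - s) gchoose (j - 1)) / of_nat j * g (s + of_nat j - 1)) =
      - (\<Sum>j=2..<Suc K. ((1 - s) gchoose j) * zeta_series (s + of_nat j - 1))"
      unfolding sum_negf[symmetric] by (rule sum.cong[OF refl])
    then show ?thesis
      using zeta_rem_suminf[OF s, of "Suc K"] step by (simp add: h_def)
  qed
  ultimately show ?case by blast
qed

lemma zeta_continuation_entire:
  "\<exists>g. g holomorphic_on UNIV \<and> (\<forall>s. Re s > 1 \<longrightarrow> g s = (s - 1) * zeta_series s)"
proof -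
  obtain G where G: "\<And>K. K \<ge> 2 \<Longrightarrow> G K holomorphic_on {s. 2 - real K < Re s}"
    "\<And>K s. K \<ge> 2 \<Longrightarrow> Re s > 1 \<Longrightarrow> G K s = (s - 1) * zeta_series s"
    using zeta_continuation_halfplane by metis
  have agree: "G L s = G K s" if KL: "2 \<le> K" "K \<le> L" and s: "2 - real K < Re s" for K L s
  proof (rule analytic_continuation_open[of "{s. 1 < Re s}" "{s. 2 - real K < Re s}" "G L" "G K"])
    show "{s. 1 < Re s} \<noteq> {}" by (auto intro!: exI[of _ 2])
    show "connected {s. 2 - real K < Re s}" by (intro convex_connected convex_halfspace_Re_gt)
    show "G L holomorphic_on {s. 2 - real K < Re s}"
      by (rule holomorphic_on_subset[OF G(1)]) (use KL in auto)
  qed (use KL s G in \<open>auto simp: open_halfplane\<close>)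
  define k where "k s = nat \<lceil>2 + \<bar>Re s\<bar>\<rceil> + 1" for s
  have k: "2 \<le> k s" "2 - real (k s) < Re s" for s
    unfolding k_def by linarith+
  define g where "g s = G (k s) s" for s
  have eq: "g s = G K s" if "2 \<le> K" "2 - real K < Re s" for K s
    using agree[of K "k s" s] agree[of "k s" K s] k[of s] that unfolding g_def
    by (cases "K \<le> k s") auto
  have "g holomorphic_on UNIV"
    unfolding holomorphic_on_def
  proof safe
    fix s
    let ?H = "{z. 2 - real (k s) < Re z}"
    have "g holomorphic_on ?H"
      using G(1)[OF k(1)] by (rule holomorphic_transform) (use eq[OF k(1)] in auto)
    then show "g field_differentiable at s"
      by (rule holomorphic_on_imp_differentiable_at) (use k open_halfplane in auto)
  qed
  moreover have "g s = (s - 1) * zeta_series s" if "Re s > 1" for s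
    unfolding g_def by (rule G(2)[OF k(1) that])
  ultimately show ?thesis by blast
qed

theorem is_zeta_ex1: "\<exists>!f. is_zeta f"
proof (rule ex_ex1I)
  obtain g where g: "g holomorphic_on UNIV" "\<And>s. Re s > 1 \<Longrightarrow> g s = (s - 1) * zeta_series s"
    using zeta_continuation_entire by blast
  have "(\<lambda>s. g s / (s - 1)) holomorphic_on (- {1})"
    by (intro holomorphic_intros holomorphic_on_subset[OF g(1)]) auto
  moreover have "g s / (s - 1) = (\<Sum>n. 1 / of_nat (Suc n) powr s)" if "Re s > 1" for s
    using that g(2)[OF that] by (auto simp: zeta_series_def)
  ultimately have "is_zeta (\<lambda>s. g s / (s - 1))" by (simp add: is_zeta_def)
  then show "\<exists>f. is_zeta f" by blast
next
  fix f g assume fg: "is_zeta f" "is_zeta g"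
  show "f = g"
  proof
    fix s
    show "f s = g s"
    proof (cases "s = 1")
      case False
      show ?thesis
      proof (rule analytic_continuation_open[of "{s. 1 < Re s}" "- {1}" f g])
        show "{s. 1 < Re s} \<noteq> {}" by (auto intro!: exI[of _ 2])
        show "connected (- {1 :: complex})"
          by (rule connected_punctured_universe) simp
      qed (use fg False in \<open>auto simp: is_zeta_def open_halfplane\<close>)
    qed (use fg in \<open>simp add: is_zeta_def\<close>)
  qed
qed

lemma is_zeta_zeta: "is_zeta zeta"
  unfolding zeta_def by (rule theI'[OF is_zeta_ex1])

end

theory Submission
  imports Defs "HOL-Probability.Probability" "HOL-Real_Asymp.Real_Asymp"
begin

text \<open>
  The Dirichlet series of \<open>S_mu\<close> is \<open>\<zeta>(s)\<^sup>2 / \<zeta>(2 s)\<^sup>2\<close>, so on \<open>Re s = 3\<close> the function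
  \<open>H(s) = \<zeta>(s)\<^sup>2 / (s \<zeta>(2 s)\<^sup>2) - (principal part at 1)\<close> is the Laplace transform of \<open>E_mu (exp v)\<close>.
  Under the Riemann hypothesis \<open>H\<close> is holomorphic on \<open>Re s > 1 / 4\<close>; shifting the line of
  integration and Plancherel's theorem bound \<open>\<integral> E_mu (exp v)\<^sup>2 exp (- 2 \<sigma> v) dv\<close>, and hence
  \<open>I_mu T / T powr (1 + 2 \<sigma>)\<close>, by the mean square of \<open>H\<close> on the line \<open>\<sigma> = 1 / 4 + \<delta>\<close>.

  On that line the functional equation turns \<open>\<zeta>(s)\<close> into \<open>\<zeta>(1 - s)\<close>, so that \<open>\<bar>H\<bar>\<^sup>2\<close> decays like
  \<open>\<bar>t\<bar> powr (- 1 - 4 \<delta>)\<close> up to the values of \<open>\<zeta>\<close> and \<open>1 / \<zeta>\<close> to the right of the critical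
  line. For these, the Phragmen-Lindelof principle applied to \<open>\<xi>(s - a) / \<xi>(s + a)\<close> shows that
  \<open>\<bar>\<xi>\<bar>\<close> increases to the right of the critical line, so that \<open>Re (\<zeta>' / \<zeta>)\<close> is bounded below by
  \<open>- O(L)\<close>, \<open>L = log \<bar>t\<bar>\<close>. A Cayley transform and the three lines theorem upgrade this to
  \<open>\<bar>log \<bar>\<zeta>(1 / 2 + \<eta> + i t)\<bar>\<bar> \<le> C L / (\<eta> (log L)\<^sup>2)\<close>. Choosing \<open>\<delta>\<close> as a suitable multiple of
  \<open>1 / log log T\<close> balances all the losses.
\<close>

section \<open>The entire function \<open>(s - 1) \<zeta>(s)\<close>\<close>

text \<open>The abscissa 1/4 is where the Riemann hypothesis puts the zeros of \<zeta>(2 s); there 1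
  + 2 \<sigma> is 3/2. The exponent - 1 - 4 \<delta> on the line is only just integrable, so all
  losses from \<zeta> and 1 / \<zeta> must fit into |t| powr (2 \<delta>). A loss C L / (\<delta>
  (log L)^2) does so once log L \<ge> K / \<delta>; smaller |t| cost a factor exp (O(exp (K /
  \<delta>) / \<delta>)). For \<delta> = 2 K / log log T this factor is exp (O(sqrt (log T) log log
  T)), which is harmless, and T powr (2 \<delta>) = exp (4 K log T / log log T) is the real cost.
  With log L in place of its square one would need log L \<ge> K / \<delta>^2, and the resulting
  \<delta> would be too large. Securing the square is thus the main obstacle; it stems from e^y - 1
  \<ge> y^2 / 2 after the Cayley transform. The transform of \<open>E_mu\<close> converges
  absolutely only to the right and \<open>E_mu\<close> has jumps, so inversion is done with a
  Gaussian factor, which justifies the contour shift and disappears in the limit by Fatou's lemma.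
  Growth bounds that merely justify a contour shift or Phragmen-Lindelof may depend on \<delta> in
  any way.\<close>

lemma zeta_sums:
  assumes "Re s > 1"
  shows "(\<lambda>n. of_nat (Suc n) powr (- s)) sums zeta s"
  using zeta_series_sums[OF assms] is_zeta_zeta assms
  by (simp add: is_zeta_def zeta_series_def)

lemma holomorphic_zeta: "zeta holomorphic_on (- {1})"
  using is_zeta_zeta by (simp add: is_zeta_def)

text \<open>The value at 1 is the residue of \<open>zeta\<close>, which makes the function entire.
  Bounds and derivatives can then be taken across the pole, and away from 1 the zeros are those of
  \<open>zeta\<close>.\<close>

definition zeta_reg :: "complex \<Rightarrow> complex" where
  "zeta_reg s = (if s = 1 then 1 else (s - 1) * zeta s)"

text \<open>\<open>s - 1\<close> times the error of the trapezoidal rule for \<open>x\<^sup>-\<^sup>s\<close> on \<open>[N, N + 1]\<close>.\<close>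

definition trap :: "nat \<Rightarrow> complex \<Rightarrow> complex" where
  "trap N s = (s - 1) / 2 * (of_nat N powr (- s) + of_nat (Suc N) powr (- s))
     + of_nat (Suc N) powr (1 - s) - of_nat N powr (1 - s)"

lemma norm_powr_shift_le:
  fixes s z :: complex
  assumes "N \<ge> 1" "z \<in> closed_segment 0 1" "Re s \<ge> - 2"
  shows "norm ((of_nat N + z) powr (- s - 2)) \<le> real N powr (- Re s - 2)"
proof -
  obtain h where h: "0 \<le> h" "h \<le> 1" "z = of_real h"
    using assms(2) by (auto simp: in_segment scaleR_conv_of_real)
  have "of_nat N + z = of_real (real N + h)" by (simp add: h)
  then have "norm ((of_nat N + z) powr (- s - 2)) = (real N + h) powr (- Re s - 2)"
    using h assms(1) by (simp only:) (subst norm_powr_real_powr, auto)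
  also have "\<dots> \<le> real N powr (- Re s - 2)"
    using assms h by (intro powr_mono2') auto
  finally show ?thesis .
qed

text \<open>Two applications of the mean value inequality: as a function of the right endpoint, the
  error and its first derivative vanish at the left endpoint, and the second derivative has size N
  powr (- Re s - 2). The summed errors therefore converge for Re s > - 1, a range that contains the
  segment (- 1, 0) on which the functional equation is first proved.\<close>

lemma trap_bound:
  assumes N: "N \<ge> 1" and s: "Re s \<ge> - 2"
  shows "norm (trap N s) \<le> norm (s - 1) * norm s * norm (s + 1) * real N powr (- Re s - 2)"
proof -
  define S where "S = closed_segment 0 (1 :: complex)"
  have S: "convex S" "0 \<in> S" "1 \<in> S" by (auto simp: S_def)
  have S_norm: "norm z \<le> 1" if "z \<in> S" for z
    using that by (auto simp: S_def in_segment)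
  have np: "of_nat N + z \<notin> \<real>\<^sub>\<le>\<^sub>0" if "z \<in> S" for z
  proof -
    have "Re (of_nat N + z) > 0" using that N by (auto simp: S_def in_segment)
    then show ?thesis by (auto simp: complex_nonpos_Reals_iff)
  qed
  define M where "M = norm (s - 1) * norm s * norm (s + 1) * real N powr (- Re s - 2)"
  \<comment> \<open>\<open>e z\<close> is the error on the interval from N to N + z;
    \<open>e1\<close> and \<open>e2\<close> are its first two derivatives in z.\<close>
  define e where "e z = (s - 1) * z / 2 * (of_nat N powr (- s) + (of_nat N + z) powr (- s))
     + (of_nat N + z) powr (1 - s) - of_nat N powr (1 - s)" for z :: complex
  define e1 where "e1 z = (s - 1) / 2 * (of_nat N powr (- s) - (of_nat N + z) powr (- s))
     - (s - 1) * s * z / 2 * (of_nat N + z) powr (- s - 1)" for z :: complex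
  define e2 where "e2 z = (s - 1) * s * (s + 1) * z / 2 * (of_nat N + z) powr (- s - 2)" for z :: complex
  have d: "(e has_field_derivative e1 z) (at z within S)" if "z \<in> S" for z
    unfolding e_def e1_def using np[OF that]
    by (auto intro!: derivative_eq_intros simp: field_simps)
  have d1: "(e1 has_field_derivative e2 z) (at z within S)" if "z \<in> S" for z
  proof -
    have "(e1 has_field_derivative
       (s - 1) / 2 * (0 - (- s) * (of_nat N + z) powr (- s - 1))
       - ((s - 1) * s * z / 2 * ((- s - 1) * (of_nat N + z) powr (- s - 1 - 1))
         + (s - 1) * s / 2 * (of_nat N + z) powr (- s - 1))) (at z within S)"
      unfolding e1_def using np[OF that]
      by (auto intro!: derivative_eq_intros simp: algebra_simps) (simp add: field_simps)
    moreover have "- s - 1 - 1 = - s - 2" by simp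
    moreover have "(s - 1) / 2 * (0 - (- s) * p) - ((s - 1) * s * z / 2 * ((- s - 1) * q)
        + (s - 1) * s / 2 * p) = (s - 1) * s * (s + 1) * z / 2 * q" for p q
      by (simp add: field_simps)
    ultimately show ?thesis by (simp only: e2_def)
  qed
  have b2: "norm (e2 z) \<le> M" if "z \<in> S" for z
  proof -
    have "norm (e2 z) = norm (s - 1) * norm s * norm (s + 1) * (norm z / 2) *
            norm ((of_nat N + z) powr (- s - 2))"
      by (simp add: e2_def norm_mult norm_divide)
    also have "\<dots> \<le> norm (s - 1) * norm s * norm (s + 1) * 1 * real N powr (- Re s - 2)"
      using norm_powr_shift_le[OF N _ s, of z] S_norm[OF that] that
      by (intro mult_mono) (auto simp: S_def)
    finally show ?thesis by (simp add: M_def)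
  qed
  have M0: "M \<ge> 0" by (simp add: M_def)
  have b1: "norm (e1 z) \<le> M" if "z \<in> S" for z
  proof -
    have "norm (e1 z - e1 0) \<le> M * norm (z - 0)"
      by (rule field_differentiable_bound[OF S(1) d1 b2]) (use that S in auto)
    also have "\<dots> \<le> M * 1" using S_norm[OF that] M0 by (intro mult_left_mono) auto
    finally show ?thesis by (simp add: e1_def)
  qed
  have "norm (e 1 - e 0) \<le> M * norm (1 - 0 :: complex)"
    by (rule field_differentiable_bound[OF S(1) d b1]) (use S in auto)
  then show ?thesis by (simp add: e_def M_def trap_def add.commute)
qed

text \<open>The Weierstrass test on small closed discs. The uniform limit is stated on its own
  because it serves twice, for holomorphy and for termwise differentiation at 1.\<close>

lemma uniform_limit_trap:
  assumes "Re x > - 1"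
  shows "\<exists>d>0. cball x d \<subseteq> {s. - 1 < Re s} \<and>
    uniform_limit (cball x d) (\<lambda>n s. \<Sum>i<n. trap (Suc i) s) (\<lambda>s. \<Sum>n. trap (Suc n) s) sequentially"
proof -
  define d where "d = (Re x + 1) / 2"
  have d: "d > 0" using assms by (simp add: d_def)
  have Re_ge: "- 1 + d \<le> Re y" if "y \<in> cball x d" for y
    using abs_Re_le_cmod[of "x - y"] that by (simp add: dist_norm d_def)
  define B where "B = norm x + d + 1"
  have B: "norm (y - 1) \<le> B" "norm y \<le> B" "norm (y + 1) \<le> B" if "y \<in> cball x d" for y
  proof -
    have *: "norm y \<le> norm x + d"
      using norm_triangle_ineq[of x "y - x"] that by (simp add: dist_norm norm_minus_commute)
    show "norm y \<le> B" "norm (y - 1) \<le> B" "norm (y + 1) \<le> B"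
      using * norm_triangle_ineq[of y 1] norm_triangle_ineq4[of y 1] by (auto simp: B_def)
  qed
  have B0: "B \<ge> 0" using d by (simp add: B_def)
  define M where "M n = B * B * B * real (Suc n) powr (- 1 - d)" for n
  have "uniform_limit (cball x d) (\<lambda>n s. \<Sum>i<n. trap (Suc i) s) (\<lambda>s. \<Sum>n. trap (Suc n) s)
          sequentially"
  proof (rule Weierstrass_m_test)
    show "summable M"
      unfolding M_def using d by (intro summable_mult summable_Suc_powr) auto
    fix n y assume y: "y \<in> cball x d"
    have "norm (trap (Suc n) y) \<le> norm (y - 1) * norm y * norm (y + 1) * real (Suc n) powr (- Re y - 2)"
      using Re_ge[OF y] d by (intro trap_bound) auto
    also have "\<dots> \<le> M n"
      unfolding M_def using Re_ge[OF y] B[OF y] B0 by (intro mult_mono powr_mono) auto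
    finally show "norm (trap (Suc n) y) \<le> M n" .
  qed
  moreover have "cball x d \<subseteq> {s. - 1 < Re s}" using Re_ge d by fastforce
  ultimately show ?thesis using d by blast
qed

lemma holomorphic_trap [holomorphic_intros]: "trap (Suc N) holomorphic_on A"
  unfolding trap_def by (intro holomorphic_intros) auto

lemma holomorphic_trap_suminf: "(\<lambda>s. \<Sum>n. trap (Suc n) s) holomorphic_on {s. - 1 < Re s}"
  by (rule holomorphic_uniform_sequence[where f = "\<lambda>n s. \<Sum>i<n. trap (Suc i) s"])
     (use uniform_limit_trap in \<open>auto intro!: holomorphic_intros open_halfplane\<close>)

text \<open>For Re s > 1 the power terms telescope and the averages sum to \<zeta>(s) - 1/2; both
  sides are holomorphic for Re s > - 1, where the identity theorem extends the equation. The series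
  gives explicit growth, the derivative at 1 and, at negative s, the entry to the functional
  equation.\<close>

lemma zeta_reg_eq_trap:
  assumes "Re s > - 1"
  shows "zeta_reg s = 1 + (s - 1) / 2 + (\<Sum>n. trap (Suc n) s)"
proof (cases "s = 1")
  case True
  then show ?thesis by (simp add: zeta_reg_def trap_def del: of_nat_Suc)
next
  case False
  let ?H = "{s. - 1 < Re s}"
  define f where "f s = 1 + (s - 1) / 2 + (\<Sum>n. trap (Suc n) s)" for s
  have "(s - 1) * zeta s = f s"
  proof (rule analytic_continuation_open[of "{s. 1 < Re s}" "?H - {1}" "\<lambda>s. (s - 1) * zeta s" f])
    show "{s. 1 < Re s} \<noteq> {}" by (auto intro!: exI[of _ 2])
    show "connected (?H - {1})"
      by (intro connected_open_delete convex_connected convex_halfspace_Re_gt open_halfplane) simp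
    show "(\<lambda>s. (s - 1) * zeta s) holomorphic_on ?H - {1}"
      by (intro holomorphic_intros holomorphic_on_subset[OF holomorphic_zeta]) auto
    show "f holomorphic_on ?H - {1}"
      unfolding f_def
      by (intro holomorphic_intros holomorphic_on_subset[OF holomorphic_trap_suminf]) auto
    fix z assume "z \<in> {s. 1 < Re s}"
    then have z: "Re z > 1" by simp
    have z1: "(\<lambda>n. of_nat (Suc n) powr (- z)) sums zeta z" by (rule zeta_sums[OF z])
    have z2: "(\<lambda>n. of_nat (Suc (Suc n)) powr (- z)) sums (zeta z - 1)"
      using z1 by (subst sums_Suc_iff) simp
    have "(\<lambda>n. of_nat (Suc n) powr (1 - z)) \<longlonglongrightarrow> (0 :: complex)"
    proof (rule tendsto_norm_zero_cancel)
      have "(\<lambda>n. real (Suc n) powr (1 - Re z)) \<longlonglongrightarrow> 0"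
        using z by (intro tendsto_neg_powr filterlim_compose[OF filterlim_real_sequentially]
                      filterlim_Suc) auto
      then show "(\<lambda>n. norm (of_nat (Suc n) powr (1 - z) :: complex)) \<longlonglongrightarrow> 0"
        by (subst norm_powr_real_powr) auto
    qed
    from telescope_sums[OF this]
    have "(\<lambda>n. of_nat (Suc (Suc n)) powr (1 - z) - of_nat (Suc n) powr (1 - z)) sums (- 1)"
      by simp
    from sums_add[OF sums_mult[OF sums_add[OF z1 z2], of "(z - 1) / 2"] this]
    have "(\<lambda>n. trap (Suc n) z) sums ((z - 1) / 2 * (zeta z + (zeta z - 1)) + - 1)"
      by (simp add: trap_def algebra_simps del: of_nat_Suc)
    then show "(z - 1) * zeta z = f z"
      by (simp add: f_def sums_iff field_simps)
  qed (use assms False in \<open>auto simp: open_halfplane\<close>)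
  then show ?thesis using False by (simp add: zeta_reg_def f_def)
qed

lemma holomorphic_zeta_reg: "zeta_reg holomorphic_on UNIV"
proof -
  have 1: "zeta_reg holomorphic_on {s. - 1 < Re s}"
  proof (rule holomorphic_transform)
    show "(\<lambda>s. 1 + (s - 1) / 2 + (\<Sum>n. trap (Suc n) s)) holomorphic_on {s. - 1 < Re s}"
      by (intro holomorphic_intros holomorphic_trap_suminf) auto
  qed (simp add: zeta_reg_eq_trap)
  have 2: "zeta_reg holomorphic_on (- {1})"
  proof (rule holomorphic_transform)
    show "(\<lambda>s. (s - 1) * zeta s) holomorphic_on (- {1})"
      by (intro holomorphic_intros holomorphic_zeta)
  qed (simp add: zeta_reg_def)
  have "zeta_reg holomorphic_on ({s. - 1 < Re s} \<union> - {1})"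
    by (intro holomorphic_on_Un 1 2 open_halfplane) auto
  moreover have "{s. - 1 < Re s} \<union> - {1} = (UNIV :: complex set)" by auto
  ultimately show ?thesis by simp
qed

lemmas holomorphic_zeta_reg' [holomorphic_intros] =
  holomorphic_on_compose_gen[OF _ holomorphic_zeta_reg, unfolded o_def, OF _ subset_UNIV]

lemma zeta_reg_differentiable: "zeta_reg field_differentiable at s"
  using holomorphic_zeta_reg by (simp add: holomorphic_on_def)

text \<open>A constant below 2 is what counts: it keeps \<zeta> away from 0 on Re s \<ge> 2.\<close>

lemma suminf_Suc_powr_minus_2: "(\<Sum>n. real (Suc n) powr (- 2)) \<le> 5 / 3"
proof -
  have "(\<lambda>n. real (Suc n) powr (- 2)) sums (pi\<^sup>2 / 6)"
    using inverse_squares_sums by (simp add: powr_minus_divide add.commute)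
  moreover have "pi\<^sup>2 \<le> 3.16\<^sup>2"
    using pi_approx by (intro power_mono) auto
  ultimately show ?thesis by (simp add: sums_iff power2_eq_square)
qed

text \<open>Only the polynomial order matters. The bound feeds the Borel-Caratheodory argument, the
  Phragmen-Lindelof principle and the contour shift; no final exponent depends on it.\<close>

lemma zeta_reg_growth:
  assumes "Re s \<ge> 0"
  shows "norm (zeta_reg s) \<le> 4 * (1 + norm s) ^ 3"
proof -
  let ?m = "1 + norm s"
  have sm: "summable (\<lambda>n. real (Suc n) powr (- 2))"
    by (rule summable_Suc_powr) simp
  have le: "norm (trap (Suc n) s) \<le> ?m ^ 3 * real (Suc n) powr (- 2)" for n
  proof -
    have "norm (trap (Suc n) s) \<le> norm (s - 1) * norm s * norm (s + 1) * real (Suc n) powr (- Re s - 2)"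
      using assms by (intro trap_bound) auto
    also have "\<dots> \<le> ?m * ?m * ?m * real (Suc n) powr (- 2)"
      using assms norm_triangle_ineq[of s 1] norm_triangle_ineq4[of s 1]
      by (intro mult_mono powr_mono) auto
    finally show ?thesis by (simp add: power3_eq_cube)
  qed
  have "norm (\<Sum>n. trap (Suc n) s) \<le> (\<Sum>n. ?m ^ 3 * real (Suc n) powr (- 2))"
    by (intro norm_suminf_le le summable_mult sm)
  also have "\<dots> = ?m ^ 3 * (\<Sum>n. real (Suc n) powr (- 2))"
    by (rule suminf_mult[OF sm])
  also have "\<dots> \<le> ?m ^ 3 * (5 / 3)"
    by (intro mult_left_mono suminf_Suc_powr_minus_2) auto
  finally have 1: "norm (\<Sum>n. trap (Suc n) s) \<le> ?m ^ 3 * (5 / 3)" .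
  have 2: "norm (1 + (s - 1) / 2) \<le> 1 + ?m / 2"
  proof -
    have "norm (1 + (s - 1) / 2) \<le> 1 + norm ((s - 1) / 2)"
      using norm_triangle_ineq[of 1 "(s - 1) / 2"] by simp
    also have "\<dots> \<le> 1 + ?m / 2"
      unfolding norm_divide using norm_triangle_ineq4[of s 1] by simp
    finally show ?thesis .
  qed
  have 3: "1 + ?m / 2 \<le> ?m ^ 3 * 2"
  proof -
    have *: "1 + m / 2 \<le> p * 2" if "1 \<le> p" "m \<le> p" for m p :: real
      using that by simp
    show ?thesis
      by (rule *) (use one_le_power[of ?m 3] power_increasing[of 1 3 ?m] in simp_all)
  qed
  have "norm (zeta_reg s) \<le> norm (1 + (s - 1) / 2) + norm (\<Sum>n. trap (Suc n) s)"
    using assms by (subst zeta_reg_eq_trap) (auto intro: norm_triangle_ineq)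
  also have "\<dots> \<le> ?m ^ 3 * 2 + ?m ^ 3 * (5 / 3)"
    by (intro add_mono order.trans[OF 2 3] 1)
  also have "\<dots> = ?m ^ 3 * (11 / 3)" by simp
  also have "\<dots> \<le> ?m ^ 3 * 4" by (intro mult_left_mono) auto
  finally show ?thesis by (simp only: mult.commute)
qed

text \<open>Conjugating argument and value preserves the defining property, so uniqueness of the
  continuation gives the symmetry.\<close>

lemma zeta_cnj: "zeta (cnj s) = cnj (zeta s)"
proof -
  have "is_zeta (cnj \<circ> zeta \<circ> cnj)"
    unfolding is_zeta_def
  proof (intro conjI allI impI)
    show "cnj \<circ> zeta \<circ> cnj holomorphic_on - {1}"
      by (rule holomorphic_on_compose_cnj_cnj)
         (auto intro: holomorphic_on_subset[OF holomorphic_zeta] simp: open_Compl)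
    show "(cnj \<circ> zeta \<circ> cnj) 1 = 0" using is_zeta_zeta by (simp add: is_zeta_def)
    fix s :: complex assume s: "Re s > 1"
    have "(\<lambda>n. of_nat (Suc n) powr (- cnj s)) sums zeta (cnj s)"
      by (rule zeta_sums) (use s in simp)
    then have "(\<lambda>n. cnj (of_nat (Suc n) powr (- cnj s))) sums cnj (zeta (cnj s))"
      by (simp only: sums_cnj)
    moreover have "cnj (of_nat (Suc n) powr (- cnj s)) = 1 / of_nat (Suc n) powr s" for n
      by (subst cnj_powr) (auto simp: powr_minus_divide)
    ultimately show "(cnj \<circ> zeta \<circ> cnj) s = (\<Sum>n. 1 / of_nat (Suc n) powr s)"
      by (simp add: sums_iff del: of_nat_Suc)
  qed
  then have "cnj \<circ> zeta \<circ> cnj = zeta"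
    using is_zeta_ex1 is_zeta_zeta by blast
  then have "cnj (zeta (cnj (cnj s))) = zeta (cnj s)" by (metis comp_apply)
  then show ?thesis by simp
qed

lemma zeta_reg_cnj: "zeta_reg (cnj s) = cnj (zeta_reg s)"
  by (auto simp: zeta_reg_def zeta_cnj)

lemma has_field_derivative_powr_diff:
  fixes w a z :: complex
  assumes "w \<noteq> 0"
  shows "((\<lambda>z. w powr (a - z)) has_field_derivative (- Ln w * w powr (a - z))) (at z within A)"
proof -
  have "((\<lambda>z. w powr (a - z)) has_field_derivative (Ln w * w powr (a - z)) * (0 - 1)) (at z within A)"
    by (rule DERIV_chain2[OF has_field_derivative_powr_right[OF assms]]) (auto intro!: derivative_eq_intros)
  then show ?thesis by simp
qed

text \<open>This is the constant term of \<zeta> at its pole. Differentiating the trapezoidal series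
  termwise gives a series for Euler's constant, shifted by a telescoping sum of value - 1/2 that the
  linear term (s - 1) / 2 compensates. It produces the 2 \<gamma> in the main term of
  \<open>S_mu\<close>.\<close>

lemma deriv_zeta_reg_1: "deriv zeta_reg 1 = of_real euler_mascheroni"
proof -
  let ?f = "\<lambda>n s. \<Sum>i<n. trap (Suc i) s" and ?g = "\<lambda>s. \<Sum>n. trap (Suc n) s"
  obtain d where d: "d > 0"
    "uniform_limit (cball 1 d) ?f ?g sequentially"
    using uniform_limit_trap[of 1] by auto
  have "(\<lambda>n. (deriv ^^ 1) (?f n) 1) \<longlonglongrightarrow> (deriv ^^ 1) ?g 1"
  proof (rule higher_deriv_complex_uniform_limit)
    show "uniform_limit (ball 1 d) ?f ?g sequentially"
      by (rule uniform_limit_on_subset[OF d(2)]) auto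
    show "\<forall>\<^sub>F n in sequentially. ?f n holomorphic_on ball 1 d"
      by (intro always_eventually allI holomorphic_intros)
  qed (use d in auto)
  moreover have "deriv (?f n) 1 =
     (\<Sum>i<n. (1 / of_nat (Suc i) + 1 / of_nat (Suc (Suc i))) / 2
        - of_real (ln (real (Suc (Suc i)))) + of_real (ln (real (Suc i))))" for n
  proof (rule DERIV_imp_deriv, rule DERIV_sum)
    fix i
    have "(trap (Suc i) has_field_derivative
       ((of_nat (Suc i) powr - 1 + of_nat (Suc (Suc i)) powr - 1) / 2
       + of_nat (Suc (Suc i)) powr (1 - 1) * - Ln (of_nat (Suc (Suc i)))
       - of_nat (Suc i) powr (1 - 1) * - Ln (of_nat (Suc i)))) (at 1)"
    proof -
      have nz: "of_nat (Suc k) \<noteq> (0 :: complex)" for k by (simp del: of_nat_Suc)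
      have D: "((\<lambda>z. of_nat (Suc k) powr (- z)) has_field_derivative
          - Ln (of_nat (Suc k)) * of_nat (Suc k) powr (- z)) (at z)" for k z
        using has_field_derivative_powr_diff[OF nz, of k 0 z] by (simp del: of_nat_Suc)
      show ?thesis
        unfolding trap_def
        by (auto intro!: derivative_eq_intros D has_field_derivative_powr_diff[OF nz]
              simp del: of_nat_Suc)
    qed
    moreover have "Ln (of_nat (Suc k)) = of_real (ln (real (Suc k)))" for k
      using Ln_of_real[of "real (Suc k)"] by simp
    ultimately show "(trap (Suc i) has_field_derivative
       ((1 / of_nat (Suc i) + 1 / of_nat (Suc (Suc i))) / 2
        - of_real (ln (real (Suc (Suc i)))) + of_real (ln (real (Suc i))))) (at 1)"
      by (simp add: powr_minus_divide del: of_nat_Suc)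
  qed
  ultimately have "(\<lambda>i. (1 / of_nat (Suc i) + 1 / of_nat (Suc (Suc i))) / 2
        - of_real (ln (real (Suc (Suc i)))) + of_real (ln (real (Suc i)))) sums deriv ?g 1"
    by (simp add: sums_def)
  moreover have "(\<lambda>i. (1 / of_nat (Suc i) + 1 / of_nat (Suc (Suc i))) / 2
        - of_real (ln (real (Suc (Suc i)))) + of_real (ln (real (Suc i))))
        sums (of_real euler_mascheroni + (1/2) * (0 - 1) :: complex)"
  proof -
    have 1: "(\<lambda>n. of_real (inverse (real (n+1)) + ln (real (n+1)) - ln (real (n+2))))
            sums (of_real euler_mascheroni :: complex)"
      using euler_mascheroni_sum_real by (subst sums_of_real_iff) simp
    have "(\<lambda>n. 1 / of_nat (Suc n)) \<longlonglongrightarrow> (0 :: complex)"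
      by (rule LIMSEQ_Suc[OF lim_1_over_n])
    from telescope_sums[OF this]
    have "(\<lambda>n. 1 / of_nat (Suc (Suc n)) - 1 / of_nat (Suc n)) sums (0 - 1 :: complex)" by simp
    from sums_add[OF 1 sums_mult[OF this, of "1/2"]] show ?thesis
      by (elim back_subst[of "\<lambda>f. f sums _"]) (auto simp: fun_eq_iff field_simps simp del: of_nat_Suc)
  qed
  ultimately have *: "deriv ?g 1 = of_real euler_mascheroni - 1 / 2"
    by (auto dest: sums_unique2)
  have "deriv zeta_reg 1 = deriv (\<lambda>s. 1 + (s - 1) / 2 + ?g s) 1"
  proof (rule deriv_cong_ev)
    have "\<forall>\<^sub>F s in nhds 1. s \<in> {s. - 1 < Re s}"
      by (rule eventually_nhds_in_open[OF open_halfplane]) simp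
    then show "\<forall>\<^sub>F s in nhds 1. zeta_reg s = 1 + (s - 1) / 2 + ?g s"
      by eventually_elim (simp add: zeta_reg_eq_trap)
  qed simp
  also have "\<dots> = 1 / 2 + deriv ?g 1"
  proof (rule DERIV_imp_deriv)
    have "?g field_differentiable at 1"
      using holomorphic_on_imp_differentiable_at[OF holomorphic_trap_suminf open_halfplane, of 1] by simp
    then have "(?g has_field_derivative deriv ?g 1) (at 1)"
      using field_differentiable_derivI by blast
    then show "((\<lambda>s. 1 + (s - 1) / 2 + ?g s) has_field_derivative (1 / 2 + deriv ?g 1)) (at 1)"
      by (auto intro!: derivative_eq_intros)
  qed
  finally show ?thesis using * by simp
qed

section \<open>Euler product and non-vanishing on the line \<open>Re s = 1\<close>\<close>

lemma of_nat_mult_powr: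
  "(of_nat (m * n) :: complex) powr z = of_nat m powr z * of_nat n powr z"
proof -
  have "(of_real (real m) * of_nat n :: complex) powr z = of_real (real m) powr z * of_nat n powr z"
    by (rule powr_times_real) auto
  then show ?thesis by simp
qed

lemma norm_of_nat_powr: "norm ((of_nat n :: complex) powr z) = real n powr Re z"
  by (cases "n = 0") (auto simp: norm_powr_real_powr)

lemma has_sum_zeta:
  assumes "Re s > 1"
  shows "((\<lambda>n. of_nat n powr (- s)) has_sum zeta s) {n. n > 0}"
proof -
  have "((\<lambda>n. of_nat (Suc n) powr (- s)) has_sum zeta s) UNIV"
  proof (rule norm_summable_imp_has_sum)
    show "summable (\<lambda>n. norm (of_nat (Suc n) powr (- s) :: complex))"
      using summable_Suc_powr[of "- Re s"] assms by (subst norm_of_nat_powr) auto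
  qed (rule zeta_sums[OF assms])
  then have "((\<lambda>n. of_nat n powr (- s)) has_sum zeta s) (range Suc)"
    by (subst has_sum_reindex) (auto simp: o_def)
  moreover have "range Suc = {n. n > 0}" by (auto simp: image_iff gr0_conv_Suc)
  ultimately show ?thesis by simp
qed

lemma has_sum_zeta_real:
  assumes "x > 1"
  shows "((\<lambda>n. real n powr (- x)) has_sum Re (zeta (of_real x))) {n. n > 0}"
proof -
  have "((\<lambda>n. Re (of_nat n powr (- of_real x))) has_sum Re (zeta (of_real x))) {n. n > 0}"
    by (rule has_sum_Re[OF has_sum_zeta]) (use assms in simp)
  moreover have "Re (of_nat n powr (- of_real x)) = real n powr (- x)" for n
    using powr_of_real[of "real n" "- x"] by simp
  ultimately show ?thesis by simp
qed

definition coprime_to :: "nat set \<Rightarrow> nat set" where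
  "coprime_to A = {n. n > 0 \<and> (\<forall>p\<in>A. \<not> p dvd n)}"

text \<open>The sieve of Eratosthenes: among the numbers free of primes in A, the multiples of a
  further prime q are q times the same set, so removing them multiplies the sum by 1 - q powr (-
  s).\<close>

lemma has_sum_euler:
  assumes "Re s > 1" "finite A" "\<And>p. p \<in> A \<Longrightarrow> prime p"
  shows "((\<lambda>n. of_nat n powr (- s)) has_sum ((\<Prod>p\<in>A. 1 - of_nat p powr (- s)) * zeta s))
           (coprime_to A)"
  using assms(2,3)
proof (induction A)
  case empty
  then show ?case using has_sum_zeta[OF assms(1)] by (simp add: coprime_to_def)
next
  case (insert q A)
  let ?P = "(\<Prod>p\<in>A. 1 - of_nat p powr (- s)) * zeta s"
  have q: "prime q" using insert.prems by blast
  have IH: "((\<lambda>n. of_nat n powr (- s)) has_sum ?P) (coprime_to A)"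
    using insert by auto
  have "((\<lambda>n. of_nat q powr (- s) * of_nat n powr (- s)) has_sum (of_nat q powr (- s) * ?P))
          (coprime_to A)"
    by (rule has_sum_cmult_right[OF IH])
  then have "((\<lambda>n. of_nat n powr (- s)) has_sum (of_nat q powr (- s) * ?P)) ((*) q ` coprime_to A)"
    using q by (subst has_sum_reindex) (auto simp: inj_on_def o_def of_nat_mult_powr[symmetric] prime_gt_0_nat)
  moreover have "(*) q ` coprime_to A \<subseteq> coprime_to A"
  proof -
    have "\<not> p dvd q * n" if "n \<in> coprime_to A" "p \<in> A" for p n
    proof
      assume "p dvd q * n"
      moreover have "prime p" using that insert.prems by blast
      ultimately have "p dvd q" using that by (auto simp: coprime_to_def prime_dvd_mult_iff)
      then have "p = q" using \<open>prime p\<close> q by (simp add: primes_dvd_imp_eq)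
      then show False using that insert by simp
    qed
    then show ?thesis using q by (auto simp: coprime_to_def prime_gt_0_nat)
  qed
  ultimately have "((\<lambda>n. of_nat n powr (- s)) has_sum (?P - of_nat q powr (- s) * ?P))
      (coprime_to A - (*) q ` coprime_to A)"
    by (intro has_sum_Diff[OF IH])
  moreover have "coprime_to A - (*) q ` coprime_to A = coprime_to (insert q A)"
  proof -
    have "n \<in> (*) q ` coprime_to A" if "n \<in> coprime_to A" "q dvd n" for n
    proof -
      obtain k where "n = q * k" using \<open>q dvd n\<close> by (elim dvdE)
      then have "k \<in> coprime_to A" using that by (auto simp: coprime_to_def)
      then show ?thesis using \<open>n = q * k\<close> by blast
    qed
    then show ?thesis by (auto simp: coprime_to_def)
  qed
  moreover have "?P - of_nat q powr (- s) * ?P = (\<Prod>p\<in>insert q A. 1 - of_nat p powr (- s)) * zeta s"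
    using insert by (simp add: algebra_simps)
  ultimately show ?case by simp
qed

text \<open>The product of the reciprocals of the Euler factors, so that it approximates 1 /
  \<zeta>.\<close>

definition euler_prod :: "nat \<Rightarrow> complex \<Rightarrow> complex" where
  "euler_prod N s = (\<Prod>p | prime p \<and> p \<le> N. 1 - of_nat p powr (- s))"

lemma norm_has_sum_le:
  fixes f :: "nat \<Rightarrow> complex"
  assumes "(f has_sum a) A" "(g has_sum b) B" "A \<subseteq> B" "\<And>x. x \<in> B \<Longrightarrow> norm (f x) \<le> g x"
  shows "norm a \<le> b"
proof -
  have sg: "g summable_on A"
    using summable_on_subset_banach[OF has_sum_imp_summable[OF assms(2)] assms(3)] .
  have nf: "(\<lambda>x. norm (f x)) summable_on A"
    by (rule summable_on_comparison_test[OF sg]) (use assms in auto)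
  have "norm a \<le> infsum (\<lambda>x. norm (f x)) A"
    using norm_infsum_bound[OF nf] assms(1) by (simp add: infsumI)
  also have "\<dots> \<le> infsum g A"
    by (rule infsum_mono[OF nf sg]) (use assms in auto)
  also have "\<dots> \<le> infsum g B"
    by (rule infsum_mono2[OF sg has_sum_imp_summable[OF assms(2)]])
       (use assms in \<open>auto intro: order_trans[OF norm_ge_zero]\<close>)
  finally show ?thesis using infsumI[OF assms(2)] by simp
qed

text \<open>An integer above 1 without prime factors up to N exceeds N, so the sieved sum differs
  from its term 1 by at most a tail of the series for \<zeta>(Re s).\<close>

lemma euler_prod_tendsto:
  assumes s: "Re s > 1"
  shows "(\<lambda>N. euler_prod N s * zeta s) \<longlonglongrightarrow> 1"
proof -
  define t where "t N = Re (zeta (of_real (Re s))) - (\<Sum>n\<in>{1..N}. real n powr (- Re s))" for N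
  have "(\<lambda>N. \<Sum>n<N. real (Suc n) powr (- Re s)) \<longlonglongrightarrow> Re (zeta (of_real (Re s)))"
  proof -
    have "(\<lambda>n. Re (of_nat (Suc n) powr (- of_real (Re s)))) sums Re (zeta (of_real (Re s)))"
      by (rule sums_Re[OF zeta_sums]) (use s in simp)
    moreover have "Re (of_nat n powr (- of_real x)) = real n powr (- x)" for n x
      using powr_of_real[of "real n" "- x"] by simp
    ultimately show ?thesis by (simp add: sums_def del: of_nat_Suc)
  qed
  moreover have "(\<Sum>n<N. real (Suc n) powr (- Re s)) = (\<Sum>n\<in>{1..N}. real n powr (- Re s))" for N
    by (rule sum.reindex_bij_witness[of _ "\<lambda>n. n - 1" Suc]) auto
  ultimately have t0: "t \<longlonglongrightarrow> 0"
    unfolding t_def by (auto intro!: tendsto_eq_intros)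
  have le: "norm (euler_prod N s * zeta s - 1) \<le> t N" if "N \<ge> 1" for N
  proof (rule norm_has_sum_le)
    let ?A = "{p. prime p \<and> p \<le> N}"
    have fin: "finite ?A" by (rule finite_subset[of _ "{..N}"]) auto
    show "((\<lambda>n. of_nat n powr (- s)) has_sum (euler_prod N s * zeta s - 1)) (coprime_to ?A - {1})"
    proof (rule has_sum_Diff)
      show "((\<lambda>n. of_nat n powr (- s)) has_sum (euler_prod N s * zeta s)) (coprime_to ?A)"
        unfolding euler_prod_def by (rule has_sum_euler[OF s fin]) auto
      show "((\<lambda>n. of_nat n powr (- s)) has_sum (1 :: complex)) {1}"
        using has_sum_finite[of "{1}" "\<lambda>n. of_nat n powr (- s)"] by simp
    qed (auto simp: coprime_to_def)
    show "((\<lambda>n. real n powr (- Re s)) has_sum t N) ({n. n > 0} - {1..N})"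
      unfolding t_def
      by (intro has_sum_Diff has_sum_zeta_real has_sum_finite s) auto
    show "coprime_to ?A - {1} \<subseteq> {n. n > 0} - {1..N}"
    proof
      fix n assume n: "n \<in> coprime_to ?A - {1}"
      then have "n \<noteq> 1" by simp
      then obtain p where p: "prime p" "p dvd n" using prime_factor_nat by blast
      moreover have "p \<le> n" using n p by (auto simp: coprime_to_def intro: dvd_imp_le)
      ultimately show "n \<in> {n. n > 0} - {1..N}" using n by (force simp: coprime_to_def)
    qed
  qed (simp add: norm_of_nat_powr)
  have "(\<lambda>N. euler_prod N s * zeta s - 1) \<longlonglongrightarrow> 0"
    by (rule Lim_null_comparison[OF _ t0]) (auto intro!: eventually_sequentiallyI[of 1] le)
  then show ?thesis by (simp add: LIM_zero_iff)
qed

lemma zeta_nonzero_Re_gt_1: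
  assumes "Re s > 1"
  shows "zeta s \<noteq> 0"
  using euler_prod_tendsto[OF assms] LIMSEQ_unique[of "\<lambda>_. 0 :: complex" 0 1] by auto

lemma ln_norm_one_minus_sums:
  assumes "norm w < 1"
  shows "(\<lambda>n. Re (w ^ n) / real n) sums (- ln (norm (1 - w)))"
proof -
  have w: "1 - w \<noteq> 0" using assms by auto
  have "(\<lambda>n. (-1) ^ Suc n / of_nat n * (- w) ^ n) sums ln (1 + - w)"
    by (rule Ln_series) (use assms in simp)
  moreover have "(-1) ^ Suc n / of_nat n * (- w) ^ n = - (w ^ n / of_nat n)" for n
  proof -
    have "(-1) ^ n * (- w) ^ n = w ^ n" by (simp add: power_mult_distrib[symmetric])
    then show ?thesis by (metis mult.commute mult_minus_left power_Suc mult_1 times_divide_eq_left minus_divide_left)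
  qed
  ultimately have "(\<lambda>n. - (w ^ n / of_nat n)) sums Ln (1 - w)" by (simp only: diff_conv_add_uminus)
  from sums_Re[OF sums_minus[OF this]] show ?thesis
    using w by (simp add: complex_Re_of_nat Re_divide_of_nat)
qed

lemma Re_of_real_mult: "Re (complex_of_real a * z) = a * Re z"
  by simp

text \<open>The inequality \<open>3 + 4 cos \<theta> + cos 2\<theta> = 2 (1 + cos \<theta>)\<^sup>2 \<ge> 0\<close>, applied to each term
  of the logarithmic series.\<close>

lemma euler_factor_3_4_1:
  fixes z :: complex
  assumes r: "0 \<le> r" "r < 1" and z: "norm z = 1"
  shows "norm (1 - complex_of_real r) ^ 3 * norm (1 - complex_of_real r * z) ^ 4 * norm (1 - complex_of_real r * z ^ 2) \<le> 1"
proof -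
  have n: "norm (complex_of_real r) < 1" "norm (complex_of_real r * z) < 1" "norm (complex_of_real r * z ^ 2) < 1"
    using r z by (auto simp: norm_mult norm_power)
  have "norm (1 - w) > 0" if "norm w < 1" for w :: complex
    using that by auto
  then have pos: "norm (1 - complex_of_real r) > 0" "norm (1 - complex_of_real r * z) > 0"
    "norm (1 - complex_of_real r * z ^ 2) > 0" using n by blast+
  have S: "(\<lambda>n. 3 * (Re (complex_of_real r ^ n) / real n) + 4 * (Re ((complex_of_real r * z) ^ n) / real n)
           + Re ((complex_of_real r * z ^ 2) ^ n) / real n)
      sums (3 * (- ln (norm (1 - complex_of_real r))) + 4 * (- ln (norm (1 - complex_of_real r * z)))
         + (- ln (norm (1 - complex_of_real r * z ^ 2))))"
    by (intro sums_add sums_mult ln_norm_one_minus_sums n)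
  have "0 \<le> 3 * (- ln (norm (1 - complex_of_real r))) + 4 * (- ln (norm (1 - complex_of_real r * z)))
         + (- ln (norm (1 - complex_of_real r * z ^ 2)))"
  proof (rule sums_le[OF _ sums_zero S])
    fix n
    define c where "c = Re (z ^ n)"
    have "norm (z ^ n) = 1" using z by (simp add: norm_power)
    then have "c ^ 2 + Im (z ^ n) ^ 2 = 1"
      by (simp add: c_def cmod_def)
    then have "Re (z ^ n * z ^ n) = 2 * c ^ 2 - 1"
      by (simp add: c_def power2_eq_square)
    moreover have "(z ^ 2) ^ n = z ^ n * z ^ n" by (simp add: power2_eq_square power_mult_distrib)
    ultimately have z2: "Re ((z ^ 2) ^ n) = 2 * c ^ 2 - 1" by simp
    have rn: "(complex_of_real r :: complex) ^ n = of_real (r ^ n)" by simp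
    have "3 * (Re (complex_of_real r ^ n) / real n) + 4 * (Re ((complex_of_real r * z) ^ n) / real n)
           + Re ((complex_of_real r * z ^ 2) ^ n) / real n = r ^ n / real n * (2 * (1 + c) ^ 2)"
    proof -
      have e: "Re (complex_of_real r ^ n) = r ^ n" "Re ((complex_of_real r * z) ^ n) = r ^ n * c"
        "Re ((complex_of_real r * z ^ 2) ^ n) = r ^ n * (2 * c ^ 2 - 1)"
        unfolding power_mult_distrib[of "complex_of_real r"] rn c_def[symmetric] z2[symmetric]
        by (simp_all only: c_def Re_complex_of_real Re_of_real_mult)
      show ?thesis
        unfolding e by (simp add: add_divide_distrib diff_divide_distrib power2_eq_square algebra_simps)
    qed
    also have "\<dots> \<ge> 0" using r by (intro mult_nonneg_nonneg divide_nonneg_nonneg) auto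
    finally show "0 \<le> 3 * (Re (complex_of_real r ^ n) / real n) + 4 * (Re ((complex_of_real r * z) ^ n) / real n)
           + Re ((complex_of_real r * z ^ 2) ^ n) / real n" .
  qed
  then have "ln (norm (1 - complex_of_real r) ^ 3 * norm (1 - complex_of_real r * z) ^ 4 * norm (1 - complex_of_real r * z ^ 2)) \<le> 0"
    using pos by (simp add: ln_mult ln_realpow)
  then show ?thesis using pos by (subst (asm) ln_le_zero_iff) auto
qed

text \<open>The factorwise bound says that the finite products from \<open>euler_prod\<close>
  contribute at most 1, while multiplied by the corresponding values of \<zeta> they tend to
  1.\<close>

lemma zeta_3_4_1:
  assumes x: "x > 1"
  shows "1 \<le> norm (zeta (of_real x)) ^ 3 * norm (zeta (Complex x t)) ^ 4 * norm (zeta (Complex x (2 * t)))"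
proof -
  define E where "E N = norm (euler_prod N (of_real x)) ^ 3 * norm (euler_prod N (Complex x t)) ^ 4
    * norm (euler_prod N (Complex x (2 * t)))" for N
  define Q where "Q = norm (zeta (of_real x)) ^ 3 * norm (zeta (Complex x t)) ^ 4 * norm (zeta (Complex x (2 * t)))"
  have "E N \<le> 1" for N
  proof -
    have fac: "norm (1 - of_nat p powr (- complex_of_real x)) ^ 3 * norm (1 - of_nat p powr (- Complex x t)) ^ 4
        * norm (1 - of_nat p powr (- Complex x (2 * t))) \<le> 1" if "prime p" for p :: nat
    proof -
      have p: "p \<noteq> 0" "1 < p" using that prime_gt_1_nat[OF that] by auto
      define r where "r = real p powr (- x)"
      define z where "z = (of_nat p :: complex) powr (- (\<i> * of_real t))"
      have r: "0 \<le> r" "r < 1" using x p by (auto simp: r_def powr_less_one)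
      have 1: "of_nat p powr (- of_real x) = (of_real r :: complex)"
        using powr_of_real[of "real p" "- x"] by (simp add: r_def)
      have "- Complex x t = - of_real x + - (\<i> * of_real t)" by (simp add: Complex_eq)
      then have 2: "of_nat p powr (- Complex x t) = of_real r * z"
        using 1 by (simp only: powr_add z_def)
      have "- Complex x (2 * t) = - of_real x + (- (\<i> * of_real t) + - (\<i> * of_real t))"
        by (simp add: Complex_eq)
      then have 3: "of_nat p powr (- Complex x (2 * t)) = of_real r * z ^ 2"
        using 1 by (simp only: powr_add z_def power2_eq_square)
      have "norm z = 1" using p by (simp add: z_def norm_of_nat_powr)
      then show ?thesis using euler_factor_3_4_1[OF r, of z] by (simp only: 1 2 3)
    qed
    have "E N = (\<Prod>p | prime p \<and> p \<le> N. norm (1 - of_nat p powr (- complex_of_real x)) ^ 3 *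
        norm (1 - of_nat p powr (- Complex x t)) ^ 4 * norm (1 - of_nat p powr (- Complex x (2 * t))))"
      by (simp add: E_def euler_prod_def prod.distrib prod_power_distrib flip: prod_norm)
    also have "\<dots> \<le> 1"
      by (intro prod_le_1) (auto intro!: fac)
    finally show ?thesis .
  qed
  then have "E N * Q \<le> 1 * Q" for N by (intro mult_right_mono) (auto simp: Q_def)
  moreover have "(\<lambda>N. norm (euler_prod N (of_real x) * zeta (of_real x)) ^ 3
       * norm (euler_prod N (Complex x t) * zeta (Complex x t)) ^ 4
       * norm (euler_prod N (Complex x (2 * t)) * zeta (Complex x (2 * t))))
     \<longlonglongrightarrow> norm (1 :: complex) ^ 3 * norm (1 :: complex) ^ 4 * norm (1 :: complex)"
    by (intro tendsto_intros euler_prod_tendsto) (use x in auto)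
  then have "(\<lambda>N. E N * Q) \<longlonglongrightarrow> 1"
    by (simp add: E_def Q_def norm_mult power_mult_distrib mult_ac)
  ultimately have "1 \<le> Q" by (intro LIMSEQ_le_const2[of "\<lambda>N. E N * Q"]) auto
  then show ?thesis by (simp add: Q_def)
qed

text \<open>The classical argument on Re s = 1: a zero at 1 + i t would give h^4 against the h^(- 3)
  from the pole at 1, with \<zeta> finite at 1 + 2 i t, contradicting the lower bound 1 of
  \<open>zeta_3_4_1\<close> as h tends to 0.\<close>

lemma zeta_reg_nonzero_Re_ge_1:
  assumes "Re s \<ge> 1"
  shows "zeta_reg s \<noteq> 0"
proof (cases "Re s > 1 \<or> s = 1")
  case True
  then show ?thesis using zeta_nonzero_Re_gt_1[of s] by (auto simp: zeta_reg_def)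
next
  case False
  define t where "t = Im s"
  have s: "s = Complex 1 t" and t: "t \<noteq> 0"
    using False assms by (auto simp: t_def complex_eq_iff)
  show ?thesis
  proof
    assume Z0: "zeta_reg s = 0"
    define h where "h n = 1 / real (Suc n)" for n
    have h: "h n > 0" for n by (simp add: h_def)
    have h0: "h \<longlonglongrightarrow> 0"
      using LIMSEQ_Suc[OF lim_1_over_n[where 'a = real]] by (simp add: h_def[abs_def] del: of_nat_Suc)
    have hc: "(\<lambda>n. complex_of_real (h n)) \<longlonglongrightarrow> 0"
      using tendsto_of_real[OF h0, where 'a = complex] by simp
    let ?Z = zeta_reg
    \<comment> \<open>The difference quotient absorbs four powers of h; after the cube of the pole
      one power of h remains, and it forces \<open>R\<close> to 0.\<close>
    define R where "R n = norm (?Z (1 + of_real (h n))) ^ 3 * norm (?Z (s + of_real (h n)) / of_real (h n)) ^ 4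
       * norm (?Z (Complex 1 (2 * t) + of_real (h n))) * h n" for n
    have cont: "isCont ?Z z" for z
      by (rule field_differentiable_imp_continuous_at[OF zeta_reg_differentiable])
    have lim: "(\<lambda>n. ?Z (z + of_real (h n))) \<longlonglongrightarrow> ?Z z" for z :: complex
    proof -
      have "(\<lambda>n. z + of_real (h n)) \<longlonglongrightarrow> z"
        using tendsto_add[OF tendsto_const hc, of z] by simp
      then show ?thesis by (rule isCont_tendsto_compose[OF cont])
    qed
    have "(\<lambda>n. ?Z (s + of_real (h n)) / of_real (h n)) \<longlonglongrightarrow> deriv ?Z s"
    proof -
      have "((\<lambda>h. (?Z (s + h) - ?Z s) / h) \<longlongrightarrow> deriv ?Z s) (at 0)"
        using field_differentiable_derivI[OF zeta_reg_differentiable[of s]] by (simp add: DERIV_def)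
      moreover have "filterlim (\<lambda>n. complex_of_real (h n)) (at 0) sequentially"
        unfolding filterlim_at using hc h[THEN less_imp_neq] by (auto intro!: always_eventually)
      ultimately show ?thesis using Z0 filterlim_compose by fastforce
    qed
    from this lim[of 1] lim[of "Complex 1 (2 * t)"] h0
    have "R \<longlonglongrightarrow> norm (?Z 1) ^ 3 * norm (deriv ?Z s) ^ 4 * norm (?Z (Complex 1 (2 * t))) * 0"
      unfolding R_def by (intro tendsto_intros)
    then have R0: "R \<longlonglongrightarrow> 0" by simp
    have "\<bar>t\<bar> ^ 4 * \<bar>2 * t\<bar> \<le> R n" for n
    proof -
      let ?x = "1 + h n"
      have zz: "norm (zeta z) = norm (?Z z) / norm (z - 1)" if "z \<noteq> 1" for z
        using that by (simp add: zeta_reg_def norm_mult)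
      have e: "s + of_real (h n) = Complex ?x t" "Complex 1 (2 * t) + of_real (h n) = Complex ?x (2 * t)"
        "1 + of_real (h n) = complex_of_real ?x" by (auto simp: s complex_eq_iff)
      have hn: "h n > 0" by (rule h)
      have "1 \<le> norm (zeta (of_real ?x)) ^ 3 * norm (zeta (Complex ?x t)) ^ 4 * norm (zeta (Complex ?x (2 * t)))"
        by (rule zeta_3_4_1) (use hn in simp)
      also have "norm (zeta (of_real ?x)) = norm (?Z (of_real ?x)) / h n"
        using hn by (subst zz) (auto simp: complex_eq_iff)
      also have "norm (zeta (Complex ?x t)) = norm (?Z (Complex ?x t)) / norm (Complex (h n) t)"
        using hn by (subst zz) (auto simp: complex_eq_iff cmod_def)
      also have "norm (zeta (Complex ?x (2 * t))) = norm (?Z (Complex ?x (2 * t))) / norm (Complex (h n) (2 * t))"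
        using hn by (subst zz) (auto simp: complex_eq_iff cmod_def)
      also have "(norm (?Z (of_real ?x)) / h n) ^ 3 * (norm (?Z (Complex ?x t)) / norm (Complex (h n) t)) ^ 4 *
          (norm (?Z (Complex ?x (2 * t))) / norm (Complex (h n) (2 * t)))
          \<le> (norm (?Z (of_real ?x)) / h n) ^ 3 * (norm (?Z (Complex ?x t)) / \<bar>t\<bar>) ^ 4 *
          (norm (?Z (Complex ?x (2 * t))) / \<bar>2 * t\<bar>)"
        using hn t abs_Im_le_cmod[of "Complex (h n) t"] abs_Im_le_cmod[of "Complex (h n) (2 * t)"]
        by (intro mult_mono power_mono divide_left_mono mult_pos_pos mult_nonneg_nonneg zero_le_power divide_nonneg_nonneg)
           (auto simp: complex_eq_iff)
      also have "\<dots> = R n / (\<bar>t\<bar> ^ 4 * \<bar>2 * t\<bar>)"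
        unfolding R_def e using hn t
        by (simp add: norm_divide power_divide norm_mult field_simps power4_eq_xxxx power3_eq_cube)
      finally show ?thesis using t by (simp add: field_simps)
    qed
    then have "\<bar>t\<bar> ^ 4 * \<bar>2 * t\<bar> \<le> 0" by (intro LIMSEQ_le_const[OF R0]) auto
    then show False using t by (simp add: mult_le_0_iff)
  qed
qed

lemma norm_zeta_minus_1_le:
  assumes "Re s \<ge> 2"
  shows "norm (zeta s - 1) \<le> 2 / 3"
proof -
  have 1: "((\<lambda>n. of_nat n powr (- s)) has_sum (zeta s - 1)) ({n. n > 0} - {1})"
    using has_sum_Diff[OF has_sum_zeta[of s] has_sum_finite[of "{1}" "\<lambda>n. of_nat n powr (- s)"]] assms
    by simp
  have 2: "((\<lambda>n. real n powr (- 2)) has_sum (Re (zeta (of_real 2)) - 1)) ({n. n > 0} - {1})"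
    using has_sum_Diff[OF has_sum_zeta_real[of 2] has_sum_finite[of "{1}" "\<lambda>n. real n powr (- 2)"]]
    by simp
  have "norm (zeta s - 1) \<le> Re (zeta (of_real 2)) - 1"
    by (rule norm_has_sum_le[OF 1 2]) (use assms in \<open>auto simp: norm_of_nat_powr intro!: powr_mono\<close>)
  also have "(\<lambda>n. Re (of_nat (Suc n) powr (- of_real 2))) sums Re (zeta (of_real 2))"
    by (rule sums_Re[OF zeta_sums]) simp
  then have "Re (zeta (of_real 2)) = (\<Sum>n. real (Suc n) powr (- 2))"
    using powr_of_real[of "real (Suc n)" "- 2" for n] by (simp add: sums_iff del: of_nat_Suc)
  then have "Re (zeta (of_real 2)) - 1 \<le> 2 / 3" using suminf_Suc_powr_minus_2 by simp
  finally show ?thesis .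
qed

lemma norm_zeta_Re_ge_2:
  assumes "Re s \<ge> 2"
  shows "1 / 3 \<le> norm (zeta s)" "norm (zeta s) \<le> 5 / 3"
  using norm_zeta_minus_1_le[OF assms] norm_triangle_ineq3[of "zeta s" 1] by (auto simp: abs_le_iff)

section \<open>Growth of the Gamma function\<close>

lemma Re_Digamma_LIMSEQ:
  assumes "z \<noteq> (0 :: complex)"
  shows "(\<lambda>m. ln (real m) - (\<Sum>n<m. Re (inverse (z + of_nat n)))) \<longlonglongrightarrow> Re (Digamma z)"
  using tendsto_Re[OF Digamma_LIMSEQ[OF assms]] by simp

text \<open>Comparison with Digamma at 1, term by term: |z + n| \<ge> 1 + n for Re z \<ge> 1. The
  value there is minus Euler's constant.\<close>

lemma Re_Digamma_ge:
  assumes "Re z \<ge> 1"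
  shows "Re (Digamma z) \<ge> - 1"
proof -
  have "z \<noteq> 0" using assms by auto
  have "(\<lambda>m. of_real (ln (real m)) - (\<Sum>n<m. inverse (1 + of_nat n))) \<longlonglongrightarrow> Digamma (1 :: real)"
    by (rule Digamma_LIMSEQ) simp
  then have "(\<lambda>m. ln (real m) - (\<Sum>n<m. inverse (1 + real n))) \<longlonglongrightarrow> - euler_mascheroni"
    by simp
  then have "- euler_mascheroni \<le> Re (Digamma z)"
  proof (rule LIMSEQ_le[OF _ Re_Digamma_LIMSEQ[OF \<open>z \<noteq> 0\<close>]], intro exI allI impI diff_left_mono sum_mono)
    fix n
    have "Re (inverse (z + of_nat n)) \<le> norm (inverse (z + of_nat n))" by (rule complex_Re_le_cmod)
    also have "\<dots> = inverse (norm (z + of_nat n))" by (simp add: norm_inverse)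
    also have "\<dots> \<le> inverse (1 + real n)"
      using assms abs_Re_le_cmod[of "z + of_nat n"] by (intro le_imp_inverse_le) auto
    finally show "Re (inverse (z + of_nat n)) \<le> inverse (1 + real n)" .
  qed
  moreover have "(euler_mascheroni :: real) < 13 / 22" by (rule euler_mascheroni_less_13_over_22)
  ultimately show ?thesis by simp
qed

lemma sum_inverse_ge_ln:
  fixes c :: real
  assumes "c > 0" "k \<le> m"
  shows "ln (real m + c) - ln (real k + c) \<le> (\<Sum>n = k..<m. 1 / (real n + c))"
  using assms(2)
proof (induction m rule: dec_induct)
  case (step m)
  have "ln (real (Suc m) + c) - ln (real m + c) = ln (1 + 1 / (real m + c))"
  proof -
    have "1 + 1 / (real m + c) = (real (Suc m) + c) / (real m + c)"
      using assms by (simp add: field_simps)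
    then show ?thesis using assms by (simp only:) (subst ln_div, auto)
  qed
  also have "\<dots> \<le> 1 / (real m + c)" using assms by (intro ln_add_one_self_le_self) auto
  finally show ?case using step by simp
qed simp

text \<open>Terms with n below |Im z| are dropped, being nonnegative; beyond that Re z + n \<ge> |Im
  z| gives Re (1 / (z + n)) \<ge> 1 / (Re z + n + |Im z|), and the harmonic tail is compared with a
  logarithm.\<close>

lemma Re_Digamma_le:
  assumes z: "1 \<le> Re z" "Re z \<le> 2"
  shows "Re (Digamma z) \<le> ln (2 * \<bar>Im z\<bar> + 3)"
proof -
  define y where "y = \<bar>Im z\<bar>"
  define k where "k = nat \<lceil>y\<rceil>"
  have y: "y \<ge> 0" by (simp add: y_def)
  have k: "y \<le> real k" "real k \<le> y + 1" using y by (auto simp: k_def)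
  have "z \<noteq> 0" using z by auto
  from Re_Digamma_LIMSEQ[OF this] show ?thesis
  proof (rule LIMSEQ_le_const2, intro exI allI impI)
    fix m assume m: "m \<ge> Suc k"
    have Re_inv: "Re (inverse (z + of_nat n)) = (Re z + n) / ((Re z + n)\<^sup>2 + y\<^sup>2)" for n
      by (simp add: y_def)
    have "ln (real m) - ln (2 * y + 3) \<le> ln (real m + (2 + y)) - ln (real k + (2 + y))"
      using m y k by (intro diff_mono) (auto)
    also have "\<dots> \<le> (\<Sum>n = k..<m. 1 / (real n + (2 + y)))"
      by (rule sum_inverse_ge_ln) (use m y in auto)
    also have "\<dots> \<le> (\<Sum>n = k..<m. Re (inverse (z + of_nat n)))"
    proof (rule sum_mono)
      fix n assume n: "n \<in> {k..<m}"
      define x where "x = Re z + n"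
      have x: "x \<ge> y" "x > 0" "x \<le> real n + 2" using n k z by (auto simp: x_def)
      have "1 / (real n + (2 + y)) \<le> 1 / (x + y)"
        using x y by (intro divide_left_mono) auto
      also have "\<dots> \<le> x / (x\<^sup>2 + y\<^sup>2)"
      proof -
        have "y * y \<le> x * y" using x y by (intro mult_right_mono) auto
        then have "x / (x * (x + y)) \<le> x / (x\<^sup>2 + y\<^sup>2)"
          using x y by (intro divide_left_mono mult_pos_pos add_pos_nonneg)
            (auto simp: power2_eq_square algebra_simps)
        then show ?thesis using x by simp
      qed
      finally show "1 / (real n + (2 + y)) \<le> Re (inverse (z + of_nat n))"
        unfolding Re_inv x_def .
    qed
    also have "\<dots> \<le> (\<Sum>n<m. Re (inverse (z + of_nat n)))"
      by (rule sum_mono2) (use z in \<open>auto simp: Re_inv\<close>)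
    finally show "ln (real m) - (\<Sum>n<m. Re (inverse (z + of_nat n))) \<le> ln (2 * \<bar>Im z\<bar> + 3)"
      by (simp add: y_def)
  qed
qed

lemma has_real_derivative_ln_norm:
  fixes f :: "complex \<Rightarrow> complex"
  assumes "(f has_field_derivative f') (at (Complex x y))" "f (Complex x y) \<noteq> 0"
  shows "((\<lambda>x. ln (norm (f (Complex x y)))) has_real_derivative Re (f' / f (Complex x y))) (at x)"
proof -
  define F where "F x = f (Complex x y)" for x
  have "((\<lambda>x. of_real x + \<i> * of_real y) has_vector_derivative 1) (at x)"
    by (auto intro!: derivative_eq_intros)
  from field_vector_diff_chain_at[OF this, of f f'] assms(1)
  have Fv: "(F has_vector_derivative f') (at x)"
    by (simp add: o_def F_def[abs_def] Complex_eq)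
  then have R: "((\<lambda>x. Re (F x)) has_real_derivative Re f') (at x)"
    and I: "((\<lambda>x. Im (F x)) has_real_derivative Im f') (at x)"
    by (auto simp: has_vector_derivative_complex_iff)
  have nz: "(Re (F x))\<^sup>2 + (Im (F x))\<^sup>2 > 0"
    using assms(2) by (simp add: F_def complex_neq_0 sum_power2_gt_zero_iff complex_eq_iff)
  have "((\<lambda>x. (Re (F x))\<^sup>2 + (Im (F x))\<^sup>2) has_real_derivative
      (2 * Re (F x) * Re f' + 2 * Im (F x) * Im f')) (at x)"
    by (auto intro!: derivative_eq_intros R I Fv)
  from DERIV_cdivide[OF DERIV_chain2[OF DERIV_ln_divide[OF nz] this], of 2]
  have "((\<lambda>x. ln ((Re (F x))\<^sup>2 + (Im (F x))\<^sup>2) / 2) has_real_derivative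
      (2 * Re (F x) * Re f' + 2 * Im (F x) * Im f') / ((Re (F x))\<^sup>2 + (Im (F x))\<^sup>2) / 2) (at x)"
    by simp
  moreover have "(\<lambda>x. ln ((Re (F x))\<^sup>2 + (Im (F x))\<^sup>2) / 2) = (\<lambda>x. ln (norm (F x)))"
    by (auto simp: fun_eq_iff cmod_def ln_sqrt add_nonneg_nonneg)
  moreover have "(2 * Re (F x) * Re f' + 2 * Im (F x) * Im f') / ((Re (F x))\<^sup>2 + (Im (F x))\<^sup>2) / 2
      = Re (f' / F x)"
  proof -
    have "(2 * p * a + 2 * q * b) / S / 2 = (a * p + b * q) / S" for p a q b S :: real
      by (cases "S = 0") (auto simp: field_simps)
    then show ?thesis by (simp only: Re_divide)
  qed
  ultimately show ?thesis by (simp add: F_def)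
qed

lemma ln_norm_Gamma_deriv:
  assumes "x > 0"
  shows "((\<lambda>x. ln (norm (Gamma (Complex x y)))) has_real_derivative Re (Digamma (Complex x y))) (at x)"
proof -
  have "Complex x y \<notin> \<int>\<^sub>\<le>\<^sub>0" using assms by (auto elim!: nonpos_Ints_cases simp: complex_eq_iff)
  then show ?thesis
    using has_real_derivative_ln_norm[OF has_field_derivative_Gamma, of x y] by (simp add: Gamma_eq_zero_iff)
qed

lemma norm_Gamma_pos:
  assumes "x > 0"
  shows "norm (Gamma (Complex x y)) > 0"
proof -
  have "Complex x y \<notin> \<int>\<^sub>\<le>\<^sub>0" using assms by (auto elim!: nonpos_Ints_cases simp: complex_eq_iff)
  then show ?thesis by (simp add: Gamma_eq_zero_iff)
qed

text \<open>Growth in the manner of Stirling's formula, with exponent exactly x2 - x1: the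
  derivative of log |Gamma| along a horizontal line is Re Digamma, and the mean value theorem
  applies. The exact exponent decides the final power of |t|.\<close>

lemma norm_Gamma_ratio_le:
  assumes "1 \<le> x1" "x1 \<le> x2" "x2 \<le> 2"
  shows "norm (Gamma (Complex x2 y)) \<le> (2 * \<bar>y\<bar> + 3) powr (x2 - x1) * norm (Gamma (Complex x1 y))"
proof (cases "x1 = x2")
  case False
  then have "x1 < x2" using assms by simp
  have "\<exists>x>x1. x < x2 \<and> ln (norm (Gamma (Complex x2 y))) - ln (norm (Gamma (Complex x1 y)))
      = (x2 - x1) * Re (Digamma (Complex x y))"
    by (rule MVT2[OF \<open>x1 < x2\<close> ln_norm_Gamma_deriv]) (use assms in auto)
  then obtain x where x: "x1 < x" "x < x2"
    "ln (norm (Gamma (Complex x2 y))) - ln (norm (Gamma (Complex x1 y))) = (x2 - x1) * Re (Digamma (Complex x y))"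
    by blast
  have "Re (Digamma (Complex x y)) \<le> ln (2 * \<bar>y\<bar> + 3)"
    using Re_Digamma_le[of "Complex x y"] x assms by simp
  then have "ln (norm (Gamma (Complex x2 y))) \<le> (x2 - x1) * ln (2 * \<bar>y\<bar> + 3) + ln (norm (Gamma (Complex x1 y)))"
    using x assms mult_left_mono[of "Re (Digamma (Complex x y))" "ln (2 * \<bar>y\<bar> + 3)" "x2 - x1"] by linarith
  also have "\<dots> = ln ((2 * \<bar>y\<bar> + 3) powr (x2 - x1) * norm (Gamma (Complex x1 y)))"
    using norm_Gamma_pos[of x1 y] assms by (subst ln_mult) (auto simp: ln_powr)
  finally show ?thesis
    using norm_Gamma_pos[of x1 y] norm_Gamma_pos[of x2 y] assms
    by (subst (asm) ln_le_cancel_iff) (auto intro!: mult_pos_pos)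
qed simp

text \<open>Moving to the right cannot shrink Gamma by more than the exponential of the
  displacement; this controls the Gamma quotient in \<xi>(s - a) / \<xi>(s + a).\<close>

lemma norm_Gamma_ratio_ge:
  assumes "1 \<le> x1" "x1 \<le> x2"
  shows "norm (Gamma (Complex x1 y)) \<le> exp (x2 - x1) * norm (Gamma (Complex x2 y))"
proof (cases "x1 = x2")
  case False
  then have "x1 < x2" using assms by simp
  have "\<exists>x>x1. x < x2 \<and> ln (norm (Gamma (Complex x2 y))) - ln (norm (Gamma (Complex x1 y)))
      = (x2 - x1) * Re (Digamma (Complex x y))"
    by (rule MVT2[OF \<open>x1 < x2\<close> ln_norm_Gamma_deriv]) (use assms in auto)
  then obtain x where x: "x1 < x" "x < x2"
    "ln (norm (Gamma (Complex x2 y))) - ln (norm (Gamma (Complex x1 y))) = (x2 - x1) * Re (Digamma (Complex x y))"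
    by blast
  have "- 1 \<le> Re (Digamma (Complex x y))"
    using Re_Digamma_ge[of "Complex x y"] x assms by simp
  then have "ln (norm (Gamma (Complex x1 y))) \<le> (x2 - x1) + ln (norm (Gamma (Complex x2 y)))"
    using x mult_left_mono[of "- 1" "Re (Digamma (Complex x y))" "x2 - x1"] by simp
  also have "\<dots> = ln (exp (x2 - x1) * norm (Gamma (Complex x2 y)))"
    using norm_Gamma_pos[of x2 y] assms by (subst ln_mult) auto
  finally show ?thesis
    using norm_Gamma_pos[of x1 y] norm_Gamma_pos[of x2 y] assms
    by (subst (asm) ln_le_cancel_iff) (auto intro!: mult_pos_pos)
qed simp

section \<open>A mean square estimate for Laplace transforms\<close>

abbreviation nu :: "real \<Rightarrow> real" where "nu \<equiv> std_normal_density"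

lemma integrable_nu: "integrable lborel nu"
  using integrable_std_normal_moment[of 0] by simp

lemma integral_nu: "(LBINT x. nu x) = 1"
  using integral_std_normal_moment_even[of 0] by simp

lemma exp_eq_nu: "exp (- x\<^sup>2 / 2) = sqrt (2 * pi) * nu x"
  by (simp add: std_normal_density_def)

lemma nu_fourier: "(CLBINT x. of_real (nu x) * iexp (b * x)) = of_real (exp (- b\<^sup>2 / 2))"
proof -
  have "(CLBINT x. of_real (nu x) * iexp (b * x)) = (CLINT x|std_normal_distribution. iexp (b * x))"
    by (subst integral_density) (auto simp: scaleR_conv_of_real)
  also have "\<dots> = char std_normal_distribution b" by (simp add: char_def)
  finally show ?thesis by (simp add: char_std_normal_distribution)
qed

lemma gauss_fourier:
  assumes a: "a > 0"
  shows "integrable lborel (\<lambda>t. of_real (exp (- (t / a)\<^sup>2 / 2)) * iexp (b * t))"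
    and "(CLBINT t. of_real (exp (- (t / a)\<^sup>2 / 2)) * iexp (b * t)) = of_real (2 * pi * a * nu (a * b))"
proof -
  define f where "f t = complex_of_real (exp (- (t / a)\<^sup>2 / 2)) * iexp (b * t)" for t
  have f: "f (0 + a * t) = of_real (sqrt (2 * pi)) * (of_real (nu t) * iexp ((a * b) * t))" for t
    unfolding f_def exp_eq_nu of_real_mult using a by (simp add: mult_ac)
  have int: "integrable lborel (\<lambda>t. of_real (nu t) * iexp ((a * b) * t))"
  proof (rule Bochner_Integration.integrable_bound[OF integrable_nu])
    show "AE t in lborel. norm (of_real (nu t) * iexp ((a * b) * t)) \<le> norm (nu t)"
      by (simp add: norm_mult)
  qed measurable
  have "integrable lborel (\<lambda>t. f (0 + a * t))"
    unfolding f by (intro integrable_mult_right int)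
  then show "integrable lborel (\<lambda>t. of_real (exp (- (t / a)\<^sup>2 / 2)) * iexp (b * t))"
    using lborel_integrable_real_affine_iff[of a f 0] a by (simp add: f_def[abs_def])
  have "(CLBINT t. f t) = \<bar>a\<bar> *\<^sub>R (CLBINT t. f (0 + a * t))"
    by (rule lborel_integral_real_affine) (use a in auto)
  also have "(CLBINT t. f (0 + a * t)) = of_real (sqrt (2 * pi)) * of_real (exp (- (a * b)\<^sup>2 / 2))"
    unfolding f integral_mult_right_zero nu_fourier by simp
  also have "\<bar>a\<bar> *\<^sub>R \<dots> = of_real (\<bar>a\<bar> * (sqrt (2 * pi) * exp (- (a * b)\<^sup>2 / 2)))"
    by (simp only: scaleR_conv_of_real of_real_mult)
  also have "\<bar>a\<bar> * (sqrt (2 * pi) * exp (- (a * b)\<^sup>2 / 2)) = 2 * pi * a * nu (a * b)"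
    unfolding exp_eq_nu using a real_sqrt_mult_self[of "2 * pi"]
    by (simp only: mult.assoc[symmetric] abs_of_pos) (simp add: mult_ac)
  finally show "(CLBINT t. of_real (exp (- (t / a)\<^sup>2 / 2)) * iexp (b * t)) = of_real (2 * pi * a * nu (a * b))"
    by (simp add: f_def)
qed

lemma nu_even: "nu (- x) = nu x"
  by (simp add: std_normal_density_def)

lemma integrable_gauss: "(a :: real) > 0 \<Longrightarrow> integrable lborel (\<lambda>t. exp (- (t / a)\<^sup>2 / 2))"
  using integrable_Re[OF gauss_fourier(1)[of a 0]] by simp

lemma integrable_product:
  fixes f :: "real \<Rightarrow> real" and h :: "real \<Rightarrow> real"
  assumes "integrable lborel f" "integrable lborel h"
  shows "integrable (lborel \<Otimes>\<^sub>M lborel) (\<lambda>(x, y). f x * h y)"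
proof -
  have [measurable]: "f \<in> borel_measurable borel" "h \<in> borel_measurable borel"
    using assms by auto
  show ?thesis
  proof (rule lborel_pair.Fubini_integrable)
    show "integrable lborel (\<lambda>x. LBINT y. norm (case (x, y) of (x, y) \<Rightarrow> f x * h y))"
      using assms by (simp add: abs_mult)
    show "AE x in lborel. integrable lborel (\<lambda>y. case (x, y) of (x, y) \<Rightarrow> f x * h y)"
      using assms by simp
  qed measurable
qed

text \<open>Laplace inversion on the line Re s = c, damped by exp (s^2 / (2 a^2)). The factor is
  entire, so the line can be moved later, and it decays like a Gaussian along it, so Fubini's
  theorem applies; its effect is to replace g by its average against a normal density of standard
  deviation 1 / a.\<close>

lemma gaussian_mellin_inversion:
  fixes g :: "real \<Rightarrow> real"
  assumes a: "a > 0" and g[measurable]: "g \<in> borel_measurable borel"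
    and int: "integrable lborel (\<lambda>v. g v * exp (- c * v))"
  shows "(CLBINT t. (CLBINT v. of_real (g v) * exp (- Complex c t * of_real v))
            * exp ((Complex c t)\<^sup>2 / of_real (2 * a\<^sup>2) + Complex c t * of_real u))
         = of_real (2 * pi * (LBINT z. g (u - z / a) * nu z))"
proof -
  define K where "K t = exp ((Complex c t)\<^sup>2 / of_real (2 * a\<^sup>2) + Complex c t * of_real u)" for t
  define C where "C = exp (c\<^sup>2 / (2 * a\<^sup>2) + c * u)"
  have nK: "norm (K t) = C * exp (- (t / a)\<^sup>2 / 2)" for t
  proof -
    have "Re ((Complex c t)\<^sup>2 / of_real (2 * a\<^sup>2) + Complex c t * of_real u)
        = (c\<^sup>2 - t\<^sup>2) / (2 * a\<^sup>2) + c * u"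
      by (simp add: power2_eq_square flip: of_real_power of_real_mult)
    also have "\<dots> = (c\<^sup>2 / (2 * a\<^sup>2) + c * u) + - (t / a)\<^sup>2 / 2"
      by (simp add: diff_divide_distrib power_divide)
    finally show ?thesis unfolding K_def C_def norm_exp_eq_Re by (simp only: exp_add)
  qed
  have K_meas[measurable]: "K \<in> borel_measurable borel"
    unfolding K_def Complex_eq by measurable
  define F where "F = (\<lambda>(v, t). of_real (g v) * exp (- Complex c t * of_real v) * K t)"
  have F_meas[measurable]: "F \<in> borel_measurable (lborel \<Otimes>\<^sub>M lborel)"
    unfolding F_def Complex_eq by measurable
  have F_int: "integrable (lborel \<Otimes>\<^sub>M lborel) F"
  proof (rule Bochner_Integration.integrable_bound)
    show "integrable (lborel \<Otimes>\<^sub>M lborel) (\<lambda>(v, t). (g v * exp (- c * v)) * (C * exp (- (t / a)\<^sup>2 / 2)))"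
      by (intro integrable_product int integrable_mult_right integrable_gauss a)
    show "AE x in lborel \<Otimes>\<^sub>M lborel. norm (F x) \<le>
        norm (case x of (v, t) \<Rightarrow> (g v * exp (- c * v)) * (C * exp (- (t / a)\<^sup>2 / 2)))"
      by (rule AE_I2) (auto simp: F_def norm_mult nK norm_exp_eq_Re abs_mult C_def)
  qed measurable
  have "(CLBINT t. (CLBINT v. of_real (g v) * exp (- Complex c t * of_real v)) * K t)
      = (CLBINT t. (CLBINT v. F (v, t)))"
    by (simp add: F_def)
  also have "\<dots> = (CLBINT v. (CLBINT t. F (v, t)))"
    using lborel_pair.Fubini_integral[of "\<lambda>v t. F (v, t)"] F_int by simp
  also have "(\<lambda>v. CLBINT t. F (v, t)) = (\<lambda>v. of_real (2 * pi * (g v * (a * nu (a * (u - v))))))"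
  proof
    fix v
    \<comment> \<open>Completing the square: the terms linear in i t have total frequency b, and
      together with the real factors the dependence on c cancels.\<close>
    define b where "b = c / a\<^sup>2 + u - v"
    have e: "F (v, t) = of_real (g v * (C * exp (- c * v))) * (of_real (exp (- (t / a)\<^sup>2 / 2)) * iexp (b * t))" for t
    proof -
      have "- Complex c t * of_real v + ((Complex c t)\<^sup>2 / of_real (2 * a\<^sup>2) + Complex c t * of_real u)
        = of_real ((c\<^sup>2 / (2 * a\<^sup>2) + c * u) + - c * v) + (of_real (- (t / a)\<^sup>2 / 2) + \<i> * of_real (b * t))"
        using a by (simp add: complex_eq_iff b_def power2_eq_square field_simps flip: of_real_power of_real_mult)
      then have "exp (- Complex c t * of_real v) * K t
        = exp (of_real ((c\<^sup>2 / (2 * a\<^sup>2) + c * u) + - c * v) + (of_real (- (t / a)\<^sup>2 / 2) + \<i> * of_real (b * t)))"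
        unfolding K_def exp_add[symmetric] by (simp only:)
      also have "\<dots> = of_real (C * exp (- c * v)) * (of_real (exp (- (t / a)\<^sup>2 / 2)) * iexp (b * t))"
        unfolding C_def exp_add exp_of_real of_real_mult by (simp only: mult_ac)
      finally have "exp (- Complex c t * of_real v) * K t
        = of_real (C * exp (- c * v)) * (of_real (exp (- (t / a)\<^sup>2 / 2)) * iexp (b * t))" .
      then show ?thesis by (simp add: F_def mult_ac)
    qed
    have "C * exp (- c * v) * nu (a * b) = nu (a * (u - v))"
    proof -
      have "c\<^sup>2 / (2 * a\<^sup>2) + c * u + - c * v + - (a * b)\<^sup>2 / 2 = - (a * (u - v))\<^sup>2 / 2"
        using a by (simp add: b_def power2_eq_square field_simps)
      then have "C * exp (- c * v) * exp (- (a * b)\<^sup>2 / 2) = exp (- (a * (u - v))\<^sup>2 / 2)"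
        unfolding C_def exp_add[symmetric] by simp
      then show ?thesis by (simp add: std_normal_density_def)
    qed
    then show "(CLBINT t. F (v, t)) = of_real (2 * pi * (g v * (a * nu (a * (u - v)))))"
      unfolding e integral_mult_right_zero gauss_fourier(2)[OF a] of_real_mult[symmetric] of_real_eq_iff
      by (metis (no_types, opaque_lifting) mult.assoc mult.commute)
  qed
  also have "(CLBINT v. of_real (2 * pi * (g v * (a * nu (a * (u - v)))))) =
      of_real (2 * pi * (LBINT v. g v * (a * nu (a * (u - v)))))"
    by (simp only: integral_complex_of_real integral_mult_right_zero)
  also have "(LBINT v. g v * (a * nu (a * (u - v)))) = \<bar>- 1 / a\<bar> *\<^sub>R
      (LBINT z. g (u + - 1 / a * z) * (a * nu (a * (u - (u + - 1 / a * z)))))"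
    by (rule lborel_integral_real_affine) (use a in auto)
  also have "\<dots> = (LBINT z. g (u - z / a) * nu z)"
    using a by (simp add: mult_ac flip: integral_mult_right_zero) 
  finally show ?thesis by (simp add: K_def)
qed

section \<open>Moving the line of integration\<close>

lemma line_integral_symmetric_limit:
  assumes "integrable lborel (f :: real \<Rightarrow> complex)"
  shows "(\<lambda>n. CLBINT t. indicator {- real n..real n} t *\<^sub>R f t) \<longlonglongrightarrow> (CLBINT t. f t)"
proof (rule integral_dominated_convergence)
  show "integrable lborel (\<lambda>t. norm (f t))" using assms by simp
  show "AE t in lborel. (\<lambda>n. indicator {- real n..real n} t *\<^sub>R f t) \<longlonglongrightarrow> f t"
  proof (rule AE_I2)
    fix t
    have "\<forall>\<^sub>F n in sequentially. indicator {- real n..real n} t *\<^sub>R f t = f t"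
      using eventually_ge_at_top[of "nat \<lceil>\<bar>t\<bar>\<rceil>"]
      by eventually_elim (auto simp: indicator_def)
    then show "(\<lambda>n. indicator {- real n..real n} t *\<^sub>R f t) \<longlonglongrightarrow> f t"
      by (rule tendsto_eventually)
  qed
qed (use assms in \<open>auto simp: indicator_def\<close>)

text \<open>Cauchy's theorem through a primitive P: an integral over a vertical segment is a
  difference of values of P, and P changes along the horizontal edges by at most (b - a) B |y|,
  which tends to 0.\<close>

lemma line_integral_shift:
  fixes f :: "complex \<Rightarrow> complex"
  assumes S: "convex S" "open S" and hol: "f holomorphic_on S" and ab: "a \<le> b"
    and sub: "\<And>x y. a \<le> x \<Longrightarrow> x \<le> b \<Longrightarrow> Complex x y \<in> S"
    and int: "integrable lborel (\<lambda>t. f (Complex a t))" "integrable lborel (\<lambda>t. f (Complex b t))"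
    and bd: "\<And>x y. a \<le> x \<Longrightarrow> x \<le> b \<Longrightarrow> norm (f (Complex x y)) \<le> B \<bar>y\<bar>"
    and B: "(B \<longlongrightarrow> 0) at_top"
  shows "(CLBINT t. f (Complex a t)) = (CLBINT t. f (Complex b t))"
proof -
  obtain P where P: "\<And>z. z \<in> S \<Longrightarrow> (P has_field_derivative f z) (at z)"
    using holomorphic_convex_primitive'[OF S hol] S(2) by (metis at_within_open)
  have line: "(CLBINT t. indicator {- T..T} t *\<^sub>R f (Complex x t)) = - \<i> * (P (Complex x T) - P (Complex x (- T)))"
    if x: "a \<le> x" "x \<le> b" and T: "T \<ge> 0" for x T
  proof -
    have "(CLBINT t. indicator {- T..T} t *\<^sub>R f (Complex x t)) = - \<i> * P (Complex x T) - - \<i> * P (Complex x (- T))"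
    proof (rule integral_FTC_Icc)
      fix t
      have "((\<lambda>t. P (Complex x t)) has_vector_derivative \<i> * f (Complex x t)) (at t within {- T..T})"
      proof -
        have "((\<lambda>t. of_real x + \<i> * of_real t) has_vector_derivative \<i>) (at t within {- T..T})"
          by (auto intro!: derivative_eq_intros)
        moreover have "(P has_field_derivative f (Complex x t)) (at (of_real x + \<i> * of_real t))"
          using P[OF sub[OF x, of t]] by (simp add: Complex_eq)
        ultimately show ?thesis
          using field_vector_diff_chain_within[of "\<lambda>t. of_real x + \<i> * of_real t" \<i> t "{- T..T}" P "f (Complex x t)"]
          by (auto simp: o_def Complex_eq intro: has_field_derivative_at_within)
      qed
      from has_vector_derivative_mult_right[OF this, of "- \<i>"]
      show "((\<lambda>t. - \<i> * P (Complex x t)) has_vector_derivative f (Complex x t)) (at t within {- T..T})"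
        by simp
    next
      have "continuous_on S f" using hol holomorphic_on_imp_continuous_on by blast
      then show "continuous_on {- T..T} (\<lambda>t. f (Complex x t))"
        unfolding Complex_eq
        by (rule continuous_on_compose2) (use sub x in \<open>auto intro!: continuous_intros simp: Complex_eq\<close>)
    qed (use T in auto)
    then show ?thesis by (simp add: algebra_simps)
  qed
  define D where "D n = (CLBINT t. indicator {- real n..real n} t *\<^sub>R f (Complex a t))
     - (CLBINT t. indicator {- real n..real n} t *\<^sub>R f (Complex b t))" for n
  have "D \<longlonglongrightarrow> (CLBINT t. f (Complex a t)) - (CLBINT t. f (Complex b t))"
    unfolding D_def by (intro tendsto_diff line_integral_symmetric_limit int)
  moreover have "D \<longlonglongrightarrow> 0"
  proof (rule Lim_null_comparison)
    have hor: "norm (P (Complex a y) - P (Complex b y)) \<le> B \<bar>y\<bar> * (b - a)" for y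
    proof -
      have "norm (P (Complex a y) - P (Complex b y)) \<le> B \<bar>y\<bar> * norm (Complex a y - Complex b y)"
      proof (rule field_differentiable_bound[of "closed_segment (Complex a y) (Complex b y)" P f])
        fix z assume "z \<in> closed_segment (Complex a y) (Complex b y)"
        then obtain t where t: "0 \<le> t" "t \<le> 1" "z = (1 - t) *\<^sub>R Complex a y + t *\<^sub>R Complex b y"
          by (auto simp: in_segment)
        have "a \<le> (1 - t) * a + t * b" "(1 - t) * a + t * b \<le> b"
        proof -
          have "(1 - t) * a + t * b = a + t * (b - a)" "(1 - t) * a + t * b = b - (1 - t) * (b - a)"
            by (simp_all add: algebra_simps)
          then show "a \<le> (1 - t) * a + t * b" "(1 - t) * a + t * b \<le> b"
            using t ab by (metis add_increasing2 diff_ge_0_iff_ge mult_nonneg_nonneg order_refl,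
              metis diff_ge_0_iff_ge mult_nonneg_nonneg le_diff_eq add_le_same_cancel1 add.commute diff_le_eq le_add_same_cancel1)
        qed
        moreover have "z = Complex ((1 - t) * a + t * b) y"
          by (simp add: t complex_eq_iff algebra_simps)
        ultimately show "norm (f z) \<le> B \<bar>y\<bar>" "(P has_field_derivative f z) (at z within closed_segment (Complex a y) (Complex b y))"
          using bd P[OF sub] by (auto intro: has_field_derivative_at_within)
      qed auto
      also have "norm (Complex a y - Complex b y) = b - a"
        using ab by (simp add: cmod_def)
      finally show ?thesis .
    qed
    show "\<forall>\<^sub>F n in sequentially. norm (D n) \<le> 2 * (B (real n) * (b - a))"
    proof (rule always_eventually, rule allI)
      fix n
      have "D n = - \<i> * ((P (Complex a (real n)) - P (Complex b (real n)))
         - (P (Complex a (- real n)) - P (Complex b (- real n))))"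
        unfolding D_def using ab by (subst (1 2) line) (auto simp: algebra_simps)
      then have "norm (D n) \<le> norm (P (Complex a (real n)) - P (Complex b (real n)))
         + norm (P (Complex a (- real n)) - P (Complex b (- real n)))"
        by (simp add: norm_mult norm_triangle_ineq4)
      then show "norm (D n) \<le> 2 * (B (real n) * (b - a))"
        using hor[of "real n"] hor[of "- real n"] by simp
    qed
    show "(\<lambda>n. 2 * (B (real n) * (b - a))) \<longlonglongrightarrow> 0"
      using filterlim_compose[OF B filterlim_real_sequentially] by (auto intro!: tendsto_eq_intros)
  qed
  ultimately show ?thesis using LIMSEQ_unique by fastforce
qed

section \<open>A Plancherel inequality with Gaussian weight\<close>

lemma borel_measurable_cnj [measurable (raw)]:
  "f \<in> borel_measurable M \<Longrightarrow> (\<lambda>x. cnj (f x)) \<in> borel_measurable M"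
  by (rule measurable_compose[of f M borel]) (auto intro!: borel_measurable_continuous_onI continuous_intros)

lemma nn_integral_nu: "(\<integral>\<^sup>+x. ennreal (nu x) \<partial>lborel) = 1"
  using nn_integral_eq_integral[OF integrable_nu] by (simp add: integral_nu)

lemma nn_integral_nu_affine:
  assumes a: "a > 0"
  shows "(\<integral>\<^sup>+s. ennreal (a * nu (a * (s - t))) \<partial>lborel) = 1"
proof -
  have "(\<integral>\<^sup>+x. ennreal (nu x) \<partial>lborel) = ennreal \<bar>a\<bar> * (\<integral>\<^sup>+s. ennreal (nu (- a * t + a * s)) \<partial>lborel)"
    by (rule nn_integral_real_affine) (use a in auto)
  also have "\<dots> = (\<integral>\<^sup>+s. ennreal (a * nu (a * (s - t))) \<partial>lborel)"
    using a by (subst nn_integral_cmult[symmetric])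
      (auto simp: ennreal_mult algebra_simps intro!: nn_integral_cong)
  finally show ?thesis by (simp add: nn_integral_nu)
qed

text \<open>The product of the two moduli is at most half the sum of their squares, and the kernel
  is symmetric with total mass 1 in each variable.\<close>

lemma schur_test_gaussian:
  fixes Q :: "real \<Rightarrow> complex"
  assumes a: "a > 0" and [measurable]: "Q \<in> borel_measurable borel"
  shows "(\<integral>\<^sup>+t. \<integral>\<^sup>+s. ennreal (norm (Q t) * norm (Q s) * (a * nu (a * (s - t)))) \<partial>lborel \<partial>lborel)
           \<le> (\<integral>\<^sup>+t. ennreal ((norm (Q t))\<^sup>2) \<partial>lborel)"
proof -
  let ?k = "\<lambda>s t. a * nu (a * (s - t))"
  let ?q = "\<lambda>t. ennreal ((norm (Q t))\<^sup>2)"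
  have k0: "?k s t \<ge> 0" for s t using a by simp
  have sym: "?k s t = ?k t s" for s t
    using nu_even[of "a * (s - t)"] by (simp add: algebra_simps)
  have half: "ennreal (norm (Q t) * norm (Q s) * ?k s t)
      \<le> ennreal (1/2) * (?q t * ennreal (?k s t) + ?q s * ennreal (?k s t))" for s t
  proof -
    have "norm (Q t) * norm (Q s) * ?k s t \<le> ((norm (Q t))\<^sup>2 + (norm (Q s))\<^sup>2) / 2 * ?k s t"
      using sum_squares_bound[of "norm (Q t)" "norm (Q s)"] k0[of s t]
      by (intro mult_right_mono) auto
    also have "\<dots> = 1/2 * ((norm (Q t))\<^sup>2 * ?k s t + (norm (Q s))\<^sup>2 * ?k s t)"
      by (simp add: algebra_simps add_divide_distrib)
    finally have "ennreal (norm (Q t) * norm (Q s) * ?k s t)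
        \<le> ennreal (1/2 * ((norm (Q t))\<^sup>2 * ?k s t + (norm (Q s))\<^sup>2 * ?k s t))"
      by (rule ennreal_leI)
    also have "\<dots> = ennreal (1/2) * (?q t * ennreal (?k s t) + ?q s * ennreal (?k s t))"
      using k0[of s t] by (simp only: ennreal_mult ennreal_plus zero_le_power2 mult_nonneg_nonneg add_nonneg_nonneg zero_le_divide_1_iff zero_le_numeral)
    finally show ?thesis .
  qed
  have "(\<integral>\<^sup>+t. \<integral>\<^sup>+s. ennreal (norm (Q t) * norm (Q s) * ?k s t) \<partial>lborel \<partial>lborel)
     \<le> (\<integral>\<^sup>+t. \<integral>\<^sup>+s. ennreal (1/2) * (?q t * ennreal (?k s t) + ?q s * ennreal (?k s t)) \<partial>lborel \<partial>lborel)"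
    by (intro nn_integral_mono half)
  also have "\<dots> = ennreal (1/2) * ((\<integral>\<^sup>+t. \<integral>\<^sup>+s. ?q t * ennreal (?k s t) \<partial>lborel \<partial>lborel)
      + (\<integral>\<^sup>+t. \<integral>\<^sup>+s. ?q s * ennreal (?k s t) \<partial>lborel \<partial>lborel))"
    by (simp add: nn_integral_cmult nn_integral_add)
  also have "(\<integral>\<^sup>+t. \<integral>\<^sup>+s. ?q s * ennreal (?k s t) \<partial>lborel \<partial>lborel) =
      (\<integral>\<^sup>+s. \<integral>\<^sup>+t. ?q s * ennreal (?k s t) \<partial>lborel \<partial>lborel)"
    by (rule lborel_pair.Fubini') measurable
  also have "(\<integral>\<^sup>+s. \<integral>\<^sup>+t. ?q s * ennreal (?k s t) \<partial>lborel \<partial>lborel) = (\<integral>\<^sup>+s. ?q s \<partial>lborel)"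
  proof -
    have "(\<integral>\<^sup>+t. ennreal (?k s t) \<partial>lborel) = 1" for s
      unfolding sym[of s] by (rule nn_integral_nu_affine[OF a])
    then show ?thesis by (simp add: nn_integral_cmult)
  qed
  also have "(\<integral>\<^sup>+t. \<integral>\<^sup>+s. ?q t * ennreal (?k s t) \<partial>lborel \<partial>lborel) = (\<integral>\<^sup>+s. ?q s \<partial>lborel)"
    by (simp add: nn_integral_cmult nn_integral_nu_affine[OF a])
  also have "ennreal (1/2) * ((\<integral>\<^sup>+s. ?q s \<partial>lborel) + (\<integral>\<^sup>+s. ?q s \<partial>lborel)) = (\<integral>\<^sup>+s. ?q s \<partial>lborel)"
  proof -
    have "ennreal (1/2) * 2 = ennreal (1/2 * 2)" by (subst ennreal_mult) auto
    then have "ennreal (1/2) * 2 = 1" by simp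
    then show ?thesis by (simp add: mult_2[symmetric] mult.assoc[symmetric])
  qed
  finally show ?thesis .
qed

text \<open>Half of Plancherel's theorem; the Gaussian weight \<open>exp (- (u / a)\<^sup>2 / 2)\<close> makes all
  the integrals absolutely convergent.\<close>

lemma plancherel_gaussian_le:
  fixes Q :: "real \<Rightarrow> complex"
  assumes a: "a > 0" and Q: "integrable lborel Q"
  defines "w \<equiv> \<lambda>u. CLBINT t. Q t * iexp (t * u)"
  shows "(\<integral>\<^sup>+u. ennreal ((norm (w u))\<^sup>2 * exp (- (u / a)\<^sup>2 / 2)) \<partial>lborel)
           \<le> ennreal (2 * pi) * (\<integral>\<^sup>+t. ennreal ((norm (Q t))\<^sup>2) \<partial>lborel)"
proof -
  have [measurable]: "Q \<in> borel_measurable borel" using Q by auto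
  define G where "G u = exp (- (u / a)\<^sup>2 / 2)" for u
  have [measurable]: "G \<in> borel_measurable borel" unfolding G_def by measurable
  have G: "integrable lborel G" unfolding G_def by (rule integrable_gauss[OF a])
  have G0: "G u > 0" for u by (simp add: G_def)
  have [measurable]: "w \<in> borel_measurable borel" unfolding w_def by measurable
  define M where "M = (LBINT t. norm (Q t))"
  have wM: "norm (w u) \<le> M" for u
  proof -
    have "norm (w u) \<le> (LBINT t. norm (Q t * iexp (t * u)))" unfolding w_def by (rule integral_norm_bound)
    then show ?thesis by (simp add: M_def norm_mult)
  qed
  have M0: "M \<ge> 0" using wM[of 0] norm_ge_zero order_trans by blast
  have nQ: "integrable lborel (\<lambda>t. norm (Q t))" using Q by simp
  \<comment> \<open>\<open>V\<close> transforms \<open>w\<close> times the weight back; by Fubini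
    and the transform of a Gaussian it is 2 pi times a Gaussian average of \<open>Q\<close>.\<close>
  define V where "V t = (CLBINT u. w u * of_real (G u) * iexp (- t * u))" for t
  have V: "V t = (CLBINT s. Q s * of_real (2 * pi * (a * nu (a * (s - t)))))" for t
  proof -
    have "V t = (CLBINT u. (CLBINT s. Q s * (of_real (G u) * iexp ((s - t) * u))))"
      unfolding V_def w_def
      by (intro Bochner_Integration.integral_cong refl, subst integral_mult_left_zero[symmetric], subst integral_mult_left_zero[symmetric],
        intro Bochner_Integration.integral_cong refl)
        (simp add: mult_ac algebra_simps exp_add[symmetric])
    also have "\<dots> = (CLBINT s. (CLBINT u. Q s * (of_real (G u) * iexp ((s - t) * u))))"
    proof (rule lborel_pair.Fubini_integral)
      show "integrable (lborel \<Otimes>\<^sub>M lborel) (\<lambda>(s, u). Q s * (of_real (G u) * iexp ((s - t) * u)))"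
      proof (rule Bochner_Integration.integrable_bound[OF integrable_product[OF nQ G]])
        show "AE x in lborel \<Otimes>\<^sub>M lborel. norm (case x of (s, u) \<Rightarrow> Q s * (of_real (G u) * iexp ((s - t) * u)))
            \<le> norm (case x of (s, u) \<Rightarrow> norm (Q s) * G u)"
          by (rule AE_I2) (auto simp: norm_mult)
      qed measurable
    qed
    also have "\<dots> = (CLBINT s. Q s * of_real (2 * pi * (a * nu (a * (s - t)))))"
      by (simp only: integral_mult_right_zero G_def gauss_fourier(2)[OF a] mult.assoc)
    finally show ?thesis .
  qed
  have VM: "norm (V t) \<le> 2 * pi * (LBINT s. norm (Q s) * (a * nu (a * (s - t))))" for t
  proof -
    have "norm (V t) \<le> (LBINT s. norm (Q s * of_real (2 * pi * (a * nu (a * (s - t))))))"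
      unfolding V by (rule integral_norm_bound)
    also have "\<dots> = (LBINT s. (2 * pi) * (norm (Q s) * (a * nu (a * (s - t)))))"
      using a by (intro Bochner_Integration.integral_cong) (auto simp: norm_mult abs_mult)
    finally show ?thesis by simp
  qed
  have w2: "of_real ((norm (w u))\<^sup>2 * G u) = (CLBINT t. Q t * cnj (w u * of_real (G u) * iexp (- t * u)))" for u
  proof -
    have "(CLBINT t. Q t * cnj (w u * of_real (G u) * iexp (- t * u)))
        = (CLBINT t. (Q t * iexp (t * u)) * (cnj (w u) * of_real (G u)))"
      by (intro Bochner_Integration.integral_cong) (auto simp: exp_cnj mult_ac)
    also have "\<dots> = w u * (cnj (w u) * of_real (G u))"
      unfolding integral_mult_left_zero w_def ..
    finally show ?thesis unfolding of_real_mult complex_norm_square by (simp add: mult.assoc)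
  qed
  have intW: "integrable lborel (\<lambda>u. (norm (w u))\<^sup>2 * G u)"
  proof (rule Bochner_Integration.integrable_bound[OF integrable_mult_right[OF G, of "M\<^sup>2"]])
    show "AE u in lborel. norm ((norm (w u))\<^sup>2 * G u) \<le> norm (M\<^sup>2 * G u)"
      using wM M0 G0[THEN less_imp_le] by (auto simp: abs_mult intro!: AE_I2 mult_right_mono power_mono)
  qed measurable
  \<comment> \<open>Duality: the weighted square integral of \<open>w\<close> equals the pairing of
    \<open>Q\<close> with \<open>V\<close>, so that the Schur test applies.\<close>
  have "of_real (LBINT u. (norm (w u))\<^sup>2 * G u)
      = (CLBINT u. (CLBINT t. Q t * cnj (w u * of_real (G u) * iexp (- t * u))))"
    unfolding w2[symmetric] by (simp only: integral_complex_of_real)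
  also have "\<dots> = (CLBINT t. (CLBINT u. Q t * cnj (w u * of_real (G u) * iexp (- t * u))))"
  proof (rule lborel_pair.Fubini_integral)
    show "integrable (lborel \<Otimes>\<^sub>M lborel) (\<lambda>(t, u). Q t * cnj (w u * of_real (G u) * iexp (- t * u)))"
    proof (rule Bochner_Integration.integrable_bound[OF integrable_product[OF nQ integrable_mult_right[OF G, of M]]])
      show "AE x in lborel \<Otimes>\<^sub>M lborel. norm (case x of (t, u) \<Rightarrow> Q t * cnj (w u * of_real (G u) * iexp (- t * u)))
          \<le> norm (case x of (t, u) \<Rightarrow> norm (Q t) * (M * G u))"
        using wM M0 G0[THEN less_imp_le]
        by (intro AE_I2) (auto simp: norm_mult abs_mult intro!: mult_left_mono mult_right_mono)
    qed measurable
  qed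
  also have "\<dots> = (CLBINT t. Q t * cnj (V t))"
    by (simp only: V_def integral_mult_right_zero Bochner_Integration.integral_cnj)
  finally have eq: "of_real (LBINT u. (norm (w u))\<^sup>2 * G u) = (CLBINT t. Q t * cnj (V t))" .
  have "(\<integral>\<^sup>+u. ennreal ((norm (w u))\<^sup>2 * G u) \<partial>lborel) = ennreal (LBINT u. (norm (w u))\<^sup>2 * G u)"
    by (rule nn_integral_eq_integral[OF intW]) (use G0[THEN less_imp_le] in auto)
  also have "(LBINT u. (norm (w u))\<^sup>2 * G u) \<le> norm (complex_of_real (LBINT u. (norm (w u))\<^sup>2 * G u))"
    by simp
  then have "ennreal (LBINT u. (norm (w u))\<^sup>2 * G u) \<le> ennreal (norm (CLBINT t. Q t * cnj (V t)))"
    unfolding eq by (rule ennreal_leI)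
  \<comment> \<open>If the pairing were not integrable, its Bochner integral would be 0 by
    convention and the bound trivial; both cases are covered.\<close>
  also have "\<dots> \<le> (\<integral>\<^sup>+t. ennreal (norm (Q t * cnj (V t))) \<partial>lborel)"
    by (cases "integrable lborel (\<lambda>t. Q t * cnj (V t))")
       (auto intro: integral_norm_bound_ennreal simp: not_integrable_integral_eq)
  also have "\<dots> \<le> (\<integral>\<^sup>+t. ennreal (2 * pi) * (\<integral>\<^sup>+s. ennreal (norm (Q t) * norm (Q s) * (a * nu (a * (s - t)))) \<partial>lborel) \<partial>lborel)"
  proof (rule nn_integral_mono)
    fix t
    have i: "integrable lborel (\<lambda>s. norm (Q t) * norm (Q s) * (a * nu (a * (s - t))))"
    proof (rule Bochner_Integration.integrable_bound[OF integrable_mult_right[OF nQ, of "norm (Q t) * a"]])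
      have "nu x \<le> 1" for x
      proof -
        have "nu x = exp (- x\<^sup>2 / 2) / sqrt (2 * pi)" by (simp add: std_normal_density_def)
        also have "\<dots> \<le> 1 / 1" using pi_gt3 by (intro frac_le) (auto simp: real_le_rsqrt)
        finally show ?thesis by simp
      qed
      then show "AE s in lborel. norm (norm (Q t) * norm (Q s) * (a * nu (a * (s - t)))) \<le> norm (norm (Q t) * a * norm (Q s))"
        using a by (intro AE_I2) (auto simp: abs_mult mult_ac intro!: mult_left_le mult_left_mono)
    qed measurable
    have "norm (Q t * cnj (V t)) \<le> norm (Q t) * (2 * pi * (LBINT s. norm (Q s) * (a * nu (a * (s - t)))))"
      unfolding norm_mult complex_mod_cnj by (intro mult_left_mono VM) auto
    also have "\<dots> = 2 * pi * (LBINT s. norm (Q t) * norm (Q s) * (a * nu (a * (s - t))))"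
      by (simp add: mult.assoc)
    finally have "ennreal (norm (Q t * cnj (V t))) \<le> ennreal (2 * pi * (LBINT s. norm (Q t) * norm (Q s) * (a * nu (a * (s - t)))))"
      by (rule ennreal_leI)
    also have "\<dots> = ennreal (2 * pi) * (\<integral>\<^sup>+s. ennreal (norm (Q t) * norm (Q s) * (a * nu (a * (s - t)))) \<partial>lborel)"
      using a by (subst nn_integral_eq_integral[OF i]) (auto simp: ennreal_mult intro!: ennreal_mult integral_nonneg_AE)
    finally show "ennreal (norm (Q t * cnj (V t))) \<le> ennreal (2 * pi) * (\<integral>\<^sup>+s. ennreal (norm (Q t) * norm (Q s) * (a * nu (a * (s - t)))) \<partial>lborel)" .
  qed
  also have "\<dots> = ennreal (2 * pi) * (\<integral>\<^sup>+t. \<integral>\<^sup>+s. ennreal (norm (Q t) * norm (Q s) * (a * nu (a * (s - t)))) \<partial>lborel \<partial>lborel)"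
    by (rule nn_integral_cmult) measurable
  also have "\<dots> \<le> ennreal (2 * pi) * (\<integral>\<^sup>+t. ennreal ((norm (Q t))\<^sup>2) \<partial>lborel)"
    by (intro mult_left_mono schur_test_gaussian a) auto
  finally show ?thesis by (simp add: G_def)
qed

text \<open>Completing the square with x = |y| / a: the difference of the two sides is (a b - x /
  2)^2 + x^2 / 8. An exponential factor is thus absorbed by doubling the width of the
  Gaussian.\<close>

lemma abs_minus_gauss_le:
  fixes a b y :: real
  assumes a: "a > 0"
  shows "b * \<bar>y\<bar> - (y / a)\<^sup>2 / 2 \<le> (a * b)\<^sup>2 - (y / (2 * a))\<^sup>2 / 2"
proof -
  define x where "x = \<bar>y\<bar> / a"
  have x: "\<bar>y\<bar> = a * x" "(y / a)\<^sup>2 = x\<^sup>2" "(y / (2 * a))\<^sup>2 = x\<^sup>2 / 4"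
    using a by (auto simp: x_def power_divide power_mult_distrib)
  have "0 \<le> (a * b - x / 2)\<^sup>2 + x\<^sup>2 / 8" by simp
  then show ?thesis unfolding x by (simp add: power2_eq_square algebra_simps)
qed

lemma exp_abs_gauss_le:
  fixes a b y :: real
  assumes a: "a > 0"
  shows "exp (b * \<bar>y\<bar>) * exp (- (y / a)\<^sup>2 / 2) \<le> exp ((a * b)\<^sup>2) * exp (- (y / (2 * a))\<^sup>2 / 2)"
  using abs_minus_gauss_le[OF a, of b y] unfolding exp_add[symmetric] by simp

lemma nu_le_gauss: "nu z \<le> exp (- (z / 1)\<^sup>2 / 2)"
proof -
  have "nu z = exp (- z\<^sup>2 / 2) / sqrt (2 * pi)" by (simp add: std_normal_density_def)
  also have "\<dots> \<le> exp (- z\<^sup>2 / 2) / 1" using pi_gt3 by (intro divide_left_mono) (auto simp: real_le_rsqrt)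
  finally show ?thesis by simp
qed

text \<open>Dominated convergence for an approximate identity of width 1 / (n + 1). Continuity at
  the single point u suffices, which matters because the function to be averaged has jumps.\<close>

lemma gaussian_average_tendsto:
  fixes g :: "real \<Rightarrow> real"
  assumes [measurable]: "g \<in> borel_measurable borel"
    and g: "\<And>v. \<bar>g v\<bar> \<le> M * exp (b * \<bar>v\<bar>)" and b: "b \<ge> 0" and cont: "isCont g u"
  shows "(\<lambda>n. LBINT z. g (u - z / real (Suc n)) * nu z) \<longlonglongrightarrow> g u"
proof -
  have M: "M \<ge> 0" using g[of 0] by auto
  have "(\<lambda>n. LBINT z. g (u - z / real (Suc n)) * nu z) \<longlonglongrightarrow> (LBINT z. g u * nu z)"
  proof (rule integral_dominated_convergence)
    show "integrable lborel (\<lambda>z. (M * exp (b * \<bar>u\<bar>) * exp ((1 * b)\<^sup>2)) * exp (- (z / (2 * 1))\<^sup>2 / 2))"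
      by (intro integrable_mult_right integrable_gauss) simp
    show "AE z in lborel. (\<lambda>n. g (u - z / real (Suc n)) * nu z) \<longlonglongrightarrow> g u * nu z"
    proof (rule AE_I2)
      fix z
      have "(\<lambda>n. z * (1 / real (Suc n))) \<longlonglongrightarrow> z * 0"
        by (intro tendsto_intros LIMSEQ_Suc[OF lim_1_over_n])
      then have "(\<lambda>n. u - z / real (Suc n)) \<longlonglongrightarrow> u - 0"
        by (intro tendsto_diff tendsto_const) simp
      then have "(\<lambda>n. g (u - z / real (Suc n))) \<longlonglongrightarrow> g u"
        using isCont_tendsto_compose[OF cont] by simp
      then show "(\<lambda>n. g (u - z / real (Suc n)) * nu z) \<longlonglongrightarrow> g u * nu z"
        by (intro tendsto_mult tendsto_const)
    qed
    fix n
    show "AE z in lborel. norm (g (u - z / real (Suc n)) * nu z)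
        \<le> (M * exp (b * \<bar>u\<bar>) * exp ((1 * b)\<^sup>2)) * exp (- (z / (2 * 1))\<^sup>2 / 2)"
    proof (rule AE_I2)
      fix z
      have "\<bar>z / real (Suc n)\<bar> \<le> \<bar>z\<bar>" by (simp add: field_simps)
      then have "\<bar>u - z / real (Suc n)\<bar> \<le> \<bar>u\<bar> + \<bar>z\<bar>" by linarith
      then have "b * \<bar>u - z / real (Suc n)\<bar> \<le> b * \<bar>u\<bar> + b * \<bar>z\<bar>"
        unfolding distrib_left[symmetric] using b by (intro mult_left_mono)
      then have "M * exp (b * \<bar>u - z / real (Suc n)\<bar>) \<le> M * (exp (b * \<bar>u\<bar>) * exp (b * \<bar>z\<bar>))"
        unfolding exp_add[symmetric] using M by (intro mult_left_mono) auto
      with g[of "u - z / real (Suc n)"]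
      have "\<bar>g (u - z / real (Suc n))\<bar> \<le> M * (exp (b * \<bar>u\<bar>) * exp (b * \<bar>z\<bar>))" by linarith
      then have "\<bar>g (u - z / real (Suc n))\<bar> * nu z \<le> M * (exp (b * \<bar>u\<bar>) * exp (b * \<bar>z\<bar>)) * exp (- (z / 1)\<^sup>2 / 2)"
        using M by (intro mult_mono nu_le_gauss) auto
      also have "\<dots> = (M * exp (b * \<bar>u\<bar>)) * (exp (b * \<bar>z\<bar>) * exp (- (z / 1)\<^sup>2 / 2))" by (simp add: mult_ac)
      also have "\<dots> \<le> (M * exp (b * \<bar>u\<bar>)) * (exp ((1 * b)\<^sup>2) * exp (- (z / (2 * 1))\<^sup>2 / 2))"
        using M by (intro mult_left_mono exp_abs_gauss_le) auto
      finally show "norm (g (u - z / real (Suc n)) * nu z)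
        \<le> (M * exp (b * \<bar>u\<bar>) * exp ((1 * b)\<^sup>2)) * exp (- (z / (2 * 1))\<^sup>2 / 2)"
        by (simp add: abs_mult mult_ac)
    qed
  qed measurable
  then show ?thesis by (simp add: integral_nu)
qed

lemma integrable_exp_bounded:
  fixes g :: "real \<Rightarrow> real"
  assumes [measurable]: "g \<in> borel_measurable borel"
    and g: "\<And>v. \<bar>g v\<bar> \<le> M * exp (b * \<bar>v\<bar>)" and g0: "\<And>v. v < 0 \<Longrightarrow> g v = 0" and bc: "b < c"
  shows "integrable lborel (\<lambda>v. g v * exp (- c * v))"
proof (rule Bochner_Integration.integrable_bound)
  show "integrable lborel (\<lambda>v. M * (indicator {0<..} v * exp (- (v * (c - b)))))"
    using integrable_I0i_exp_mscale[of "c - b"] bc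
    by (intro integrable_mult_right) (simp add: set_integrable_def)
  show "AE v in lborel. norm (g v * exp (- c * v)) \<le> norm (M * (indicator {0<..} v * exp (- (v * (c - b)))))"
  proof (rule AE_mp[OF AE_lborel_singleton[of 0]], rule AE_I2, rule impI)
    fix v :: real assume v: "v \<noteq> 0"
    have M: "M \<ge> 0" using g[of 0] by auto
    show "norm (g v * exp (- c * v)) \<le> norm (M * (indicator {0<..} v * exp (- (v * (c - b)))))"
    proof (cases "v < 0")
      case False
      then have "v > 0" using v by simp
      have "norm (g v * exp (- c * v)) \<le> M * exp (b * v) * exp (- c * v)"
        using g[of v] \<open>v > 0\<close> by (simp add: abs_mult)
      also have "\<dots> = M * exp (- (v * (c - b)))"
        by (simp add: mult.assoc algebra_simps flip: exp_add)
      finally show ?thesis using \<open>v > 0\<close> M by (simp add: abs_mult)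
    qed (simp add: g0)
  qed
qed measurable

text \<open>For each n the Gaussian average \<open>g' n\<close> is recovered from H on Re s = c, the
  line is moved to \<sigma>, where the integral becomes an ordinary Fourier integral in t, and
  \<open>plancherel_gaussian_le\<close> bounds its weighted mean square. Fatou's lemma removes the
  averaging at almost every u, since g is continuous there. The growth exp |y| is tame enough for
  any Gaussian.\<close>

theorem mellin_mean_square:
  fixes g :: "real \<Rightarrow> real" and H :: "complex \<Rightarrow> complex"
  assumes [measurable]: "g \<in> borel_measurable borel"
    and g: "\<And>v. \<bar>g v\<bar> \<le> M * exp (b * \<bar>v\<bar>)" and g0: "\<And>v. v < 0 \<Longrightarrow> g v = 0"
    and bc: "0 \<le> b" "b < c" and cont: "AE v in lborel. isCont g v"
    and S: "convex S" "open S" and hol: "H holomorphic_on S"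
    and \<sigma>: "0 \<le> \<sigma>" "\<sigma> \<le> 1 / 2" "\<sigma> \<le> c"
    and sub: "\<And>x y. \<sigma> \<le> x \<Longrightarrow> x \<le> c \<Longrightarrow> Complex x y \<in> S"
    and H: "\<And>t. H (Complex c t) = (CLBINT v. of_real (g v) * exp (- Complex c t * of_real v))"
    and growth: "\<And>x y. \<sigma> \<le> x \<Longrightarrow> x \<le> c \<Longrightarrow> norm (H (Complex x y)) \<le> K * exp \<bar>y\<bar>"
    and U: "U > 0"
  shows "(\<integral>\<^sup>+u\<in>{0..U}. ennreal ((g u)\<^sup>2 * exp (- 2 * \<sigma> * u)) \<partial>lborel)
           \<le> (\<integral>\<^sup>+t. ennreal ((norm (H (Complex \<sigma> t)))\<^sup>2) \<partial>lborel)"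
proof -
  define R where "R = (\<integral>\<^sup>+t. ennreal ((norm (H (Complex \<sigma> t)))\<^sup>2) \<partial>lborel)"
  define g' where "g' n u = (LBINT z. g (u - z / real (Suc n)) * nu z)" for n u
  have g'_meas[measurable]: "g' n \<in> borel_measurable borel" for n unfolding g'_def by measurable
  have contH: "continuous_on S H" using hol by (rule holomorphic_on_imp_continuous_on)
  have H_meas[measurable]: "(\<lambda>t. H (Complex x t)) \<in> borel_measurable borel" if "\<sigma> \<le> x" "x \<le> c" for x
    unfolding Complex_eq
    by (intro borel_measurable_continuous_onI continuous_on_compose2[OF contH])
       (use sub that in \<open>auto intro!: continuous_intros simp: Complex_eq\<close>)
  have K0: "K \<ge> 0" using growth[of \<sigma> 0] \<sigma> order_trans[OF norm_ge_zero] by force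
  have step: "(\<integral>\<^sup>+u\<in>{0..U}. ennreal ((g' n u)\<^sup>2 * exp (- 2 * \<sigma> * u)) \<partial>lborel) \<le> R" for n
  proof -
    define a where "a = real (Suc n)"
    have a: "a \<ge> 1" by (simp add: a_def)
    define f where "f u s = H s * exp (s\<^sup>2 / of_real (2 * a\<^sup>2) + s * of_real u)" for u s
    define Q where "Q t = H (Complex \<sigma> t) * exp ((Complex \<sigma> t)\<^sup>2 / of_real (2 * a\<^sup>2))" for t
    define w where "w u = (CLBINT t. Q t * iexp (t * u))" for u
    have ns: "norm (exp ((Complex x y)\<^sup>2 / of_real (2 * a\<^sup>2))) = exp (x\<^sup>2 / (2 * a\<^sup>2)) * exp (- (y / a)\<^sup>2 / 2)" for x y
    proof -
      have "Re ((Complex x y)\<^sup>2 / of_real (2 * a\<^sup>2)) = x\<^sup>2 / (2 * a\<^sup>2) + - (y / a)\<^sup>2 / 2"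
        by (simp add: power2_eq_square diff_divide_distrib flip: of_real_power of_real_mult)
      then show ?thesis unfolding norm_exp_eq_Re by (simp only: exp_add)
    qed
    define B where "B u y = K * (exp (c\<^sup>2) * exp (c * \<bar>u\<bar>)) * (exp ((a * 1)\<^sup>2) * exp (- (y / (2 * a))\<^sup>2 / 2))" for u y
    have bd: "norm (f u (Complex x y)) \<le> B u \<bar>y\<bar>" if x: "\<sigma> \<le> x" "x \<le> c" for u x y
    proof -
      have "x\<^sup>2 / (2 * a\<^sup>2) \<le> c\<^sup>2 / 1"
      proof (intro frac_le power_mono)
        have "1 \<le> a\<^sup>2" using a by (rule one_le_power)
        then show "1 \<le> 2 * a\<^sup>2" by linarith
      qed (use x \<sigma> in auto)
      then have p1: "exp (x\<^sup>2 / (2 * a\<^sup>2)) \<le> exp (c\<^sup>2)" by simp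
      have "x * u \<le> c * \<bar>u\<bar>"
        using x \<sigma> by (intro order_trans[OF mult_left_mono[of u "\<bar>u\<bar>" x] mult_right_mono]) auto
      then have p2: "exp (x * u) \<le> exp (c * \<bar>u\<bar>)" by simp
      have "norm (f u (Complex x y)) = norm (H (Complex x y)) * (exp (x\<^sup>2 / (2 * a\<^sup>2)) * exp (x * u)) * exp (- (y / a)\<^sup>2 / 2)"
        unfolding f_def exp_add norm_mult ns by (simp add: norm_exp_eq_Re)
      also have "\<dots> \<le> K * exp \<bar>y\<bar> * (exp (c\<^sup>2) * exp (c * \<bar>u\<bar>)) * exp (- (y / a)\<^sup>2 / 2)"
        by (intro mult_right_mono mult_mono[OF growth[OF x]] mult_mono[OF p1 p2] mult_nonneg_nonneg K0 exp_ge_zero)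
      also have "\<dots> = K * (exp (c\<^sup>2) * exp (c * \<bar>u\<bar>)) * (exp (1 * \<bar>y\<bar>) * exp (- (y / a)\<^sup>2 / 2))"
        by (simp add: mult_ac)
      also have "\<dots> \<le> K * (exp (c\<^sup>2) * exp (c * \<bar>u\<bar>)) * (exp ((a * 1)\<^sup>2) * exp (- (y / (2 * a))\<^sup>2 / 2))"
        using a by (intro mult_left_mono exp_abs_gauss_le) (auto intro!: mult_nonneg_nonneg K0)
      finally show ?thesis by (simp add: B_def power_divide)
    qed
    have f_int: "integrable lborel (\<lambda>t. f u (Complex x t))" if x: "\<sigma> \<le> x" "x \<le> c" for u x
    proof (rule Bochner_Integration.integrable_bound)
      show "integrable lborel (B u)"
        unfolding B_def using a by (intro integrable_mult_right integrable_gauss) auto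
      show "AE t in lborel. norm (f u (Complex x t)) \<le> norm (B u t)"
        using bd[OF x, of u] K0 by (intro AE_I2) (auto simp: B_def abs_mult power_divide)
      have [measurable]: "(\<lambda>t. H (Complex x t)) \<in> borel_measurable borel" by (rule H_meas[OF x])
      have "(\<lambda>t. exp ((Complex x t)\<^sup>2 / of_real (2 * a\<^sup>2) + Complex x t * of_real u)) \<in> borel_measurable borel"
        unfolding Complex_eq by measurable
      then show "(\<lambda>t. f u (Complex x t)) \<in> borel_measurable lborel"
        unfolding f_def by measurable
    qed
    have B0: "(B u \<longlongrightarrow> 0) at_top" for u
    proof -
      have "filterlim (\<lambda>y. (1 / (8 * a\<^sup>2)) * y\<^sup>2) at_top at_top"
        using a by (intro filterlim_tendsto_pos_mult_at_top[OF tendsto_const] filterlim_pow_at_top filterlim_ident) auto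
      then have "filterlim (\<lambda>y. - ((1 / (8 * a\<^sup>2)) * y\<^sup>2)) at_bot at_top"
        by (simp add: filterlim_uminus_at_top)
      moreover have "(\<lambda>y. - ((1 / (8 * a\<^sup>2)) * y\<^sup>2)) = (\<lambda>y. - (y / (2 * a))\<^sup>2 / 2)"
        by (auto simp: fun_eq_iff power_divide power_mult_distrib)
      ultimately have "((\<lambda>y. exp (- (y / (2 * a))\<^sup>2 / 2)) \<longlongrightarrow> 0) at_top"
        by (auto intro: filterlim_compose[OF exp_at_bot])
      then have "((\<lambda>y. K * (exp (c\<^sup>2) * exp (c * \<bar>u\<bar>)) * (exp ((a * 1)\<^sup>2) * exp (- (y / (2 * a))\<^sup>2 / 2)))
           \<longlongrightarrow> K * (exp (c\<^sup>2) * exp (c * \<bar>u\<bar>)) * (exp ((a * 1)\<^sup>2) * 0)) at_top"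
        by (intro tendsto_mult tendsto_const)
      then show ?thesis by (simp add: B_def[abs_def])
    qed
    have shift: "(CLBINT t. f u (Complex \<sigma> t)) = of_real (2 * pi * g' n u)" for u
    proof -
      have "(CLBINT t. f u (Complex \<sigma> t)) = (CLBINT t. f u (Complex c t))"
      proof (rule line_integral_shift[OF S, where B = "B u"])
        show "f u holomorphic_on S" unfolding f_def by (intro holomorphic_intros hol) (use a in auto)
      qed (use \<sigma> sub f_int bd B0 in auto)
      also have "\<dots> = (CLBINT t. (CLBINT v. of_real (g v) * exp (- Complex c t * of_real v))
            * exp ((Complex c t)\<^sup>2 / of_real (2 * a\<^sup>2) + Complex c t * of_real u))"
        by (simp add: f_def H)
      also have "\<dots> = of_real (2 * pi * (LBINT z. g (u - z / a) * nu z))"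
        by (rule gaussian_mellin_inversion) (use a in \<open>auto intro!: integrable_exp_bounded[OF _ g g0 bc(2), simplified]\<close>)
      finally show ?thesis by (simp add: g'_def a_def)
    qed
    \<comment> \<open>Dividing by exp (\<sigma> u) strips \<open>f u\<close> of its real exponential
      and leaves the Fourier transform of \<open>Q\<close>.\<close>
    have w: "w u = of_real (exp (- \<sigma> * u) * (2 * pi * g' n u))" for u
    proof -
      have "Q t * iexp (t * u) = f u (Complex \<sigma> t) * of_real (exp (- \<sigma> * u))" for t
      proof -
        have "f u (Complex \<sigma> t) * of_real (exp (- \<sigma> * u)) =
            Q t * exp (Complex \<sigma> t * of_real u + of_real (- \<sigma> * u))"
          unfolding f_def Q_def exp_add exp_of_real by (simp only: mult_ac)
        also have "Complex \<sigma> t * of_real u + of_real (- \<sigma> * u) = \<i> * of_real (t * u)"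
          by (simp add: complex_eq_iff)
        finally show ?thesis by simp
      qed
      then show ?thesis unfolding w_def by (simp add: shift mult_ac)
    qed
    have Q_int: "integrable lborel Q"
      using f_int[of \<sigma> 0] \<sigma> by (simp add: f_def Q_def[abs_def])
    \<comment> \<open>\<sigma> \<le> 1/2 and a \<ge> 1 bound the factor exp (\<sigma>^2 / (2 a^2))
      by exp (1/8), uniformly in n.\<close>
    have Q_le: "(norm (Q t))\<^sup>2 \<le> exp (1/4) * (norm (H (Complex \<sigma> t)))\<^sup>2" for t
    proof -
      have "\<sigma>\<^sup>2 \<le> (1/2)\<^sup>2" using \<sigma> by (intro power_mono) auto
      then have "\<sigma>\<^sup>2 / (2 * a\<^sup>2) \<le> (1/4) / 2"
      proof (intro frac_le)
        have "1 \<le> a\<^sup>2" using a by (rule one_le_power)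
        then show "2 \<le> 2 * a\<^sup>2" by linarith
      qed (auto simp: power2_eq_square)
      then have "exp (\<sigma>\<^sup>2 / (2 * a\<^sup>2)) * exp (- (t / a)\<^sup>2 / 2) \<le> exp (1/8) * 1"
        by (intro mult_mono) auto
      then have "norm (Q t) \<le> norm (H (Complex \<sigma> t)) * exp (1/8)"
        unfolding Q_def norm_mult ns by (intro mult_left_mono) auto
      then have "(norm (Q t))\<^sup>2 \<le> (norm (H (Complex \<sigma> t)) * exp (1/8))\<^sup>2"
        by (intro power_mono) auto
      also have "\<dots> = exp (1/4) * (norm (H (Complex \<sigma> t)))\<^sup>2"
        by (simp add: power_mult_distrib flip: exp_of_nat_mult)
      finally show ?thesis .
    qed
    have pl: "(\<integral>\<^sup>+u. ennreal ((norm (w u))\<^sup>2 * exp (- (u / U)\<^sup>2 / 2)) \<partial>lborel) \<le> ennreal (2 * pi) * (ennreal (exp (1/4)) * R)"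
    proof -
      have "(\<integral>\<^sup>+u. ennreal ((norm (w u))\<^sup>2 * exp (- (u / U)\<^sup>2 / 2)) \<partial>lborel)
          \<le> ennreal (2 * pi) * (\<integral>\<^sup>+t. ennreal ((norm (Q t))\<^sup>2) \<partial>lborel)"
        unfolding w_def by (rule plancherel_gaussian_le[OF U Q_int])
      also have "(\<integral>\<^sup>+t. ennreal ((norm (Q t))\<^sup>2) \<partial>lborel)
          \<le> (\<integral>\<^sup>+t. ennreal (exp (1/4)) * ennreal ((norm (H (Complex \<sigma> t)))\<^sup>2) \<partial>lborel)"
        using Q_le by (intro nn_integral_mono) (simp add: ennreal_leI flip: ennreal_mult)
      also have "\<dots> = ennreal (exp (1/4)) * R"
        unfolding R_def using H_meas[of \<sigma>] \<sigma> by (intro nn_integral_cmult) measurable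
      finally show ?thesis by (simp add: mult_left_mono)
    qed
    have "(\<integral>\<^sup>+u\<in>{0..U}. ennreal ((g' n u)\<^sup>2 * exp (- 2 * \<sigma> * u)) \<partial>lborel)
       \<le> (\<integral>\<^sup>+u. ennreal (exp (1/2) / (4 * pi\<^sup>2)) * ennreal ((norm (w u))\<^sup>2 * exp (- (u / U)\<^sup>2 / 2)) \<partial>lborel)"
    proof (rule nn_integral_mono)
      fix u
      show "ennreal ((g' n u)\<^sup>2 * exp (- 2 * \<sigma> * u)) * indicator {0..U} u
         \<le> ennreal (exp (1/2) / (4 * pi\<^sup>2)) * ennreal ((norm (w u))\<^sup>2 * exp (- (u / U)\<^sup>2 / 2))"
      proof (cases "u \<in> {0..U}")
        case True
        have "(norm (w u))\<^sup>2 = 4 * pi\<^sup>2 * ((g' n u)\<^sup>2 * exp (- 2 * \<sigma> * u))"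
          unfolding w norm_of_real by (simp add: power_mult_distrib mult_ac power2_abs flip: exp_of_nat_mult)
        then have 1: "(g' n u)\<^sup>2 * exp (- 2 * \<sigma> * u) = (norm (w u))\<^sup>2 / (4 * pi\<^sup>2)" by simp
        \<comment> \<open>On [0, U] the Plancherel weight of width U is at least exp (-
          1/2).\<close>
        have "(u / U)\<^sup>2 \<le> 1\<^sup>2" using True U by (intro power_mono) auto
        then have "1 \<le> exp (1/2) * exp (- (u / U)\<^sup>2 / 2)" unfolding exp_add[symmetric] by simp
        then have "(norm (w u))\<^sup>2 / (4 * pi\<^sup>2) * 1 \<le> (norm (w u))\<^sup>2 / (4 * pi\<^sup>2) * (exp (1/2) * exp (- (u / U)\<^sup>2 / 2))"
          by (intro mult_left_mono) auto
        then have "(g' n u)\<^sup>2 * exp (- 2 * \<sigma> * u) \<le> exp (1/2) / (4 * pi\<^sup>2) * ((norm (w u))\<^sup>2 * exp (- (u / U)\<^sup>2 / 2))"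
          unfolding 1 by (simp add: mult_ac)
        then show ?thesis using True by (simp add: ennreal_leI flip: ennreal_mult)
      qed simp
    qed
    also have "\<dots> = ennreal (exp (1/2) / (4 * pi\<^sup>2)) * (\<integral>\<^sup>+u. ennreal ((norm (w u))\<^sup>2 * exp (- (u / U)\<^sup>2 / 2)) \<partial>lborel)"
    proof (rule nn_integral_cmult)
      have "w = (\<lambda>u. of_real (exp (- \<sigma> * u) * (2 * pi * g' n u)))" using w by blast
      then have [measurable]: "w \<in> borel_measurable borel" by simp
      show "(\<lambda>u. ennreal ((norm (w u))\<^sup>2 * exp (- (u / U)\<^sup>2 / 2))) \<in> borel_measurable lborel" by measurable
    qed
    also have "\<dots> \<le> ennreal (exp (1/2) / (4 * pi\<^sup>2)) * (ennreal (2 * pi) * (ennreal (exp (1/4)) * R))"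
      by (intro mult_left_mono pl) auto
    also have "\<dots> = ennreal (exp (1/2) / (4 * pi\<^sup>2) * (2 * pi * exp (1/4))) * R"
    proof -
      have "ennreal A * (ennreal B * (ennreal C * R)) = ennreal (A * (B * C)) * R"
        if "A \<ge> 0" "B \<ge> 0" "C \<ge> 0" for A B C
        using that by (simp only: ennreal_mult mult_nonneg_nonneg mult.assoc)
      then show ?thesis by simp
    qed
    also have "\<dots> \<le> ennreal 1 * R"
    proof (intro mult_right_mono ennreal_leI)
      \<comment> \<open>The accumulated constants exp (1/2), exp (1/4), 2 pi and 1 / (4 pi^2)
        combine to exp (3/4) / (2 pi), which is below 1.\<close>
      have "exp (1/2) / (4 * pi\<^sup>2) * (2 * pi * exp (1/4)) = exp (3/4 :: real) / (2 * pi)"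
        by (simp add: power2_eq_square field_simps flip: exp_add)
      also have "\<dots> \<le> 1"
      proof -
        have "exp (3/4 :: real) \<le> exp 1" by simp
        also have "\<dots> \<le> 3" by (rule exp_le)
        finally show ?thesis using pi_gt3 by simp
      qed
      finally show "exp (1/2) / (4 * pi\<^sup>2) * (2 * pi * exp (1/4)) \<le> (1 :: real)" .
    qed auto
    finally show ?thesis by simp
  qed
  have "(\<integral>\<^sup>+u\<in>{0..U}. ennreal ((g u)\<^sup>2 * exp (- 2 * \<sigma> * u)) \<partial>lborel)
      \<le> (\<integral>\<^sup>+u. liminf (\<lambda>n. ennreal ((g' n u)\<^sup>2 * exp (- 2 * \<sigma> * u)) * indicator {0..U} u) \<partial>lborel)"
  proof (rule nn_integral_mono_AE, rule AE_mp[OF cont], rule AE_I2, rule impI)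
    fix u assume "isCont g u"
    have lim: "(\<lambda>n. g' n u) \<longlonglongrightarrow> g u"
      unfolding g'_def by (rule gaussian_average_tendsto[OF _ g bc(1) \<open>isCont g u\<close>]) simp
    have "(\<lambda>n. ennreal ((g' n u)\<^sup>2 * exp (- 2 * \<sigma> * u))) \<longlonglongrightarrow> ennreal ((g u)\<^sup>2 * exp (- 2 * \<sigma> * u))"
      by (intro tendsto_ennrealI tendsto_intros lim)
    then have "(\<lambda>n. ennreal ((g' n u)\<^sup>2 * exp (- 2 * \<sigma> * u)) * indicator {0..U} u)
        \<longlonglongrightarrow> ennreal ((g u)\<^sup>2 * exp (- 2 * \<sigma> * u)) * indicator {0..U} u"
      by (cases "u \<in> {0..U}") auto
    then show "ennreal ((g u)\<^sup>2 * exp (- 2 * \<sigma> * u)) * indicator {0..U} u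
      \<le> liminf (\<lambda>n. ennreal ((g' n u)\<^sup>2 * exp (- 2 * \<sigma> * u)) * indicator {0..U} u)"
      using lim_imp_Liminf[OF sequentially_bot] by force
  qed
  also have "\<dots> \<le> liminf (\<lambda>n. \<integral>\<^sup>+u. ennreal ((g' n u)\<^sup>2 * exp (- 2 * \<sigma> * u)) * indicator {0..U} u \<partial>lborel)"
    by (rule nn_integral_liminf) measurable
  also have "\<dots> \<le> liminf (\<lambda>n. R)"
    by (intro Liminf_mono always_eventually allI step)
  also have "\<dots> = R" by (simp add: Liminf_const)
  finally show ?thesis by (simp add: R_def)
qed

section \<open>The functional equation\<close>

lemma Digamma_reflection_complex:
  fixes z :: complex
  assumes z: "z \<notin> \<int>"
  shows "Digamma (1 - z) - Digamma z = of_real pi * cos (of_real pi * z) / sin (of_real pi * z)"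
proof -
  have n: "z \<notin> \<int>\<^sub>\<le>\<^sub>0" "1 - z \<notin> \<int>\<^sub>\<le>\<^sub>0"
    using z nonpos_Ints_Int Ints_diff[OF Ints_1, of "1 - z"] by auto
  have s: "sin (of_real pi * z) \<noteq> 0"
    using Gamma_reflection_complex[of z] n by (auto simp: Gamma_eq_zero_iff)
  have "((\<lambda>w. Gamma (1 - w)) has_field_derivative (Gamma (1 - z) * Digamma (1 - z)) * (0 - 1)) (at z)"
    by (rule DERIV_chain2[OF has_field_derivative_Gamma]) (use n in \<open>auto intro!: derivative_eq_intros\<close>)
  from DERIV_mult[OF has_field_derivative_Gamma[OF n(1)] this]
  have "((\<lambda>w. Gamma w * Gamma (1 - w)) has_field_derivative
      Gamma z * Gamma (1 - z) * (Digamma z - Digamma (1 - z))) (at z)"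
    by (rule DERIV_cong) (simp add: algebra_simps)
  moreover have "((\<lambda>w. of_real pi / sin (of_real pi * w)) has_field_derivative
      of_real pi / sin (of_real pi * z) * (- (of_real pi * cos (of_real pi * z) / sin (of_real pi * z)))) (at z)"
    using s by (auto intro!: derivative_eq_intros simp: power2_eq_square)
  moreover have "(\<lambda>w :: complex. Gamma w * Gamma (1 - w)) = (\<lambda>w. of_real pi / sin (of_real pi * w))"
    by (rule ext) (rule Gamma_reflection_complex)
  ultimately have "of_real pi / sin (of_real pi * z) * (Digamma z - Digamma (1 - z))
      = of_real pi / sin (of_real pi * z) * (- (of_real pi * cos (of_real pi * z) / sin (of_real pi * z)))"
    using DERIV_unique Gamma_reflection_complex by metis
  moreover have "of_real pi / sin (of_real pi * z) \<noteq> 0" using s by simp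
  ultimately have "Digamma z - Digamma (1 - z) = - (of_real pi * cos (of_real pi * z) / sin (of_real pi * z))"
    using mult_left_cancel by blast
  then show ?thesis by (simp add: algebra_simps)
qed

text \<open>The reflection formula writes pi cot (pi z) as a difference of Digamma series at 1 - z
  and z. Adding a telescoping series of value - 1 / z shifts one index, so that the terms pair up as
  1 / (z - n) + 1 / (z + n).\<close>

lemma cot_partial_fractions:
  fixes z :: complex
  assumes z: "z \<notin> \<int>"
  shows "(\<lambda>k. 2 * z / (z\<^sup>2 - (of_nat (Suc k))\<^sup>2))
     sums (of_real pi * cos (of_real pi * z) / sin (of_real pi * z) - 1 / z)"
proof -
  have nz: "z \<noteq> 0" "1 - z \<noteq> 0" using z by auto
  have 1: "(\<lambda>k. inverse (of_nat (Suc k)) - inverse (w + of_nat k)) sums (Digamma w + euler_mascheroni)"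
    if "w \<noteq> 0" for w :: complex
    using summable_sums[OF summable_Digamma[OF that]] by (simp add: Digamma_def)
  have 2: "(\<lambda>k. inverse (z + of_nat k) - inverse (1 - z + of_nat k)) sums (Digamma (1 - z) - Digamma z)"
    using sums_diff[OF 1[OF nz(2)] 1[OF nz(1)]] by (simp add: algebra_simps)
  have "(\<lambda>k. inverse (z + of_nat k)) \<longlonglongrightarrow> 0"
    by (intro filterlim_compose[OF tendsto_inverse_0]
              tendsto_add_filterlim_at_infinity[OF tendsto_const] tendsto_of_nat)
  from telescope_sums[OF this]
  have 3: "(\<lambda>k. inverse (z + of_nat (Suc k)) - inverse (z + of_nat k)) sums (0 - inverse z)" by simp
  have "inverse (z + of_nat k) - inverse (1 - z + of_nat k) + (inverse (z + of_nat (Suc k)) - inverse (z + of_nat k))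
     = 2 * z / (z\<^sup>2 - (of_nat (Suc k))\<^sup>2)" for k
  proof -
    define n where "n = (of_nat (Suc k) :: complex)"
    have n: "z + n \<noteq> 0" "z - n \<noteq> 0"
    proof -
      have "z \<noteq> of_int i" for i using z by auto
      from this[of "- int (Suc k)"] this[of "int (Suc k)"] show "z + n \<noteq> 0" "z - n \<noteq> 0"
        by (auto simp: n_def add_eq_0_iff2 simp del: of_nat_Suc)
    qed
    have "1 - z + of_nat k = - (z - n)" by (simp add: n_def)
    then have "inverse (z + of_nat k) - inverse (1 - z + of_nat k) + (inverse (z + of_nat (Suc k)) - inverse (z + of_nat k))
       = inverse (z - n) + inverse (z + n)"
      by (simp only: n_def[symmetric] inverse_minus_eq) simp
    also have "\<dots> = 2 * z / ((z - n) * (z + n))" using n by (simp add: divide_simps)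
    also have "(z - n) * (z + n) = z\<^sup>2 - n\<^sup>2" by (simp add: power2_eq_square algebra_simps)
    finally show ?thesis by (simp add: n_def)
  qed
  with sums_add[OF 2 3] show ?thesis
    unfolding Digamma_reflection_complex[OF z] by (simp add: inverse_eq_divide)
qed

text \<open>The cotangent expansion at the imaginary point i u / (2 pi), where it becomes coth (u /
  2). All terms are positive, which allows sums and integrals to be exchanged freely later.\<close>

lemma coth_partial_fractions:
  fixes u :: real
  assumes u: "u > 0"
  shows "(\<lambda>k. 4 * u / (u\<^sup>2 + (2 * pi * real (Suc k))\<^sup>2)) sums ((1 + exp (- u)) / (1 - exp (- u)) - 2 / u)"
proof -
  define z where "z = \<i> * of_real (u / (2 * pi))"
  have z: "z \<notin> \<int>"
  proof
    assume "z \<in> \<int>"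
    then have "Im z = 0" by (auto elim!: Ints_cases)
    then show False using u by (simp add: z_def)
  qed
  have pz: "of_real pi * z = \<i> * of_real (u / 2)" by (simp add: z_def)
  define e where "e = exp (u / 2)"
  have e: "e > 1" "exp (- u) = inverse e * inverse e"
    using u by (auto simp: e_def simp flip: exp_minus exp_add)
  have ii: "\<i> * (\<i> * of_real (u / 2)) = complex_of_real (- u / 2)" by (simp flip: mult.assoc)
  have exps: "exp (\<i> * (of_real pi * z)) = of_real (inverse e)" "exp (- (\<i> * (of_real pi * z))) = of_real e"
    unfolding pz ii e_def of_real_minus[symmetric] exp_of_real by (simp_all add: exp_minus)
  have "\<i> / of_real pi * (of_real pi * cos (of_real pi * z) / sin (of_real pi * z) - 1 / z)
     = of_real ((1 + exp (- u)) / (1 - exp (- u)) - 2 / u)"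
  proof -
    have "cos (of_real pi * z) / sin (of_real pi * z) = \<i> * (of_real (inverse e) + of_real e) / (of_real (inverse e) - of_real e)"
    proof -
      have *: "p / 2 / (q / (2 * \<i>)) = \<i> * p / q" for p q :: complex
        by (cases "q = 0") (auto simp: field_simps)
      show ?thesis unfolding sin_exp_eq cos_exp_eq exps by (rule *)
    qed
    also have "\<dots> = \<i> * of_real ((inverse e + e) / (inverse e - e))" by simp
    also have "(inverse e + e) / (inverse e - e) = - ((1 + exp (- u)) / (1 - exp (- u)))"
    proof -
      have "inverse e - e < 0" "1 - inverse e * inverse e > 0"
        using e by (auto simp: field_simps one_less_inverse_iff intro: less_1_mult)
      then show ?thesis using e unfolding e(2) by (simp add: divide_simps) (simp add: algebra_simps)
    qed
    finally have c: "cos (of_real pi * z) / sin (of_real pi * z) = - \<i> * of_real ((1 + exp (- u)) / (1 - exp (- u)))"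
      by simp
    have "\<i> / of_real pi * (of_real pi * cos (of_real pi * z) / sin (of_real pi * z) - 1 / z)
      = \<i> * (cos (of_real pi * z) / sin (of_real pi * z)) - \<i> / of_real pi / z"
      by (simp add: right_diff_distrib)
    also have "\<i> / of_real pi / z = of_real (2 / u)" using u by (simp add: z_def field_simps)
    also have "\<i> * (cos (of_real pi * z) / sin (of_real pi * z)) = of_real ((1 + exp (- u)) / (1 - exp (- u)))"
    proof -
      have "\<i> * (- \<i> * x) = x" for x by (simp flip: mult.assoc)
      then show ?thesis by (simp only: c)
    qed
    finally show ?thesis by simp
  qed
  moreover have "\<i> / of_real pi * (2 * z / (z\<^sup>2 - (of_nat (Suc k))\<^sup>2)) = of_real (4 * u / (u\<^sup>2 + (2 * pi * real (Suc k))\<^sup>2))" for k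
  proof -
    have "z\<^sup>2 - (of_nat (Suc k))\<^sup>2 = of_real (- ((u / (2 * pi))\<^sup>2 + (real (Suc k))\<^sup>2))"
      by (simp add: z_def power_mult_distrib power_divide del: of_nat_Suc)
    moreover have "\<i> / of_real pi * (2 * z) = of_real (- (u / pi\<^sup>2))"
      by (simp add: z_def power2_eq_square field_simps)
    ultimately have "\<i> / of_real pi * (2 * z / (z\<^sup>2 - (of_nat (Suc k))\<^sup>2)) = of_real (- (u / pi\<^sup>2) / (- ((u / (2 * pi))\<^sup>2 + (real (Suc k))\<^sup>2)))"
      by (simp only: times_divide_eq_right of_real_divide)
    also have "- (u / pi\<^sup>2) / (- ((u / (2 * pi))\<^sup>2 + (real (Suc k))\<^sup>2)) = 4 * u / (u\<^sup>2 + (2 * pi * real (Suc k))\<^sup>2)"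
    proof -
      have "(u / (2 * pi))\<^sup>2 + (real (Suc k))\<^sup>2 = (u\<^sup>2 + (2 * pi * real (Suc k))\<^sup>2) / (4 * pi\<^sup>2)"
        by (simp add: power_divide power_mult_distrib add_divide_distrib del: of_nat_Suc)
      then show ?thesis by (simp del: of_nat_Suc)
    qed
    finally show ?thesis .
  qed
  ultimately have "(\<lambda>k. complex_of_real (4 * u / (u\<^sup>2 + (2 * pi * real (Suc k))\<^sup>2)))
      sums of_real ((1 + exp (- u)) / (1 - exp (- u)) - 2 / u)"
    using sums_mult[OF cot_partial_fractions[OF z], of "\<i> / of_real pi"] by (simp only:)
  then show ?thesis by (simp only: sums_of_real_iff)
qed

section \<open>Integrals of Gamma type\<close>

lemma nn_integral_Gamma_scaled:
  assumes a: "a > 0" and c: "c > 0"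
  shows "(\<integral>\<^sup>+u. ennreal (indicator {0<..} u * (u powr (a - 1) * exp (- (c * u)))) \<partial>lborel)
           = ennreal (Gamma a * c powr (- a))"
proof -
  have "ennreal (Gamma a) = (\<integral>\<^sup>+t. ennreal (indicator {0..} t * t powr (a - 1) / exp t) \<partial>lborel)"
    by (rule Gamma_conv_nn_integral_real[OF a])
  also have "\<dots> = ennreal \<bar>c\<bar> * (\<integral>\<^sup>+u. ennreal (indicator {0..} (0 + c * u) * (0 + c * u) powr (a - 1) / exp (0 + c * u)) \<partial>lborel)"
    by (rule nn_integral_real_affine) (use c in auto)
  also have "(\<integral>\<^sup>+u. ennreal (indicator {0..} (0 + c * u) * (0 + c * u) powr (a - 1) / exp (0 + c * u)) \<partial>lborel)
     = (\<integral>\<^sup>+u. ennreal (c powr (a - 1)) * ennreal (indicator {0<..} u * (u powr (a - 1) * exp (- (c * u)))) \<partial>lborel)"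
    using c by (intro nn_integral_cong)
      (auto simp: indicator_def powr_mult exp_minus divide_simps zero_le_mult_iff not_less ennreal_mult[symmetric])
  also have "\<dots> = ennreal (c powr (a - 1)) * (\<integral>\<^sup>+u. ennreal (indicator {0<..} u * (u powr (a - 1) * exp (- (c * u)))) \<partial>lborel)"
    by (rule nn_integral_cmult) measurable
  finally have "ennreal (Gamma a) = ennreal (c powr a) * (\<integral>\<^sup>+u. ennreal (indicator {0<..} u * (u powr (a - 1) * exp (- (c * u)))) \<partial>lborel)"
    using c by (simp add: powr_diff ennreal_mult[symmetric] mult.assoc[symmetric])
  then have "ennreal (c powr (- a)) * ennreal (Gamma a) = ennreal (c powr (- a)) * ennreal (c powr a) *
      (\<integral>\<^sup>+u. ennreal (indicator {0<..} u * (u powr (a - 1) * exp (- (c * u)))) \<partial>lborel)"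
    by (simp add: mult.assoc)
  also have "ennreal (c powr (- a)) * ennreal (c powr a) = 1"
    using c by (simp add: ennreal_mult[symmetric] powr_minus)
  finally show ?thesis using a by (simp add: ennreal_mult mult.commute)
qed

lemma nn_integral_Gamma_square:
  assumes r: "r < 1" and v: "v > 0"
  shows "(\<integral>\<^sup>+u. ennreal (indicator {0<..} u * (u powr (- r) * exp (- (v * u\<^sup>2)))) \<partial>lborel)
           = ennreal (Gamma ((1 - r) / 2) / 2 * v powr (- ((1 - r) / 2)))"
proof -
  define a where "a = (1 - r) / 2"
  have a: "a > 0" using r by (simp add: a_def)
  define f where "f t = t powr (a - 1) * exp (- (v * t))" for t
  have n1: "(\<integral>\<^sup>+t. ennreal (indicator {0<..} t * f t) \<partial>lborel) = ennreal (Gamma a * v powr (- a))"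
    unfolding f_def by (rule nn_integral_Gamma_scaled[OF a v])
  have "has_bochner_integral lborel (\<lambda>t. indicator {0<..} t * f t) (Gamma a * v powr (- a))"
    by (rule has_bochner_integral_nn_integral[OF _ _ _ n1]) (use a in \<open>auto simp: f_def\<close>)
  then have I: "set_integrable lborel {0<..} f" "set_lebesgue_integral lborel {0<..} f = Gamma a * v powr (- a)"
    by (auto simp: set_integrable_def set_lebesgue_integral_def has_bochner_integral_iff)
  have "f absolutely_integrable_on {0<..}" "integral {0<..} f = Gamma a * v powr (- a)"
    using I set_borel_integral_eq_integral[OF I(1)] by (auto intro: absolutely_integrable_onI simp: set_integrable_def integrable_completion)
  moreover have "(\<lambda>x::real. x\<^sup>2) ` {0<..} = {0<..}"
  proof -
    have "x \<in> (\<lambda>x. x\<^sup>2) ` {0<..}" if "x > 0" for x :: real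
      using that by (intro image_eqI[of _ _ "sqrt x"]) auto
    then show ?thesis by auto
  qed
  moreover have "((\<lambda>x. \<bar>2 * x\<bar> * f (x\<^sup>2)) absolutely_integrable_on {0<..} \<and>
      integral {0<..} (\<lambda>x. \<bar>2 * x\<bar> * f (x\<^sup>2)) = Gamma a * v powr - a) \<longleftrightarrow>
      (f absolutely_integrable_on (\<lambda>x. x\<^sup>2) ` {0<..} \<and> integral ((\<lambda>x. x\<^sup>2) ` {0<..}) f = Gamma a * v powr - a)"
    by (rule has_absolute_integral_change_of_variables_1')
       (auto intro!: derivative_eq_intros simp: inj_on_def power2_eq_iff)
  ultimately have J: "(\<lambda>x. \<bar>2 * x\<bar> * f (x\<^sup>2)) absolutely_integrable_on {0<..}"
      "integral {0<..} (\<lambda>x. \<bar>2 * x\<bar> * f (x\<^sup>2)) = Gamma a * v powr (- a)"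
    by auto
  have "((\<lambda>x. \<bar>2 * x\<bar> * f (x\<^sup>2)) has_integral (Gamma a * v powr (- a))) {0<..}"
    using J set_lebesgue_integral_eq_integral(1) integrable_integral by fastforce
  then have "(\<integral>\<^sup>+x. ennreal (indicator {0<..} x * (\<bar>2 * x\<bar> * f (x\<^sup>2))) \<partial>lborel) = ennreal (Gamma a * v powr (- a))"
    by (intro nn_integral_has_integral_lebesgue) (auto simp: f_def)
  also have "(\<integral>\<^sup>+x. ennreal (indicator {0<..} x * (\<bar>2 * x\<bar> * f (x\<^sup>2))) \<partial>lborel)
     = (\<integral>\<^sup>+x. ennreal 2 * ennreal (indicator {0<..} x * (x powr (- r) * exp (- (v * x\<^sup>2)))) \<partial>lborel)"
  proof (intro nn_integral_cong)
    fix x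
    show "ennreal (indicator {0<..} x * (\<bar>2 * x\<bar> * f (x\<^sup>2))) = ennreal 2 * ennreal (indicator {0<..} x * (x powr (- r) * exp (- (v * x\<^sup>2))))"
    proof (cases "x > 0")
      case True
      then have "x * (x\<^sup>2) powr (a - 1) = x powr 1 * x powr (2 * (a - 1))"
        by (simp add: powr_powr flip: powr_numeral)
      also have "\<dots> = x powr (- r)" unfolding powr_add[symmetric] by (simp add: a_def field_simps)
      finally have e: "x * (x\<^sup>2) powr (a - 1) = x powr (- r)" .
      have "\<bar>2 * x\<bar> * f (x\<^sup>2) = 2 * ((x * (x\<^sup>2) powr (a - 1)) * exp (- (v * x\<^sup>2)))"
        using True by (simp add: f_def)
      also have "ennreal \<dots> = ennreal 2 * ennreal (x powr (- r) * exp (- (v * x\<^sup>2)))"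
        unfolding e by (intro ennreal_mult) auto
      finally show ?thesis using True by simp
    qed simp
  qed
  also have "\<dots> = ennreal 2 * (\<integral>\<^sup>+x. ennreal (indicator {0<..} x * (x powr (- r) * exp (- (v * x\<^sup>2)))) \<partial>lborel)"
    by (rule nn_integral_cmult) measurable
  finally have e: "ennreal 2 * (\<integral>\<^sup>+x. ennreal (indicator {0<..} x * (x powr (- r) * exp (- (v * x\<^sup>2)))) \<partial>lborel)
      = ennreal (Gamma a * v powr (- a))" by simp
  have "ennreal (1/2) * ennreal 2 = 1" by (subst ennreal_mult[symmetric]) auto
  then have "X = ennreal (1/2) * (ennreal 2 * X)" for X by (simp only: mult.assoc[symmetric] mult_1)
  from this[of "\<integral>\<^sup>+x. ennreal (indicator {0<..} x * (x powr (- r) * exp (- (v * x\<^sup>2)))) \<partial>lborel"]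
  have "(\<integral>\<^sup>+x. ennreal (indicator {0<..} x * (x powr (- r) * exp (- (v * x\<^sup>2)))) \<partial>lborel)
     = ennreal (1/2 * (Gamma a * v powr (- a)))"
    unfolding e using a by (subst (asm) ennreal_mult[symmetric]) auto
  then show ?thesis by (simp add: a_def)
qed

text \<open>Writing 1 / (u^2 + b^2) as the integral of exp (- v (u^2 + b^2)) over v > 0 and
  exchanging the order turns it into two Gamma integrals. The nonnegative integral is used
  throughout, so Tonelli's theorem covers the exchange.\<close>

lemma nn_integral_powr_over_square:
  assumes r: "0 < r" "r < 1" and b: "b > 0"
  shows "(\<integral>\<^sup>+u. ennreal (indicator {0<..} u * (u powr (- r) / (u\<^sup>2 + b\<^sup>2))) \<partial>lborel)
           = ennreal (Gamma ((1 - r) / 2) * Gamma ((1 + r) / 2) / 2 * b powr (- 1 - r))"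
proof -
  let ?k = "\<lambda>u v :: real. ennreal (indicator {0<..} u * indicator {0<..} v * (u powr (- r) * exp (- (v * (u\<^sup>2 + b\<^sup>2)))))"
  have "(\<integral>\<^sup>+u. ennreal (indicator {0<..} u * (u powr (- r) / (u\<^sup>2 + b\<^sup>2))) \<partial>lborel) = (\<integral>\<^sup>+u. \<integral>\<^sup>+v. ?k u v \<partial>lborel \<partial>lborel)"
  proof (intro nn_integral_cong)
    fix u :: real
    show "ennreal (indicator {0<..} u * (u powr (- r) / (u\<^sup>2 + b\<^sup>2))) = (\<integral>\<^sup>+v. ?k u v \<partial>lborel)"
    proof (cases "u > 0")
      case True
      have p: "u\<^sup>2 + b\<^sup>2 > 0" using b by (simp add: add_nonneg_pos)
      have "(\<integral>\<^sup>+v. ?k u v \<partial>lborel) = (\<integral>\<^sup>+v. ennreal (u powr (- r)) * ennreal (indicator {0<..} v * (v powr (1 - 1) * exp (- ((u\<^sup>2 + b\<^sup>2) * v)))) \<partial>lborel)"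
        using True by (intro nn_integral_cong) (auto simp: indicator_def mult_ac simp flip: ennreal_mult)
      also have "\<dots> = ennreal (u powr (- r)) * (\<integral>\<^sup>+v. ennreal (indicator {0<..} v * (v powr (1 - 1) * exp (- ((u\<^sup>2 + b\<^sup>2) * v)))) \<partial>lborel)"
        by (rule nn_integral_cmult) measurable
      also have "\<dots> = ennreal (u powr (- r)) * ennreal (Gamma 1 * (u\<^sup>2 + b\<^sup>2) powr (- 1))"
        by (subst nn_integral_Gamma_scaled) (use p in auto)
      finally show ?thesis using True p by (simp add: powr_minus divide_inverse flip: ennreal_mult)
    qed simp
  qed
  also have "\<dots> = (\<integral>\<^sup>+v. \<integral>\<^sup>+u. ?k u v \<partial>lborel \<partial>lborel)"
    by (rule lborel_pair.Fubini') measurable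
  also have "\<dots> = (\<integral>\<^sup>+v. ennreal (Gamma ((1 - r) / 2) / 2) * ennreal (indicator {0<..} v * (v powr ((1 + r) / 2 - 1) * exp (- (b\<^sup>2 * v)))) \<partial>lborel)"
  proof (intro nn_integral_cong)
    fix v :: real
    show "(\<integral>\<^sup>+u. ?k u v \<partial>lborel) = ennreal (Gamma ((1 - r) / 2) / 2) * ennreal (indicator {0<..} v * (v powr ((1 + r) / 2 - 1) * exp (- (b\<^sup>2 * v))))"
    proof (cases "v > 0")
      case True
      have "(\<integral>\<^sup>+u. ?k u v \<partial>lborel) = (\<integral>\<^sup>+u. ennreal (exp (- (b\<^sup>2 * v))) * ennreal (indicator {0<..} u * (u powr (- r) * exp (- (v * u\<^sup>2)))) \<partial>lborel)"
        using True by (intro nn_integral_cong) (auto simp: indicator_def mult_ac algebra_simps simp flip: ennreal_mult exp_add)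
      also have "\<dots> = ennreal (exp (- (b\<^sup>2 * v))) * (\<integral>\<^sup>+u. ennreal (indicator {0<..} u * (u powr (- r) * exp (- (v * u\<^sup>2)))) \<partial>lborel)"
        by (rule nn_integral_cmult) measurable
      also have "\<dots> = ennreal (exp (- (b\<^sup>2 * v))) * ennreal (Gamma ((1 - r) / 2) / 2 * v powr (- ((1 - r) / 2)))"
        by (subst nn_integral_Gamma_square) (use r True in auto)
      also have "- ((1 - r) / 2) = (1 + r) / 2 - 1" by (simp add: field_simps)
      finally show ?thesis using True r by (simp add: mult_ac flip: ennreal_mult)
    qed simp
  qed
  also have "\<dots> = ennreal (Gamma ((1 - r) / 2) / 2) * (\<integral>\<^sup>+v. ennreal (indicator {0<..} v * (v powr ((1 + r) / 2 - 1) * exp (- (b\<^sup>2 * v)))) \<partial>lborel)"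
    by (rule nn_integral_cmult) measurable
  also have "\<dots> = ennreal (Gamma ((1 - r) / 2) / 2) * ennreal (Gamma ((1 + r) / 2) * (b\<^sup>2) powr (- ((1 + r) / 2)))"
    by (subst nn_integral_Gamma_scaled) (use r b in auto)
  also have "(b\<^sup>2) powr (- ((1 + r) / 2)) = b powr (2 * (- ((1 + r) / 2)))"
    using b by (simp add: powr_powr flip: powr_numeral)
  also have "2 * (- ((1 + r) / 2)) = - 1 - r" by (simp add: field_simps)
  finally show ?thesis using r by (simp flip: ennreal_mult)
qed

section \<open>The trapezoidal kernel and reflection on a real segment\<close>

lemma summable_trap:
  assumes s: "Re s > - 1"
  shows "summable (\<lambda>n. trap (Suc n) s)"
proof (rule summable_norm_cancel, rule summable_comparison_test')
  show "summable (\<lambda>n. norm (s - 1) * norm s * norm (s + 1) * real (Suc n) powr (- Re s - 2))"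
    using s by (intro summable_mult summable_Suc_powr) auto
  show "norm (norm (trap (Suc n) s)) \<le> norm (s - 1) * norm s * norm (s + 1) * real (Suc n) powr (- Re s - 2)"
    for n using trap_bound[of "Suc n" s] s by simp
qed

text \<open>The integral of \<open>(x - N) (N + 1 - x) x\<^sup>r\<^sup>-\<^sup>2\<close> over \<open>[N, N + 1]\<close>, scaled by
  \<open>r (1 - r\<^sup>2) / 2\<close>; for \<open>N > 0\<close> this is the trapezoidal error \<open>trap N (- r)\<close>.\<close>

definition trap_real :: "real \<Rightarrow> nat \<Rightarrow> real" where
  "trap_real r N = (if N = 0 then (1 - r) / 2 else
     (- r - 1) / 2 * (real N powr r + real (Suc N) powr r) + real (Suc N) powr (1 + r) - real N powr (1 + r))"

text \<open>The term with index 0 is the closed part 1 + (s - 1) / 2 at s = - r, so that the whole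
  value becomes one series.\<close>

lemma trap_real_sums:
  assumes r: "0 < r" "r < 1"
  shows "trap_real r sums Re (zeta_reg (- of_real r))"
    and "Im (zeta_reg (- of_real r)) = 0"
proof -
  have "trap (Suc n) (- of_real r) = of_real (trap_real r (Suc n))" for n
  proof -
    have "complex_of_nat n powr of_real x = of_real (real n powr x)" for n x
      using powr_of_real[of "real n" x] by simp
    from this[of _ r] this[of _ "1 + r"] show ?thesis
      by (simp add: trap_def trap_real_def del: of_nat_Suc)
  qed
  then have "(\<lambda>n. of_real (trap_real r (Suc n))) sums (\<Sum>n. trap (Suc n) (- of_real r))"
    using summable_sums[OF summable_trap[of "- of_real r"]] r by simp
  moreover have "(\<Sum>n. trap (Suc n) (- of_real r)) = zeta_reg (- of_real r) - of_real (trap_real r 0)"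
    using zeta_reg_eq_trap[of "- of_real r"] r by (simp add: trap_real_def field_simps)
  ultimately have s: "(\<lambda>n. complex_of_real (trap_real r (Suc n))) sums (zeta_reg (- of_real r) - of_real (trap_real r 0))"
    by simp
  from sums_Re[OF s] show "trap_real r sums Re (zeta_reg (- of_real r))"
    using sums_Suc_iff[of "trap_real r"] by simp
  from sums_Im[OF s] show "Im (zeta_reg (- of_real r)) = 0"
    by (simp add: sums_unique2[OF _ sums_zero])
qed

text \<open>The Peano kernel of the trapezoidal rule applied to x powr r, whose second derivative is
  r (r - 1) x powr (r - 2); the factor r (1 - r^2) / 2 collects this, the 1/2 of the kernel and the
  factor s - 1 = - (1 + r). On [0, 1] the integrand is singular at 0, hence the separate
  case.\<close>

lemma nn_integral_trap_real:
  assumes r: "0 < r" "r < 1"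
  shows "(\<integral>\<^sup>+x. ennreal (indicator {real N..real N + 1} x * ((x - real N) * (real N + 1 - x) * x powr (r - 2))) \<partial>lborel)
          = ennreal (trap_real r N / (r * (1 - r\<^sup>2) / 2))" (is "?lhs = _")
proof -
  define k where "k = r * (1 - r\<^sup>2) / 2"
  have "r\<^sup>2 < 1" using r by (simp add: power_less_one_iff abs_square_less_1)
  then have k: "k > 0" using r by (simp add: k_def)
  have I: "((\<lambda>x. (x - real N) * (real N + 1 - x) * x powr (r - 2)) has_integral (trap_real r N / k)) {real N..real N + 1}"
  proof (cases "N = 0")
    case True
    have "((\<lambda>x. x powr (r - 1) - x powr r) has_integral (1 powr (r - 1 + 1) / (r - 1 + 1) - 1 powr (r + 1) / (r + 1))) {0..1}"
      by (intro has_integral_diff has_integral_powr_from_0) (use r in auto)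
    moreover have "1 powr (r - 1 + 1) / (r - 1 + 1) - 1 powr (r + 1) / (r + 1) = trap_real r N / k"
    proof -
      have "k = (1 - r) / 2 * (r * (1 + r))" by (simp add: k_def power2_eq_square algebra_simps)
      moreover have "a / (a * x) = 1 / x" if "a \<noteq> 0" for a x :: real using that by simp
      from this[of "(1 - r) / 2" "r * (1 + r)"]
      have "(1 - r) / 2 / ((1 - r) / 2 * (r * (1 + r))) = 1 / (r * (1 + r))" using r by simp
      ultimately have "trap_real r N / k = 1 / (r * (1 + r))"
        using True by (simp only: trap_real_def simp_thms if_True)
      then show ?thesis using r by (simp add: field_simps)
    qed
    ultimately have "((\<lambda>x. x powr (r - 1) - x powr r) has_integral (trap_real r N / k)) {0..1}" by simp
    then have "((\<lambda>x. x * (1 - x) * x powr (r - 2)) has_integral (trap_real r N / k)) {0..1}"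
    proof (rule has_integral_spike[OF negligible_sing[of 0], rotated])
      fix x :: real assume "x \<in> {0..1} - {0}"
      then have x: "x > 0" by auto
      have "x powr (r - 1) = x powr (r - 2) * x" "x powr r = x powr (r - 2) * x * x"
        using x by (simp_all add: powr_diff field_simps power2_eq_square)
      then show "x * (1 - x) * x powr (r - 2) = x powr (r - 1) - x powr r"
        by (simp add: algebra_simps)
    qed
    then show ?thesis using True by simp
  next
    case False
    then have N: "real N > 0" by simp
    define F where "F x = - (x powr (r + 1) / (r + 1)) + (2 * real N + 1) * (x powr r / r)
        - real N * (real N + 1) * (x powr (r - 1) / (r - 1))" for x
    have "((\<lambda>x. (x - real N) * (real N + 1 - x) * x powr (r - 2)) has_integral (F (real N + 1) - F (real N))) {real N..real N + 1}"
    proof (rule fundamental_theorem_of_calculus)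
      fix x assume "x \<in> {real N..real N + 1}"
      then have x: "x > 0" using N by auto
      have "(F has_real_derivative (- (x powr r) + (2 * real N + 1) * x powr (r - 1) - real N * (real N + 1) * x powr (r - 1 - 1))) (at x within {real N..real N + 1})"
      proof -
        have p: "((\<lambda>x. x powr a / a) has_real_derivative x powr (a - 1)) (at x within {real N..real N + 1})"
          if "a \<noteq> 0" for a using x that by (auto intro!: derivative_eq_intros)
        have "r + 1 \<noteq> 0" "r \<noteq> 0" "r - 1 \<noteq> 0" using r by auto
        from DERIV_diff[OF DERIV_add[OF DERIV_minus[OF p[OF this(1)]] DERIV_cmult[OF p[OF this(2)], of "2 * real N + 1"]]
            DERIV_cmult[OF p[OF this(3)], of "real N * (real N + 1)"]]
        show ?thesis unfolding F_def by simp
      qed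
      moreover have "x powr (r - 1) = x powr (r - 2) * x" "x powr r = x powr (r - 2) * x * x" "r - 1 - 1 = r - 2"
        using x by (simp_all add: powr_diff field_simps power2_eq_square)
      ultimately have "(F has_real_derivative (x - real N) * (real N + 1 - x) * x powr (r - 2)) (at x within {real N..real N + 1})"
        by (simp add: algebra_simps)
      then show "(F has_vector_derivative (x - real N) * (real N + 1 - x) * x powr (r - 2)) (at x within {real N..real N + 1})"
        by (simp add: has_real_derivative_iff_has_vector_derivative)
    qed simp
    moreover have "F (real N + 1) - F (real N) = trap_real r N / k"
    proof -
      define m where "m = real N + 1"
      have m: "m > 0" using N by (simp add: m_def)
      have eN: "real N powr (r + 1) = real N * real N powr r" "real N * real N powr (r - 1) = real N powr r"
        and em: "m powr (r + 1) = m * m powr r" "m * m powr (r - 1) = m powr r"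
        using N m by (simp_all add: powr_add powr_diff)
      have FN: "F (real N) = real N powr r * (- real N / (r + 1) + (2 * real N + 1) / r - (real N + 1) / (r - 1))"
      proof -
        have "F (real N) = - (real N powr (r + 1)) / (r + 1) + (2 * real N + 1) * real N powr r / r
          - (real N + 1) * (real N * real N powr (r - 1)) / (r - 1)"
          by (simp add: F_def mult_ac)
        then show ?thesis unfolding eN by (simp add: algebra_simps add_divide_distrib)
      qed
      have Fm: "F m = m powr r * (- m / (r + 1) + (2 * m - 1) / r - (m - 1) / (r - 1))"
      proof -
        have "F m = - (m powr (r + 1)) / (r + 1) + (2 * m - 1) * m powr r / r
          - (m - 1) * (m * m powr (r - 1)) / (r - 1)"
          by (simp add: F_def m_def mult_ac)
        then show ?thesis unfolding em by (simp add: algebra_simps add_divide_distrib)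
      qed
      have kk: "k = - (r * (r - 1) * (r + 1) / 2)" by (simp add: k_def power2_eq_square field_simps)
      have c1: "k * (- m / (r + 1) + (2 * m - 1) / r - (m - 1) / (r - 1)) = m - (1 + r) / 2"
        and c2: "k * (- real N / (r + 1) + (2 * real N + 1) / r - (real N + 1) / (r - 1)) = real N + (1 + r) / 2"
      proof -
        have *: "- (r * (r - 1) * (r + 1) / 2) * (- a / (r + 1) + b / r - c / (r - 1))
           = (a * (r * (r - 1)) - b * ((r - 1) * (r + 1)) + c * (r * (r + 1))) / 2" for a b c
          using r by (simp add: divide_simps) (simp add: algebra_simps)
        show "k * (- m / (r + 1) + (2 * m - 1) / r - (m - 1) / (r - 1)) = m - (1 + r) / 2"
          and "k * (- real N / (r + 1) + (2 * real N + 1) / r - (real N + 1) / (r - 1)) = real N + (1 + r) / 2"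
          unfolding kk * by (simp_all add: algebra_simps add_divide_distrib diff_divide_distrib)
      qed
      have "k * (F m - F (real N)) = m powr r * (m - (1 + r) / 2) - real N powr r * (real N + (1 + r) / 2)"
        unfolding FN Fm c1[symmetric] c2[symmetric] by (simp add: algebra_simps)
      also have "\<dots> = trap_real r N"
      proof -
        have "trap_real r N = (- r - 1) / 2 * (real N powr r + m powr r) + m powr (r + 1) - real N powr (r + 1)"
          using False by (simp add: trap_real_def m_def add.commute)
        then show ?thesis unfolding em(1) eN(1) by (simp add: field_simps)
      qed
      finally show ?thesis using k by (simp add: m_def field_simps)
    qed
    ultimately show ?thesis by simp
  qed
  have "?lhs = ennreal (trap_real r N / k)"
    by (rule nn_integral_has_integral_lebesgue[OF _ I]) auto
  then show ?thesis by (simp add: k_def)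
qed

text \<open>The Laplace transform of the Peano kernel. Its dependence on N is geometric, so that the
  sum over N involves only 1 / (1 - exp (- u)) and leads to coth (u / 2).\<close>

lemma nn_integral_laplace_hat:
  fixes u :: real
  assumes u: "u > 0"
  shows "(\<integral>\<^sup>+x. ennreal (indicator {real N..real N + 1} x * ((x - real N) * (real N + 1 - x) * exp (- (x * u)))) \<partial>lborel)
    = ennreal (exp (- u) ^ N * ((1 + exp (- u)) / u\<^sup>2 - 2 * (1 - exp (- u)) / u ^ 3))" (is "?lhs = _")
proof -
  define F where "F x = - exp (- (x * u)) * ((x - real N) * (real N + 1 - x) / u + (1 - 2 * (x - real N)) / u\<^sup>2 - 2 / u ^ 3)" for x
  have "((\<lambda>x. (x - real N) * (real N + 1 - x) * exp (- (x * u))) has_integral (F (real N + 1) - F (real N))) {real N..real N + 1}"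
  proof (rule fundamental_theorem_of_calculus)
    fix x
    have "(F has_real_derivative (x - real N) * (real N + 1 - x) * exp (- (x * u))) (at x within {real N..real N + 1})"
      unfolding F_def using u
      by (auto intro!: derivative_eq_intros simp: divide_simps) (simp add: algebra_simps power2_eq_square power3_eq_cube)
    then show "(F has_vector_derivative (x - real N) * (real N + 1 - x) * exp (- (x * u))) (at x within {real N..real N + 1})"
      by (simp add: has_real_derivative_iff_has_vector_derivative)
  qed simp
  moreover have "F (real N + 1) - F (real N) = exp (- u) ^ N * ((1 + exp (- u)) / u\<^sup>2 - 2 * (1 - exp (- u)) / u ^ 3)"
  proof -
    have e: "exp (- (real N * u)) = exp (- u) ^ N" "exp (- ((real N + 1) * u)) = exp (- u) ^ N * exp (- u)"
      using exp_of_nat_mult[of N "- u"] by (simp_all add: algebra_simps flip: exp_add) (simp add: exp_diff exp_minus divide_inverse)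
    show ?thesis unfolding F_def e using u by (simp add: divide_simps) (simp add: algebra_simps)
  qed
  ultimately have "((\<lambda>x. (x - real N) * (real N + 1 - x) * exp (- (x * u))) has_integral
      exp (- u) ^ N * ((1 + exp (- u)) / u\<^sup>2 - 2 * (1 - exp (- u)) / u ^ 3)) {real N..real N + 1}" by simp
  then show ?thesis by (rule nn_integral_has_integral_lebesgue[rotated]) auto
qed

text \<open>Expressing x powr (r - 2) as a Gamma integral of exp (- x u) turns the trapezoidal
  series on the left into an integral of u powr (1 - r) against a function of coth type. Expanding
  coth into partial fractions and integrating termwise gives multiples of j powr (- 1 - r), whose
  sum is \<zeta>(1 + r). Every term is nonnegative, so all exchanges happen in
  \<open>ennreal\<close>.\<close>

lemma zeta_reg_reflect_real:
  assumes r: "0 < r" "r < 1"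
  shows "Gamma (2 - r) * (Re (zeta_reg (- of_real r)) / (r * (1 - r\<^sup>2) / 2))
    = 2 * Gamma ((1 - r) / 2) * Gamma ((1 + r) / 2) * (2 * pi) powr (- 1 - r) * Re (zeta (1 + of_real r))"
proof -
  define k where "k = r * (1 - r\<^sup>2) / 2"
  have "r\<^sup>2 < 1" using r by (simp add: power_less_one_iff abs_square_less_1)
  then have k: "k > 0" using r by (simp add: k_def)
  define GG where "GG = Gamma ((1 - r) / 2) * Gamma ((1 + r) / 2)"
  have GG: "GG > 0" using r by (simp add: GG_def)
  define w where "w N x = indicator {real N..real N + 1} x * ((x - real N) * (real N + 1 - x))" for N x
  have w0: "w N x \<ge> 0" for N x by (simp add: w_def indicator_def)
  have w_meas[measurable]: "w N \<in> borel_measurable borel" for N unfolding w_def by measurable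
  have wx: "(\<integral>\<^sup>+x. ennreal (w N x * x powr (r - 2)) \<partial>lborel) = ennreal (trap_real r N / k)" for N
    using nn_integral_trap_real[OF r, of N] by (simp only: w_def k_def mult.assoc)
  \<comment> \<open>Nonnegativity is read off the integral: \<open>ennreal\<close> of a negative
    number is 0, and then the kernel would vanish almost everywhere on the interval.\<close>
  have T0: "trap_real r N \<ge> 0" for N
  proof (rule ccontr)
    assume "\<not> ?thesis"
    then have neg: "trap_real r N < 0" by simp
    then have "N \<noteq> 0" using r by (cases "N = 0") (auto simp: trap_real_def)
    have "(\<integral>\<^sup>+x. ennreal (w N x * x powr (r - 2)) \<partial>lborel) = 0"
      unfolding wx using neg k by (simp add: ennreal_neg divide_nonpos_pos)
    then have "AE x in lborel. ennreal (w N x * x powr (r - 2)) = 0"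
      by (subst (asm) nn_integral_0_iff_AE) auto
    then have "AE x in lborel. x \<notin> {real N<..<real N + 1}"
    proof (rule AE_mp, intro AE_I2 impI notI)
      fix x assume "ennreal (w N x * x powr (r - 2)) = 0" "x \<in> {real N<..<real N + 1}"
      then show False using \<open>N \<noteq> 0\<close> by (auto simp: w_def ennreal_eq_0_iff mult_le_0_iff)
    qed
    then have "emeasure lborel {real N<..<real N + 1} = 0"
      by (subst (asm) AE_iff_null_sets[symmetric]) (auto simp: null_sets_def)
    then show False by simp
  qed
  have N_int: "ennreal (Gamma (2 - r) * (trap_real r N / k)) =
      (\<integral>\<^sup>+u. ennreal (indicator {0<..} u * u powr (1 - r)) *
         ennreal (indicator {0<..} u * (exp (- u) ^ N * ((1 + exp (- u)) / u\<^sup>2 - 2 * (1 - exp (- u)) / u ^ 3))) \<partial>lborel)" for N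
  proof -
    let ?h = "\<lambda>x u. ennreal (w N x * (indicator {0<..} u * (u powr (1 - r) * exp (- (x * u)))))"
    have "ennreal (Gamma (2 - r) * (trap_real r N / k)) = ennreal (Gamma (2 - r)) * (\<integral>\<^sup>+x. ennreal (w N x * x powr (r - 2)) \<partial>lborel)"
      unfolding wx by (rule ennreal_mult') (use r in simp)
    also have "\<dots> = (\<integral>\<^sup>+x. ennreal (Gamma (2 - r)) * ennreal (w N x * x powr (r - 2)) \<partial>lborel)"
      by (rule nn_integral_cmult[symmetric]) measurable
    also have "\<dots> = (\<integral>\<^sup>+x. \<integral>\<^sup>+u. ?h x u \<partial>lborel \<partial>lborel)"
    proof (intro nn_integral_cong)
      fix x
      show "ennreal (Gamma (2 - r)) * ennreal (w N x * x powr (r - 2)) = (\<integral>\<^sup>+u. ?h x u \<partial>lborel)"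
      proof (cases "x > 0")
        case True
        have "(\<integral>\<^sup>+u. ?h x u \<partial>lborel) = (\<integral>\<^sup>+u. ennreal (w N x) * ennreal (indicator {0<..} u * (u powr ((2 - r) - 1) * exp (- (x * u)))) \<partial>lborel)"
          by (intro nn_integral_cong) (simp add: ennreal_mult w0)
        also have "\<dots> = ennreal (w N x) * (\<integral>\<^sup>+u. ennreal (indicator {0<..} u * (u powr ((2 - r) - 1) * exp (- (x * u)))) \<partial>lborel)"
          by (rule nn_integral_cmult) measurable
        also have "\<dots> = ennreal (w N x) * ennreal (Gamma (2 - r) * x powr (- (2 - r)))"
          by (subst nn_integral_Gamma_scaled) (use r True in auto)
        finally show ?thesis using r w0 by (simp add: mult_ac flip: ennreal_mult)
      next
        case False
        then have "w N x = 0" by (auto simp: w_def indicator_def)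
        then show ?thesis by simp
      qed
    qed
    also have "\<dots> = (\<integral>\<^sup>+u. \<integral>\<^sup>+x. ?h x u \<partial>lborel \<partial>lborel)"
      by (rule lborel_pair.Fubini') measurable
    also have "\<dots> = (\<integral>\<^sup>+u. ennreal (indicator {0<..} u * u powr (1 - r)) *
         ennreal (indicator {0<..} u * (exp (- u) ^ N * ((1 + exp (- u)) / u\<^sup>2 - 2 * (1 - exp (- u)) / u ^ 3))) \<partial>lborel)"
    proof (intro nn_integral_cong)
      fix u :: real
      show "(\<integral>\<^sup>+x. ?h x u \<partial>lborel) = ennreal (indicator {0<..} u * u powr (1 - r)) *
         ennreal (indicator {0<..} u * (exp (- u) ^ N * ((1 + exp (- u)) / u\<^sup>2 - 2 * (1 - exp (- u)) / u ^ 3)))"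
      proof (cases "u > 0")
        case True
        have "(\<integral>\<^sup>+x. ?h x u \<partial>lborel) = (\<integral>\<^sup>+x. ennreal (u powr (1 - r)) * ennreal (w N x * exp (- (x * u))) \<partial>lborel)"
          using True w0 by (intro nn_integral_cong) (simp add: mult_ac flip: ennreal_mult)
        also have "\<dots> = ennreal (u powr (1 - r)) * (\<integral>\<^sup>+x. ennreal (w N x * exp (- (x * u))) \<partial>lborel)"
          by (rule nn_integral_cmult) measurable
        finally show ?thesis
          using True nn_integral_laplace_hat[OF True, of N] by (simp add: w_def mult.assoc)
      qed simp
    qed
    finally show ?thesis .
  qed
  \<comment> \<open>Both sides equal u powr (1 - r) times B / (1 - q): on the left by the geometric
    series, on the right by the expansion of coth.\<close>
  have pw: "ennreal (indicator {0<..} u * u powr (1 - r)) *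
      (\<Sum>N. ennreal (indicator {0<..} u * (exp (- u) ^ N * ((1 + exp (- u)) / u\<^sup>2 - 2 * (1 - exp (- u)) / u ^ 3))))
    = (\<Sum>j. ennreal 4 * ennreal (indicator {0<..} u * (u powr (- r) / (u\<^sup>2 + (2 * pi * real (Suc j))\<^sup>2))))" for u :: real
  proof (cases "u > 0")
    case True
    define B where "B = (1 + exp (- u)) / u\<^sup>2 - 2 * (1 - exp (- u)) / u ^ 3"
    define q where "q = exp (- u)"
    have q: "0 < q" "q < 1" using True by (auto simp: q_def)
    have cs: "(\<lambda>j. 4 * u / (u\<^sup>2 + (2 * pi * real (Suc j))\<^sup>2)) sums (u\<^sup>2 * (B / (1 - q)))"
    proof -
      have "(1 + q) / (1 - q) - 2 / u = u\<^sup>2 * (B / (1 - q))"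
        using q True unfolding B_def q_def[symmetric]
        by (simp add: divide_simps power2_eq_square power3_eq_cube)
      then show ?thesis using coth_partial_fractions[OF True] by (simp add: q_def)
    qed
    have "0 \<le> u\<^sup>2 * (B / (1 - q))"
      by (rule sums_le[OF _ sums_zero cs]) (use True in auto)
    then have B0: "B \<ge> 0" using q True by (simp add: zero_le_mult_iff zero_le_divide_iff)
    have "(\<lambda>N. q ^ N * B) sums (1 / (1 - q) * B)"
      by (intro sums_mult2 geometric_sums) (use q in auto)
    then have "(\<Sum>N. ennreal (q ^ N * B)) = ennreal (1 / (1 - q) * B)"
      by (intro suminf_ennreal_eq) (use q B0 in auto)
    then have "ennreal (indicator {0<..} u * u powr (1 - r)) *
      (\<Sum>N. ennreal (indicator {0<..} u * (exp (- u) ^ N * ((1 + exp (- u)) / u\<^sup>2 - 2 * (1 - exp (- u)) / u ^ 3))))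
      = ennreal (u powr (1 - r) * (B / (1 - q)))"
      using True q B0 unfolding B_def[symmetric] unfolding q_def[symmetric] by (simp flip: ennreal_mult)
    also have "\<dots> = (\<Sum>j. ennreal (4 * (u powr (- r) / (u\<^sup>2 + (2 * pi * real (Suc j))\<^sup>2))))"
    proof (rule suminf_ennreal_eq[symmetric])
      have "(\<lambda>j. u powr (- r) / u * (4 * u / (u\<^sup>2 + (2 * pi * real (Suc j))\<^sup>2))) sums (u powr (- r) / u * (u\<^sup>2 * (B / (1 - q))))"
        by (rule sums_mult[OF cs])
      moreover have "u powr (- r) / u * (u\<^sup>2 * (B / (1 - q))) = u powr (1 - r) * (B / (1 - q))"
        using True by (simp add: powr_diff powr_minus power2_eq_square field_simps)
      moreover have "u powr (- r) / u * (4 * u / (u\<^sup>2 + (2 * pi * real (Suc j))\<^sup>2)) = 4 * (u powr (- r) / (u\<^sup>2 + (2 * pi * real (Suc j))\<^sup>2))" for j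
        using True by simp
      ultimately show "(\<lambda>j. 4 * (u powr (- r) / (u\<^sup>2 + (2 * pi * real (Suc j))\<^sup>2))) sums (u powr (1 - r) * (B / (1 - q)))"
        by (simp only:)
    qed simp
    also have "\<dots> = (\<Sum>j. ennreal 4 * ennreal (indicator {0<..} u * (u powr (- r) / (u\<^sup>2 + (2 * pi * real (Suc j))\<^sup>2))))"
    proof (rule suminf_cong)
      fix j
      have "ennreal (4 * x) = ennreal 4 * ennreal (indicator {0<..} u * x)" for x
        using True ennreal_mult'[of 4 x] by simp
      then show "ennreal (4 * (u powr (- r) / (u\<^sup>2 + (2 * pi * real (Suc j))\<^sup>2))) =
          ennreal 4 * ennreal (indicator {0<..} u * (u powr (- r) / (u\<^sup>2 + (2 * pi * real (Suc j))\<^sup>2)))" .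
    qed
    finally show ?thesis .
  qed simp
  have "ennreal (Gamma (2 - r) * (Re (zeta_reg (- of_real r)) / k)) = (\<Sum>N. ennreal (Gamma (2 - r) * (trap_real r N / k)))"
    by (rule suminf_ennreal_eq[symmetric])
       (use T0 k r trap_real_sums(1)[OF r] in \<open>auto intro!: sums_mult sums_divide mult_nonneg_nonneg divide_nonneg_pos\<close>)
  also have "\<dots> = (\<integral>\<^sup>+u. (\<Sum>N. ennreal (indicator {0<..} u * u powr (1 - r)) *
         ennreal (indicator {0<..} u * (exp (- u) ^ N * ((1 + exp (- u)) / u\<^sup>2 - 2 * (1 - exp (- u)) / u ^ 3)))) \<partial>lborel)"
    unfolding N_int by (rule nn_integral_suminf[symmetric]) measurable
  also have "\<dots> = (\<integral>\<^sup>+u. (\<Sum>j. ennreal 4 * ennreal (indicator {0<..} u * (u powr (- r) / (u\<^sup>2 + (2 * pi * real (Suc j))\<^sup>2)))) \<partial>lborel)"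
    unfolding ennreal_suminf_cmult pw[unfolded ennreal_suminf_cmult] ..
  also have "\<dots> = (\<Sum>j. \<integral>\<^sup>+u. ennreal 4 * ennreal (indicator {0<..} u * (u powr (- r) / (u\<^sup>2 + (2 * pi * real (Suc j))\<^sup>2))) \<partial>lborel)"
    by (rule nn_integral_suminf) measurable
  also have "\<dots> = (\<Sum>j. ennreal (2 * GG * ((2 * pi) powr (- 1 - r) * real (Suc j) powr (- (1 + r)))))"
  proof (rule suminf_cong)
    fix j
    have "(\<integral>\<^sup>+u. ennreal 4 * ennreal (indicator {0<..} u * (u powr (- r) / (u\<^sup>2 + (2 * pi * real (Suc j))\<^sup>2))) \<partial>lborel)
      = ennreal 4 * (\<integral>\<^sup>+u. ennreal (indicator {0<..} u * (u powr (- r) / (u\<^sup>2 + (2 * pi * real (Suc j))\<^sup>2))) \<partial>lborel)"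
      by (rule nn_integral_cmult) measurable
    also have "\<dots> = ennreal 4 * ennreal (GG / 2 * (2 * pi * real (Suc j)) powr (- 1 - r))"
      unfolding GG_def by (subst nn_integral_powr_over_square) (use r in auto)
    also have "\<dots> = ennreal (4 * (GG / 2 * (2 * pi * real (Suc j)) powr (- 1 - r)))"
      using GG by (intro ennreal_mult[symmetric]) auto
    also have "4 * (GG / 2 * (2 * pi * real (Suc j)) powr (- 1 - r)) = 2 * GG * ((2 * pi) powr (- 1 - r) * real (Suc j) powr (- (1 + r)))"
      by (subst powr_mult) (auto simp del: of_nat_Suc)
    finally show "(\<integral>\<^sup>+u. ennreal 4 * ennreal (indicator {0<..} u * (u powr (- r) / (u\<^sup>2 + (2 * pi * real (Suc j))\<^sup>2))) \<partial>lborel)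
      = ennreal (2 * GG * ((2 * pi) powr (- 1 - r) * real (Suc j) powr (- (1 + r))))" .
  qed
  also have "\<dots> = ennreal (2 * GG * ((2 * pi) powr (- 1 - r) * Re (zeta (1 + of_real r))))"
  proof (rule suminf_ennreal_eq)
    have "(\<lambda>n. Re (of_nat (Suc n) powr (- (1 + of_real r)))) sums Re (zeta (1 + of_real r))"
      by (rule sums_Re[OF zeta_sums]) (use r in simp)
    moreover have "Re (of_nat n powr (- (1 + of_real r))) = real n powr (- (1 + r))" for n
      using powr_of_real[of "real n" "- (1 + r)"] by simp
    ultimately show "(\<lambda>j. 2 * GG * ((2 * pi) powr (- 1 - r) * real (Suc j) powr (- (1 + r)))) sums
        (2 * GG * ((2 * pi) powr (- 1 - r) * Re (zeta (1 + of_real r))))"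
      by (intro sums_mult) (simp only:)
  qed (use GG in auto)
  finally have e: "ennreal (Gamma (2 - r) * (Re (zeta_reg (- of_real r)) / k)) =
     ennreal (2 * GG * ((2 * pi) powr (- 1 - r) * Re (zeta (1 + of_real r))))" .
  have "0 \<le> Re (zeta_reg (- of_real r))"
    by (rule sums_le[OF _ sums_zero trap_real_sums(1)[OF r]]) (rule T0)
  moreover have "0 \<le> Re (zeta (1 + of_real r))"
    using has_sum_nonneg[OF has_sum_zeta_real[of "1 + r"]] r by simp
  ultimately have "Gamma (2 - r) * (Re (zeta_reg (- of_real r)) / k) =
     2 * GG * ((2 * pi) powr (- 1 - r) * Re (zeta (1 + of_real r)))"
    using e GG k r by (subst (asm) ennreal_inj) (auto intro!: mult_nonneg_nonneg divide_nonneg_pos)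
  then show ?thesis by (simp add: k_def GG_def mult_ac)
qed

text \<open>Riemann's function (1/2) s (s - 1) \<pi> powr (- s/2) Gamma (s/2) \<zeta>(s): since
  Gamma (1 + s/2) = (s/2) Gamma (s/2), this form shows no singularity at 0 or 1.\<close>

definition xi :: "complex \<Rightarrow> complex" where
  "xi s = zeta_reg s * Gamma (1 + s / 2) * of_real pi powr (- s / 2)"

lemma holomorphic_xi: "xi holomorphic_on {s. - 2 < Re s}"
  unfolding xi_def
proof (intro holomorphic_intros holomorphic_on_subset[OF holomorphic_zeta_reg])
  fix s :: complex assume "s \<in> {s. - 2 < Re s}"
  then show "1 + s / 2 \<notin> \<int>\<^sub>\<le>\<^sub>0" by (auto elim!: nonpos_Ints_cases simp: complex_eq_iff)
qed auto

text \<open>Legendre's duplication formula at (1 - r) / 2 trades Gamma (1 - r) for Gamma (1 - r /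
  2), the factor that occurs in \<open>xi\<close>; the powers of 2 and pi then match.\<close>

lemma xi_reflect_real:
  assumes r: "0 < r" "r < 1"
  shows "xi (- of_real r) = xi (1 + of_real r)"
proof -
  define k where "k = r * (1 - r\<^sup>2) / 2"
  have kk: "k = r * (1 - r) * (1 + r) / 2" by (simp add: k_def power2_eq_square field_simps)
  define Zm where "Zm = Re (zeta_reg (- of_real r))"
  define Zp where "Zp = Re (zeta (1 + of_real r))"
  define g1 where "g1 = Gamma ((1 - r) / 2)"
  define g2 where "g2 = Gamma ((1 + r) / 2)"
  define g3 where "g3 = Gamma (1 - r / 2)"
  define g4 where "g4 = Gamma (1 - r)"
  have pos: "g1 > 0" "g2 > 0" "g3 > 0" "g4 > 0" using r by (simp_all add: g1_def g2_def g3_def g4_def)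
  have np: "x \<notin> \<int>\<^sub>\<le>\<^sub>0" if "x > 0" for x :: real using that nonpos_Ints_nonpos by force
  have "Gamma (2 - r) = (1 - r) * g4"
    using Gamma_plus1[of "1 - r"] r np by (simp add: g4_def)
  then have main: "(1 - r) * g4 * (Zm / k) = 2 * g1 * g2 * (2 * pi) powr (- 1 - r) * Zp"
    using zeta_reg_reflect_real[OF r] by (simp add: Zm_def Zp_def g1_def g2_def k_def)
  have dup: "g1 * g3 = 2 powr r * sqrt pi * g4"
  proof -
    define z where "z = complex_of_real ((1 - r) / 2)"
    have npc: "x \<notin> \<int>\<^sub>\<le>\<^sub>0" if "Re x > 0" for x :: complex
      using that by (auto elim!: nonpos_Ints_cases)
    have "z \<notin> \<int>\<^sub>\<le>\<^sub>0" "z + 1 / 2 \<notin> \<int>\<^sub>\<le>\<^sub>0"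
      using r by (auto intro!: npc simp: z_def field_simps)
    from Gamma_legendre_duplication[OF this]
    have "Gamma z * Gamma (z + 1 / 2) = exp ((1 - 2 * z) * of_real (ln 2)) * of_real (sqrt pi) * Gamma (2 * z)" .
    moreover have "z + 1 / 2 = of_real (1 - r / 2)" "2 * z = of_real (1 - r)"
      "(1 - 2 * z) * of_real (ln 2) = of_real (r * ln 2)"
      by (simp_all add: z_def field_simps)
    ultimately have "of_real (g1 * g3) = complex_of_real (exp (r * ln 2) * sqrt pi * g4)"
      by (simp only: z_def g1_def g3_def g4_def Gamma_complex_of_real of_real_mult
          exp_of_real[of "r * ln 2", unfolded of_real_mult])
    then have "g1 * g3 = exp (r * ln 2) * sqrt pi * g4" by (simp only: of_real_eq_iff)
    then show ?thesis by (simp add: powr_def mult.commute)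
  qed
  have g5: "Gamma (1 + (1 + r) / 2) = (1 + r) / 2 * g2"
    using Gamma_plus1[of "(1 + r) / 2"] r np by (simp add: g2_def add.commute)
  have "Zm * g3 * pi powr (r / 2) = r * Zp * ((1 + r) / 2 * g2) * pi powr (- (1 + r) / 2)"
  proof -
    have "(1 - r) * g4 * Zm = k * (2 * g1 * g2 * (2 * pi) powr (- 1 - r) * Zp)"
    proof -
      have "k \<noteq> 0" using r by (simp add: kk)
      then have "(1 - r) * g4 * Zm = k * ((1 - r) * g4 * (Zm / k))" by simp
      then show ?thesis by (simp only: main)
    qed
    also have "\<dots> = (1 - r) * (r * (1 + r) * g1 * g2 * (2 * pi) powr (- 1 - r) * Zp)"
      unfolding kk by simp
    finally have "(1 - r) * (g4 * Zm) = (1 - r) * (r * (1 + r) * g1 * g2 * (2 * pi) powr (- 1 - r) * Zp)"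
      by (simp only: mult.assoc)
    then have "g4 * Zm = r * (1 + r) * g1 * g2 * (2 * pi) powr (- 1 - r) * Zp"
      using r by (subst (asm) mult_left_cancel) auto
    then have "g4 * (Zm * g3) = r * (1 + r) * (g1 * g3) * g2 * (2 * pi) powr (- 1 - r) * Zp"
      by (simp add: mult_ac)
    also have "\<dots> = g4 * (r * (1 + r) * g2 * Zp * (2 powr r * (2 powr (- 1 - r) * (sqrt pi * pi powr (- 1 - r)))))"
      unfolding dup by (simp add: powr_mult mult_ac)
    also have "2 powr r * (2 powr (- 1 - r) * (sqrt pi * pi powr (- 1 - r))) = (2 powr r * 2 powr (- 1 - r)) * (pi powr (1/2) * pi powr (- 1 - r))"
      by (simp add: powr_half_sqrt)
    also have "\<dots> = 1 / 2 * pi powr (- 1/2 - r)"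
      by (simp add: powr_add[symmetric] powr_minus)
    finally have "Zm * g3 = r * (1 + r) * g2 * Zp * (1 / 2 * pi powr (- 1/2 - r))"
      using pos by (subst (asm) mult_left_cancel) auto
    then have "Zm * g3 * pi powr (r / 2) = r * (1 + r) * g2 * Zp * (1 / 2 * (pi powr (- 1/2 - r) * pi powr (r / 2)))"
      by (simp add: mult.assoc)
    also have "pi powr (- 1/2 - r) * pi powr (r / 2) = pi powr (- (1 + r) / 2)"
      unfolding powr_add[symmetric] by (simp add: field_simps)
    finally show ?thesis by (simp add: field_simps)
  qed
  moreover have "xi (- of_real r) = of_real (Zm * g3 * pi powr (r / 2))"
  proof -
    have "zeta_reg (- of_real r) = of_real Zm"
      using trap_real_sums(2)[OF r] by (simp add: Zm_def complex_eq_iff)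
    moreover have "1 + - complex_of_real r / 2 = of_real (1 - r / 2)" "- (- complex_of_real r) / 2 = of_real (r / 2)" by simp_all
    moreover have "complex_of_real pi powr of_real (r / 2) = of_real (pi powr (r / 2))" by (rule powr_of_real) simp
    ultimately show ?thesis unfolding xi_def g3_def by (simp only: Gamma_complex_of_real of_real_mult)
  qed
  moreover have "xi (1 + of_real r) = of_real (r * Zp * ((1 + r) / 2 * g2) * pi powr (- (1 + r) / 2))"
  proof -
    have "cnj (zeta (1 + of_real r)) = zeta (1 + of_real r)" using zeta_cnj[of "1 + of_real r"] by simp
    then have "zeta (1 + of_real r) = of_real Zp" by (simp add: Zp_def complex_eq_iff)
    then have "zeta_reg (1 + of_real r) = of_real (r * Zp)" using r by (simp add: zeta_reg_def)
    moreover have "1 + (1 + complex_of_real r) / 2 = of_real (1 + (1 + r) / 2)" "- (1 + complex_of_real r) / 2 = of_real (- (1 + r) / 2)" by simp_all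
    moreover have "complex_of_real pi powr of_real (- (1 + r) / 2) = of_real (pi powr (- (1 + r) / 2))" by (rule powr_of_real) simp
    ultimately show ?thesis unfolding xi_def g5[symmetric] by (simp only: Gamma_complex_of_real of_real_mult)
  qed
  ultimately show ?thesis by (simp only:)
qed

text \<open>The two sides agree on the real segment (- 1, 0), which has a limit point in the strip;
  the strip is chosen so that s and 1 - s both stay in Re > - 2.\<close>

theorem xi_reflect:
  assumes s: "- 2 < Re s" "Re s < 3"
  shows "xi (1 - s) = xi s"
proof -
  let ?S = "{s. - 2 < Re s} \<inter> {s. Re s < 3}"
  let ?U = "complex_of_real ` {- 1<..<0}"
  have "xi s - xi (1 - s) = 0"
  proof (rule analytic_continuation[of "\<lambda>s. xi s - xi (1 - s)" ?S ?U "of_real (- 1 / 2)"])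
    have "(\<lambda>s. xi (1 - s)) holomorphic_on ?S"
      by (rule holomorphic_on_compose_gen[OF _ holomorphic_xi, unfolded o_def]) (auto intro!: holomorphic_intros)
    then show "(\<lambda>s. xi s - xi (1 - s)) holomorphic_on ?S"
      by (intro holomorphic_intros holomorphic_on_subset[OF holomorphic_xi]) auto
    show "open ?S" by (intro open_Int open_halfspace_Re_gt open_halfspace_Re_lt)
    show "connected ?S" by (intro convex_connected convex_Int convex_halfspace_Re_gt convex_halfspace_Re_lt)
    show "complex_of_real (- 1 / 2) islimpt ?U"
    proof (rule islimpt_isCont_image)
      show "(- 1 / 2 :: real) islimpt {- 1<..<0}" by (intro interior_limit_point) simp
      show "\<forall>\<^sub>F y in at (- 1 / 2). complex_of_real y \<noteq> of_real (- 1 / 2)"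
        unfolding eventually_at_filter of_real_eq_iff by simp
    qed (intro continuous_intros)
    show "xi z - xi (1 - z) = 0" if z: "z \<in> ?U" for z
    proof -
      obtain x where x: "z = of_real x" "- 1 < x" "x < 0" using z by auto
      have "xi (- of_real (- x)) = xi (1 + of_real (- x))"
        by (rule xi_reflect_real) (use x in auto)
      then show ?thesis using x by simp
    qed
  qed (use s in auto)
  then show ?thesis by simp
qed

lemma xi_cnj: "xi (cnj s) = cnj (xi s)"
proof -
  have "cnj (of_real pi powr (- s / 2)) = of_real pi powr (- cnj s / 2)"
    by (subst cnj_powr) (auto)
  moreover have "1 + cnj s / 2 = cnj (1 + s / 2)" by simp
  ultimately show ?thesis unfolding xi_def by (simp only: zeta_reg_cnj cnj_Gamma complex_cnj_mult)
qed

section \<open>Zeta in the half-plane \<open>Re s > 1 / 2\<close> under the Riemann hypothesis\<close>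

text \<open>The hypothesis speaks of the open strip only; the line Re s = 1 and the region beyond it
  come from the Euler product.\<close>

lemma zeta_reg_nonzero:
  assumes RH: riemann_hypothesis and s: "Re s > 1 / 2"
  shows "zeta_reg s \<noteq> 0"
proof (cases "Re s \<ge> 1")
  case False
  then have "zeta s \<noteq> 0" using RH s unfolding riemann_hypothesis_def by force
  then show ?thesis using False by (auto simp: zeta_reg_def)
qed (rule zeta_reg_nonzero_Re_ge_1)

lemma Gamma_xi_arg: "Re s > - 2 \<Longrightarrow> 1 + s / 2 \<notin> \<int>\<^sub>\<le>\<^sub>0"
  by (auto elim!: nonpos_Ints_cases simp: complex_eq_iff)

lemma Gamma_xi_nonzero: "Re s > - 2 \<Longrightarrow> Gamma (1 + s / 2) \<noteq> 0"
  using Gamma_xi_arg[of s] by (simp only: Gamma_eq_zero_iff not_False_eq_True)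

lemma xi_nonzero: "riemann_hypothesis \<Longrightarrow> Re s > 1 / 2 \<Longrightarrow> xi s \<noteq> 0"
  using zeta_reg_nonzero[of s] Gamma_xi_nonzero[of s] by (simp add: xi_def)

text \<open>A consequence of the Borel-Caratheodory theorem: the Schwarz lemma is applied to
  \<open>l / (2 A - l)\<close> for a logarithm \<open>l\<close> of \<open>f / f w\<close>, where \<open>Re l \<le> A\<close>.\<close>

lemma nonvanishing_lower_bound:
  fixes f :: "complex \<Rightarrow> complex"
  assumes hol: "f holomorphic_on ball w r" and nz: "\<And>z. z \<in> ball w r \<Longrightarrow> f z \<noteq> 0"
    and M: "\<And>z. z \<in> ball w r \<Longrightarrow> norm (f z) \<le> M" "norm (f w) < M" and z: "z \<in> ball w r"
  shows "norm (f w) * exp (- (2 * ln (M / norm (f w)) * dist w z / (r - dist w z))) \<le> norm (f z)"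
proof -
  have r: "r > 0" using z by (metis dist_nz mem_ball order_less_le_trans zero_le_dist not_less le_less_trans)
  obtain g where g: "g holomorphic_on ball w r" "\<And>z. z \<in> ball w r \<Longrightarrow> f z = exp (g z)"
    using contractible_imp_holomorphic_log[OF hol convex_imp_contractible[OF convex_ball] nz] by blast
  have w: "w \<in> ball w r" using r by simp
  define A where "A = ln (M / norm (f w))"
  have fw: "norm (f w) > 0" using nz[OF w] by simp
  have M0: "M > 0" using M(2) fw by linarith
  have A: "A > 0" unfolding A_def using M(2) fw by (intro ln_gt_zero) (simp add: field_simps)
  define l where "l x = g (w + of_real r * x) - g w" for x
  have inb: "w + of_real r * x \<in> ball w r" if "norm x < 1" for x
    using that r by (simp add: dist_norm norm_mult)
  have holl: "l holomorphic_on ball 0 1"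
    unfolding l_def
    by (intro holomorphic_intros holomorphic_on_compose_gen[OF _ g(1), unfolded o_def])
       (use inb in \<open>auto intro!: holomorphic_intros\<close>)
  have fl: "f (w + of_real r * x) = f w * exp (l x)" if "norm x < 1" for x
    using g(2)[OF inb[OF that]] g(2)[OF w] by (simp add: l_def exp_diff)
  have Rel: "Re (l x) \<le> A" if "norm x < 1" for x
  proof -
    have "norm (f w) * exp (Re (l x)) \<le> M"
      using M(1)[OF inb[OF that]] unfolding fl[OF that] by (simp add: norm_mult)
    then have "exp (Re (l x)) \<le> M / norm (f w)" using fw by (simp add: field_simps)
    then have "ln (exp (Re (l x))) \<le> A" unfolding A_def using fw M0 by (subst ln_le_cancel_iff) auto
    then show ?thesis by simp
  qed
  define p where "p x = l x / (2 * of_real A - l x)" for x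
  have den: "2 * of_real A - l x \<noteq> 0" if "norm x < 1" for x
  proof
    assume "2 * of_real A - l x = 0"
    then have "Re (2 * of_real A - l x) = 0" by simp
    then show False using Rel[OF that] A by simp
  qed
  have pn: "norm (p x) < 1" if "norm x < 1" for x
  proof -
    have "(norm (l x))\<^sup>2 < (norm (2 * of_real A - l x))\<^sup>2"
    proof -
      have "(norm (2 * of_real A - l x))\<^sup>2 - (norm (l x))\<^sup>2 = 4 * A * (A - Re (l x))"
        unfolding cmod_power2 by (simp add: power2_eq_square algebra_simps)
      \<comment> \<open>The Schwarz lemma asks for |p| strictly below 1, hence the strict
        inequality: equality inside the disc would make exp l constant by the maximum principle,
        against l 0 = 0 and A > 0.\<close>
      moreover have "Re (l x) < A"
      proof (rule ccontr)
        assume "\<not> Re (l x) < A"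
        then have eq: "Re (l x) = A" using Rel[OF that] by simp
        have "(\<lambda>x. exp (l x)) constant_on ball 0 1"
        proof (rule maximum_modulus_principle[of _ "ball 0 1" "ball 0 1" x])
          show "(\<lambda>x. exp (l x)) holomorphic_on ball 0 1" by (intro holomorphic_intros holl)
        qed (use that eq Rel in auto)
        then obtain c where "\<And>y. y \<in> ball 0 1 \<Longrightarrow> exp (l y) = c" unfolding constant_on_def by blast
        from this[of x] this[of 0] that have "exp (l x) = exp (l 0)" by simp
        then have "norm (exp (l x)) = norm (exp (l 0))" by simp
        then have "Re (l x) = Re (l 0)" by simp
        then show False using eq A by (simp add: l_def)
      qed
      ultimately show ?thesis using A by (smt (verit) mult_pos_pos)
    qed
    then have "norm (l x) < norm (2 * of_real A - l x)" by (simp add: power2_less_imp_less)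
    then show ?thesis using den[OF that] by (simp add: p_def norm_divide)
  qed
  define x where "x = (z - w) / of_real r"
  have x: "norm x = dist w z / r" "norm x < 1" "w + of_real r * x = z"
    using z r by (simp_all add: x_def dist_norm norm_divide norm_minus_commute)
  have "norm (p x) \<le> norm x"
  proof (rule Schwarz_Lemma(1))
    show "p holomorphic_on ball 0 1" unfolding p_def by (intro holomorphic_intros holl den) auto
    show "p 0 = 0" by (simp add: p_def l_def)
  qed (use pn x in auto)
  have lp: "l x = 2 * of_real A * p x / (1 + p x)"
  proof -
    have "1 + p x = 2 * of_real A / (2 * of_real A - l x)"
      using den[OF x(2)] by (simp add: p_def divide_simps)
    then show ?thesis using den[OF x(2)] A by (simp add: p_def)
  qed
  have "norm (l x) = 2 * A * norm (p x) / norm (1 + p x)"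
    unfolding lp norm_divide norm_mult using A by simp
  also have "\<dots> \<le> 2 * A * norm x / (1 - norm x)"
  proof (rule frac_le)
    show "1 - norm x \<le> norm (1 + p x)"
      using \<open>norm (p x) \<le> norm x\<close> norm_triangle_ineq2[of 1 "- p x"] by simp
    show "2 * A * norm (p x) \<le> 2 * A * norm x"
      using A \<open>norm (p x) \<le> norm x\<close> by (intro mult_left_mono) auto
    show "0 \<le> 2 * A * norm x" using A by simp
    show "0 < 1 - norm x" using x(2) by simp
  qed
  also have "\<dots> = 2 * A * dist w z / (r - dist w z)"
  proof -
    have dz: "dist w z = r * norm x" using r x by simp
    have "2 * A * norm x / (1 - norm x) = (r * (2 * A * norm x)) / (r * (1 - norm x))" using r by simp
    then show ?thesis unfolding dz by (simp add: algebra_simps)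
  qed
  finally have "- (2 * A * dist w z / (r - dist w z)) \<le> Re (l x)"
    using abs_Re_le_cmod[of "l x"] by linarith
  then have "norm (f w) * exp (- (2 * A * dist w z / (r - dist w z))) \<le> norm (f w) * exp (Re (l x))"
    by (intro mult_left_mono) auto
  also have "\<dots> = norm (f z)" using fl[OF x(2)] x(3) by (simp add: norm_mult)
  finally show ?thesis by (simp add: A_def)
qed

lemma zeta_reg_Re_ge_2:
  assumes "Re s \<ge> 2"
  shows "norm (s - 1) / 3 \<le> norm (zeta_reg s)" "norm (zeta_reg s) \<le> 5 / 3 * norm (s - 1)"
proof -
  have "zeta_reg s = (s - 1) * zeta s" using assms by (auto simp: zeta_reg_def)
  then show "norm (s - 1) / 3 \<le> norm (zeta_reg s)" "norm (zeta_reg s) \<le> 5 / 3 * norm (s - 1)"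
    using norm_zeta_Re_ge_2[OF assms] mult_left_mono[of "1/3" "norm (zeta s)" "norm (s - 1)"]
      mult_left_mono[of "norm (zeta s)" "5/3" "norm (s - 1)"] by (auto simp: norm_mult mult.commute)
qed

text \<open>The non-vanishing bound on discs of radius 3/2 about 2 + i t, which stay in Re > 1/2,
  compared with the centre, where |\<zeta>| is at least 1/3. The exponent grows like 1 / a, which is
  harmless: the result only has to be polynomial.\<close>

lemma inverse_zeta_reg_growth:
  assumes RH: riemann_hypothesis and a: "0 < a"
  shows "\<exists>N. \<forall>s. Re s \<ge> 1 / 2 + a \<longrightarrow> 1 \<le> 3 * (norm s + 5) ^ N * norm (zeta_reg s)"
proof -
  define n where "n = nat \<lceil>3 / a\<rceil>"
  have n: "3 / a \<le> real n" using a by (simp add: n_def)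
  show ?thesis
  proof (intro exI[of _ "5 * n"] allI impI)
    fix s assume s: "Re s \<ge> 1 / 2 + a"
    define m where "m = norm s + 5"
    have m: "m \<ge> 5" by (simp add: m_def)
    show "1 \<le> 3 * (norm s + 5) ^ (5 * n) * norm (zeta_reg s)"
    proof (cases "Re s \<ge> 2")
      case True
      have "1 \<le> norm (s - 1)" using True abs_Re_le_cmod[of "s - 1"] by simp
      then have "1 / 3 \<le> norm (zeta_reg s)" using zeta_reg_Re_ge_2(1)[OF True] by simp
      moreover have "1 \<le> m ^ (5 * n)" using m by (intro one_le_power) auto
      ultimately have "3 * 1 * (1 / 3) \<le> 3 * m ^ (5 * n) * norm (zeta_reg s)"
        by (intro mult_mono) auto
      then show ?thesis by (simp add: m_def)
    next
      case False
      define w where "w = Complex 2 (Im s)"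
      define M where "M = 4 * m ^ 3"
      define d where "d = dist w s"
      have d: "d = 2 - Re s" using False by (simp add: d_def w_def dist_norm cmod_def)
      have "norm w \<le> norm s + 2"
        using cmod_le[of w] abs_Im_le_cmod[of s] by (simp add: w_def)
      then have zn: "norm z \<le> norm s + 4" if "z \<in> ball w (3/2)" for z
        using that norm_triangle_ineq[of w "z - w"] by (simp add: dist_norm norm_minus_commute)
      have Rez: "Re z > 1 / 2" if "z \<in> ball w (3/2)" for z
        using that abs_Re_le_cmod[of "w - z"] by (simp add: dist_norm w_def)
      have MM: "norm (zeta_reg z) \<le> M" if "z \<in> ball w (3/2)" for z
      proof -
        have "norm (zeta_reg z) \<le> 4 * (1 + norm z) ^ 3" using Rez[OF that] by (intro zeta_reg_growth) auto
        also have "\<dots> \<le> M" unfolding M_def m_def using zn[OF that] by (intro mult_left_mono power_mono) auto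
        finally show ?thesis .
      qed
      have w1: "1 \<le> norm (w - 1)" using abs_Re_le_cmod[of "w - 1"] by (simp add: w_def)
      have Zw: "1 / 3 \<le> norm (zeta_reg w)" using zeta_reg_Re_ge_2(1)[of w] w1 by (simp add: w_def)
      have "norm (zeta_reg w) \<le> 5 / 3 * norm (w - 1)" by (rule zeta_reg_Re_ge_2) (simp add: w_def)
      also have "\<dots> < 4 * m"
        using norm_triangle_ineq4[of w 1] \<open>norm w \<le> norm s + 2\<close> norm_ge_zero[of s]
          unfolding m_def norm_one by argo
      also have "\<dots> \<le> M" unfolding M_def using power_increasing[of 1 3 m] m by simp
      finally have wM: "norm (zeta_reg w) < M" .
      define A where "A = ln (M / norm (zeta_reg w))"
      have Zw0: "norm (zeta_reg w) > 0" using Zw by linarith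
      then have A: "A > 0" unfolding A_def using wM by (intro ln_gt_zero) (simp add: field_simps)
      have "norm (zeta_reg w) * exp (- (2 * ln (M / norm (zeta_reg w)) * dist w s / (3/2 - dist w s))) \<le> norm (zeta_reg s)"
      proof (rule nonvanishing_lower_bound[where M = M])
        show "zeta_reg holomorphic_on ball w (3/2)" by (rule holomorphic_on_subset[OF holomorphic_zeta_reg]) simp
        show "s \<in> ball w (3/2)" using d d_def s a by simp
      qed (use zeta_reg_nonzero[OF RH Rez] MM wM in auto)
      then have low: "norm (zeta_reg w) * exp (- (2 * A * d / (3/2 - d))) \<le> norm (zeta_reg s)"
        by (simp add: A_def d_def)
      \<comment> \<open>3/2 - d is the distance Re s - 1/2 \<ge> a, and d < 3/2, whence the choice
        of n.\<close>
      have "2 * A * d / (3/2 - d) \<le> 2 * A * (3/2) / a"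
        using A d s a False by (intro frac_le mult_left_mono) auto
      also have "\<dots> = 3 / a * A" by simp
      also have "\<dots> \<le> real n * A" using n A by (intro mult_right_mono) auto
      finally have "exp (- (real n * A)) \<le> exp (- (2 * A * d / (3/2 - d)))" by simp
      then have "1 / 3 * exp (- (real n * A)) \<le> norm (zeta_reg w) * exp (- (2 * A * d / (3/2 - d)))"
        using Zw by (intro mult_mono) auto
      with low have low2: "1 / 3 * exp (- (real n * A)) \<le> norm (zeta_reg s)" by linarith
      have "exp A = M / norm (zeta_reg w)" unfolding A_def using wM Zw0 order.strict_trans[OF Zw0 wM] by (intro exp_ln divide_pos_pos) auto
      also have "\<dots> \<le> M / (1 / 3)" using Zw m by (intro divide_left_mono) (auto simp: M_def)
      also have "\<dots> = 12 * m ^ 3" by (simp add: M_def)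
      also have "\<dots> \<le> m ^ 2 * m ^ 3"
      proof (intro mult_right_mono)
        have "5 ^ 2 \<le> m ^ 2" using m by (intro power_mono) auto
        then show "12 \<le> m ^ 2" by simp
      qed (use m in auto)
      also have "\<dots> = m ^ 5" by (simp flip: power_add)
      finally have "exp A ^ n \<le> (m ^ 5) ^ n" by (intro power_mono) auto
      then have en: "exp (real n * A) \<le> m ^ (5 * n)" by (simp add: exp_of_nat_mult power_mult)
      have "1 = 3 * (exp (real n * A) * (1 / 3 * exp (- (real n * A))))"
        by (simp add: exp_minus)
      also have "\<dots> \<le> 3 * (m ^ (5 * n) * norm (zeta_reg s))"
        using m by (intro mult_left_mono mult_mono en low2) auto
      finally show ?thesis by (simp add: m_def mult.assoc)
    qed
  qed
qed

text \<open>Each factor of the quotient is handled separately; the Gamma quotient is bounded because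
  its denominator lies to the right. The growth is therefore polynomial, as the Phragmen-Lindelof
  principle requires.\<close>

lemma xi_ratio_growth:
  assumes RH: riemann_hypothesis and a: "0 < a" "a < 1 / 4"
  shows "\<exists>C N. C > 0 \<and> (\<forall>s. Re s \<ge> 1 / 2 \<longrightarrow> norm (xi (s - of_real a) / xi (s + of_real a)) \<le> C * (norm s + 6) ^ N)"
proof -
  obtain N where N: "\<And>s. Re s \<ge> 1 / 2 + a \<Longrightarrow> 1 \<le> 3 * (norm s + 5) ^ N * norm (zeta_reg s)"
    using inverse_zeta_reg_growth[OF RH a(1)] by blast
  define C where "C = 12 * exp a * pi powr a"
  show ?thesis
  proof (intro exI[of _ C] exI[of _ "N + 3"] conjI allI impI)
    show "C > 0" by (simp add: C_def)
    fix s assume s: "Re s \<ge> 1 / 2"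
    define m where "m = norm s + 6"
    have na: "norm (s - of_real a) \<le> norm s + 1 / 4" "norm (s + of_real a) \<le> norm s + 1 / 4"
      using norm_triangle_ineq4[of s "of_real a"] norm_triangle_ineq[of s "of_real a"] a by auto
    have nz: "zeta_reg (s + of_real a) \<noteq> 0" by (rule zeta_reg_nonzero[OF RH]) (use s a in simp)
    have "norm (zeta_reg (s - of_real a)) \<le> 4 * (1 + norm (s - of_real a)) ^ 3"
      by (rule zeta_reg_growth) (use s a in simp)
    also have "\<dots> \<le> 4 * m ^ 3" using na by (intro mult_left_mono power_mono) (auto simp: m_def)
    finally have 1: "norm (zeta_reg (s - of_real a)) \<le> 4 * m ^ 3" .
    have "1 \<le> 3 * (norm (s + of_real a) + 5) ^ N * norm (zeta_reg (s + of_real a))"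
      by (rule N) (use s in simp)
    also have "\<dots> \<le> 3 * m ^ N * norm (zeta_reg (s + of_real a))"
      using na by (intro mult_right_mono mult_left_mono power_mono) (auto simp: m_def)
    finally have 2: "1 / norm (zeta_reg (s + of_real a)) \<le> 3 * m ^ N" using nz by (simp add: field_simps)
    have 3: "norm (Gamma (1 + (s - of_real a) / 2)) / norm (Gamma (1 + (s + of_real a) / 2)) \<le> exp a"
    proof -
      have "1 + (s - of_real a) / 2 = Complex (1 + (Re s - a) / 2) (Im s / 2)"
        "1 + (s + of_real a) / 2 = Complex (1 + (Re s + a) / 2) (Im s / 2)"
        by (simp_all add: complex_eq_iff)
      moreover have "norm (Gamma (Complex (1 + (Re s - a) / 2) (Im s / 2))) \<le>
          exp ((1 + (Re s + a) / 2) - (1 + (Re s - a) / 2)) * norm (Gamma (Complex (1 + (Re s + a) / 2) (Im s / 2)))"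
        by (rule norm_Gamma_ratio_ge) (use s a in auto)
      moreover have "(1 + (Re s + a) / 2) - (1 + (Re s - a) / 2) = a" by (simp add: field_simps)
      ultimately show ?thesis
        using norm_Gamma_pos[of "1 + (Re s + a) / 2" "Im s / 2"] s a by (simp add: divide_le_eq)
    qed
    have 4: "norm (of_real pi powr (- (s - of_real a) / 2)) / norm (of_real pi powr (- (s + of_real a) / 2)) = pi powr a"
      by (simp add: norm_powr_real_powr flip: powr_diff) (simp add: field_simps)
    have "norm (xi (s - of_real a) / xi (s + of_real a)) =
        norm (zeta_reg (s - of_real a)) * (1 / norm (zeta_reg (s + of_real a))) *
        (norm (Gamma (1 + (s - of_real a) / 2)) / norm (Gamma (1 + (s + of_real a) / 2))) *
        (norm (of_real pi powr (- (s - of_real a) / 2)) / norm (of_real pi powr (- (s + of_real a) / 2)))"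
      by (simp add: xi_def norm_divide norm_mult)
    also have "\<dots> \<le> (4 * m ^ 3) * (3 * m ^ N) * exp a * pi powr a"
      unfolding 4 by (intro mult_right_mono mult_mono 1 2 3) (auto simp: m_def)
    also have "\<dots> = C * m ^ (N + 3)" by (simp add: C_def power_add)
    finally show "norm (xi (s - of_real a) / xi (s + of_real a)) \<le> C * (norm s + 6) ^ (N + 3)"
      by (simp add: m_def)
  qed
qed

text \<open>The Phragmen-Lindelof principle: dividing by a power of \<open>1 + \<epsilon> (s - 1 / 2)\<close>, whose modulus
  is at least \<open>1\<close> on the half-plane, forces decay at infinity.\<close>

lemma halfplane_bound:
  fixes R :: "complex \<Rightarrow> complex"
  assumes S: "open S" "{s. Re s \<ge> 1 / 2} \<subseteq> S" and hol: "R holomorphic_on S"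
    and line: "\<And>s. Re s = 1 / 2 \<Longrightarrow> norm (R s) \<le> 1"
    and growth: "\<And>s. Re s \<ge> 1 / 2 \<Longrightarrow> norm (R s) \<le> C * (norm s + 6) ^ N" and C: "C > 0"
    and s: "Re s \<ge> 1 / 2"
  shows "norm (R s) \<le> 1"
proof -
  have eps: "norm (R s) \<le> norm (1 + of_real e * (s - 1 / 2)) ^ Suc N" if e: "e > 0" for e
  proof -
    \<comment> \<open>The radius is so large that C (2 \<rho>)^N / (e \<rho>)^(N + 1) is at most 1
      on the arc; the value 7 gives norm z + 6 \<le> 2 \<rho> there, and s lies in the
      half-disc.\<close>
    define \<rho> where "\<rho> = max (max 7 (norm (s - 1 / 2))) (C * 2 ^ N / e ^ Suc N)"
    have \<rho>: "\<rho> \<ge> 7" "norm (s - 1 / 2) \<le> \<rho>" "C * 2 ^ N / e ^ Suc N \<le> \<rho>" by (auto simp: \<rho>_def)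
    define K where "K = {z. Re z \<ge> 1 / 2} \<inter> cball (1 / 2) \<rho>"
    define \<Phi> where "\<Phi> z = R z / (1 + of_real e * (z - 1 / 2)) ^ Suc N" for z
    have den: "norm (1 + of_real e * (z - 1 / 2)) \<ge> 1" "norm (1 + of_real e * (z - 1 / 2)) \<ge> e * norm (z - 1 / 2)"
      if "Re z \<ge> 1 / 2" for z
    proof -
      define w where "w = of_real e * (z - 1 / 2)"
      have w: "Re w \<ge> 0" using that e by (simp add: w_def)
      have "1 \<le> norm (1 + w)" using w complex_Re_le_cmod[of "1 + w"] by simp
      then show "norm (1 + of_real e * (z - 1 / 2)) \<ge> 1" by (simp add: w_def)
      have "norm w \<le> norm (1 + w)"
        unfolding cmod_def using w by (auto intro!: power_mono)
      then show "norm (1 + of_real e * (z - 1 / 2)) \<ge> e * norm (z - 1 / 2)"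
        using e by (simp add: w_def norm_mult)
    qed
    have den0: "1 + of_real e * (z - 1 / 2) \<noteq> 0" if "Re z \<ge> 1 / 2" for z
      using den(1)[OF that] by auto
    have Kcl: "closed K" unfolding K_def by (intro closed_Int closed_halfspace_Re_ge closed_cball)
    have "norm (\<Phi> s) \<le> 1"
    proof (rule maximum_modulus_frontier[of \<Phi> K])
      have h: "\<Phi> holomorphic_on K" unfolding \<Phi>_def K_def
        by (intro holomorphic_intros holomorphic_on_subset[OF hol]) (use S den0 in auto)
      then show "\<Phi> holomorphic_on interior K" by (rule holomorphic_on_subset) (rule interior_subset)
      show "continuous_on (closure K) \<Phi>"
        using h Kcl by (simp add: closure_closed holomorphic_on_imp_continuous_on)
      show "bounded K" unfolding K_def by (intro bounded_Int) auto
      show "s \<in> K" using s \<rho> by (simp add: K_def dist_norm norm_minus_commute)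
      fix z assume z: "z \<in> frontier K"
      have zK: "z \<in> K" using z Kcl frontier_subset_closed by blast
      then have Rez: "Re z \<ge> 1 / 2" by (simp add: K_def)
      have "z \<notin> {z. Re z > 1 / 2} \<inter> ball (1 / 2) \<rho>"
      proof
        assume "z \<in> {z. Re z > 1 / 2} \<inter> ball (1 / 2) \<rho>"
        moreover have "{z. Re z > 1 / 2} \<inter> ball (1 / 2) \<rho> \<subseteq> interior K"
        proof (rule interior_maximal)
          show "open ({z. Re z > 1 / 2} \<inter> ball (1 / 2) \<rho>)"
            by (intro open_Int open_halfspace_Re_gt open_ball)
        qed (auto simp: K_def)
        ultimately show False using z by (auto simp: frontier_def)
      qed
      then consider "Re z = 1 / 2" | "dist (1 / 2) z = \<rho>" using zK by (force simp: K_def)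
      then show "norm (\<Phi> z) \<le> 1"
      proof cases
        case 1
        have "norm (\<Phi> z) \<le> 1 / 1 ^ Suc N"
          unfolding \<Phi>_def norm_divide norm_power using den(1)[OF Rez] line[OF 1]
          by (intro frac_le power_mono) auto
        then show ?thesis by simp
      next
        case 2
        then have n: "norm (z - 1 / 2) = \<rho>" by (simp add: dist_norm norm_minus_commute)
        have "norm z \<le> \<rho> + 1 / 2" using norm_triangle_ineq[of "z - 1 / 2" "1 / 2"] n by simp
        then have "norm z + 6 \<le> 2 * \<rho>" using \<rho> by simp
        then have "C * (norm z + 6) ^ N \<le> C * (2 * \<rho>) ^ N" using C by (intro mult_left_mono power_mono) auto
        with growth[OF Rez] have "norm (R z) \<le> C * (2 * \<rho>) ^ N" by linarith
        moreover have "(e * \<rho>) ^ Suc N \<le> norm (1 + of_real e * (z - 1 / 2)) ^ Suc N"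
          using den(2)[OF Rez] e \<rho> n by (intro power_mono) auto
        ultimately have "norm (\<Phi> z) \<le> C * (2 * \<rho>) ^ N / (e * \<rho>) ^ Suc N"
          unfolding \<Phi>_def norm_divide norm_power using e \<rho> C by (intro frac_le) auto
        also have "\<dots> = (C * 2 ^ N / e ^ Suc N) / \<rho>"
          using e \<rho> by (simp add: power_mult_distrib field_simps)
        also have "\<dots> \<le> \<rho> / \<rho>" using \<rho>(1) by (intro divide_right_mono \<rho>(3)) auto
        also have "\<rho> / \<rho> = 1" using \<rho>(1) by simp
        finally show ?thesis .
      qed
    qed
    then have "norm (R s) / norm (1 + of_real e * (s - 1 / 2)) ^ Suc N \<le> 1"
      unfolding \<Phi>_def norm_divide norm_power .
    moreover have "norm (1 + of_real e * (s - 1 / 2)) ^ Suc N > 0"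
      using den(1)[OF s] by (intro zero_less_power) linarith
    ultimately show ?thesis by (subst (asm) divide_le_eq_1_pos)
  qed
  have "((\<lambda>e. norm (1 + of_real e * (s - 1 / 2)) ^ Suc N) \<longlongrightarrow> norm (1 + of_real 0 * (s - 1 / 2)) ^ Suc N) (at_right 0)"
    by (intro tendsto_intros)
  then have "((\<lambda>e. norm (1 + of_real e * (s - 1 / 2)) ^ Suc N) \<longlongrightarrow> 1) (at_right 0)" by simp
  then show ?thesis
  proof (rule tendsto_lowerbound)
    show "\<forall>\<^sub>F e in at_right 0. norm (R s) \<le> norm (1 + of_real e * (s - 1 / 2)) ^ Suc N"
      using eventually_at_right_less[of 0] by eventually_elim (rule eps)
  qed simp
qed

text \<open>On the critical line the conjugate of s - a is 1 - (s + a), so by reflection and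
  conjugation the quotient \<xi>(s - a) / \<xi>(s + a) has modulus 1 there. It is holomorphic to the
  right, where the denominator has no zeros, and of polynomial growth.\<close>

lemma xi_shift_le:
  assumes RH: riemann_hypothesis and a: "0 < a" "a < 1 / 4" and s: "Re s \<ge> 1 / 2"
  shows "norm (xi (s - of_real a)) \<le> norm (xi (s + of_real a))"
proof -
  obtain C N where C: "C > 0" "\<And>s. Re s \<ge> 1 / 2 \<Longrightarrow> norm (xi (s - of_real a) / xi (s + of_real a)) \<le> C * (norm s + 6) ^ N"
    using xi_ratio_growth[OF RH a] by blast
  let ?S = "{s. 1 / 2 - a < Re s}"
  have nz: "xi (s + of_real a) \<noteq> 0" if "s \<in> ?S" for s
    by (rule xi_nonzero[OF RH]) (use that in simp)
  have "norm (xi (s - of_real a) / xi (s + of_real a)) \<le> 1"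
  proof (rule halfplane_bound[where S = ?S and s = s and R = "\<lambda>s. xi (s - of_real a) / xi (s + of_real a)"])
    show "open ?S" by (rule open_halfspace_Re_gt)
    have "(\<lambda>s. xi (s - of_real a)) holomorphic_on ?S" "(\<lambda>s. xi (s + of_real a)) holomorphic_on ?S"
      by (rule holomorphic_on_compose_gen[OF _ holomorphic_xi, unfolded o_def];
          use a in \<open>auto intro!: holomorphic_intros\<close>)+
    then show "(\<lambda>s. xi (s - of_real a) / xi (s + of_real a)) holomorphic_on ?S"
      using nz by (intro holomorphic_intros) auto
    fix z assume z: "Re z = 1 / 2"
    have "cnj (z - of_real a) = 1 - (z + of_real a)" using z by (simp add: complex_eq_iff)
    then have "cnj (xi (z - of_real a)) = xi (1 - (z + of_real a))" by (metis xi_cnj)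
    also have "\<dots> = xi (z + of_real a)" by (rule xi_reflect) (use z a in auto)
    finally have "cnj (xi (z - of_real a)) = xi (z + of_real a)" .
    then have "norm (xi (z - of_real a)) = norm (xi (z + of_real a))" by (metis complex_mod_cnj)
    then show "norm (xi (z - of_real a) / xi (z + of_real a)) \<le> 1" by (simp add: norm_divide)
  qed (use C a s in auto)
  then show ?thesis using nz[of s] s a by (simp add: norm_divide divide_le_eq_1)
qed

text \<open>Midpoint and half-distance of the two abscissas go into \<open>xi_shift_le\<close>; the
  bound 1/2 on the distance matches a < 1/4.\<close>

lemma xi_mono:
  assumes RH: riemann_hypothesis and x: "1 / 2 < x" "x \<le> x'" "x' < x + 1 / 2"
  shows "norm (xi (Complex x y)) \<le> norm (xi (Complex x' y))"
proof (cases "x = x'")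
  case False
  define a where "a = (x' - x) / 2"
  define s where "s = Complex ((x + x') / 2) y"
  have "norm (xi (s - of_real a)) \<le> norm (xi (s + of_real a))"
    by (rule xi_shift_le[OF RH]) (use x False in \<open>auto simp: a_def s_def\<close>)
  moreover have "s - of_real a = Complex x y" "s + of_real a = Complex x' y"
    by (auto simp: s_def a_def complex_eq_iff field_simps)
  ultimately show ?thesis by simp
qed simp

text \<open>Since |\<xi>| increases to the right, its logarithmic derivative has nonnegative real
  part. Splitting off the Gamma factor costs half of Re Digamma, and the power of pi only
  helps.\<close>

lemma zeta_reg_logderiv_ge:
  assumes RH: riemann_hypothesis and s: "1 / 2 < Re s" "Re s \<le> 2"
  shows "Re (deriv zeta_reg s / zeta_reg s) \<ge> - ln (\<bar>Im s\<bar> + 3) / 2"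
proof -
  define x where "x = Re s"
  define y where "y = Im s"
  have sc: "s = Complex x y" by (simp add: x_def y_def)
  have nz: "zeta_reg s \<noteq> 0" "Gamma (1 + s / 2) \<noteq> 0" "xi s \<noteq> 0" "of_real pi powr (- s / 2) \<noteq> (0 :: complex)"
    using zeta_reg_nonzero[OF RH] Gamma_xi_nonzero xi_nonzero[OF RH] s by auto
  define D where "D = deriv zeta_reg s / zeta_reg s + Digamma (1 + s / 2) / 2 - of_real (ln pi) / 2"
  have dZ: "(zeta_reg has_field_derivative deriv zeta_reg s) (at s)"
    by (rule field_differentiable_derivI[OF zeta_reg_differentiable])
  have dG: "((\<lambda>s. Gamma (1 + s / 2)) has_field_derivative (Gamma (1 + s / 2) * Digamma (1 + s / 2)) * (1 / 2)) (at s)"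
    by (rule DERIV_chain2[OF has_field_derivative_Gamma]) (use s Gamma_xi_arg in \<open>auto intro!: derivative_eq_intros\<close>)
  have dP: "((\<lambda>s. of_real pi powr (- s / 2)) has_field_derivative (Ln (of_real pi) * of_real pi powr (- s / 2)) * (- 1 / 2)) (at s)"
    by (rule DERIV_chain2[OF has_field_derivative_powr_right]) (auto intro!: derivative_eq_intros)
  have "(xi has_field_derivative xi s * D) (at s)"
    unfolding xi_def
    by (rule DERIV_cong[OF DERIV_mult[OF DERIV_mult[OF dZ dG] dP]])
       (use nz in \<open>simp add: D_def Ln_of_real field_simps\<close>)
  then have der: "((\<lambda>x. ln (norm (xi (Complex x y)))) has_real_derivative Re D) (at x)"
    using has_real_derivative_ln_norm[of xi "xi s * D" x y] nz by (simp add: sc)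
  have "Re D \<ge> 0"
  proof (rule ccontr)
    assume "\<not> Re D \<ge> 0"
    then have "Re D < 0" by simp
    from DERIV_neg_dec_right[OF der this] obtain d where d: "d > 0"
      "\<And>h. h > 0 \<Longrightarrow> h < d \<Longrightarrow> ln (norm (xi (Complex (x + h) y))) < ln (norm (xi (Complex x y)))" by auto
    define h where "h = min (d / 2) (1 / 4)"
    have h: "h > 0" "h < d" "h < 1 / 2" using d(1) by (auto simp: h_def)
    have "norm (xi (Complex x y)) \<le> norm (xi (Complex (x + h) y))"
      by (rule xi_mono[OF RH]) (use s h in \<open>auto simp: x_def\<close>)
    moreover have "norm (xi (Complex x y)) > 0" using nz(3) by (simp add: sc)
    ultimately have "ln (norm (xi (Complex x y))) \<le> ln (norm (xi (Complex (x + h) y)))"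
      by (intro iffD2[OF ln_le_cancel_iff]) auto
    then show False using d(2)[OF h(1,2)] by simp
  qed
  moreover have "Re (Digamma (1 + s / 2)) \<le> ln (\<bar>Im s\<bar> + 3)"
    using Re_Digamma_le[of "1 + s / 2"] s by simp
  moreover have "ln pi \<ge> 0" using pi_gt3 by (intro ln_ge_zero) auto
  moreover have "Re D = Re (deriv zeta_reg s / zeta_reg s) + Re (Digamma (1 + s / 2)) / 2 - ln pi / 2"
    by (simp add: D_def)
  ultimately show ?thesis by linarith
qed

section \<open>From the one-sided bound to bounds for log |zeta|\<close>

lemma zeta_reg_logderiv_at_2:
  "\<exists>B. \<forall>t. norm (deriv zeta_reg (Complex 2 t) / zeta_reg (Complex 2 t)) \<le> B"
proof -
  define B where "B = Re (zeta (of_real (3 / 2)))"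
  have zB: "norm (zeta z) \<le> B" if "Re z \<ge> 3 / 2" for z
    unfolding B_def
  proof (rule norm_has_sum_le)
    show "((\<lambda>n. of_nat n powr (- z)) has_sum zeta z) {n. n > 0}" by (rule has_sum_zeta) (use that in simp)
    show "((\<lambda>n. real n powr (- (3 / 2))) has_sum Re (zeta (of_real (3 / 2)))) {n. n > 0}"
      by (rule has_sum_zeta_real) simp
  qed (use that in \<open>auto simp: norm_of_nat_powr intro!: powr_mono\<close>)
  show ?thesis
  proof (intro exI[of _ "1 + 6 * B"] allI)
    fix t
    define s where "s = Complex 2 t"
    have s1: "norm (s - 1) \<ge> 1" using abs_Re_le_cmod[of "s - 1"] by (simp add: s_def)
    have hol: "zeta holomorphic_on {s. Re s > 1}"
      by (rule holomorphic_on_subset[OF holomorphic_zeta]) auto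
    have Rez: "Re z \<ge> 3 / 2" if "z \<in> cball s (1 / 2)" for z
      using that abs_Re_le_cmod[of "s - z"] by (simp add: dist_norm s_def)
    have "norm ((deriv ^^ 1) zeta s) \<le> fact 1 * B / (1 / 2) ^ 1"
    proof (rule Cauchy_inequality)
      have "zeta holomorphic_on cball s (1 / 2)"
        by (rule holomorphic_on_subset[OF hol]) (use Rez in force)
      then show "zeta holomorphic_on ball s (1 / 2)" "continuous_on (cball s (1 / 2)) zeta"
        by (auto intro: holomorphic_on_subset holomorphic_on_imp_continuous_on ball_subset_cball[THEN subsetD])
      fix x assume "norm (s - x) = 1 / 2"
      then show "norm (zeta x) \<le> B" by (intro zB Rez) (simp add: dist_norm)
    qed simp
    then have d: "norm (deriv zeta s) \<le> 2 * B" by simp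
    have dz: "(zeta has_field_derivative deriv zeta s) (at s)"
      by (rule field_differentiable_derivI, rule holomorphic_on_imp_differentiable_at[OF hol])
         (auto simp: s_def open_halfspace_Re_gt)
    have "deriv zeta_reg s = deriv (\<lambda>s. (s - 1) * zeta s) s"
    proof (rule deriv_cong_ev)
      have "\<forall>\<^sub>F z in nhds s. z \<in> - {1}" by (rule eventually_nhds_in_open) (auto simp: s_def complex_eq_iff)
      then show "\<forall>\<^sub>F z in nhds s. zeta_reg z = (z - 1) * zeta z" by eventually_elim (simp add: zeta_reg_def)
    qed simp
    also have "\<dots> = zeta s + (s - 1) * deriv zeta s"
      by (rule DERIV_imp_deriv) (auto intro!: derivative_eq_intros dz)
    finally have "deriv zeta_reg s / zeta_reg s = (zeta s + (s - 1) * deriv zeta s) / ((s - 1) * zeta s)"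
      using s1 by (auto simp: zeta_reg_def)
    also have "\<dots> = 1 / (s - 1) + deriv zeta s / zeta s"
      using s1 norm_zeta_Re_ge_2(1)[of s] by (auto simp: s_def divide_simps)
    finally have "norm (deriv zeta_reg s / zeta_reg s) \<le> norm (1 / (s - 1)) + norm (deriv zeta s / zeta s)"
      by (simp add: norm_triangle_ineq)
    also have "\<dots> \<le> 1 + 2 * B / (1 / 3)"
      unfolding norm_divide using s1 d norm_zeta_Re_ge_2(1)[of s]
      by (intro add_mono frac_le) (auto simp: s_def order_trans[OF norm_ge_zero d] divide_le_eq_1)
    finally show "norm (deriv zeta_reg (Complex 2 t) / zeta_reg (Complex 2 t)) \<le> 1 + 6 * B"
      by (simp add: s_def)
  qed
qed

text \<open>The Cayley transform \<open>q / (q + 2 L)\<close> turns the one-sided bound \<open>Re q \<ge> - L\<close> into a bound by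
  \<open>1\<close>, without losing a factor near the edge of the region. The three lines theorem then
  interpolates between this and the bound \<open>C / L\<close> on the right edge.\<close>

lemma cayley_three_lines:
  fixes q :: "complex \<Rightarrow> complex"
  assumes hol: "q holomorphic_on {s. Re s > 1 / 2}"
    and low: "\<And>s. 1 / 2 < Re s \<Longrightarrow> Re s \<le> 2 \<Longrightarrow> \<bar>Im s - t\<bar> \<le> 3 \<Longrightarrow> Re (q s) \<ge> - L"
    and right: "\<And>s. Re s = 2 \<Longrightarrow> norm (q s) \<le> C"
    and L: "C \<le> L powr (1 / 16)" "C \<ge> 0" "exp 1 \<le> L" and \<eta>: "0 < \<eta>" "\<eta> \<le> 3 / 2"
  shows "norm (q (Complex (1 / 2 + \<eta>) t)) \<le> 256 * L / (\<eta> * ln L)\<^sup>2"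
proof -
  define lam where "lam = ln L"
  have L1: "L \<ge> 1" using L(3) exp_ge_add_one_self[of 1] by linarith
  have lam: "lam \<ge> 1" using L(3) L1 ln_le_cancel_iff[of "exp 1" L] by (simp add: lam_def)
  have Le: "L = exp lam" using L1 by (simp add: lam_def)
  have CL: "C \<le> L"
  proof -
    have "L powr (1 / 16) \<le> L powr 1" using L1 by (intro powr_mono) auto
    then show ?thesis using L L1 by simp
  qed
  define s0 where "s0 = Complex (1 / 2 + \<eta>) t"
  define p where "p s = q s / (q s + 2 * of_real L)" for s
  \<comment> \<open>The linear term interpolates between the left and the right edge; the quadratic
    term, with real part (x^2 - v^2) / 9, pays for the horizontal edges at heights t - 3 and t + 3.
    At \<open>s0\<close> the factor is 1.\<close>
  define F where "F s = p s * exp (of_real (lam / 3) * (s - s0) + of_real (lam / 9) * (s - s0)\<^sup>2)" for s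
  \<comment> \<open>The left edge lies halfway between \<open>s0\<close> and the critical line, so
    the closed rectangle stays inside the domain.\<close>
  define K where "K = cbox (Complex (1 / 2 + \<eta> / 2) (t - 3)) (Complex 2 (t + 3))"
  have K: "1 / 2 < Re s" "Re s \<le> 2" "\<bar>Im s - t\<bar> \<le> 3" "Re s \<ge> 1 / 2 + \<eta> / 2" if "s \<in> K" for s
    using that \<eta> by (auto simp: K_def in_cbox_complex_iff)
  have pos: "Re (q s + 2 * of_real L) > 0" if "s \<in> K" for s
    using low[OF K(1-3)[OF that]] L1 by simp
  have den: "q s + 2 * of_real L \<noteq> 0" if "s \<in> K" for s
    using pos[OF that] by force
  have p1: "norm (p s) \<le> 1" if "s \<in> K" for s
  proof -
    have "(norm (q s))\<^sup>2 \<le> (norm (q s + 2 * of_real L))\<^sup>2"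
    proof -
      have *: "(a + 2 * L)\<^sup>2 + b\<^sup>2 = a\<^sup>2 + b\<^sup>2 + 4 * L * (a + L)" for a b :: real
        by (simp add: power2_eq_square algebra_simps)
      have "Re (q s + 2 * of_real L) = Re (q s) + 2 * L" "Im (q s + 2 * of_real L) = Im (q s)" by simp_all
      then have eq: "(norm (q s + 2 * of_real L))\<^sup>2 = (norm (q s))\<^sup>2 + 4 * L * (Re (q s) + L)"
        by (simp only: cmod_power2 *)
      have "0 \<le> 4 * L * (Re (q s) + L)" using low[OF K(1-3)[OF that]] L1 by simp
      then show ?thesis unfolding eq by (rule add_increasing2) simp
    qed
    then have "norm (q s) \<le> norm (q s + 2 * of_real L)" by (rule power2_le_imp_le) simp
    then show ?thesis using den[OF that] by (simp add: p_def norm_divide)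
  qed
  have Fn: "norm (F s) = norm (p s) * exp (lam * (x / 3 + (x\<^sup>2 - v\<^sup>2) / 9))"
    if "x = Re s - (1 / 2 + \<eta>)" "v = Im s - t" for s x v
  proof -
    have "s - s0 = Complex x v" unfolding that s0_def by (rule complex_eqI) simp_all
    moreover have "Re ((Complex x v)\<^sup>2) = x\<^sup>2 - v\<^sup>2" by (simp add: power2_eq_square)
    ultimately have "Re (of_real (lam / 3) * (s - s0) + of_real (lam / 9) * (s - s0)\<^sup>2) = lam / 3 * x + lam / 9 * (x\<^sup>2 - v\<^sup>2)"
      by (simp only: plus_complex.simps Re_of_real_mult complex.sel)
    also have "\<dots> = lam * (x / 3 + (x\<^sup>2 - v\<^sup>2) / 9)" by (simp add: field_simps)
    finally have "Re (of_real (lam / 3) * (s - s0) + of_real (lam / 9) * (s - s0)\<^sup>2) = lam * (x / 3 + (x\<^sup>2 - v\<^sup>2) / 9)" .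
    then show ?thesis by (simp add: F_def norm_mult norm_exp_eq_Re)
  qed
  \<comment> \<open>The common bound on all edges. In units of \<open>lam\<close> the exponent is at
    most - \<eta>/6 + \<eta>/24 = - \<eta>/8 on the left, - 15/16 + 3/4 on the right and 1/2 + 1/4 -
    1 on the horizontal edges; \<eta> \<le> 3/2 makes the first the worst.\<close>
  define y where "y = \<eta> * lam / 8"
  have y: "y > 0" using \<eta> lam by (simp add: y_def)
  have "norm (F s0) \<le> exp (- y)"
  proof (rule maximum_modulus_frontier[of F K])
    have "F holomorphic_on K" unfolding F_def p_def
      by (intro holomorphic_intros holomorphic_on_subset[OF hol] den) (use K in auto)
    then show "F holomorphic_on interior K" by (rule holomorphic_on_subset) (rule interior_subset)
    show "continuous_on (closure K) F"
      using \<open>F holomorphic_on K\<close> by (simp add: K_def closure_closed holomorphic_on_imp_continuous_on)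
    show "bounded K" unfolding K_def by (rule bounded_cbox)
    show "s0 \<in> K" using \<eta> by (simp add: K_def s0_def in_cbox_complex_iff)
    fix z assume z: "z \<in> frontier K"
    have zK: "z \<in> K" using z frontier_subset_closed[of K] by (auto simp: K_def)
    define x where "x = Re z - (1 / 2 + \<eta>)"
    define v where "v = Im z - t"
    have "z \<notin> box (Complex (1 / 2 + \<eta> / 2) (t - 3)) (Complex 2 (t + 3))"
      using z by (simp add: K_def frontier_def interior_cbox)
    then have "\<not> (1 / 2 + \<eta> / 2 < Re z \<and> Re z < 2 \<and> t - 3 < Im z \<and> Im z < t + 3)"
      by (simp add: in_box_complex_iff)
    then have "Re z = 1 / 2 + \<eta> / 2 \<or> Re z = 2 \<or> v = 3 \<or> v = - 3"
      using K(2-4)[OF zK] unfolding v_def by (smt (verit))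
    then consider "Re z = 1 / 2 + \<eta> / 2" | "Re z = 2" | "v\<^sup>2 = 9" by fastforce
    then show "norm (F z) \<le> exp (- y)"
    proof cases
      case 1
      then have x: "x = - \<eta> / 2" by (simp add: x_def field_simps)
      have "norm (F z) \<le> 1 * exp (lam * (x / 3 + (x\<^sup>2 - v\<^sup>2) / 9))"
        unfolding Fn[OF x_def v_def] by (intro mult_right_mono p1 zK) auto
      also have "\<dots> \<le> exp (- y)"
      proof -
        have "\<eta> * \<eta> \<le> 3 / 2 * \<eta>" using \<eta> by (intro mult_right_mono) auto
        moreover have "x\<^sup>2 = \<eta> * \<eta> / 4" by (simp add: x power2_eq_square)
        moreover have "X / 3 + (Y - V) / 9 \<le> - e / 8"
          if "W \<le> 3 / 2 * e" "Y = W / 4" "0 \<le> V" "X = - e / 2" for X Y V W e :: real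
          using that by (simp add: field_simps)
        ultimately have "x / 3 + (x\<^sup>2 - v\<^sup>2) / 9 \<le> - \<eta> / 8"
          using zero_le_power2[of v] x by blast
        then have "lam * (x / 3 + (x\<^sup>2 - v\<^sup>2) / 9) \<le> lam * (- \<eta> / 8)" using lam by (intro mult_left_mono) auto
        then show ?thesis by (simp add: y_def mult.commute)
      qed
      finally show ?thesis .
    next
      case 2
      then have x: "x = 3 / 2 - \<eta>" by (simp add: x_def)
      have "norm (p z) \<le> C / L"
      proof -
        have "norm (q z + 2 * of_real L) \<ge> 2 * L - C"
          using norm_triangle_ineq2[of "2 * of_real L" "- q z"] right[OF 2] L1 by (simp add: add.commute)
        then have "L \<le> norm (q z + 2 * of_real L)" using CL by linarith
        then show ?thesis unfolding p_def norm_divide using right[OF 2] L L1 by (intro frac_le) auto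
      qed
      also have "\<dots> \<le> exp (lam / 16) / exp lam"
        using L(1) L1 by (simp add: Le powr_def divide_right_mono)
      finally have pz: "norm (p z) \<le> exp (lam / 16 - lam)" by (simp only: exp_diff)
      have "x\<^sup>2 \<le> (3 / 2)\<^sup>2" using x \<eta> by (intro power_mono) auto
      then have "x\<^sup>2 \<le> 9 / 4" by (simp add: power2_eq_square)
      moreover have "X / 3 + (Y - V) / 9 \<le> 3 / 4" if "Y \<le> 9 / 4" "0 \<le> V" "X \<le> 3 / 2" for X Y V :: real
        using that by (simp add: field_simps)
      moreover have "x \<le> 3 / 2" using x \<eta> by simp
      ultimately have "x / 3 + (x\<^sup>2 - v\<^sup>2) / 9 \<le> 3 / 4"
        using zero_le_power2[of v] by blast
      then have "lam * (x / 3 + (x\<^sup>2 - v\<^sup>2) / 9) \<le> lam * (3 / 4)" using lam by (intro mult_left_mono) auto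
      then have "norm (F z) \<le> exp (lam / 16 - lam) * exp (lam * (3 / 4))"
        unfolding Fn[OF x_def v_def] by (intro mult_mono pz) auto
      also have "\<dots> = exp (- (lam * (3 / 16)))" by (simp flip: exp_add)
      also have "\<dots> \<le> exp (- y)" using lam \<eta> mult_right_mono[of \<eta> "3/2" lam] by (simp add: y_def)
      finally show ?thesis .
    next
      case 3
      have x: "\<bar>x\<bar> \<le> 3 / 2" unfolding x_def using K(2,4)[OF zK] \<eta> by linarith
      then have "\<bar>x\<bar>\<^sup>2 \<le> (3 / 2)\<^sup>2" by (intro power_mono) auto
      then have "x\<^sup>2 \<le> 9 / 4" by (simp add: power2_eq_square)
      moreover have "X / 3 + (Y - 9) / 9 \<le> - 1 / 4" if "Y \<le> 9 / 4" "\<bar>X\<bar> \<le> 3 / 2" for X Y :: real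
        using that by (simp add: field_simps abs_le_iff)
      ultimately have "x / 3 + (x\<^sup>2 - v\<^sup>2) / 9 \<le> - 1 / 4"
        unfolding 3 using x by blast
      then have "lam * (x / 3 + (x\<^sup>2 - v\<^sup>2) / 9) \<le> lam * (- 1 / 4)" using lam by (intro mult_left_mono) auto
      moreover have "lam * (- 1 / 4) \<le> - y" using lam \<eta> mult_right_mono[of \<eta> "2" lam] by (simp add: y_def)
      ultimately have "exp (lam * (x / 3 + (x\<^sup>2 - v\<^sup>2) / 9)) \<le> exp (- y)" by simp
      then have "norm (F z) \<le> 1 * exp (- y)"
        unfolding Fn[OF x_def v_def] by (intro mult_mono p1 zK) auto
      then show ?thesis by simp
    qed
  qed
  then have py: "norm (p s0) \<le> exp (- y)" by (simp add: F_def)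
  have s0K: "s0 \<in> K" using \<eta> by (simp add: K_def s0_def in_cbox_complex_iff)
  have ey: "exp (- y) < 1" using y by simp
  have n1: "norm (1 - p s0) \<ge> 1 - exp (- y)" using norm_triangle_ineq2[of 1 "p s0"] py by simp
  \<comment> \<open>Inverting the Cayley transform, q = 2 L p / (1 - p), gives |q| \<le> 2 L / (e^y
    - 1). The bound e^y - 1 \<ge> y^2 / 2 yields the square of \<open>lam\<close> and, with y =
    \<eta> lam / 8, the constant 256.\<close>
  have "1 - p s0 = 2 * of_real L / (q s0 + 2 * of_real L)"
    using den[OF s0K] by (simp add: p_def divide_simps)
  then have "q s0 * (1 - p s0) = 2 * of_real L * p s0" by (simp add: p_def)
  then have "norm (q s0) * norm (1 - p s0) = 2 * L * norm (p s0)"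
    using L1 by (metis norm_mult norm_of_real abs_of_nonneg norm_numeral order_trans zero_le_one)
  moreover have "norm (q s0) * (1 - exp (- y)) \<le> norm (q s0) * norm (1 - p s0)"
    by (intro mult_left_mono n1) auto
  moreover have "2 * L * norm (p s0) \<le> 2 * L * exp (- y)" using L1 py by (intro mult_left_mono) auto
  ultimately have "norm (q s0) * (1 - exp (- y)) \<le> 2 * L * exp (- y)" by linarith
  then have "norm (q s0) * (1 - exp (- y)) * exp y \<le> 2 * L * exp (- y) * exp y"
    by (intro mult_right_mono) auto
  moreover have e1: "exp (- y) * exp y = 1" by (simp flip: exp_add)
  moreover have "(1 - exp (- y)) * exp y = exp y - 1" by (simp add: left_diff_distrib e1)
  ultimately have "norm (q s0) * (exp y - 1) \<le> 2 * L" by (simp only: mult.assoc mult_1_right)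
  moreover have "y\<^sup>2 / 2 \<le> exp y - 1" using exp_lower_Taylor_quadratic[of y] y by simp
  then have "norm (q s0) * (y\<^sup>2 / 2) \<le> norm (q s0) * (exp y - 1)" by (intro mult_left_mono) auto
  ultimately have "norm (q s0) * (y\<^sup>2 / 2) \<le> 2 * L" by linarith
  then have "norm (q s0) \<le> 4 * L / y\<^sup>2" using y by (simp add: field_simps)
  also have "\<dots> = 256 * L / (\<eta> * lam)\<^sup>2" by (simp add: y_def power_divide)
  finally show ?thesis by (simp add: s0_def lam_def)
qed

text \<open>\<open>cayley_three_lines\<close> is applied with L = C log (|t| + 8). The 8 leaves room
  for heights within 3 of t and keeps the logarithm above 1.\<close>

lemma zeta_reg_logderiv_bound:
  assumes RH: riemann_hypothesis
  shows "\<exists>C\<ge>exp 1. \<forall>t \<eta>. 0 < \<eta> \<longrightarrow> \<eta> \<le> 3 / 2 \<longrightarrow>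
    norm (deriv zeta_reg (Complex (1 / 2 + \<eta>) t) / zeta_reg (Complex (1 / 2 + \<eta>) t))
      \<le> 256 * (C * ln (\<bar>t\<bar> + 8)) / (\<eta> * ln (C * ln (\<bar>t\<bar> + 8)))\<^sup>2"
proof -
  obtain B where B: "\<And>t. norm (deriv zeta_reg (Complex 2 t) / zeta_reg (Complex 2 t)) \<le> B"
    using zeta_reg_logderiv_at_2 by blast
  have B0: "B \<ge> 0" using order_trans[OF norm_ge_zero B] by blast
  \<comment> \<open>The sixteenth power makes B at most L powr (1/16), the smallness needed on the
    right edge; the summand exp 1 makes log L at least 1.\<close>
  define C where "C = exp 1 + B ^ 16"
  have C: "C \<ge> exp 1" "B ^ 16 \<le> C" using B0 by (auto simp: C_def)
  have C2: "C \<ge> 2" using C(1) exp_ge_add_one_self[of 1] by linarith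
  show ?thesis
  proof (intro exI[of _ C] conjI allI impI C(1))
    fix t \<eta> :: real assume \<eta>: "0 < \<eta>" "\<eta> \<le> 3 / 2"
    define q where "q s = deriv zeta_reg s / zeta_reg s" for s
    have l1: "ln (\<bar>t\<bar> + 8) \<ge> 1"
    proof -
      have "exp 1 \<le> \<bar>t\<bar> + 8" using exp_le by linarith
      then show ?thesis by (metis add_nonneg_pos abs_ge_zero ln_ge_iff zero_less_numeral)
    qed
    have LC: "C \<le> C * ln (\<bar>t\<bar> + 8)" using mult_left_mono[OF l1, of C] C2 by simp
    show "norm (deriv zeta_reg (Complex (1 / 2 + \<eta>) t) / zeta_reg (Complex (1 / 2 + \<eta>) t))
      \<le> 256 * (C * ln (\<bar>t\<bar> + 8)) / (\<eta> * ln (C * ln (\<bar>t\<bar> + 8)))\<^sup>2"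
      unfolding q_def[symmetric]
    proof (rule cayley_three_lines[where C = B])
      show "q holomorphic_on {s. 1 / 2 < Re s}"
        unfolding q_def
        by (intro holomorphic_intros holomorphic_deriv[OF holomorphic_on_subset[OF holomorphic_zeta_reg]]
              holomorphic_on_subset[OF holomorphic_zeta_reg] open_halfspace_Re_gt)
           (use zeta_reg_nonzero[OF RH] in auto)
      show "exp 1 \<le> C * ln (\<bar>t\<bar> + 8)" using C LC by linarith
      show "B \<le> (C * ln (\<bar>t\<bar> + 8)) powr (1 / 16)"
      proof (cases "B = 0")
        case False
        then have "B ^ 16 = B powr 16" using powr_realpow[of B 16] B0 by simp
        moreover have "(B powr 16) powr (1 / 16) = B" using B0 by (subst powr_powr) simp
        ultimately have "B = (B ^ 16) powr (1 / 16)" by (simp only:)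
        also have "\<dots> \<le> (C * ln (\<bar>t\<bar> + 8)) powr (1 / 16)"
          using C LC by (intro powr_mono2) (auto simp: B0)
        finally show ?thesis .
      qed simp
      show "norm (q s) \<le> B" if "Re s = 2" for s
        using B[of "Im s"] that complex_surj[of s] by (simp add: q_def)
      show "- (C * ln (\<bar>t\<bar> + 8)) \<le> Re (q s)" if "1 / 2 < Re s" "Re s \<le> 2" "\<bar>Im s - t\<bar> \<le> 3" for s
      proof -
        have "\<bar>Im s\<bar> + 3 \<le> \<bar>t\<bar> + 8" using that(3) by linarith
        then have "ln (\<bar>Im s\<bar> + 3) \<le> ln (\<bar>t\<bar> + 8)" by (subst ln_le_cancel_iff) auto
        also have "\<dots> \<le> C * ln (\<bar>t\<bar> + 8)" using C2 l1 mult_right_mono[of 1 C "ln (\<bar>t\<bar> + 8)"] by simp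
        finally have "ln (\<bar>Im s\<bar> + 3) \<le> C * ln (\<bar>t\<bar> + 8)" .
        moreover have "ln (\<bar>Im s\<bar> + 3) \<ge> 0" by (intro ln_ge_zero) auto
        ultimately show ?thesis
          using zeta_reg_logderiv_ge[OF RH that(1,2)] unfolding q_def by linarith
      qed
    qed (use \<eta> B0 in auto)
  qed
qed

text \<open>Integrating the bound M / e^2 for the logarithmic derivative horizontally from 1/2 +
  \<eta> to 2 costs only M / \<eta>. The integration is phrased as monotonicity of f + M / e and f -
  M / e.\<close>

lemma zeta_reg_log_bound:
  assumes RH: riemann_hypothesis
  shows "\<exists>C\<ge>exp 1. \<forall>t \<eta>. 0 < \<eta> \<longrightarrow> \<eta> \<le> 3 / 2 \<longrightarrow>
    \<bar>ln (norm (zeta_reg (Complex (1 / 2 + \<eta>) t))) - ln (norm (zeta_reg (Complex 2 t)))\<bar>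
      \<le> 256 * (C * ln (\<bar>t\<bar> + 8)) / (\<eta> * (ln (C * ln (\<bar>t\<bar> + 8)))\<^sup>2)"
proof -
  obtain C where C: "C \<ge> exp 1" and bd: "\<And>t \<eta>. 0 < \<eta> \<Longrightarrow> \<eta> \<le> 3 / 2 \<Longrightarrow>
    norm (deriv zeta_reg (Complex (1 / 2 + \<eta>) t) / zeta_reg (Complex (1 / 2 + \<eta>) t))
      \<le> 256 * (C * ln (\<bar>t\<bar> + 8)) / (\<eta> * ln (C * ln (\<bar>t\<bar> + 8)))\<^sup>2"
    using zeta_reg_logderiv_bound[OF RH] by metis
  show ?thesis
  proof (intro exI[of _ C] conjI allI impI C)
    fix t \<eta> :: real assume \<eta>: "0 < \<eta>" "\<eta> \<le> 3 / 2"
    define M where "M = 256 * (C * ln (\<bar>t\<bar> + 8)) / (ln (C * ln (\<bar>t\<bar> + 8)))\<^sup>2"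
    have M: "M \<ge> 0"
    proof -
      have "C > 0" using C by (rule less_le_trans[OF exp_gt_zero])
      then show ?thesis unfolding M_def by (intro divide_nonneg_nonneg mult_nonneg_nonneg ln_ge_zero) auto
    qed
    define f where "f e = ln (norm (zeta_reg (Complex (1 / 2 + e) t)))" for e
    define f' where "f' e = Re (deriv zeta_reg (Complex (1 / 2 + e) t) / zeta_reg (Complex (1 / 2 + e) t))" for e
    have df: "(f has_real_derivative f' e) (at e)" if "e > 0" for e
    proof -
      have "((\<lambda>x. ln (norm (zeta_reg (Complex x t)))) has_real_derivative f' e) (at (1 / 2 + e))"
        unfolding f'_def using that
        by (intro has_real_derivative_ln_norm field_differentiable_derivI[OF zeta_reg_differentiable] zeta_reg_nonzero[OF RH]) auto
      moreover have "((\<lambda>e. 1 / 2 + e) has_real_derivative 1) (at e)"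
        by (auto intro!: derivative_eq_intros)
      ultimately show ?thesis
        using DERIV_chain2[of "\<lambda>x. ln (norm (zeta_reg (Complex x t)))" "f' e" "\<lambda>e. 1 / 2 + e" e 1 UNIV]
        by (simp add: f_def[abs_def])
    qed
    have f': "\<bar>f' e\<bar> \<le> M / e\<^sup>2" if "0 < e" "e \<le> 3 / 2" for e
    proof -
      have "\<bar>f' e\<bar> \<le> norm (deriv zeta_reg (Complex (1 / 2 + e) t) / zeta_reg (Complex (1 / 2 + e) t))"
        unfolding f'_def by (rule abs_Re_le_cmod)
      also have "\<dots> \<le> 256 * (C * ln (\<bar>t\<bar> + 8)) / (e * ln (C * ln (\<bar>t\<bar> + 8)))\<^sup>2" by (rule bd[OF that])
      also have "\<dots> = M / e\<^sup>2" by (simp add: M_def power_mult_distrib mult.commute)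
      finally show ?thesis .
    qed
    have dM: "((\<lambda>e. M / e) has_real_derivative - (M / e\<^sup>2)) (at e)" if "e > 0" for e
      using that by (auto intro!: derivative_eq_intros simp: power2_eq_square)
    have "f (3 / 2) + M / (3 / 2) \<le> f \<eta> + M / \<eta>"
    proof (rule DERIV_nonpos_imp_nonincreasing[OF \<eta>(2)])
      fix e assume e: "\<eta> \<le> e" "e \<le> 3 / 2"
      then have e0: "e > 0" using \<eta> by simp
      show "\<exists>y. ((\<lambda>e. f e + M / e) has_real_derivative y) (at e) \<and> y \<le> 0"
        using DERIV_add[OF df[OF e0] dM[OF e0]] f'[OF e0 e(2)] by (intro exI conjI) auto
    qed
    moreover have "f \<eta> - M / \<eta> \<le> f (3 / 2) - M / (3 / 2)"
    proof (rule DERIV_nonneg_imp_nondecreasing[OF \<eta>(2)])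
      fix e assume e: "\<eta> \<le> e" "e \<le> 3 / 2"
      then have e0: "e > 0" using \<eta> by simp
      show "\<exists>y. ((\<lambda>e. f e - M / e) has_real_derivative y) (at e) \<and> y \<ge> 0"
        using DERIV_diff[OF df[OF e0] dM[OF e0]] f'[OF e0 e(2)] by (intro exI conjI) auto
    qed
    moreover have "M / (3 / 2) \<ge> 0" using M by simp
    ultimately have "\<bar>f \<eta> - f (3 / 2)\<bar> \<le> M / \<eta>" by linarith
    then show "\<bar>ln (norm (zeta_reg (Complex (1 / 2 + \<eta>) t))) - ln (norm (zeta_reg (Complex 2 t)))\<bar>
      \<le> 256 * (C * ln (\<bar>t\<bar> + 8)) / (\<eta> * (ln (C * ln (\<bar>t\<bar> + 8)))\<^sup>2)"
      by (simp add: f_def M_def mult.commute)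
  qed
qed

section \<open>The Dirichlet series of \<open>S_mu\<close>\<close>

lemma has_sum_product_complex:
  fixes f :: "'a \<Rightarrow> complex" and g :: "'b \<Rightarrow> complex"
  assumes f: "(f has_sum a) A" and g: "(g has_sum b) B"
  shows "((\<lambda>(x, y). f x * g y) has_sum (a * b)) (A \<times> B)"
proof (rule has_sum_SigmaI)
  show "((\<lambda>y. case (x, y) of (x, y) \<Rightarrow> f x * g y) has_sum (f x * b)) B" for x
    using has_sum_cmult_right[OF g, of "f x"] by simp
  show "((\<lambda>x. f x * b) has_sum (a * b)) A" by (rule has_sum_cmult_left[OF f])
  have nf: "(\<lambda>x. norm (f x)) summable_on A" and ng: "(\<lambda>y. norm (g y)) summable_on B"
    using has_sum_imp_summable[OF f] has_sum_imp_summable[OF g] summable_on_iff_abs_summable_on_complex by blast+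
  have "(\<lambda>z. norm (case z of (x, y) \<Rightarrow> f x * g y)) summable_on (A \<times> B)"
  proof (rule summable_on_SigmaI)
    show "((\<lambda>y. norm (case (x, y) of (x, y) \<Rightarrow> f x * g y)) has_sum (norm (f x) * infsum (\<lambda>y. norm (g y)) B)) B" for x
      using has_sum_cmult_right[OF has_sum_infsum[OF ng], of "norm (f x)"] by (simp add: norm_mult)
    show "(\<lambda>x. norm (f x) * infsum (\<lambda>y. norm (g y)) B) summable_on A"
      by (intro summable_on_cmult_left nf)
  qed auto
  then show "(\<lambda>(x, y). f x * g y) summable_on (A \<times> B)" by (rule abs_summable_summable)
qed

text \<open>For n > 1 a prime p dividing n pairs each squarefree divisor d prime to p with p d,
  which has the opposite sign.\<close>

lemma sum_moebius_mu_divisors: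
  assumes n: "n > 0"
  shows "(\<Sum>d | d dvd n. moebius_mu d) = (if n = 1 then 1 else 0)"
proof (cases "n = 1")
  case True
  have "{d :: nat. d dvd 1} = {1}" by auto
  then show ?thesis using True by (simp add: moebius_mu_def)
next
  case False
  then obtain p where p: "prime p" "p dvd n" using prime_factor_nat by blast
  define A where "A = {d. d dvd n \<and> squarefree d \<and> \<not> p dvd d}"
  have fin: "finite {d. d dvd n}" using n by (rule finite_divisors_nat)
  have finA: "finite A" by (rule finite_subset[OF _ fin]) (auto simp: A_def)
  have p0: "p > 0" using p prime_gt_0_nat by blast
  have sq: "squarefree (p * d) \<longleftrightarrow> squarefree d" if "\<not> p dvd d" for d
  proof -
    have "coprime p d" using p that by (simp add: prime_imp_coprime)
    then show ?thesis using p squarefree_mult_coprime squarefree_prime squarefree_multD by metis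
  qed
  have img: "{d. d dvd n \<and> squarefree d \<and> p dvd d} = (*) p ` A"
  proof (intro equalityI subsetI)
    fix d assume d: "d \<in> {d. d dvd n \<and> squarefree d \<and> p dvd d}"
    then obtain e where e: "d = p * e" by blast
    have "\<not> p dvd e"
    proof
      assume "p dvd e"
      then have "p ^ 2 dvd d" by (auto simp: e power2_eq_square)
      then have "is_unit p" using d by (auto simp: squarefree_def)
      then show False using p by (simp add: prime_nat_iff)
    qed
    then show "d \<in> (*) p ` A" using d sq[of e] by (auto simp: A_def e dest: dvd_mult_right)
  next
    fix d assume "d \<in> (*) p ` A"
    then obtain e where e: "d = p * e" "e \<in> A" by blast
    then have "coprime p e" using p by (simp add: A_def prime_imp_coprime)
    then have "p * e dvd n" using e p by (auto simp: A_def intro: divides_mult)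
    then show "d \<in> {d. d dvd n \<and> squarefree d \<and> p dvd d}" using e sq[of e] by (auto simp: A_def)
  qed
  have mu: "moebius_mu (p * d) = - moebius_mu d" if "d \<in> A" for d
  proof -
    have d: "\<not> p dvd d" "squarefree d" "d \<noteq> 0" using that n by (auto simp: A_def)
    have "prime_factors (p * d) = insert p (prime_factors d)"
      using p d p0 by (simp add: prime_factors_product prime_factorization_prime)
    moreover have "p \<notin> prime_factors d" using d by auto
    ultimately have "card (prime_factors (p * d)) = Suc (card (prime_factors d))" by simp
    then show ?thesis using d sq[of d] by (simp add: moebius_mu_def)
  qed
  have "(\<Sum>d | d dvd n. moebius_mu d) = (\<Sum>d \<in> A \<union> {d. d dvd n \<and> squarefree d \<and> p dvd d}. moebius_mu d)"
    by (rule sum.mono_neutral_right[OF fin]) (auto simp: A_def moebius_mu_def)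
  also have "\<dots> = (\<Sum>d\<in>A. moebius_mu d) + (\<Sum>d\<in>(*) p ` A. moebius_mu d)"
    unfolding img[symmetric]
    by (rule sum.union_disjoint) (auto simp: finA A_def intro: finite_subset[OF _ fin])
  also have "(\<Sum>d\<in>(*) p ` A. moebius_mu d) = (\<Sum>d\<in>A. moebius_mu (p * d))"
    using p0 by (subst sum.reindex) (auto simp: inj_on_def)
  also have "\<dots> = - (\<Sum>d\<in>A. moebius_mu d)" using mu by (simp add: sum_negf)
  finally show ?thesis using False by simp
qed

lemma abs_moebius_mu_le: "\<bar>real_of_int (moebius_mu n)\<bar> \<le> 1"
  by (simp add: moebius_mu_def power_abs)

lemma bij_betw_divisor_pairs:
  "bij_betw (\<lambda>(n, d). (d, n div d)) (SIGMA n:{n. n > 0}. {d. d dvd n}) ({m :: nat. m > 0} \<times> {m. m > 0})"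
  by (rule bij_betw_byWitness[of _ "\<lambda>(d, e). (d * e, d)"]) (auto elim!: dvdE)

text \<open>Absolute convergence provides some sum M; multiplying by \<zeta>(s) and collecting by
  the product n leaves only n = 1, so M \<zeta>(s) = 1.\<close>

lemma has_sum_moebius:
  assumes s: "Re s > 1"
  shows "((\<lambda>g. of_int (moebius_mu g) * of_nat g powr (- s)) has_sum (1 / zeta s)) {g. g > 0}"
proof -
  let ?f = "\<lambda>g. of_int (moebius_mu g) * of_nat g powr (- s)"
  have "?f summable_on {g. g > 0}"
  proof (rule abs_summable_summable, rule summable_on_comparison_test)
    show "(\<lambda>g. real g powr (- Re s)) summable_on {g. g > 0}"
      using has_sum_zeta_real[OF s] by (rule has_sum_imp_summable)
    fix g
    show "norm (?f g) \<le> real g powr (- Re s)"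
      using abs_moebius_mu_le[of g] by (auto simp: norm_mult norm_of_nat_powr intro: mult_left_le_one_le)
  qed auto
  then obtain M where M: "(?f has_sum M) {g. g > 0}" by (auto simp: summable_on_def)
  let ?S = "SIGMA n:{n. n > (0 :: nat)}. {d. d dvd n}"
  have "((\<lambda>(g, m). ?f g * of_nat m powr (- s)) has_sum (M * zeta s)) ({g. g > 0} \<times> {m. m > 0})"
    by (rule has_sum_product_complex[OF M has_sum_zeta[OF s]])
  then have "((\<lambda>z. case (case z of (n, d) \<Rightarrow> (d, n div d)) of (g, m) \<Rightarrow> ?f g * of_nat m powr (- s))
      has_sum (M * zeta s)) ?S"
    by (subst has_sum_reindex_bij_betw[OF bij_betw_divisor_pairs])
  then have "((\<lambda>n. \<Sum>d | d dvd n. ?f d * of_nat (n div d) powr (- s)) has_sum (M * zeta s)) {n. n > 0}"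
    by (rule has_sum_SigmaD) (auto intro!: has_sum_finiteI finite_divisors_nat)
  also have "?this \<longleftrightarrow> ((\<lambda>n. if n = 1 then 1 else 0) has_sum (M * zeta s)) {n :: nat. n > 0}"
  proof (rule has_sum_cong)
    fix n :: nat assume n: "n \<in> {n. n > 0}"
    have "(\<Sum>d | d dvd n. ?f d * of_nat (n div d) powr (- s)) = (\<Sum>d | d dvd n. of_int (moebius_mu d) * of_nat n powr (- s))"
    proof (rule sum.cong)
      fix d assume "d \<in> {d. d dvd n}"
      then have "n = d * (n div d)" by simp
      then have "of_nat n powr (- s) = of_nat d powr (- s) * (of_nat (n div d) powr (- s) :: complex)"
        by (metis of_nat_mult_powr)
      then show "?f d * of_nat (n div d) powr (- s) = of_int (moebius_mu d) * of_nat n powr (- s)" by simp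
    qed simp
    also have "\<dots> = of_int (\<Sum>d | d dvd n. moebius_mu d) * of_nat n powr (- s)"
      by (simp only: sum_distrib_right of_int_sum)
    also have "\<dots> = (if n = 1 then 1 else 0)"
      using n by (subst sum_moebius_mu_divisors) auto
    finally show "(\<Sum>d | d dvd n. ?f d * of_nat (n div d) powr (- s)) = (if n = 1 then 1 else 0)" .
  qed
  finally have "((\<lambda>n. if n = 1 then 1 else 0) has_sum (M * zeta s)) {n :: nat. n > 0}" .
  moreover have "((\<lambda>n. if n = 1 then 1 else 0) has_sum (1 :: complex)) {n :: nat. n > 0}"
    by (rule has_sum_finite_neutralI[of "{1}"]) auto
  ultimately have "M * zeta s = 1" by (rule has_sum_unique)
  then have "M = 1 / zeta s" using zeta_nonzero_Re_gt_1[OF s] by (simp add: field_simps)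
  then show ?thesis using M by simp
qed

lemma gcd_mult_coprime: "coprime a b \<Longrightarrow> gcd (g * a) (g * b) = (g :: nat)"
  by (simp add: gcd_mult_left coprime_imp_gcd_eq_1)

lemma bij_betw_gcd_pairs:
  "bij_betw (\<lambda>(g, a, b). (g * a, g * b)) ({g :: nat. g > 0} \<times> {(a, b). a > 0 \<and> b > 0 \<and> coprime a b})
     ({m :: nat. m > 0} \<times> {m. m > 0})"
proof (rule bij_betw_byWitness[of _ "\<lambda>(m, n). (gcd m n, m div gcd m n, n div gcd m n)"])
  show "\<forall>z\<in>{g :: nat. g > 0} \<times> {(a, b). a > 0 \<and> b > 0 \<and> coprime a b}.
      (case case z of (g, a, b) \<Rightarrow> (g * a, g * b) of (m, n) \<Rightarrow> (gcd m n, m div gcd m n, n div gcd m n)) = z"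
  proof
    fix z :: "nat \<times> nat \<times> nat" assume "z \<in> {g :: nat. g > 0} \<times> {(a, b). a > 0 \<and> b > 0 \<and> coprime a b}"
    then obtain g a b where z: "z = (g, a, b)" "g > 0" "coprime a b" by auto
    have "gcd (g * a) (g * b) = g" by (rule gcd_mult_coprime[OF z(3)])
    then show "(case case z of (g, a, b) \<Rightarrow> (g * a, g * b) of (m, n) \<Rightarrow> (gcd m n, m div gcd m n, n div gcd m n)) = z"
      using z by simp
  qed
  show "(\<lambda>(m, n). (gcd m n, m div gcd m n, n div gcd m n)) ` ({m :: nat. m > 0} \<times> {m. m > 0})
     \<subseteq> {g :: nat. g > 0} \<times> {(a, b). a > 0 \<and> b > 0 \<and> coprime a b}"
    by (auto simp: div_gcd_coprime dvd_imp_le div_greater_zero_iff gcd_le1_nat gcd_le2_nat)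
qed auto

text \<open>Every pair is (g a, g b) with a, b coprime and g the gcd. The sum K over coprime pairs
  is found by summing without the weight, \<zeta>(s)^2 = \<zeta>(2 s) K; with the weight \<mu>(g)
  the factor \<zeta>(2 s) becomes 1 / \<zeta>(2 s).\<close>

lemma has_sum_moebius_gcd:
  assumes s: "Re s > 1"
  shows "((\<lambda>(m, n). of_int (moebius_mu (gcd m n)) * (of_nat m powr (- s) * of_nat n powr (- s)))
     has_sum ((zeta s)\<^sup>2 / (zeta (2 * s))\<^sup>2)) ({m. m > 0} \<times> {m. m > 0})"
proof -
  let ?C = "{(a :: nat, b :: nat). a > 0 \<and> b > 0 \<and> coprime a b}"
  let ?h = "\<lambda>(m :: nat, n :: nat). of_nat m powr (- s) * (of_nat n powr (- s) :: complex)"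
  have s2: "Re (2 * s) > 1" using s by simp
  have P: "(?h has_sum (zeta s * zeta s)) ({m. m > 0} \<times> {m. m > 0})"
    by (rule has_sum_product_complex) (rule has_sum_zeta[OF s])+
  have "?h summable_on ?C"
    by (rule summable_on_subset_banach[OF has_sum_imp_summable[OF P]]) auto
  then obtain K where K: "(?h has_sum K) ?C" by (auto simp: summable_on_def)
  have hg: "?h (g * a, g * b) = of_nat g powr (- (2 * s)) * ?h (a, b)" for g a b
  proof -
    have "(of_nat g :: complex) powr (- (2 * s)) = of_nat g powr (- s) * of_nat g powr (- s)"
      by (subst powr_add[symmetric]) simp
    then show ?thesis by (simp only: prod.case of_nat_mult_powr mult_ac)
  qed
  have "((\<lambda>(g, z). of_nat g powr (- (2 * s)) * ?h z) has_sum (zeta (2 * s) * K)) ({g :: nat. g > 0} \<times> ?C)"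
    by (rule has_sum_product_complex[OF has_sum_zeta[OF s2] K])
  also have "?this \<longleftrightarrow> ((\<lambda>z. ?h (case z of (g, a, b) \<Rightarrow> (g * a, g * b))) has_sum (zeta (2 * s) * K)) ({g :: nat. g > 0} \<times> ?C)"
  proof (rule has_sum_cong)
    fix z :: "nat \<times> nat \<times> nat"
    obtain g a b where z: "z = (g, a, b)" by (cases z) auto
    show "(case z of (g, z) \<Rightarrow> of_nat g powr (- (2 * s)) * ?h z) = ?h (case z of (g, a, b) \<Rightarrow> (g * a, g * b))"
      unfolding z prod.case[of _ g] using hg[of g a b] by (simp only: prod.case)
  qed
  also have "\<dots> \<longleftrightarrow> (?h has_sum (zeta (2 * s) * K)) ({m. m > 0} \<times> {m. m > 0})"
    by (rule has_sum_reindex_bij_betw[OF bij_betw_gcd_pairs])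
  finally have "zeta s * zeta s = zeta (2 * s) * K" using P has_sum_unique by blast
  then have Kv: "K = (zeta s)\<^sup>2 / zeta (2 * s)"
    using zeta_nonzero_Re_gt_1[OF s2] by (simp add: field_simps power2_eq_square)
  let ?H = "\<lambda>(m, n). of_int (moebius_mu (gcd m n)) * ?h (m, n)"
  have "((\<lambda>(g, z). (of_int (moebius_mu g) * of_nat g powr (- (2 * s))) * ?h z) has_sum (1 / zeta (2 * s) * K)) ({g :: nat. g > 0} \<times> ?C)"
    by (rule has_sum_product_complex[OF has_sum_moebius[OF s2] K])
  also have "?this \<longleftrightarrow> ((\<lambda>z. ?H (case z of (g, a, b) \<Rightarrow> (g * a, g * b))) has_sum (1 / zeta (2 * s) * K)) ({g :: nat. g > 0} \<times> ?C)"
  proof (rule has_sum_cong)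
    fix z assume "z \<in> {g :: nat. g > 0} \<times> ?C"
    then obtain g a b where z: "z = (g, a, b)" "coprime a b" by auto
    have "gcd (g * a) (g * b) = g" using z by (simp add: gcd_mult_coprime)
    then show "(case z of (g, z) \<Rightarrow> (of_int (moebius_mu g) * of_nat g powr (- (2 * s))) * ?h z)
       = ?H (case z of (g, a, b) \<Rightarrow> (g * a, g * b))"
      unfolding z prod.case using hg[of g a b] by (simp only: prod.case mult.assoc)
  qed
  also have "\<dots> \<longleftrightarrow> (?H has_sum (1 / zeta (2 * s) * K)) ({m. m > 0} \<times> {m. m > 0})"
    by (rule has_sum_reindex_bij_betw[OF bij_betw_gcd_pairs])
  finally show ?thesis by (simp add: Kv power2_eq_square)
qed

definition mu_gcd_coeff :: "nat \<Rightarrow> real" where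
  "mu_gcd_coeff n = (\<Sum>d | d dvd n. of_int (moebius_mu (gcd d (n div d))))"

text \<open>Trivial but sufficient: at Re s = 3, where the Laplace transform is computed, even
  coefficients of size n are summable.\<close>

lemma abs_mu_gcd_coeff_le:
  assumes "n > 0"
  shows "\<bar>mu_gcd_coeff n\<bar> \<le> real n"
proof -
  have "\<bar>mu_gcd_coeff n\<bar> \<le> (\<Sum>d | d dvd n. 1)"
    unfolding mu_gcd_coeff_def by (rule order_trans[OF sum_abs sum_mono]) (rule abs_moebius_mu_le)
  also have "\<dots> = real (card {d. d dvd n})" by simp
  also have "card {d. d dvd n} \<le> card {1..n}"
    using assms by (intro card_mono) (auto dest: dvd_imp_le intro: Nat.gr0I)
  finally show ?thesis by simp
qed

lemma has_sum_mu_gcd_coeff: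
  assumes s: "Re s > 1"
  shows "((\<lambda>n. of_real (mu_gcd_coeff n) * of_nat n powr (- s)) has_sum ((zeta s)\<^sup>2 / (zeta (2 * s))\<^sup>2)) {n. n > 0}"
proof -
  let ?S = "SIGMA n:{n. n > (0 :: nat)}. {d. d dvd n}"
  let ?h = "\<lambda>(m, n). of_int (moebius_mu (gcd m n)) * (of_nat m powr (- s) * (of_nat n powr (- s) :: complex))"
  have "((\<lambda>z. ?h (case z of (n, d) \<Rightarrow> (d, n div d))) has_sum ((zeta s)\<^sup>2 / (zeta (2 * s))\<^sup>2)) ?S"
    by (subst has_sum_reindex_bij_betw[OF bij_betw_divisor_pairs]) (rule has_sum_moebius_gcd[OF s])
  then have "((\<lambda>n. \<Sum>d | d dvd n. ?h (d, n div d)) has_sum ((zeta s)\<^sup>2 / (zeta (2 * s))\<^sup>2)) {n. n > 0}"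
    by (rule has_sum_SigmaD) (auto intro!: has_sum_finiteI finite_divisors_nat)
  also have "?this \<longleftrightarrow> ?thesis"
  proof (rule has_sum_cong)
    fix n :: nat
    have "(\<Sum>d | d dvd n. ?h (d, n div d)) = (\<Sum>d | d dvd n. of_int (moebius_mu (gcd d (n div d))) * of_nat n powr (- s))"
    proof (rule sum.cong)
      fix d assume "d \<in> {d. d dvd n}"
      then have "n = d * (n div d)" by simp
      then have "of_nat n powr (- s) = of_nat d powr (- s) * (of_nat (n div d) powr (- s) :: complex)"
        by (metis of_nat_mult_powr)
      then show "?h (d, n div d) = of_int (moebius_mu (gcd d (n div d))) * of_nat n powr (- s)" by simp
    qed simp
    then show "(\<Sum>d | d dvd n. ?h (d, n div d)) = of_real (mu_gcd_coeff n) * of_nat n powr (- s)"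
      by (simp add: mu_gcd_coeff_def sum_distrib_right)
  qed
  finally show ?thesis .
qed

lemma real_le_of_le_nat_floor:
  assumes "n \<le> nat \<lfloor>x\<rfloor>" "1 \<le> n"
  shows "real n \<le> x"
proof -
  have "int n \<le> \<lfloor>x\<rfloor>" using assms by linarith
  then show ?thesis by (simp add: le_floor_iff)
qed

text \<open>Pairs are grouped by their product n, the first component being a divisor of n.\<close>

lemma S_mu_eq_sum: "S_mu x = (\<Sum>n\<in>{1..nat \<lfloor>x\<rfloor>}. mu_gcd_coeff n)"
proof -
  let ?T = "SIGMA n:{1..nat \<lfloor>x\<rfloor>}. {d. d dvd n}"
  have "S_mu x = (\<Sum>(n, d)\<in>?T. of_int (moebius_mu (gcd d (n div d))))"
    unfolding S_mu_def
  proof (rule sum.reindex_bij_witness[of _ "\<lambda>(n, d). (d, n div d)" "\<lambda>(m, n). (m * n, m)"])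
    fix z assume z: "z \<in> {(m, n). m > 0 \<and> n > 0 \<and> real (m * n) \<le> x}"
    then show "(case z of (m, n) \<Rightarrow> (m * n, m)) \<in> ?T"
      by (auto simp: le_nat_floor simp del: of_nat_mult)
  next
    fix z assume z: "z \<in> ?T"
    then obtain n d where nd: "z = (n, d)" "1 \<le> n" "n \<le> nat \<lfloor>x\<rfloor>" "d dvd n" by auto
    then have "real n \<le> x" by (intro real_le_of_le_nat_floor)
    moreover have "d > 0" "n div d > 0" using nd by (auto intro!: Nat.gr0I)
    ultimately show "(case z of (n, d) \<Rightarrow> (d, n div d)) \<in> {(m, n). m > 0 \<and> n > 0 \<and> real (m * n) \<le> x}"
      using nd by (simp flip: of_nat_mult)
  qed auto
  also have "\<dots> = (\<Sum>n\<in>{1..nat \<lfloor>x\<rfloor>}. mu_gcd_coeff n)"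
    unfolding mu_gcd_coeff_def by (rule sum.Sigma[symmetric]) (auto intro: finite_divisors_nat)
  finally show ?thesis .
qed

lemma abs_S_mu_le:
  assumes "x \<ge> 1"
  shows "\<bar>S_mu x\<bar> \<le> x\<^sup>2"
proof -
  have "\<bar>S_mu x\<bar> \<le> (\<Sum>n\<in>{1..nat \<lfloor>x\<rfloor>}. x)"
    unfolding S_mu_eq_sum
  proof (rule order_trans[OF sum_abs sum_mono])
    fix n assume n: "n \<in> {1..nat \<lfloor>x\<rfloor>}"
    then have "real n \<le> x" by (intro real_le_of_le_nat_floor) auto
    then show "\<bar>mu_gcd_coeff n\<bar> \<le> x" using abs_mu_gcd_coeff_le[of n] n by simp
  qed
  also have "\<dots> = real (nat \<lfloor>x\<rfloor>) * x" by simp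
  also have "\<dots> \<le> x * x" using assms by (intro mult_right_mono) (auto simp: of_nat_floor)
  finally show ?thesis by (simp add: power2_eq_square)
qed

text \<open>A superposition of unit steps at the points log n; for each u only finitely many terms
  are nonzero.\<close>

lemma S_mu_exp_sums:
  "(\<lambda>n. mu_gcd_coeff (Suc n) * indicator {ln (real (Suc n))..} u) sums S_mu (exp u)"
proof -
  have ind: "indicator {ln (real (Suc n))..} u = (if Suc n \<le> nat \<lfloor>exp u\<rfloor> then 1 else 0 :: real)" for n
  proof -
    have "ln (real (Suc n)) \<le> u \<longleftrightarrow> real (Suc n) \<le> exp u"
      by (subst ln_le_cancel_iff[symmetric, of _ "exp u", simplified]) auto
    also have "\<dots> \<longleftrightarrow> Suc n \<le> nat \<lfloor>exp u\<rfloor>"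
      by (metis le_floor_iff le_nat_iff nat_le_iff of_int_of_nat_eq floor_of_nat le_nat_floor of_nat_floor exp_ge_zero order_trans of_nat_le_iff)
    finally show ?thesis by (simp add: indicator_def)
  qed
  have "(\<lambda>n. mu_gcd_coeff (Suc n) * indicator {ln (real (Suc n))..} u) sums
      (\<Sum>n<nat \<lfloor>exp u\<rfloor>. mu_gcd_coeff (Suc n) * indicator {ln (real (Suc n))..} u)"
    by (rule sums_finite) (auto simp: ind simp del: of_nat_Suc)
  also have "(\<Sum>n<nat \<lfloor>exp u\<rfloor>. mu_gcd_coeff (Suc n) * indicator {ln (real (Suc n))..} u) = (\<Sum>n<nat \<lfloor>exp u\<rfloor>. mu_gcd_coeff (Suc n))"
    by (rule sum.cong) (auto simp: ind simp del: of_nat_Suc)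
  also have "\<dots> = S_mu (exp u)"
    unfolding S_mu_eq_sum by (rule sum.reindex_bij_witness[of _ "\<lambda>n. n - 1" Suc]) auto
  finally show ?thesis .
qed

section \<open>The Laplace transform of the error term\<close>

lemma integral_FTC_half_line:
  fixes F f :: "real \<Rightarrow> complex"
  assumes F: "\<And>t. a \<le> t \<Longrightarrow> (F has_vector_derivative f t) (at t)" and cont: "continuous_on {a..} f"
    and int: "integrable lborel (\<lambda>t. indicator {a..} t *\<^sub>R f t)" and lim: "(F \<longlongrightarrow> L) at_top"
  shows "(CLBINT t. indicator {a..} t *\<^sub>R f t) = L - F a"
proof (rule LIMSEQ_unique)
  show "(\<lambda>n. CLBINT t. indicator {a..a + real n} t *\<^sub>R f t) \<longlonglongrightarrow> (CLBINT t. indicator {a..} t *\<^sub>R f t)"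
  proof (rule integral_dominated_convergence)
    show "integrable lborel (\<lambda>t. norm (indicator {a..} t *\<^sub>R f t))" using int by (rule integrable_norm)
    show "AE t in lborel. (\<lambda>n. indicator {a..a + real n} t *\<^sub>R f t) \<longlonglongrightarrow> indicator {a..} t *\<^sub>R f t"
    proof (rule AE_I2)
      fix t
      have "\<forall>\<^sub>F n in sequentially. indicator {a..a + real n} t *\<^sub>R f t = indicator {a..} t *\<^sub>R f t"
        using eventually_ge_at_top[of "nat \<lceil>\<bar>t - a\<bar>\<rceil>"]
        by eventually_elim (auto simp: indicator_def)
      then show "(\<lambda>n. indicator {a..a + real n} t *\<^sub>R f t) \<longlonglongrightarrow> indicator {a..} t *\<^sub>R f t"
        by (rule tendsto_eventually)
    qed
    fix n
    have "(\<lambda>t. indicator {a..a + real n} t *\<^sub>R f t) = (\<lambda>t. indicator {a..a + real n} t *\<^sub>R (indicator {a..} t *\<^sub>R f t))"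
      by (auto simp: indicator_def)
    moreover have "\<dots> \<in> borel_measurable lborel"
      by (intro borel_measurable_scaleR borel_measurable_integrable[OF int]) simp
    ultimately show "(\<lambda>t. indicator {a..a + real n} t *\<^sub>R f t) \<in> borel_measurable lborel"
      by (simp only:)
  qed (use int in \<open>auto simp: indicator_def\<close>)
  have "(CLBINT t. indicator {a..a + real n} t *\<^sub>R f t) = F (a + real n) - F a" for n
    by (rule integral_FTC_Icc)
       (use F cont in \<open>auto intro: has_vector_derivative_at_within continuous_on_subset\<close>)
  moreover have "(\<lambda>n. F (a + real n) - F a) \<longlonglongrightarrow> L - F a"
    by (intro tendsto_diff tendsto_const filterlim_compose[OF lim]
          filterlim_tendsto_add_at_top[OF tendsto_const filterlim_real_sequentially])
  ultimately show "(\<lambda>n. CLBINT t. indicator {a..a + real n} t *\<^sub>R f t) \<longlonglongrightarrow> L - F a" by simp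
qed

lemma norm_exp_mult_of_real: "norm (exp (- s * of_real v)) = exp (- Re s * v)"
  by (simp add: norm_exp_eq_Re)

lemma exp_minus_tendsto_0:
  assumes "Re s > 0"
  shows "((\<lambda>v. exp (- s * of_real v)) \<longlongrightarrow> 0) at_top" "((\<lambda>v. of_real v * exp (- s * of_real v)) \<longlongrightarrow> 0) at_top"
proof -
  have 1: "((\<lambda>v. exp (- a * v)) \<longlongrightarrow> 0) at_top" if "a > 0" for a :: real
    using that by real_asymp
  have 2: "((\<lambda>v. v * exp (- a * v)) \<longlongrightarrow> 0) at_top" if "a > 0" for a :: real
    using that by real_asymp
  have "((\<lambda>v. \<bar>v\<bar> * exp (- Re s * v)) \<longlongrightarrow> 0) at_top"
    using tendsto_rabs_zero[OF 2[OF assms]] by (simp add: abs_mult)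
  with 1[OF assms] have *: "((\<lambda>v. norm (exp (- s * of_real v))) \<longlongrightarrow> 0) at_top"
      "((\<lambda>v. norm (of_real v * exp (- s * of_real v))) \<longlongrightarrow> 0) at_top"
    by (simp_all only: norm_mult norm_of_real norm_exp_mult_of_real)
  from *[THEN tendsto_norm_zero_cancel] show "((\<lambda>v. exp (- s * of_real v)) \<longlongrightarrow> 0) at_top" "((\<lambda>v. of_real v * exp (- s * of_real v)) \<longlongrightarrow> 0) at_top"
    .
qed

lemma laplace_indicator:
  assumes s: "Re s > 0" and a: "a \<ge> 0"
  shows "integrable lborel (\<lambda>v. of_real (indicator {a..} v) * exp (- s * of_real v))"
    and "(CLBINT v. of_real (indicator {a..} v) * exp (- s * of_real v)) = exp (- s * of_real a) / s"
proof -
  have r: "integrable lborel (\<lambda>v. indicator {a..} v * exp (- Re s * v))"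
    by (rule integrable_exp_bounded[where M = 1 and b = 0]) (use s a in \<open>auto simp: indicator_def\<close>)
  have int: "integrable lborel (\<lambda>v. indicator {a..} v *\<^sub>R exp (- s * of_real v))"
    by (rule Bochner_Integration.integrable_bound[OF r])
       (auto simp: norm_exp_mult_of_real indicator_def intro!: AE_I2)
  then show "integrable lborel (\<lambda>v. of_real (indicator {a..} v) * exp (- s * of_real v))"
    by (simp add: scaleR_conv_of_real)
  have s0: "s \<noteq> 0" using s by auto
  have "(CLBINT v. indicator {a..} v *\<^sub>R exp (- s * of_real v)) = 0 - (- exp (- s * of_real a) / s)"
  proof (rule integral_FTC_half_line)
    show "((\<lambda>v. - exp (- s * of_real v) / s) has_vector_derivative exp (- s * of_real t)) (at t)" for t
    proof -
      have "((\<lambda>z. - exp (- s * z) / s) has_field_derivative exp (- s * of_real t)) (at (of_real t))"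
        using s0 by (auto intro!: derivative_eq_intros)
      from has_vector_derivative_real_field[OF this] show ?thesis by simp
    qed
    have "((\<lambda>v. - exp (- s * of_real v) / s) \<longlongrightarrow> - 0 / s) at_top"
      by (intro tendsto_divide tendsto_minus exp_minus_tendsto_0[OF s] tendsto_const s0)
    then show "((\<lambda>v. - exp (- s * of_real v) / s) \<longlongrightarrow> 0) at_top" by simp
  qed (use int in \<open>auto intro!: continuous_intros\<close>)
  then show "(CLBINT v. of_real (indicator {a..} v) * exp (- s * of_real v)) = exp (- s * of_real a) / s"
    by (simp add: scaleR_conv_of_real)
qed

lemma le_exp_div: "b > 0 \<Longrightarrow> v \<le> 1 / b * exp (b * v)" for b v :: real
proof -
  assume b: "b > 0"
  have "b * v \<le> exp (b * v)" using exp_ge_add_one_self[of "b * v"] by linarith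
  then show ?thesis using b by (simp add: field_simps)
qed

lemma laplace_id:
  assumes s: "Re s > 0"
  shows "integrable lborel (\<lambda>v. of_real (indicator {0..} v * v) * exp (- s * of_real v))"
    and "(CLBINT v. of_real (indicator {0..} v * v) * exp (- s * of_real v)) = 1 / s\<^sup>2"
proof -
  have r: "integrable lborel (\<lambda>v. (indicator {0..} v * v) * exp (- Re s * v))"
    by (rule integrable_exp_bounded[where M = "1 / (Re s / 2)" and b = "Re s / 2"])
       (use s le_exp_div[of "Re s / 2"] in \<open>auto simp: indicator_def\<close>)
  have int: "integrable lborel (\<lambda>v. indicator {0..} v *\<^sub>R (of_real v * exp (- s * of_real v)))"
    by (rule Bochner_Integration.integrable_bound[OF r])
       (auto simp: norm_exp_mult_of_real norm_mult indicator_def intro!: AE_I2)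
  then show "integrable lborel (\<lambda>v. of_real (indicator {0..} v * v) * exp (- s * of_real v))"
    by (simp add: scaleR_conv_of_real mult.assoc)
  have s0: "s \<noteq> 0" using s by auto
  define F where "F v = - (of_real v * exp (- s * of_real v)) / s - exp (- s * of_real v) / s\<^sup>2" for v
  have "(CLBINT v. indicator {0..} v *\<^sub>R (of_real v * exp (- s * of_real v))) = 0 - F 0"
  proof (rule integral_FTC_half_line)
    show "(F has_vector_derivative of_real t * exp (- s * of_real t)) (at t)" for t
    proof -
      have "((\<lambda>z. - (z * exp (- s * z)) / s - exp (- s * z) / s\<^sup>2) has_field_derivative of_real t * exp (- s * of_real t)) (at (of_real t))"
        using s0 by (auto intro!: derivative_eq_intros simp: power2_eq_square divide_simps)
      from has_vector_derivative_real_field[OF this] show ?thesis by (simp add: F_def[abs_def])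
    qed
    have "(F \<longlongrightarrow> - 0 / s - 0 / s\<^sup>2) at_top"
      unfolding F_def using s0 by (intro tendsto_intros exp_minus_tendsto_0[OF s]) auto
    then show "(F \<longlongrightarrow> 0) at_top" by simp
  qed (use int in \<open>auto intro!: continuous_intros\<close>)
  then show "(CLBINT v. of_real (indicator {0..} v * v) * exp (- s * of_real v)) = 1 / s\<^sup>2"
    by (simp add: F_def scaleR_conv_of_real mult.assoc)
qed

lemma S_mu_measurable [measurable]: "S_mu \<in> borel_measurable borel"
proof -
  have "S_mu = (\<lambda>x. (\<lambda>k. \<Sum>n\<in>{1..nat k}. mu_gcd_coeff n) \<lfloor>x\<rfloor>)"
    by (auto simp: S_mu_eq_sum)
  also have "\<dots> \<in> borel_measurable borel"
    by (rule measurable_compose[OF measurable_real_floor]) simp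
  finally show ?thesis .
qed

text \<open>Each step at log n has transform n powr (- s) / s, and the integrals of the moduli of
  the terms are at most n powr (- 2), so the sum may be integrated termwise on the line Re s =
  3.\<close>

lemma laplace_S_mu:
  assumes s: "Re s = 3"
  shows "integrable lborel (\<lambda>v. of_real (S_mu (exp v)) * exp (- s * of_real v))"
    and "(CLBINT v. of_real (S_mu (exp v)) * exp (- s * of_real v)) = (zeta s)\<^sup>2 / (zeta (2 * s))\<^sup>2 / s"
proof -
  define f where "f n v = complex_of_real (mu_gcd_coeff (Suc n)) * (of_real (indicator {ln (real (Suc n))..} v) * exp (- s * of_real v))" for n v
  have s0: "Re s > 0" "s \<noteq> 0" using s by auto
  have fs: "(\<lambda>n. f n v) sums (of_real (S_mu (exp v)) * exp (- s * of_real v))" for v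
  proof -
    have "(\<lambda>n. complex_of_real (mu_gcd_coeff (Suc n) * indicator {ln (real (Suc n))..} v)) sums of_real (S_mu (exp v))"
      by (subst sums_of_real_iff) (rule S_mu_exp_sums)
    from sums_mult2[OF this, of "exp (- s * of_real v)"] show ?thesis by (simp add: f_def mult.assoc)
  qed
  have fi: "integrable lborel (f n)" for n
    unfolding f_def by (intro integrable_mult_right laplace_indicator s0) auto
  have fv: "(CLBINT v. f n v) = of_real (mu_gcd_coeff (Suc n)) * of_nat (Suc n) powr (- s) / s" for n
  proof -
    have "exp (- s * of_real (ln (real (Suc n)))) = of_nat (Suc n) powr (- s)"
      using Ln_of_real[of "real (Suc n)"] by (simp add: powr_def del: of_nat_Suc)
    then show ?thesis
      unfolding f_def using laplace_indicator(2)[OF s0(1), of "ln (real (Suc n))"]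
      by (simp add: integral_mult_right_zero del: of_nat_Suc)
  qed
  have fn: "(LBINT v. norm (f n v)) \<le> real (Suc n) powr (- 2)" for n
  proof -
    have 3: "Re (3 :: complex) > 0" by simp
    have "norm (f n v) = \<bar>mu_gcd_coeff (Suc n)\<bar> * Re (of_real (indicator {ln (real (Suc n))..} v) * exp (- 3 * of_real v))" for v
      using s by (simp add: f_def norm_mult norm_exp_eq_Re indicator_def Re_exp del: of_nat_Suc)
    then have "(LBINT v. norm (f n v)) = \<bar>mu_gcd_coeff (Suc n)\<bar> * Re (CLBINT v. of_real (indicator {ln (real (Suc n))..} v) * exp (- 3 * of_real v))"
      using integral_Re[OF laplace_indicator(1)[OF 3, of "ln (real (Suc n))"]] by simp
    also have "(CLBINT v. of_real (indicator {ln (real (Suc n))..} v) * exp (- 3 * of_real v)) = exp (- 3 * of_real (ln (real (Suc n)))) / 3"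
      by (rule laplace_indicator(2)[OF 3]) simp
    also have "Re \<dots> = real (Suc n) powr (- 3) / 3"
      by (simp add: Re_exp powr_def del: of_nat_Suc)
    also have "\<bar>mu_gcd_coeff (Suc n)\<bar> * (real (Suc n) powr (- 3) / 3) \<le> real (Suc n) * real (Suc n) powr (- 3)"
      using abs_mu_gcd_coeff_le[of "Suc n"] by (intro mult_mono) auto
    also have "\<dots> = real (Suc n) powr (- 2)"
      by (subst powr_mult_base) auto
    finally show ?thesis .
  qed
  have sm: "summable (\<lambda>n. LBINT v. norm (f n v))"
    by (rule summable_comparison_test'[OF summable_Suc_powr[of "- 2"]]) (use fn in auto)
  have ae: "AE v in lborel. summable (\<lambda>n. norm (f n v))"
  proof (rule AE_I2)
    fix v
    show "summable (\<lambda>n. norm (f n v))"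
    proof (rule summable_finite[of "{..nat \<lceil>exp v\<rceil>}"])
      fix n assume n: "n \<notin> {..nat \<lceil>exp v\<rceil>}"
      then have "exp v < real (Suc n)" by (simp add: not_le nat_less_iff) linarith
      then have "v < ln (real (Suc n))" by (subst ln_exp[of v, symmetric], subst ln_less_cancel_iff) auto
      then show "norm (f n v) = 0" by (simp add: f_def)
    qed simp
  qed
  have eq: "(\<lambda>v. \<Sum>n. f n v) = (\<lambda>v. of_real (S_mu (exp v)) * exp (- s * of_real v))"
    using fs by (auto simp: sums_iff)
  show "integrable lborel (\<lambda>v. of_real (S_mu (exp v)) * exp (- s * of_real v))"
    using integrable_suminf[OF fi ae sm] unfolding eq .
  have "(\<lambda>n. CLBINT v. f n v) sums (CLBINT v. of_real (S_mu (exp v)) * exp (- s * of_real v))"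
    using sums_integral[OF fi ae sm] unfolding eq .
  moreover have "(\<lambda>n. CLBINT v. f n v) sums ((zeta s)\<^sup>2 / (zeta (2 * s))\<^sup>2 / s)"
  proof -
    have "((\<lambda>n. of_real (mu_gcd_coeff n) * of_nat n powr (- s)) has_sum ((zeta s)\<^sup>2 / (zeta (2 * s))\<^sup>2)) (range Suc)"
      using has_sum_mu_gcd_coeff[of s] s by (simp add: greaterThan_0[symmetric] greaterThan_def)
    then have "((\<lambda>n. of_real (mu_gcd_coeff (Suc n)) * of_nat (Suc n) powr (- s)) has_sum ((zeta s)\<^sup>2 / (zeta (2 * s))\<^sup>2)) UNIV"
      by (subst (asm) has_sum_reindex) (auto simp: o_def)
    from sums_divide[OF has_sum_imp_sums[OF this], of s] show ?thesis unfolding fv .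
  qed
  ultimately show "(CLBINT v. of_real (S_mu (exp v)) * exp (- s * of_real v)) = (zeta s)\<^sup>2 / (zeta (2 * s))\<^sup>2 / s"
    by (rule sums_unique2)
qed

definition main_coeff :: real where
  "main_coeff = 1 / Re (zeta 2) ^ 2"

definition main_const :: real where
  "main_const = 2 * euler_mascheroni - 1 - 4 * (Re (deriv zeta 2) / Re (zeta 2))"

lemma E_mu_eq: "E_mu x = S_mu x - main_coeff * x * (ln x + main_const)"
  by (simp add: E_mu_def main_coeff_def main_const_def)

text \<open>Cutting off at v = 0 makes the Laplace integral of the main term converge;
  \<open>S_mu (exp v)\<close> itself vanishes for v < 0.\<close>

definition E_exp :: "real \<Rightarrow> real" where
  "E_exp v = (if v < 0 then 0 else E_mu (exp v))"

lemma E_exp_eq: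
  "E_exp v = S_mu (exp v) - (main_coeff * (indicator {0..} v * v) * exp v + main_coeff * main_const * indicator {0..} v * exp v)"
proof (cases "v < 0")
  case True
  then have "nat \<lfloor>exp v\<rfloor> = 0" by (simp add: floor_le_zero exp_less_one_iff less_imp_le floor_less_one)
  then have "S_mu (exp v) = 0" unfolding S_mu_eq_sum by simp
  then show ?thesis using True by (simp add: E_exp_def)
qed (simp add: E_exp_def E_mu_eq algebra_simps)

lemma E_exp_measurable [measurable]: "E_exp \<in> borel_measurable borel"
  unfolding E_exp_eq[abs_def] by measurable

lemma E_exp_bound: "\<exists>M. \<forall>v. \<bar>E_exp v\<bar> \<le> M * exp (2 * \<bar>v\<bar>)"
proof (intro exI allI)
  fix v
  let ?M = "1 + \<bar>main_coeff\<bar> * (1 + \<bar>main_const\<bar>)"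
  show "\<bar>E_exp v\<bar> \<le> ?M * exp (2 * \<bar>v\<bar>)"
  proof (cases "v < 0")
    case False
    define x where "x = exp v"
    have "v \<le> x" using exp_ge_add_one_self[of v] unfolding x_def by linarith
    then have x: "x \<ge> 1" "ln x = v" "x\<^sup>2 = exp (2 * \<bar>v\<bar>)" "0 \<le> v" "v \<le> x"
      using False by (auto simp: x_def exp_double)
    have "\<bar>v + main_const\<bar> \<le> x * (1 + \<bar>main_const\<bar>)"
      using x mult_right_mono[of 1 x "\<bar>main_const\<bar>"] by (simp add: algebra_simps)
    then have "\<bar>main_coeff * x * (v + main_const)\<bar> \<le> \<bar>main_coeff\<bar> * x * (x * (1 + \<bar>main_const\<bar>))"
      unfolding abs_mult using x by (intro mult_mono) auto
    also have "\<dots> = \<bar>main_coeff\<bar> * (1 + \<bar>main_const\<bar>) * x\<^sup>2" by (simp add: power2_eq_square)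
    finally have "\<bar>E_exp v\<bar> \<le> x\<^sup>2 + \<bar>main_coeff\<bar> * (1 + \<bar>main_const\<bar>) * x\<^sup>2"
      using abs_S_mu_le[OF x(1)] False x(2) by (simp add: E_exp_def E_mu_eq x_def[symmetric])
    then show ?thesis using x(3) by (simp add: algebra_simps)
  qed (simp add: E_exp_def)
qed

text \<open>Jumps occur only at 0 and at logarithms of integers, a countable set.\<close>

lemma E_exp_isCont: "AE v in lborel. isCont E_exp v"
proof -
  define N where "N = insert 0 (range (\<lambda>n. ln (real n)))"
  have "N \<in> null_sets lborel" unfolding N_def by (intro countable_imp_null_set_lborel) auto
  then have "AE v in lborel. v \<notin> N" by (rule AE_not_in)
  then show ?thesis
  proof (rule AE_mp, intro AE_I2 impI)
    fix v assume v: "v \<notin> N"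
    show "isCont E_exp v"
    proof (cases "v < 0")
      case True
      have "\<forall>\<^sub>F w in nhds v. w < 0" using eventually_nhds_in_open[of "{..<0}" v] True by simp
      then have "\<forall>\<^sub>F w in nhds v. E_exp w = 0" by eventually_elim (simp add: E_exp_def)
      then show ?thesis using isCont_cong[of E_exp "\<lambda>_. 0" v] by simp
    next
      case False
      then have v0: "v > 0" using v by (cases "v = 0") (auto simp: N_def)
      define k where "k = \<lfloor>exp v\<rfloor>"
      have "exp v \<noteq> of_int k"
      proof
        assume e: "exp v = of_int k"
        then have "real (nat k) = exp v" using exp_gt_zero[of v] by simp
        then have "v = ln (real (nat k))" by simp
        then show False using v by (auto simp: N_def)
      qed
      then have k: "of_int k < exp v" "exp v < of_int k + 1"
        using of_int_floor_le[of "exp v"] unfolding k_def by linarith+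
      have "open {w :: real. w > 0 \<and> of_int k < exp w \<and> exp w < of_int k + 1}"
        by (intro open_Collect_conj open_Collect_less continuous_on_exp continuous_on_id continuous_on_const)
      then have "\<forall>\<^sub>F w in nhds v. w \<in> {w. w > 0 \<and> of_int k < exp w \<and> exp w < of_int k + 1}"
        by (rule eventually_nhds_in_open) (use v0 k in auto)
      then have "\<forall>\<^sub>F w in nhds v. E_exp w = S_mu (exp v) - main_coeff * exp w * (w + main_const)"
      proof eventually_elim
        case (elim w)
        then have "\<lfloor>exp w\<rfloor> = k" by (simp add: floor_eq_iff)
        then have "S_mu (exp w) = S_mu (exp v)" unfolding S_mu_eq_sum k_def by simp
        then show ?case using elim by (simp add: E_exp_def E_mu_eq)
      qed
      moreover have "isCont (\<lambda>w. S_mu (exp v) - main_coeff * exp w * (w + main_const)) v" by (intro continuous_intros)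
      ultimately show ?thesis by (simp add: isCont_cong)
    qed
  qed
qed

text \<open>The main terms v e^v and e^v on the half-line have transforms 1 / (s - 1)^2 and 1 / (s -
  1); they are matched with the principal part at 1.\<close>

lemma laplace_E_exp:
  assumes s: "Re s = 3"
  shows "(CLBINT v. of_real (E_exp v) * exp (- s * of_real v))
     = (zeta s)\<^sup>2 / (zeta (2 * s))\<^sup>2 / s - of_real main_coeff / (s - 1)\<^sup>2 - of_real (main_coeff * main_const) / (s - 1)"
proof -
  have s1: "Re (s - 1) > 0" using s by simp
  have ex: "exp (- (s - 1) * of_real v) = of_real (exp v) * exp (- s * of_real v)" for v
    unfolding exp_of_real[symmetric] exp_add[symmetric] by (simp add: algebra_simps)
  have "of_real (E_exp v) * exp (- s * of_real v) = of_real (S_mu (exp v)) * exp (- s * of_real v)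
      - (of_real main_coeff * (of_real (indicator {0..} v * v) * exp (- (s - 1) * of_real v))
       + of_real (main_coeff * main_const) * (of_real (indicator {0..} v) * exp (- (s - 1) * of_real v)))" for v
    unfolding ex E_exp_eq by (simp add: algebra_simps)
  note eq = this
  have i1: "integrable lborel (\<lambda>v. of_real main_coeff * (of_real (indicator {0..} v * v) * exp (- (s - 1) * of_real v)))"
    and i2: "integrable lborel (\<lambda>v. of_real (main_coeff * main_const) * (of_real (indicator {0..} v) * exp (- (s - 1) * of_real v)))"
    by (intro integrable_mult_right laplace_id s1 laplace_indicator order_refl)+
  have "(CLBINT v. of_real (E_exp v) * exp (- s * of_real v)) =
      (CLBINT v. of_real (S_mu (exp v)) * exp (- s * of_real v)
      - (of_real main_coeff * (of_real (indicator {0..} v * v) * exp (- (s - 1) * of_real v))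
       + of_real (main_coeff * main_const) * (of_real (indicator {0..} v) * exp (- (s - 1) * of_real v))))"
    unfolding eq ..
  also have "\<dots> = (CLBINT v. of_real (S_mu (exp v)) * exp (- s * of_real v))
      - ((CLBINT v. of_real main_coeff * (of_real (indicator {0..} v * v) * exp (- (s - 1) * of_real v)))
       + (CLBINT v. of_real (main_coeff * main_const) * (of_real (indicator {0..} v) * exp (- (s - 1) * of_real v))))"
    by (simp only: Bochner_Integration.integral_diff[OF laplace_S_mu(1)[OF s] Bochner_Integration.integrable_add[OF i1 i2]]
      Bochner_Integration.integral_add[OF i1 i2])
  also have "\<dots> = (zeta s)\<^sup>2 / (zeta (2 * s))\<^sup>2 / s - (of_real main_coeff * (1 / (s - 1)\<^sup>2)
      + of_real (main_coeff * main_const) * (exp (- (s - 1) * of_real 0) / (s - 1)))"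
    by (simp only: integral_mult_right_zero laplace_S_mu(2)[OF s] laplace_id(2)[OF s1] laplace_indicator(2)[OF s1 order_refl])
  finally show ?thesis by (simp only: of_real_0 mult_zero_right exp_zero times_divide_eq_right mult_1_right diff_diff_add)
qed

section \<open>The mean square of the error term\<close>

text \<open>This is (s - 1)^2 \<zeta>(s)^2 / (s \<zeta>(2 s)^2) with the poles of \<zeta>(s) at 1
  and of \<zeta>(2 s) at 1/2 cleared, hence holomorphic wherever s is not 0 and \<zeta>(2 s) has no
  zero.\<close>

definition mu_kernel :: "complex \<Rightarrow> complex" where
  "mu_kernel s = (zeta_reg s)\<^sup>2 * (2 * s - 1)\<^sup>2 / (s * (zeta_reg (2 * s))\<^sup>2)"

lemma zeta_2: "zeta 2 = of_real (Re (zeta 2))" "Re (zeta 2) \<noteq> 0"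
  and deriv_zeta_2: "deriv zeta 2 = of_real (Re (deriv zeta 2))"
proof -
  have d: "(zeta has_field_derivative deriv zeta 2) (at 2)"
    by (rule holomorphic_derivI[OF holomorphic_zeta]) auto
  have "(cnj \<circ> zeta \<circ> cnj) = zeta" by (auto simp: zeta_cnj)
  then have "(zeta has_field_derivative cnj (deriv zeta 2)) (at 2)"
    using has_field_derivative_cnj_cnj[of zeta "deriv zeta 2" 2] d by simp
  then have "cnj (deriv zeta 2) = deriv zeta 2" using d DERIV_unique by blast
  then show "deriv zeta 2 = of_real (Re (deriv zeta 2))" by (simp add: complex_eq_iff)
  show r: "zeta 2 = of_real (Re (zeta 2))" using zeta_cnj[of 2] by (simp add: complex_eq_iff)
  show "Re (zeta 2) \<noteq> 0" using norm_zeta_Re_ge_2(1)[of 2] r by auto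
qed

lemma mu_kernel_1: "mu_kernel 1 = of_real main_coeff"
proof -
  have "zeta_reg 2 = of_real (Re (zeta 2))" using zeta_2 by (simp add: zeta_reg_def)
  moreover have "zeta_reg 1 = 1" by (simp add: zeta_reg_def)
  ultimately show ?thesis by (simp add: mu_kernel_def main_coeff_def)
qed

text \<open>Logarithmic differentiation at 1: \<zeta>(s)^2 contributes 2 \<gamma>, 1 / s contributes
  - 1, and \<zeta>(2 s)^(- 2) contributes - 4 \<zeta>'(2) / \<zeta>(2). Here the main term in the
  definition of \<open>E_mu\<close> is recognised as the residue.\<close>

lemma mu_kernel_deriv_1:
  "(mu_kernel has_field_derivative of_real (main_coeff * main_const)) (at 1)"
proof -
  define z where "z = complex_of_real (Re (zeta 2))"
  define z' where "z' = complex_of_real (Re (deriv zeta 2))"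
  define e where "e = complex_of_real euler_mascheroni"
  have z: "zeta 2 = z" "deriv zeta 2 = z'" "z \<noteq> 0" "zeta_reg 2 = z" "zeta_reg 1 = 1"
    using zeta_2 deriv_zeta_2 by (auto simp: z_def z'_def zeta_reg_def)
  have d: "(zeta has_field_derivative z') (at 2)"
    using holomorphic_derivI[OF holomorphic_zeta, of 2] z by auto
  have "((\<lambda>s. (s - 1) * zeta s) has_field_derivative z + z') (at 2)"
    by (rule DERIV_cong, (rule derivative_intros d refl)+) (simp add: z)
  then have dZ2: "(zeta_reg has_field_derivative z + z') (at 2)"
    by (rule has_field_derivative_transform_within_open[of _ _ _ "- {1}"]) (auto simp: zeta_reg_def)
  have dZ2': "((\<lambda>s. zeta_reg (2 * s)) has_field_derivative (z + z') * 2) (at 1)"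
    by (rule DERIV_chain2[of zeta_reg]) (use dZ2 in \<open>auto intro!: derivative_eq_intros\<close>)
  have dZ1: "(zeta_reg has_field_derivative e) (at 1)"
    using field_differentiable_derivI[OF zeta_reg_differentiable[of 1]] by (simp only: deriv_zeta_reg_1 e_def)
  have num: "((\<lambda>s. (zeta_reg s)\<^sup>2 * (2 * s - 1)\<^sup>2) has_field_derivative (2 * e + 4)) (at 1)"
    using z by (auto intro!: derivative_eq_intros dZ1)
  have den: "((\<lambda>s. s * (zeta_reg (2 * s))\<^sup>2) has_field_derivative (z\<^sup>2 + 4 * z * (z + z'))) (at 1)"
    by (rule DERIV_cong[OF DERIV_mult[OF DERIV_ident DERIV_power[OF dZ2', of 2]]])
       (use z in \<open>simp add: algebra_simps power2_eq_square\<close>)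
  have "(mu_kernel has_field_derivative ((2 * e + 4) * (1 * (zeta_reg (2 * 1))\<^sup>2)
      - ((zeta_reg 1)\<^sup>2 * (2 * 1 - 1)\<^sup>2) * (z\<^sup>2 + 4 * z * (z + z')))
      / ((1 * (zeta_reg (2 * 1))\<^sup>2) * (1 * (zeta_reg (2 * 1))\<^sup>2))) (at 1)"
    unfolding mu_kernel_def[abs_def] by (rule DERIV_divide[OF num den]) (use z in simp)
  moreover have "((2 * e + 4) * (1 * (zeta_reg (2 * 1))\<^sup>2)
      - ((zeta_reg 1)\<^sup>2 * (2 * 1 - 1)\<^sup>2) * (z\<^sup>2 + 4 * z * (z + z')))
      / ((1 * (zeta_reg (2 * 1))\<^sup>2) * (1 * (zeta_reg (2 * 1))\<^sup>2)) = 1 / z\<^sup>2 * (2 * e - 1 - 4 * (z' / z))"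
    using z by (simp add: field_simps power2_eq_square)
  moreover have "\<dots> = of_real (main_coeff * main_const)"
    by (simp add: main_coeff_def main_const_def z_def z'_def e_def)
  ultimately show ?thesis by simp
qed

text \<open>After subtraction of its Taylor polynomial of degree 1 the kernel vanishes to second
  order at 1; dividing twice by s - 1, with a removable singularity each time, gives H.\<close>

lemma mu_transform_continuation:
  assumes RH: riemann_hypothesis
  shows "\<exists>H. H holomorphic_on {s. Re s > 1 / 4} \<and>
    (\<forall>s. s \<noteq> 1 \<longrightarrow> H s = mu_kernel s / (s - 1)\<^sup>2 - of_real main_coeff / (s - 1)\<^sup>2
                          - of_real (main_coeff * main_const) / (s - 1))"
proof -
  let ?S = "{s. Re s > 1 / 4}"
  define Q where "Q s = mu_kernel s - of_real main_coeff - of_real (main_coeff * main_const) * (s - 1)" for s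
  define f where "f z = (if z = 1 then deriv Q 1 else (Q z - Q 1) / (z - 1))" for z
  define H where "H z = (if z = 1 then deriv f 1 else (f z - f 1) / (z - 1))" for z
  have "mu_kernel holomorphic_on ?S"
    unfolding mu_kernel_def[abs_def] using zeta_reg_nonzero[OF RH]
    by (intro holomorphic_intros) (auto simp: zeta_reg_nonzero[OF RH])
  then have Q: "Q holomorphic_on ?S" unfolding Q_def by (intro holomorphic_intros)
  have f: "f holomorphic_on ?S"
    unfolding f_def by (rule pole_lemma_open[OF Q]) (rule open_halfplane)
  have H: "H holomorphic_on ?S"
    unfolding H_def by (rule pole_lemma_open[OF f]) (rule open_halfplane)
  have Q1: "Q 1 = 0" by (simp add: Q_def mu_kernel_1)
  have "(Q has_field_derivative of_real (main_coeff * main_const) - 0 - of_real (main_coeff * main_const) * (1 - 0)) (at 1)"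
    unfolding Q_def by (intro DERIV_diff mu_kernel_deriv_1 DERIV_const DERIV_cmult DERIV_ident)
  then have "deriv Q 1 = 0" by (simp add: DERIV_imp_deriv)
  then have "f 1 = 0" by (simp add: f_def)
  have "H s = mu_kernel s / (s - 1)\<^sup>2 - of_real main_coeff / (s - 1)\<^sup>2
                          - of_real (main_coeff * main_const) / (s - 1)" if "s \<noteq> 1" for s
  proof -
    have "H s = Q s / (s - 1)\<^sup>2"
      using that by (simp add: H_def \<open>f 1 = 0\<close>) (simp add: f_def Q1 power2_eq_square)
    also have "\<dots> = mu_kernel s / (s - 1)\<^sup>2 - of_real main_coeff / (s - 1)\<^sup>2
                          - of_real (main_coeff * main_const) * (s - 1) / (s - 1)\<^sup>2"
      by (simp only: Q_def diff_divide_distrib)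
    also have "of_real (main_coeff * main_const) * (s - 1) / (s - 1)\<^sup>2 = of_real (main_coeff * main_const) / (s - 1)"
      using that by (simp add: power2_eq_square)
    finally show ?thesis .
  qed
  with H show ?thesis by blast
qed

lemma mu_kernel_zeta:
  assumes "Re s = 3"
  shows "mu_kernel s / (s - 1)\<^sup>2 = (zeta s)\<^sup>2 / (zeta (2 * s))\<^sup>2 / s"
proof -
  have "Re (2 * s) = 6" using assms by simp
  then have ne: "s \<noteq> 1" "2 * s \<noteq> 1" using assms by fastforce+
  then have "(s - 1)\<^sup>2 \<noteq> 0" "(2 * s - 1)\<^sup>2 \<noteq> 0" by auto
  then show ?thesis using ne by (simp add: mu_kernel_def zeta_reg_def power_mult_distrib)
qed

lemma norm_diff_diff_le: "norm (u - v - w) \<le> norm u + norm v + norm w" for u v w :: "'a :: real_normed_vector"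
  using norm_triangle_ineq4[of "u - v" w] norm_triangle_ineq4[of u v] by linarith

section \<open>Qualitative growth for the contour shift\<close>

lemma poly_le_exp_abs: "\<exists>c\<ge>0. \<forall>y :: real. (2 * \<bar>y\<bar> + 11) ^ n \<le> c * exp \<bar>y\<bar>"
proof (intro exI[of _ "(2 * real (Suc n) + 11) ^ Suc n"] conjI allI)
  fix y :: real
  let ?m = "real (Suc n)"
  \<comment> \<open>Prepares for (1 + |y| / m)^m \<le> exp |y|; the exponential form is the one that
    \<open>mellin_mean_square\<close> asks for.\<close>
  have "2 * \<bar>y\<bar> + 11 \<le> (2 * ?m + 11) * (1 + \<bar>y\<bar> / ?m)"
    by (simp add: field_simps)
  then have "(2 * \<bar>y\<bar> + 11) ^ Suc n \<le> ((2 * ?m + 11) * (1 + \<bar>y\<bar> / ?m)) ^ Suc n"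
    by (rule power_mono) simp
  also have "\<dots> \<le> (2 * ?m + 11) ^ Suc n * exp \<bar>y\<bar>"
    unfolding power_mult_distrib
    by (intro mult_left_mono exp_ge_one_plus_x_over_n_power_n zero_le_power order_trans[OF _ abs_ge_zero]) auto
  moreover have "(2 * \<bar>y\<bar> + 11) ^ n \<le> (2 * \<bar>y\<bar> + 11) ^ Suc n"
    by (rule power_increasing) auto
  ultimately show "(2 * \<bar>y\<bar> + 11) ^ n \<le> (2 * ?m + 11) ^ Suc n * exp \<bar>y\<bar>" by linarith
qed simp

text \<open>The exponent depends on d through the lower bound for \<zeta>(2 s); it only serves to
  justify moving the line of integration. The 576 is 16 times 4 times 9.\<close>

lemma mu_kernel_growth:
  assumes RH: riemann_hypothesis and d: "d > 0"
  shows "\<exists>n. \<forall>s. Re s \<ge> 1 / 4 + d \<longrightarrow> norm (mu_kernel s) \<le> 576 * (2 * norm s + 5) ^ n"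
proof -
  obtain N where N: "\<And>s. Re s \<ge> 1 / 2 + 2 * d \<Longrightarrow> 1 \<le> 3 * (norm s + 5) ^ N * norm (zeta_reg s)"
    using inverse_zeta_reg_growth[OF RH, of "2 * d"] d by auto
  have "norm (mu_kernel s) \<le> 576 * (2 * norm s + 5) ^ (8 + 2 * N)" if s: "Re s \<ge> 1 / 4 + d" for s
  proof -
    define w where "w = 2 * norm s + 5"
    define q where "q = norm (zeta_reg (2 * s))"
    have w: "w \<ge> 5" by (simp add: w_def)
    have 1: "1 \<le> 3 * w ^ N * q" using N[of "2 * s"] s by (simp add: w_def norm_mult q_def)
    then have q: "q > 0" by (cases "q = 0") (auto simp: q_def)
    have ns: "norm s \<ge> 1 / 4" using complex_Re_le_cmod[of s] s d by linarith
    have "norm (zeta_reg s) \<le> 4 * (1 + norm s) ^ 3" using s d by (intro zeta_reg_growth) auto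
    also have "\<dots> \<le> 4 * w ^ 3" by (intro mult_left_mono power_mono) (auto simp: w_def)
    finally have Z: "norm (zeta_reg s) \<le> 4 * w ^ 3" .
    have l: "norm (2 * s - 1) \<le> w"
      using norm_triangle_ineq4[of "2 * s" 1] by (simp add: w_def norm_mult)
    have "norm (mu_kernel s) = (norm (zeta_reg s))\<^sup>2 * (norm (2 * s - 1))\<^sup>2 * (1 / norm s) * (1 / q)\<^sup>2"
      by (simp add: mu_kernel_def norm_mult norm_divide norm_power q_def power_divide)
    also have "\<dots> \<le> (4 * w ^ 3)\<^sup>2 * w\<^sup>2 * 4 * (3 * w ^ N)\<^sup>2"
      using ns q 1 w by (intro mult_mono power_mono Z l mult_nonneg_nonneg)
        (auto simp: divide_simps mult_ac)
    also have "\<dots> = 576 * w ^ (8 + 2 * N)"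
      by (simp add: power_mult_distrib power_mult[symmetric] power_add mult_ac)
    finally show ?thesis by (simp add: w_def)
  qed
  then show ?thesis by blast
qed

text \<open>Near 1 compactness bounds H; elsewhere the explicit formula does, with |s - 1| \<ge>
  1/2.\<close>

lemma mu_transform_growth:
  assumes RH: riemann_hypothesis and d: "d > 0" and hol: "H holomorphic_on {s. Re s > 1 / 4}"
    and H: "\<And>s. s \<noteq> 1 \<Longrightarrow> H s = mu_kernel s / (s - 1)\<^sup>2 - of_real a / (s - 1)\<^sup>2 - of_real b / (s - 1)"
  shows "\<exists>K. \<forall>x y. 1 / 4 + d \<le> x \<longrightarrow> x \<le> 3 \<longrightarrow> norm (H (Complex x y)) \<le> K * exp \<bar>y\<bar>"
proof -
  obtain n where n: "\<And>s. Re s \<ge> 1 / 4 + d \<Longrightarrow> norm (mu_kernel s) \<le> 576 * (2 * norm s + 5) ^ n"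
    using mu_kernel_growth[OF RH d] by blast
  obtain c where c: "c \<ge> 0" "\<And>y :: real. (2 * \<bar>y\<bar> + 11) ^ n \<le> c * exp \<bar>y\<bar>"
    using poly_le_exp_abs by blast
  have "cball 1 (1 / 2) \<subseteq> {s. Re s > 1 / 4}"
  proof
    fix s :: complex assume "s \<in> cball 1 (1 / 2)"
    then have "Re (1 - s) \<le> 1 / 2" using complex_Re_le_cmod[of "1 - s"] unfolding mem_cball dist_norm by linarith
    then show "s \<in> {s. Re s > 1 / 4}" by simp
  qed
  then have "continuous_on (cball 1 (1 / 2)) H"
    by (rule continuous_on_subset[OF holomorphic_on_imp_continuous_on[OF hol]])
  from compact_imp_bounded[OF compact_continuous_image[OF this compact_cball]]
  obtain B where B: "\<And>s. s \<in> cball 1 (1 / 2) \<Longrightarrow> norm (H s) \<le> B"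
    unfolding bounded_iff by blast
  let ?K = "\<bar>B\<bar> + 4 * (576 * c) + 4 * \<bar>a\<bar> + 2 * \<bar>b\<bar>"
  have "norm (H (Complex x y)) \<le> ?K * exp \<bar>y\<bar>" if x: "1 / 4 + d \<le> x" "x \<le> 3" for x y
  proof (cases "Complex x y \<in> cball 1 (1 / 2)")
    case True
    have "norm (H (Complex x y)) \<le> \<bar>B\<bar>" using B[OF True] by simp
    also have "\<dots> \<le> ?K" using c by simp
    also have "\<dots> \<le> ?K * exp \<bar>y\<bar>" using mult_left_mono[of 1 "exp \<bar>y\<bar>" ?K] c by simp
    finally show ?thesis .
  next
    case False
    define s where "s = Complex x y"
    define r where "r = norm (s - 1)"
    have r: "r \<ge> 1 / 2" using False by (simp add: r_def s_def dist_norm norm_minus_commute)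
    have inv: "1 / r \<le> 2" using r by (simp add: divide_simps)
    then have inv2: "1 / r\<^sup>2 \<le> 4" using power_mono[OF inv, of 2] r by (simp add: power_divide)
    have s1: "s \<noteq> 1" using r by (auto simp: r_def)
    have "norm s \<le> 3 + \<bar>y\<bar>" using cmod_le[of s] x d by (simp add: s_def)
    then have "(2 * norm s + 5) ^ n \<le> (2 * \<bar>y\<bar> + 11) ^ n" by (intro power_mono) auto
    then have P: "norm (mu_kernel s) \<le> 576 * (c * exp \<bar>y\<bar>)"
      using n[of s] x c(2)[of y] by (simp add: s_def) 
    have "norm (H s) \<le> norm (mu_kernel s / (s - 1)\<^sup>2) + norm (of_real a / (s - 1)\<^sup>2) + norm (of_real b / (s - 1))"
      unfolding H[OF s1] by (rule norm_diff_diff_le)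
    also have "\<dots> = norm (mu_kernel s) * (1 / r\<^sup>2) + \<bar>a\<bar> * (1 / r\<^sup>2) + \<bar>b\<bar> * (1 / r)"
      by (simp add: norm_divide norm_power r_def)
    also have "\<dots> \<le> 576 * (c * exp \<bar>y\<bar>) * 4 + \<bar>a\<bar> * 4 + \<bar>b\<bar> * 2"
      using c(1) r by (intro add_mono mult_mono P inv inv2) auto
    also have "\<dots> \<le> 576 * (c * exp \<bar>y\<bar>) * 4 + \<bar>a\<bar> * 4 * exp \<bar>y\<bar> + \<bar>b\<bar> * 2 * exp \<bar>y\<bar> + \<bar>B\<bar> * exp \<bar>y\<bar>"
    proof -
      have "\<bar>a\<bar> * 4 * 1 \<le> \<bar>a\<bar> * 4 * exp \<bar>y\<bar>" "\<bar>b\<bar> * 2 * 1 \<le> \<bar>b\<bar> * 2 * exp \<bar>y\<bar>"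
        by (intro mult_left_mono; simp)+
      moreover have "0 \<le> \<bar>B\<bar> * exp \<bar>y\<bar>" by simp
      ultimately show ?thesis by linarith
    qed
    also have "\<dots> = ?K * exp \<bar>y\<bar>" by (simp add: algebra_simps)
    finally show ?thesis by (simp add: s_def)
  qed
  then show ?thesis by blast
qed

section \<open>Quantitative bounds on the line of abscissa 1/4 + \<delta>\<close>

definition zeta_log_bound :: "real \<Rightarrow> real \<Rightarrow> real \<Rightarrow> real" where
  "zeta_log_bound C \<eta> t = 256 * (C * ln (\<bar>t\<bar> + 8)) / (\<eta> * (ln (C * ln (\<bar>t\<bar> + 8)))\<^sup>2)"

lemma ln_8_gt_1: "ln (8 :: real) > 1" "t \<ge> 0 \<Longrightarrow> ln (t + 8) > (1 :: real)"
proof -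
  have e: "exp 1 < (8 :: real)" using exp_le by linarith
  show g: "ln (t + 8) > (1 :: real)" if "t \<ge> 0" for t
    using e that by (subst ln_exp[of 1, symmetric], subst ln_less_cancel_iff) auto
  from g[of 0] show "ln (8 :: real) > 1" by simp
qed

text \<open>The decisive trade-off. The left side is at most 2048 q with q = C l / (\<delta> b^2).
  If b \<ge> K / \<delta>, then q is at most \<delta> l / 1024, which amounts to a small power of
  |y|; otherwise C l = exp b is below exp (K / \<delta>) and q is bounded by a constant depending on
  \<delta> alone. K^2 = 1024 C is chosen so that the first loss is at most 2 \<delta> l.\<close>

lemma zeta_log_bound_sum_le:
  assumes C: "C \<ge> exp 1" and d: "0 < \<delta>" "\<delta> \<le> 1 / 16" and K: "K > 0" "K\<^sup>2 = 1024 * C"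
  shows "4 * zeta_log_bound C (1 / 4 - \<delta>) y + 4 * zeta_log_bound C (2 * \<delta>) (2 * y)
    \<le> 2 * \<delta> * ln (\<bar>y\<bar> + 8) + 2048 * exp (K / \<delta>) / \<delta>"
proof -
  define l where "l = ln (\<bar>y\<bar> + 8)"
  define l2 where "l2 = ln (\<bar>2 * y\<bar> + 8)"
  define b where "b = ln (C * l)"
  define b2 where "b2 = ln (C * l2)"
  have C0: "C > 0" using C exp_gt_zero[of 1] by linarith
  have l: "l > 1" "l \<le> l2" unfolding l_def l2_def using ln_8_gt_1(2)[of "\<bar>y\<bar>"] by auto
  \<comment> \<open>Doubling the height at most doubles the logarithm, so both bounds can be
    measured by the same l.\<close>
  have sq: "2 * u + 8 \<le> (u + 8)\<^sup>2" if "u \<ge> 0" for u :: real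
  proof -
    have "(u + 8)\<^sup>2 = u\<^sup>2 + 16 * u + 64" by (simp add: power2_eq_square algebra_simps)
    then show ?thesis using that zero_le_power2[of u] by linarith
  qed
  have "l2 \<le> ln ((\<bar>y\<bar> + 8)\<^sup>2)"
    unfolding l2_def using sq[of "\<bar>y\<bar>"] by (intro ln_mono) (auto simp: abs_mult)
  also have "\<dots> = 2 * l" unfolding l_def by (subst ln_realpow) auto
  finally have l2: "l2 \<le> 2 * l" .
  have "exp 1 \<le> C * l" using C C0 l mult_mono[of "exp 1" C 1 l] by simp
  then have b1: "b \<ge> 1" unfolding b_def by (subst ln_ge_iff) (use C0 l in auto)
  have b2: "b2 \<ge> b" unfolding b_def b2_def using C0 l by (subst ln_le_cancel_iff) auto
  have Cl: "C * l = exp b" unfolding b_def using C0 l by simp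
  define q where "q = C * l / (\<delta> * b\<^sup>2)"
  have q0: "q \<ge> 0" unfolding q_def using C0 l d by simp
  have "C * l / ((1 / 4 - \<delta>) * b\<^sup>2) \<le> C * l / (3 * \<delta> * b\<^sup>2)"
    using d b1 C0 l by (intro divide_left_mono mult_right_mono mult_nonneg_nonneg mult_pos_pos) auto
  also have "\<dots> = q / 3" by (simp add: q_def)
  finally have 1: "zeta_log_bound C (1 / 4 - \<delta>) y \<le> 256 * (q / 3)"
    by (simp add: zeta_log_bound_def l_def[symmetric] b_def[symmetric])
  have "b\<^sup>2 \<le> b2\<^sup>2" using b1 b2 by (intro power_mono) auto
  then have "C * l2 / (2 * \<delta> * b2\<^sup>2) \<le> C * (2 * l) / (2 * \<delta> * b\<^sup>2)"
    using d b1 C0 l l2 by (intro frac_le mult_left_mono mult_pos_pos mult_nonneg_nonneg) auto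
  also have "\<dots> = q" using d by (simp add: q_def)
  finally have 2: "zeta_log_bound C (2 * \<delta>) (2 * y) \<le> 256 * q"
    by (simp add: zeta_log_bound_def l2_def[symmetric] b2_def[symmetric])
  have 3: "2048 * q \<le> 2 * \<delta> * l + 2048 * exp (K / \<delta>) / \<delta>"
  proof (cases "b \<ge> K / \<delta>")
    case True
    then have "(K / \<delta>)\<^sup>2 \<le> b\<^sup>2" using K d by (intro power_mono) auto
    then have "q \<le> C * l / (\<delta> * (K / \<delta>)\<^sup>2)"
      unfolding q_def using K d C0 l b1 by (intro divide_left_mono mult_left_mono mult_pos_pos) auto
    also have "\<dots> = C * l * \<delta> / K\<^sup>2" using d K(1) by (simp add: power_divide field_simps power2_eq_square)
    also have "\<dots> = \<delta> * l / 1024" using C0 by (simp add: K(2))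
    finally have "2048 * q \<le> 2 * (\<delta> * l)" by linarith
    then have "2048 * q \<le> 2 * \<delta> * l" by (simp only: mult.assoc)
    moreover have "0 \<le> 2048 * exp (K / \<delta>) / \<delta>" using d by simp
    ultimately show ?thesis by linarith
  next
    case False
    have "q \<le> exp (K / \<delta>) / (\<delta> * 1)"
      unfolding q_def Cl using False d b1 by (intro frac_le mult_left_mono) auto
    moreover have "0 \<le> 2 * \<delta> * l" using d l by simp
    ultimately show ?thesis by simp
  qed
  show ?thesis using 1 2 3 q0 unfolding l_def by linarith
qed

lemma ln_diff_le_imp: "ln a - ln b \<le> B \<Longrightarrow> a > 0 \<Longrightarrow> b > 0 \<Longrightarrow> a \<le> b * exp B" for a b B :: real
proof -
  assume "ln a - ln b \<le> B" "a > 0" "b > 0"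
  then have "exp (ln a) \<le> exp (ln b + B)" unfolding exp_le_cancel_iff by linarith
  then show "a \<le> b * exp B" unfolding exp_add using \<open>a > 0\<close> \<open>b > 0\<close> by (simp only: exp_ln)
qed

text \<open>The functional equation leads to abscissa 1 - x, with conjugation bringing the imaginary
  part back to y; the Gamma quotient contributes the exponent 1/2 - x, and the quotient of the
  powers of pi is at most 1.\<close>

lemma zeta_reg_left_bound:
  assumes x: "0 < x" "x \<le> 1 / 2"
  shows "norm (zeta_reg (Complex x y)) \<le> (\<bar>y\<bar> + 3) powr (1 / 2 - x) * norm (zeta_reg (Complex (1 - x) y))"
proof -
  define s where "s = Complex x y"
  define s' where "s' = Complex (1 - x) y"
  have cs: "1 - s = cnj s'" by (simp add: s_def s'_def complex_eq_iff)
  have "norm (xi s) = norm (xi s')"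
    using xi_reflect[of s] x unfolding cs xi_cnj by (simp add: s_def) (metis complex_mod_cnj)
  moreover have e: "1 + s / 2 = Complex (1 + x / 2) (y / 2)" "1 + s' / 2 = Complex (1 + (1 - x) / 2) (y / 2)"
    by (auto simp: s_def s'_def complex_eq_iff)
  moreover have "norm (of_real pi powr (- s / 2)) = pi powr (- (x / 2))" "norm (of_real pi powr (- s' / 2)) = pi powr (- ((1 - x) / 2))"
    by (subst norm_powr_real_powr; simp add: s_def s'_def)+
  ultimately have eq: "norm (zeta_reg s) * norm (Gamma (Complex (1 + x / 2) (y / 2))) * pi powr (- (x / 2))
      = norm (zeta_reg s') * norm (Gamma (Complex (1 + (1 - x) / 2) (y / 2))) * pi powr (- ((1 - x) / 2))"
    by (simp only: xi_def norm_mult)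
  define g where "g = norm (Gamma (Complex (1 + x / 2) (y / 2)))"
  have g: "g > 0" unfolding g_def using x by (intro norm_Gamma_pos) auto
  have G: "norm (Gamma (Complex (1 + (1 - x) / 2) (y / 2))) \<le> (\<bar>y\<bar> + 3) powr (1 / 2 - x) * g"
    using norm_Gamma_ratio_le[of "1 + x / 2" "1 + (1 - x) / 2" "y / 2"] x unfolding g_def
    by (simp add: diff_divide_distrib abs_divide)
  have p: "pi powr (- ((1 - x) / 2)) \<le> pi powr (- (x / 2))"
    using x pi_gt3 by (intro powr_mono) auto
  have A: "norm (Gamma (Complex (1 + (1 - x) / 2) (y / 2))) * pi powr (- ((1 - x) / 2))
      \<le> ((\<bar>y\<bar> + 3) powr (1 / 2 - x) * g) * pi powr (- (x / 2))"
    using g by (intro mult_mono G p) auto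
  have "norm (zeta_reg s) * (g * pi powr (- (x / 2)))
      = norm (zeta_reg s') * (norm (Gamma (Complex (1 + (1 - x) / 2) (y / 2))) * pi powr (- ((1 - x) / 2)))"
    using eq by (simp only: g_def mult.assoc)
  also have "\<dots> \<le> norm (zeta_reg s') * (((\<bar>y\<bar> + 3) powr (1 / 2 - x) * g) * pi powr (- (x / 2)))"
    using A by (rule mult_left_mono) simp
  also have "\<dots> = ((\<bar>y\<bar> + 3) powr (1 / 2 - x) * norm (zeta_reg s')) * (g * pi powr (- (x / 2)))"
    by (simp add: mult_ac)
  finally show ?thesis
    unfolding s_def[symmetric] s'_def[symmetric]
    by (rule mult_right_le_imp_le) (use g in simp)
qed

text \<open>The power of |y| is 2 (1/4 - \<delta>) from the functional equation, plus 2 from the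
  size of \<open>zeta_reg\<close> at 2 + i y, minus 1 from the factor 1 / s. The values at abscissas
  3/4 - \<delta> and 1/2 + 2 \<delta> are compared with those at abscissa 2.\<close>

lemma mu_kernel_line_bound:
  assumes RH: riemann_hypothesis
    and bd: "\<And>t \<eta>. 0 < \<eta> \<Longrightarrow> \<eta> \<le> 3 / 2 \<Longrightarrow>
      \<bar>ln (norm (zeta_reg (Complex (1 / 2 + \<eta>) t))) - ln (norm (zeta_reg (Complex 2 t)))\<bar> \<le> zeta_log_bound C \<eta> t"
    and d: "0 < \<delta>" "\<delta> \<le> 1 / 16"
  shows "norm (mu_kernel (Complex (1 / 4 + \<delta>) y)) \<le> 468 * (\<bar>y\<bar> + 3) powr (3 / 2 - 2 * \<delta>)
    * exp (2 * zeta_log_bound C (1 / 4 - \<delta>) y + 2 * zeta_log_bound C (2 * \<delta>) (2 * y))"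
proof -
  define s where "s = Complex (1 / 4 + \<delta>) y"
  define w where "w = \<bar>y\<bar> + 3"
  have w: "w \<ge> 3" by (simp add: w_def)
  let ?B1 = "zeta_log_bound C (1 / 4 - \<delta>) y" and ?B2 = "zeta_log_bound C (2 * \<delta>) (2 * y)"
  have nz: "norm (zeta_reg z) > 0" if "Re z > 1 / 2" for z using zeta_reg_nonzero[OF RH that] by simp
  have "norm (zeta_reg (Complex (1 - (1 / 4 + \<delta>)) y)) \<le> norm (zeta_reg (Complex 2 y)) * exp ?B1"
  proof (rule ln_diff_le_imp)
    have "Complex (1 - (1 / 4 + \<delta>)) y = Complex (1 / 2 + (1 / 4 - \<delta>)) y" by simp
    then show "ln (norm (zeta_reg (Complex (1 - (1 / 4 + \<delta>)) y))) - ln (norm (zeta_reg (Complex 2 y))) \<le> ?B1"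
      using bd[of "1 / 4 - \<delta>" y] d by (simp only:) linarith
  qed (use d in \<open>auto intro!: nz simp del: zero_less_norm_iff\<close>)
  also have "\<dots> \<le> (2 * w) * exp ?B1"
  proof (rule mult_right_mono)
    have "norm (zeta_reg (Complex 2 y)) \<le> 5 / 3 * norm (Complex 2 y - 1)" by (rule zeta_reg_Re_ge_2) simp
    also have "norm (Complex 2 y - 1) \<le> 1 + \<bar>y\<bar>" using cmod_le[of "Complex 2 y - 1"] by simp
    finally show "norm (zeta_reg (Complex 2 y)) \<le> 2 * w" by (simp add: w_def)
  qed simp
  finally have Z': "norm (zeta_reg (Complex (1 - (1 / 4 + \<delta>)) y)) \<le> 2 * w * exp ?B1" .
  have "norm (zeta_reg s) \<le> w powr (1 / 2 - (1 / 4 + \<delta>)) * norm (zeta_reg (Complex (1 - (1 / 4 + \<delta>)) y))"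
    unfolding s_def w_def by (rule zeta_reg_left_bound) (use d in auto)
  also have "\<dots> \<le> w powr (1 / 4 - \<delta>) * (2 * w * exp ?B1)"
    using Z' by (intro mult_mono) auto
  also have "\<dots> = 2 * w powr (5 / 4 - \<delta>) * exp ?B1"
    using w by (simp add: powr_mult_base[of w "1 / 4 - \<delta>"] mult_ac)
  finally have Z: "norm (zeta_reg s) \<le> 2 * w powr (5 / 4 - \<delta>) * exp ?B1" .
  have e2: "2 * s = Complex (1 / 2 + 2 * \<delta>) (2 * y)" by (simp add: s_def complex_eq_iff)
  have "norm (zeta_reg (Complex 2 (2 * y))) \<le> norm (zeta_reg (2 * s)) * exp ?B2"
    unfolding e2
  proof (rule ln_diff_le_imp)
    show "ln (norm (zeta_reg (Complex 2 (2 * y)))) - ln (norm (zeta_reg (Complex (1 / 2 + 2 * \<delta>) (2 * y)))) \<le> ?B2"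
      using bd[of "2 * \<delta>" "2 * y"] d by linarith
  qed (use d in \<open>auto intro!: nz simp del: zero_less_norm_iff\<close>)
  \<comment> \<open>The factor 2 s - 1 and \<open>zeta_reg (2 * s)\<close> balance each other: the
    latter is compared with the value at abscissa 2, which is at least a third of |2 s - 1|.\<close>
  moreover have "norm (2 * s - 1) / 3 \<le> norm (zeta_reg (Complex 2 (2 * y)))"
  proof -
    have "(2 * \<delta> - 1 / 2)\<^sup>2 \<le> 1\<^sup>2" using d by (subst abs_le_square_iff[symmetric]) (auto simp: abs_le_iff)
    then have "norm (2 * s - 1) \<le> norm (Complex 2 (2 * y) - 1)"
      unfolding e2 cmod_def by (simp add: real_sqrt_le_iff)
    then show ?thesis using zeta_reg_Re_ge_2(1)[of "Complex 2 (2 * y)"] by simp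
  qed
  ultimately have R: "norm (2 * s - 1) / norm (zeta_reg (2 * s)) \<le> 3 * exp ?B2"
    using nz[of "2 * s"] d by (simp add: e2 divide_le_eq mult_ac)
  have "1 / 4 \<le> norm s" "\<bar>y\<bar> \<le> norm s"
    using complex_Re_le_cmod[of s] abs_Im_le_cmod[of s] d by (auto simp: s_def)
  then have ws: "w \<le> 13 * norm s" "norm s > 0" by (auto simp: w_def)
  then have S: "1 / norm s \<le> 13 * w powr - 1" using w by (simp add: powr_minus divide_simps)
  have "norm (mu_kernel s) = (norm (zeta_reg s))\<^sup>2 * (norm (2 * s - 1) / norm (zeta_reg (2 * s)))\<^sup>2 * (1 / norm s)"
    by (simp add: mu_kernel_def norm_mult norm_divide norm_power power_divide)
  also have "\<dots> \<le> (2 * w powr (5 / 4 - \<delta>) * exp ?B1)\<^sup>2 * (3 * exp ?B2)\<^sup>2 * (13 * w powr - 1)"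
    by (intro mult_mono power_mono Z R S) auto
  also have "\<dots> = 468 * (w powr (5 / 4 - \<delta>) * w powr (5 / 4 - \<delta>) * w powr - 1) * (exp ?B1 * exp ?B1 * exp ?B2 * exp ?B2)"
    by (simp add: power2_eq_square)
  also have "w powr (5 / 4 - \<delta>) * w powr (5 / 4 - \<delta>) * w powr - 1 = w powr (3 / 2 - 2 * \<delta>)"
    unfolding powr_add[symmetric] by (rule arg_cong[of _ _ "(powr) w"]) simp
  also have "exp ?B1 * exp ?B1 * exp ?B2 * exp ?B2 = exp (2 * ?B1 + 2 * ?B2)"
    unfolding exp_add[symmetric] by simp
  finally show ?thesis by (simp add: s_def w_def)
qed

text \<open>Squaring gives the exponent - 1 - 4 \<delta>; the losses in
  \<open>zeta_log_bound\<close> use up 2 \<delta> of it and the rest keeps the integral convergent.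
  The subtracted principal part decays at least like 1 / |y| and is dominated.\<close>

lemma mu_transform_line_bound:
  assumes RH: riemann_hypothesis and C: "C \<ge> exp 1" and K: "K > 0" "K\<^sup>2 = 1024 * C"
    and bd: "\<And>t \<eta>. 0 < \<eta> \<Longrightarrow> \<eta> \<le> 3 / 2 \<Longrightarrow>
      \<bar>ln (norm (zeta_reg (Complex (1 / 2 + \<eta>) t))) - ln (norm (zeta_reg (Complex 2 t)))\<bar> \<le> zeta_log_bound C \<eta> t"
    and d: "0 < \<delta>" "\<delta> \<le> 1 / 16"
    and H: "\<And>s. s \<noteq> 1 \<Longrightarrow> H s = mu_kernel s / (s - 1)\<^sup>2 - of_real a / (s - 1)\<^sup>2 - of_real b / (s - 1)"
  shows "(norm (H (Complex (1 / 4 + \<delta>) y)))\<^sup>2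
    \<le> 3 * (22932 + 49 * \<bar>a\<bar> + 7 * \<bar>b\<bar>)\<^sup>2 * exp (2048 * exp (K / \<delta>) / \<delta>) * (\<bar>y\<bar> + 3) powr (- 1 - 2 * \<delta>)"
proof -
  define s where "s = Complex (1 / 4 + \<delta>) y"
  define w where "w = \<bar>y\<bar> + 3"
  define r where "r = norm (s - 1)"
  define E where "E = 2 * zeta_log_bound C (1 / 4 - \<delta>) y + 2 * zeta_log_bound C (2 * \<delta>) (2 * y)"
  let ?c = "22932 + 49 * \<bar>a\<bar> + 7 * \<bar>b\<bar>"
  have w: "w \<ge> 3" by (simp add: w_def)
  have C0: "C > 0" using C exp_gt_zero[of 1] by linarith
  have "zeta_log_bound C \<eta> t \<ge> 0" if "\<eta> > 0" for \<eta> t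
    unfolding zeta_log_bound_def using C0 ln_8_gt_1(2)[of "\<bar>t\<bar>"] that by (intro divide_nonneg_nonneg mult_nonneg_nonneg) auto
  then have E0: "E \<ge> 0" using d by (simp add: E_def)
  \<comment> \<open>Re (s - 1) = - 3/4 + \<delta> with \<delta> \<le> 1/16, so |s - 1| stays
    comparable to |y| + 3.\<close>
  have "11 / 16 \<le> r" "\<bar>y\<bar> \<le> r"
    using abs_Re_le_cmod[of "s - 1"] abs_Im_le_cmod[of "s - 1"] d by (auto simp: s_def r_def)
  then have wr: "w \<le> 7 * r" "r > 0" by (auto simp: w_def)
  then have s1: "s \<noteq> 1" by (auto simp: r_def)
  have i1: "1 / r \<le> 7 / w" using wr w by (simp add: field_simps)
  have i2: "1 / r\<^sup>2 \<le> 49 / w\<^sup>2" using power_mono[OF i1, of 2] wr by (simp add: power_divide)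
  let ?p = "w powr (- 1 / 2 - \<delta> * 2) * exp E"
  have p: "1 / w \<le> w powr (- 1 / 2 - \<delta> * 2)"
  proof -
    have "1 / w = w powr - 1" using w by (simp add: powr_minus divide_inverse)
    also have "\<dots> \<le> w powr (- 1 / 2 - \<delta> * 2)" using w d by (intro powr_mono) auto
    finally show ?thesis .
  qed
  have p1: "1 / w \<le> ?p" using p E0 mult_mono[of "1 / w" "w powr (- 1 / 2 - \<delta> * 2)" 1 "exp E"] w by simp
  have p2: "1 / w\<^sup>2 \<le> 1 / w" using w by (simp add: field_simps power2_eq_square)
  have "norm (mu_kernel s) * (1 / r\<^sup>2) \<le> (468 * w powr (3 / 2 - 2 * \<delta>) * exp E) * (49 / w\<^sup>2)"
    unfolding s_def w_def E_def
    by (intro mult_mono mu_kernel_line_bound[OF RH bd d] i2[unfolded w_def]) auto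
  also have "\<dots> = 22932 * (w powr (3 / 2 - 2 * \<delta>) * w powr - 2) * exp E"
    using w by (simp add: powr_minus powr_numeral field_simps)
  also have "w powr (3 / 2 - 2 * \<delta>) * w powr - 2 = w powr (- 1 / 2 - \<delta> * 2)"
    unfolding powr_add[symmetric] by (rule arg_cong[of _ _ "(powr) w"]) simp
  finally have 1: "norm (mu_kernel s) * (1 / r\<^sup>2) \<le> 22932 * ?p" by (simp only: mult.assoc)
  have 2: "\<bar>a\<bar> * (1 / r\<^sup>2) \<le> 49 * \<bar>a\<bar> * ?p"
  proof -
    have "1 / r\<^sup>2 \<le> 49 * ?p" using i2 p2 p1 by simp
    then show ?thesis using mult_left_mono[of "1 / r\<^sup>2" "49 * ?p" "\<bar>a\<bar>"] by (simp only: mult_ac abs_ge_zero)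
  qed
  have 3: "\<bar>b\<bar> * (1 / r) \<le> 7 * \<bar>b\<bar> * ?p"
  proof -
    have "1 / r \<le> 7 * ?p" using i1 p1 by simp
    then show ?thesis using mult_left_mono[of "1 / r" "7 * ?p" "\<bar>b\<bar>"] by (simp only: mult_ac abs_ge_zero)
  qed
  have "norm (H s) \<le> norm (mu_kernel s / (s - 1)\<^sup>2) + norm (of_real a / (s - 1)\<^sup>2) + norm (of_real b / (s - 1))"
    unfolding H[OF s1] by (rule norm_diff_diff_le)
  also have "\<dots> = norm (mu_kernel s) * (1 / r\<^sup>2) + \<bar>a\<bar> * (1 / r\<^sup>2) + \<bar>b\<bar> * (1 / r)"
    by (simp add: norm_divide norm_power r_def)
  also have "\<dots> \<le> ?c * ?p" unfolding distrib_right by (intro add_mono 1 2 3)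
  finally have "(norm (H s))\<^sup>2 \<le> (?c * ?p)\<^sup>2" by (intro power_mono) auto
  also have "\<dots> = ?c\<^sup>2 * (w powr (- 1 / 2 - \<delta> * 2) * w powr (- 1 / 2 - \<delta> * 2)) * (exp E * exp E)"
    by (simp add: power2_eq_square)
  also have "w powr (- 1 / 2 - \<delta> * 2) * w powr (- 1 / 2 - \<delta> * 2) = w powr (- 1 - 4 * \<delta>)"
    unfolding powr_add[symmetric] by (rule arg_cong[of _ _ "(powr) w"]) simp
  finally have 4: "(norm (H s))\<^sup>2 \<le> ?c\<^sup>2 * w powr (- 1 - 4 * \<delta>) * (exp E * exp E)" .
  have "exp E * exp E \<le> 3 * w powr (2 * \<delta>) * exp (2048 * exp (K / \<delta>) / \<delta>)"
  proof -
    have "exp E * exp E = exp (4 * zeta_log_bound C (1 / 4 - \<delta>) y + 4 * zeta_log_bound C (2 * \<delta>) (2 * y))"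
      unfolding exp_add[symmetric] by (simp add: E_def)
    also have "\<dots> \<le> exp (2 * \<delta> * ln (\<bar>y\<bar> + 8) + 2048 * exp (K / \<delta>) / \<delta>)"
      using zeta_log_bound_sum_le[OF C d K] by simp
    also have "\<dots> = (\<bar>y\<bar> + 8) powr (2 * \<delta>) * exp (2048 * exp (K / \<delta>) / \<delta>)"
      by (simp add: exp_add powr_def abs_if)
    also have "\<dots> \<le> (3 * w powr (2 * \<delta>)) * exp (2048 * exp (K / \<delta>) / \<delta>)"
    proof (rule mult_right_mono)
    have "(\<bar>y\<bar> + 8) powr (2 * \<delta>) \<le> (3 * w) powr (2 * \<delta>)"
      using d by (intro powr_mono2) (auto simp: w_def)
    also have "\<dots> = 3 powr (2 * \<delta>) * w powr (2 * \<delta>)" using w by (simp add: powr_mult)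
    also have "\<dots> \<le> 3 powr 1 * w powr (2 * \<delta>)" using d by (intro mult_right_mono powr_mono) auto
    finally show "(\<bar>y\<bar> + 8) powr (2 * \<delta>) \<le> 3 * w powr (2 * \<delta>)" by simp
    qed simp
    finally show ?thesis by simp
  qed
  then have "?c\<^sup>2 * w powr (- 1 - 4 * \<delta>) * (exp E * exp E)
      \<le> ?c\<^sup>2 * w powr (- 1 - 4 * \<delta>) * (3 * w powr (2 * \<delta>) * exp (2048 * exp (K / \<delta>) / \<delta>))"
    by (rule mult_left_mono) simp
  from order_trans[OF 4 this] have "(norm (H s))\<^sup>2 \<le> ?c\<^sup>2 * w powr (- 1 - 4 * \<delta>) * (3 * w powr (2 * \<delta>) * exp (2048 * exp (K / \<delta>) / \<delta>))" .
  also have "\<dots> = 3 * ?c\<^sup>2 * exp (2048 * exp (K / \<delta>) / \<delta>) * (w powr (- 1 - 4 * \<delta>) * w powr (2 * \<delta>))"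
    by (simp add: mult_ac)
  also have "w powr (- 1 - 4 * \<delta>) * w powr (2 * \<delta>) = w powr (- 1 - 2 * \<delta>)"
    unfolding powr_add[symmetric] by (rule arg_cong[of _ _ "(powr) w"]) simp
  finally show ?thesis by (simp only: s_def w_def)
qed

text \<open>The reciprocal of e, the distance from the divergent exponent - 1, is kept explicit
  because \<delta> will depend on T.\<close>

lemma nn_integral_shifted_powr_le:
  assumes e: "e > 0"
  shows "(\<integral>\<^sup>+y. ennreal ((\<bar>y\<bar> + 3) powr (- 1 - e)) \<partial>lborel) \<le> ennreal (2 / e)"
proof -
  define f where "f y = (\<bar>y\<bar> + 3) powr (- 1 - e)" for y :: real
  have [measurable]: "f \<in> borel_measurable borel" unfolding f_def by measurable
  have pos: "(\<integral>\<^sup>+y. ennreal (f y) * indicator {0..} y \<partial>lborel) = ennreal (0 - (- ((0 + 3) powr (- e)) / e))"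
  proof (rule nn_integral_FTC_atLeast)
    show "((\<lambda>y. - ((y + 3) powr (- e)) / e) has_real_derivative f y) (at y)" if "0 \<le> y" for y
    proof -
      have "((\<lambda>y. - ((y + 3) powr (- e)) / e) has_real_derivative - ((- e * (y + 3) powr (- e - 1)) * 1) / e) (at y)"
        using that by (intro DERIV_cdivide DERIV_minus DERIV_chain2[OF has_real_derivative_powr] DERIV_cong[OF DERIV_add[OF DERIV_ident DERIV_const]]) auto
      then show ?thesis using e that by (simp add: f_def minus_diff_commute)
    qed
    have t: "filterlim (\<lambda>y :: real. y + 3) at_top at_top"
      using filterlim_tendsto_add_at_top[OF tendsto_const[of "3 :: real"] filterlim_ident] by (simp add: add.commute)
    have "((\<lambda>y. - ((y + 3) powr (- e)) / e) \<longlongrightarrow> - 0 / e) at_top"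
      by (intro tendsto_divide tendsto_minus tendsto_const tendsto_neg_powr t) (use e in auto)
    then show "((\<lambda>y. - ((y + 3) powr (- e)) / e) \<longlongrightarrow> 0) at_top" by simp
  qed (auto simp: f_def)
  have "(0 + 3) powr (- e) \<le> (1 :: real)" using e powr_mono[of "- e" 0 "3 :: real"] by simp
  then have "0 - (- ((0 + 3) powr (- e)) / e) \<le> 1 / e" using e by (simp add: divide_right_mono)
  then have pos_le: "(\<integral>\<^sup>+y. ennreal (f y) * indicator {0..} y \<partial>lborel) \<le> ennreal (1 / e)"
    unfolding pos by (rule ennreal_leI)
  have "(\<integral>\<^sup>+y. ennreal (f y) * indicator {..0} y \<partial>lborel) = ennreal \<bar>- 1\<bar> * (\<integral>\<^sup>+y. ennreal (f (0 + - 1 * y)) * indicator {..0} (0 + - 1 * y) \<partial>lborel)"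
    by (rule nn_integral_real_affine[where t = 0 and c = "- 1"]) auto
  also have "\<dots> = (\<integral>\<^sup>+y. ennreal (f y) * indicator {0..} y \<partial>lborel)"
    by (auto simp: f_def indicator_def intro!: nn_integral_cong)
  finally have neg: "(\<integral>\<^sup>+y. ennreal (f y) * indicator {..0} y \<partial>lborel) = (\<integral>\<^sup>+y. ennreal (f y) * indicator {0..} y \<partial>lborel)" .
  have "(\<integral>\<^sup>+y. ennreal (f y) \<partial>lborel) \<le> (\<integral>\<^sup>+y. ennreal (f y) * indicator {0..} y + ennreal (f y) * indicator {..0} y \<partial>lborel)"
    by (intro nn_integral_mono) (auto simp: indicator_def)
  also have "\<dots> = (\<integral>\<^sup>+y. ennreal (f y) * indicator {0..} y \<partial>lborel) + (\<integral>\<^sup>+y. ennreal (f y) * indicator {..0} y \<partial>lborel)"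
    by (intro nn_integral_add) auto
  also have "\<dots> \<le> ennreal (1 / e) + ennreal (1 / e)"
    unfolding neg by (intro add_mono pos_le)
  also have "\<dots> = ennreal (2 / e)" using e by (subst ennreal_plus[symmetric]) auto
  finally show ?thesis by (simp add: f_def)
qed

text \<open>With x = e^u the Jacobian e^u equals e^((1 + 2 \<sigma>) u) e^(- 2 \<sigma> u), and the
  first factor is at most T powr (1 + 2 \<sigma>) on the range.\<close>

lemma I_mu_le:
  assumes T: "T > 1" and \<sigma>: "0 \<le> \<sigma>" and D: "D \<ge> 0"
    and le: "(\<integral>\<^sup>+u\<in>{0..ln T}. ennreal ((E_exp u)\<^sup>2 * exp (- 2 * \<sigma> * u)) \<partial>lborel) \<le> ennreal D"
  shows "\<bar>I_mu T\<bar> \<le> T powr (1 + 2 * \<sigma>) * D"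
proof -
  let ?f = "\<lambda>x. (E_mu x)\<^sup>2" and ?p = "T powr (1 + 2 * \<sigma>)"
  have [measurable]: "E_mu \<in> borel_measurable borel" unfolding E_mu_eq[abs_def] by measurable
  define R where "R = (\<integral>\<^sup>+x. ennreal (?f x * indicator {1..T} x) \<partial>lborel)"
  have "R = (\<integral>\<^sup>+x. ennreal (?f x * indicator {exp 0..exp (ln T)} x) \<partial>lborel)"
    using T by (simp add: R_def)
  also have "\<dots> = (\<integral>\<^sup>+u. ennreal (?f (exp u) * exp u * indicator {0..ln T} u) \<partial>lborel)"
    by (rule nn_integral_substitution)
       (use T in \<open>auto intro!: derivative_eq_intros continuous_intros simp: set_borel_measurable_def\<close>)
  also have "\<dots> \<le> (\<integral>\<^sup>+u. ennreal ?p * (ennreal ((E_exp u)\<^sup>2 * exp (- 2 * \<sigma> * u)) * indicator {0..ln T} u) \<partial>lborel)"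
  proof (rule nn_integral_mono)
    fix u
    show "ennreal (?f (exp u) * exp u * indicator {0..ln T} u)
        \<le> ennreal ?p * (ennreal ((E_exp u)\<^sup>2 * exp (- 2 * \<sigma> * u)) * indicator {0..ln T} u)"
    proof (cases "u \<in> {0..ln T}")
      case True
      then have E: "E_exp u = E_mu (exp u)" by (simp add: E_exp_def)
      have "u * (1 + 2 * \<sigma>) \<le> ln T * (1 + 2 * \<sigma>)" using True \<sigma> by (intro mult_right_mono) auto
      then have "exp (u * (1 + 2 * \<sigma>) + - 2 * \<sigma> * u) \<le> exp ((1 + 2 * \<sigma>) * ln T + - 2 * \<sigma> * u)"
        by (simp add: mult.commute)
      also have "\<dots> = ?p * exp (- 2 * \<sigma> * u)" using T by (simp only: powr_def exp_add) simp
      finally have "exp u \<le> ?p * exp (- 2 * \<sigma> * u)" by (simp add: algebra_simps)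
      then have "?f (exp u) * exp u \<le> ?p * ((E_exp u)\<^sup>2 * exp (- 2 * \<sigma> * u))"
        unfolding E using mult_left_mono[of "exp u" "?p * exp (- 2 * \<sigma> * u)" "?f (exp u)"] by (simp only: mult_ac zero_le_power2)
      then show ?thesis using True by (simp add: ennreal_mult'[symmetric] ennreal_leI)
    qed simp
  qed
  also have "\<dots> = ennreal ?p * (\<integral>\<^sup>+u\<in>{0..ln T}. ennreal ((E_exp u)\<^sup>2 * exp (- 2 * \<sigma> * u)) \<partial>lborel)"
    by (rule nn_integral_cmult) measurable
  also have "\<dots> \<le> ennreal ?p * ennreal D" by (rule mult_left_mono[OF le]) simp
  also have "\<dots> = ennreal (?p * D)" by (simp add: ennreal_mult')
  finally have R: "R \<le> ennreal (?p * D)" .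
  \<comment> \<open>Finiteness makes the square integrable, so that the gauge integral in
    \<open>I_mu\<close> is a genuine value and not the default 0.\<close>
  then have "R < top" using ennreal_less_top order_le_less_trans by blast
  then have Re: "R = ennreal (enn2real R)" by simp
  have "((\<lambda>x. ?f x * indicator {1..T} x) has_integral enn2real R) UNIV"
    by (rule nn_integral_has_integral) (use Re in \<open>auto simp: R_def\<close>)
  moreover have "(\<lambda>x. ?f x * indicator {1..T} x) = (\<lambda>x. if x \<in> {1..T} then ?f x else 0)"
    by (auto simp: indicator_def)
  ultimately have "(?f has_integral enn2real R) {1..T}" by (simp only: has_integral_restrict_UNIV)
  then have "I_mu T = enn2real R" unfolding I_mu_def by (rule integral_unique)
  moreover have "enn2real R \<le> ?p * D" using R D by (intro enn2real_leI) auto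
  ultimately show ?thesis by simp
qed

text \<open>K and c depend neither on \<delta> nor on T. This uniformity is what allows \<delta> to
  be chosen as a function of T.\<close>

lemma I_mu_bound:
  assumes RH: riemann_hypothesis
  shows "\<exists>K>0. \<exists>c>0. \<forall>\<delta> T. 0 < \<delta> \<longrightarrow> \<delta> \<le> 1 / 16 \<longrightarrow> T > 1 \<longrightarrow>
    \<bar>I_mu T\<bar> \<le> T powr (3 / 2 + 2 * \<delta>) * (c / \<delta> * exp (2048 * exp (K / \<delta>) / \<delta>))"
proof -
  obtain C where C: "C \<ge> exp 1" and bd: "\<And>t \<eta>. 0 < \<eta> \<Longrightarrow> \<eta> \<le> 3 / 2 \<Longrightarrow>
      \<bar>ln (norm (zeta_reg (Complex (1 / 2 + \<eta>) t))) - ln (norm (zeta_reg (Complex 2 t)))\<bar> \<le> zeta_log_bound C \<eta> t"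
    using zeta_reg_log_bound[OF RH] unfolding zeta_log_bound_def by blast
  have C0: "C > 0" using C exp_gt_zero[of 1] by linarith
  define K where "K = sqrt (1024 * C)"
  have K: "K > 0" "K\<^sup>2 = 1024 * C" using C0 by (auto simp: K_def)
  obtain H where hol: "H holomorphic_on {s. Re s > 1 / 4}"
    and H: "\<And>s. s \<noteq> 1 \<Longrightarrow> H s = mu_kernel s / (s - 1)\<^sup>2 - of_real main_coeff / (s - 1)\<^sup>2
                          - of_real (main_coeff * main_const) / (s - 1)"
    using mu_transform_continuation[OF RH] by blast
  obtain M where M: "\<And>v. \<bar>E_exp v\<bar> \<le> M * exp (2 * \<bar>v\<bar>)" using E_exp_bound by blast
  define c where "c = 3 * (22932 + 49 * \<bar>main_coeff\<bar> + 7 * \<bar>main_coeff * main_const\<bar>)\<^sup>2"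
  have "22932 + 49 * \<bar>main_coeff\<bar> + 7 * \<bar>main_coeff * main_const\<bar> > 0" by (simp add: add_pos_nonneg)
  then have c: "c > 0" unfolding c_def by simp
  have "\<bar>I_mu T\<bar> \<le> T powr (3 / 2 + 2 * \<delta>) * (c / \<delta> * exp (2048 * exp (K / \<delta>) / \<delta>))"
    if d: "0 < \<delta>" "\<delta> \<le> 1 / 16" and T: "T > 1" for \<delta> T
  proof -
    obtain B where B: "\<And>x y. 1 / 4 + \<delta> \<le> x \<Longrightarrow> x \<le> 3 \<Longrightarrow> norm (H (Complex x y)) \<le> B * exp \<bar>y\<bar>"
      using mu_transform_growth[OF RH d(1) hol H] by blast
    let ?e = "exp (2048 * exp (K / \<delta>) / \<delta>)"
    have "(\<integral>\<^sup>+u\<in>{0..ln T}. ennreal ((E_exp u)\<^sup>2 * exp (- 2 * (1 / 4 + \<delta>) * u)) \<partial>lborel)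
        \<le> (\<integral>\<^sup>+t. ennreal ((norm (H (Complex (1 / 4 + \<delta>) t)))\<^sup>2) \<partial>lborel)"
    proof (rule mellin_mean_square[where M = M and b = 2 and c = 3 and S = "{s. Re s > 1 / 4}" and K = B])
      show "H (Complex 3 t) = (CLBINT v. of_real (E_exp v) * exp (- Complex 3 t * of_real v))" for t
      proof -
        have "Re (Complex 3 t) = 3" "Complex 3 t \<noteq> 1" by (auto simp: complex_eq_iff)
        then show ?thesis by (simp only: laplace_E_exp H mu_kernel_zeta not_False_eq_True)
      qed
      show "convex {s. Re s > 1 / 4}" by (rule convex_halfspace_Re_gt)
      show "open {s. Re s > 1 / 4}" by (rule open_halfplane)
      show "E_exp v = 0" if "v < 0" for v using that by (simp add: E_exp_def)
    qed (use d T M hol B E_exp_isCont in auto)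
    also have "\<dots> \<le> (\<integral>\<^sup>+t. ennreal (c * ?e) * ennreal ((\<bar>t\<bar> + 3) powr (- 1 - 2 * \<delta>)) \<partial>lborel)"
    proof (rule nn_integral_mono)
      fix t
      have "(norm (H (Complex (1 / 4 + \<delta>) t)))\<^sup>2 \<le> c * ?e * (\<bar>t\<bar> + 3) powr (- 1 - 2 * \<delta>)"
        unfolding c_def by (rule mu_transform_line_bound[OF RH C K bd d H])
      then show "ennreal ((norm (H (Complex (1 / 4 + \<delta>) t)))\<^sup>2) \<le> ennreal (c * ?e) * ennreal ((\<bar>t\<bar> + 3) powr (- 1 - 2 * \<delta>))"
        using c by (simp add: ennreal_mult'[symmetric] ennreal_leI)
    qed
    also have "\<dots> = ennreal (c * ?e) * (\<integral>\<^sup>+t. ennreal ((\<bar>t\<bar> + 3) powr (- 1 - 2 * \<delta>)) \<partial>lborel)"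
      by (rule nn_integral_cmult) measurable
    also have "\<dots> \<le> ennreal (c * ?e) * ennreal (2 / (2 * \<delta>))"
      using d by (intro mult_left_mono nn_integral_shifted_powr_le) auto
    also have "\<dots> = ennreal (c / \<delta> * ?e)" using c d by (simp add: ennreal_mult'[symmetric])
    finally have "\<bar>I_mu T\<bar> \<le> T powr (1 + 2 * (1 / 4 + \<delta>)) * (c / \<delta> * ?e)"
      using c d T by (intro I_mu_le) auto
    then show ?thesis by (simp add: distrib_left)
  qed
  then show ?thesis using K(1) c by blast
qed

lemma ln_gt_1: "T > 5 \<Longrightarrow> ln T > (1 :: real)"
  using exp_le by (subst ln_exp[of 1, symmetric], subst ln_less_cancel_iff) auto

theorem theorem4:
  assumes "riemann_hypothesis"
  shows "\<exists>A>0. \<exists>C>0. \<forall>T>5.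
           \<bar>I_mu T\<bar> \<le> C * (T powr (3 / 2) * exp (A * (ln T / ln (ln T))))"
proof -
  obtain K c where K: "K > 0" and c: "c > 0" and bd: "\<And>\<delta> T. 0 < \<delta> \<Longrightarrow> \<delta> \<le> 1 / 16 \<Longrightarrow> T > 1 \<Longrightarrow>
    \<bar>I_mu T\<bar> \<le> T powr (3 / 2 + 2 * \<delta>) * (c / \<delta> * exp (2048 * exp (K / \<delta>) / \<delta>))"
    using I_mu_bound[OF assms] by blast
  \<comment> \<open>The three summands pay for T powr (2 d), for exp (2048 exp (K / d) / d) and for
    the factor c / d, each as a multiple of log T / log log T.\<close>
  define A where "A = 4 * K + 8192 / K + 8"
  \<comment> \<open>Covers the bounded range log log T < 32 K, where d = 1/16 is used.\<close>
  define C1 where "C1 = exp (exp (32 * K)) powr (1 / 8) * (c / (1 / 16) * exp (2048 * exp (K / (1 / 16)) / (1 / 16)))"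
  define C where "C = c / (2 * K) + C1"
  have pos: "A > 0" "C1 > 0" "c / (2 * K) > 0" using K c by (auto simp: A_def C1_def add_pos_pos)
  have "\<bar>I_mu T\<bar> \<le> C * (T powr (3 / 2) * exp (A * (ln T / ln (ln T))))" if T: "T > 5" for T
  proof -
    define l where "l = ln T"
    define m where "m = ln l"
    have l: "l > 1" using ln_gt_1[OF T] by (simp add: l_def)
    have m: "m > 0" "exp m = l" using l by (auto simp: m_def)
    have Tl: "T = exp l" using T by (simp add: l_def)
    let ?X = "T powr (3 / 2) * exp (A * (l / m))"
    have X: "?X > 0" using T by simp
    have "\<bar>I_mu T\<bar> \<le> c / (2 * K) * ?X \<or> \<bar>I_mu T\<bar> \<le> C1 * ?X"
    \<comment> \<open>32 K is the threshold at which d = 2 K / m reaches 1/16.\<close>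
    proof (cases "m \<ge> 32 * K")
      case True
      define d where "d = 2 * K / m"
      define q where "q = l / m"
      have d: "0 < d" "d \<le> 1 / 16" using K m True by (auto simp: d_def field_simps)
      \<comment> \<open>exp (m / 2) is sqrt (log T); the quadratic lower bound makes sqrt (log T)
        log log T at most 8 log T / log log T, so the constant depending on d is affordable.\<close>
      have "(m / 2)\<^sup>2 / 2 \<le> exp (m / 2)"
        using exp_lower_Taylor_quadratic[of "m / 2"] m by simp
      then have m2: "m\<^sup>2 \<le> 8 * exp (m / 2)" by (simp add: power_divide)
      have hl: "exp (m / 2) * exp (m / 2) = l" by (simp add: m(2) flip: exp_add)
      have "exp (m / 2) * m\<^sup>2 \<le> exp (m / 2) * (8 * exp (m / 2))"
        by (rule mult_left_mono[OF m2]) simp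
      also have "\<dots> = 8 * l" unfolding hl[symmetric] by simp
      finally have "exp (m / 2) * m\<^sup>2 \<le> 8 * l" .
      then have 1: "exp (m / 2) * m \<le> 8 * q"
        using m(1) by (simp add: q_def field_simps power2_eq_square)
      have "m \<le> exp (m / 2) * m" using m(1) by simp
      then have 2: "m \<le> 8 * q" using 1 by linarith
      have Kd: "exp (K / d) = exp (m / 2)" using K m(1) by (simp add: d_def)
      have "2048 * exp (K / d) / d = 1024 / K * (exp (m / 2) * m)"
        unfolding Kd using K m(1) by (simp add: d_def field_simps)
      also have "\<dots> \<le> 1024 / K * (8 * q)" using 1 K by (intro mult_left_mono) auto
      finally have 3: "exp (2048 * exp (K / d) / d) \<le> exp (8192 / K * q)" by simp
      have cd: "c / d = c / (2 * K) * m" by (simp add: d_def)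
      have "m \<le> exp (8 * q)" using 2 exp_ge_add_one_self[of "8 * q"] by linarith
      then have 4: "c / d \<le> c / (2 * K) * exp (8 * q)"
        unfolding cd by (rule mult_left_mono) (rule less_imp_le[OF pos(3)])
      have "T powr (3 / 2 + 2 * d) = T powr (3 / 2) * exp (2 * d * l)"
        using T unfolding powr_add by (simp add: powr_def l_def)
      also have "2 * d * l = 4 * K * q" by (simp add: d_def q_def)
      finally have 5: "T powr (3 / 2 + 2 * d) = T powr (3 / 2) * exp (4 * K * q)" .
      have "\<bar>I_mu T\<bar> \<le> T powr (3 / 2 + 2 * d) * (c / d * exp (2048 * exp (K / d) / d))"
        using T by (intro bd d) auto
      also have "\<dots> \<le> T powr (3 / 2 + 2 * d) * (c / (2 * K) * exp (8 * q) * exp (8192 / K * q))"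
        using c d K by (intro mult_left_mono mult_mono 3 4) auto
      also have "\<dots> = c / (2 * K) * (T powr (3 / 2) * (exp (4 * K * q) * exp (8192 / K * q) * exp (8 * q)))"
        unfolding 5 by simp
      also have "exp (4 * K * q) * exp (8192 / K * q) * exp (8 * q) = exp (A * q)"
        unfolding A_def by (simp only: distrib_right exp_add)
      finally show ?thesis unfolding q_def by (rule disjI1)
    next
      case False
      have "l \<le> exp (32 * K)" using False m by (metis exp_le_cancel_iff le_cases)
      then have "T powr (1 / 8) \<le> exp (exp (32 * K)) powr (1 / 8)"
        unfolding Tl by (intro powr_mono2) auto
      moreover have "1 \<le> exp (A * (l / m))" using pos l m by simp
      moreover have "\<bar>I_mu T\<bar> \<le> T powr (3 / 2 + 2 * (1 / 16)) * (c / (1 / 16) * exp (2048 * exp (K / (1 / 16)) / (1 / 16)))"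
        using T by (intro bd) auto
      moreover have "T powr (3 / 2 + 2 * (1 / 16)) = T powr (3 / 2) * T powr (1 / 8)"
        unfolding powr_add[symmetric] by simp
      ultimately have "\<bar>I_mu T\<bar> \<le> T powr (3 / 2) * T powr (1 / 8) * (c / (1 / 16) * exp (2048 * exp (K / (1 / 16)) / (1 / 16)))"
        by (simp only:)
      also have "\<dots> \<le> T powr (3 / 2) * exp (exp (32 * K)) powr (1 / 8) * (c / (1 / 16) * exp (2048 * exp (K / (1 / 16)) / (1 / 16)))"
        using \<open>T powr (1 / 8) \<le> _\<close> c by (intro mult_right_mono mult_left_mono) auto
      also have "\<dots> = C1 * (T powr (3 / 2) * 1)" unfolding C1_def by (simp only: mult_ac mult_1_right mult_1_left)
      also have "\<dots> \<le> C1 * ?X" using pos \<open>1 \<le> exp _\<close> by (intro mult_left_mono) auto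
      finally show ?thesis by (rule disjI2)
    qed
    moreover have "c / (2 * K) * ?X \<le> C * ?X" "C1 * ?X \<le> C * ?X"
      using pos X by (intro mult_right_mono; simp add: C_def)+
    ultimately have "\<bar>I_mu T\<bar> \<le> C * ?X" by linarith
    then show ?thesis by (simp only: l_def m_def)
  qed
  moreover have "C > 0" using pos by (simp add: C_def)
  ultimately show ?thesis using pos(1) by blast
qed

end
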